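(* Let $0\le\alpha<1$ and let $(U,\mu)$ be a conformal transformation from the order-$\frac{1}{1-\alpha}$ cycle $(A,E_B,D_1)$ to the order-$\frac{1}{1-\alpha}$ cycle $(A,E'_B,D_2)$. Then the logarithmic transforms $(A,E_B,L_{D_1})$ and $(A,E'_B,L_{D_2})$ are related by the unitary $U$ up to locally bounded perturbation; in particular, $A$ is contained in the norm closure of the set of $a\in\operatorname{End}^*(E)$ such that $$(U^*L_{D_2}U-L_{D_1})a,\qquad [L_{D_1},a],\qquad [L_{D_2},UaU^*]$$ are bounded.
   Context: All C*-algebras are complex and trivially graded. For a right Hilbert $B$-module $E$, $\operatorname{End}^*(E)$ is the C*-algebra of adjointable operators. An $A$-$B$-correspondence is a right Hilbert $B$-module $E$ with a $*$-homomorphism $A\to\operatorname{End}^*(E)$; elements of $A$ are identified with their images. A densely defined operator is called bounded if it extends to an adjointable operator. For a self-adjoint regular operator $D$ put $\langle D\rangle=(1+D^2)^{1/2}$, $F_D=D(1+D^2)^{-1/2}$, and $L_D=F_D\log\langle D\rangle=D\log((1+D^2)^{1/2})(1+D^2)^{-1/2}$ (the logarithmic transform). $\overline{\operatorname{span}}$ denotes the norm-closed linear span. $\operatorname{Lip}^*_\alpha(D)$: the $*$-algebra of $a\in\operatorname{End}^*(E)$ with $a\operatorname{dom}D\subseteq\operatorname{dom}D$ such that $[D,a]\langle D\rangle^{-\alpha}$ and $\langle D\rangle^{-\alpha}[D,a]$ extend to adjointable operators. Order-$\frac{1}{1-\alpha}$ cycle ($0\le\alpha<1$): $(A,E_B,D)$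 where $E$ is an $A$-$B$-correspondence and $D$ is a regular operator on $E$ such that $D$ is self-adjoint, $(1+D^2)^{-1}a$ is compact for all $a\in A$, and $A$ is contained in the norm closure of $\operatorname{Lip}^*_\alpha(D)$. It is even if $E$ is $\mathbb{Z}/2$-graded, $A$ acts by even operators and $D$ is odd; it is odd if $E$ is ungraded. Conformal transformation $(U,\mu)$ from $(A,E_B,D_1)$ to $(A,E'_B,D_2)$: a unitary $U:E\to E'$ intertwining the representations of $A$, and an invertible $\mu\in\operatorname{End}^*(E)$ (even if the module is graded), such that $A\subseteq\overline{\operatorname{span}}(A\mathscr M)\cap\overline{\operatorname{span}}(\mathscr M A)$, where $\mathscr M$ is the set of $a\in\operatorname{End}^*(E)$ such that $(U^*D_2Ua-a\mu D_1\mu^* )\mu^{-1*}\langle D_1\rangle^{-\alpha}$ and $\langle D_2\rangle^{-\alpha}U(U^*D_2Ua-a\mu D_1\mu^* )$ are bounded and $a,\ a\mu,\ a\mu^{-1*}\in\operatorname{Lip}^*_\alpha(D_1)$. Here $\mu^{-1*}=(\mu^{-1})^*$.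
   Formalization: In the set M, a must also map dom(D1 μ* ) into dom(U*D2U); with a merely dense natural domain the claim fails (periodic/antiperiodic -i d/dx on [0,1], U=μ=1). "Related up to locally bounded perturbation" is read as U intertwining A plus the displayed property. *)

theory Defs
  imports "HOL-Analysis.Analysis"
begin

section \<open>Complex normed spaces and C*-algebras\<close>

class complex_normed_vector = real_normed_vector +
  fixes scaleC :: "complex \<Rightarrow> 'a \<Rightarrow> 'a"  (infixr \<open>*\<^sub>C\<close> 75)
  assumes scaleC_add_right: "c *\<^sub>C (x + y) = c *\<^sub>C x + c *\<^sub>C y"
    and scaleC_add_left: "(c + d) *\<^sub>C x = c *\<^sub>C x + d *\<^sub>C x"
    and scaleC_scaleC: "c *\<^sub>C d *\<^sub>C x = (c * d) *\<^sub>C x"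
    and scaleC_of_real: "of_real r *\<^sub>C x = r *\<^sub>R x"
    and norm_scaleC: "norm (c *\<^sub>C x) = cmod c * norm x"

text \<open>C*-algebras are not assumed to be unital.\<close>

class cstar_algebra = complex_normed_vector + real_normed_algebra + banach +
  fixes star :: "'a \<Rightarrow> 'a"
  assumes scaleC_mult_left: "(c *\<^sub>C x) * y = c *\<^sub>C (x * y)"
    and scaleC_mult_right: "x * (c *\<^sub>C y) = c *\<^sub>C (x * y)"
    and star_star: "star (star x) = x"
    and star_add: "star (x + y) = star x + star y"
    and star_scaleC: "star (c *\<^sub>C x) = cnj c *\<^sub>C star x"
    and star_mult: "star (x * y) = star y * star x"
    and cstar_identity: "norm (star x * x) = (norm x)\<^sup>2"

lemma scaleC_one: "1 *\<^sub>C x = (x :: 'a :: complex_normed_vector)"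
  using scaleC_of_real[of 1 x] by simp

lemma bounded_linear_scaleC: "bounded_linear (\<lambda>x :: 'a :: complex_normed_vector. c *\<^sub>C x)"
proof (rule bounded_linear_intro[where K = "cmod c"])
  fix r :: real and x :: 'a
  have "c *\<^sub>C of_real r *\<^sub>C x = of_real r *\<^sub>C c *\<^sub>C x"
    by (simp only: scaleC_scaleC mult.commute)
  then show "c *\<^sub>C (r *\<^sub>R x) = r *\<^sub>R (c *\<^sub>C x)"
    by (simp only: scaleC_of_real)
qed (simp_all add: scaleC_add_right norm_scaleC mult.commute)

instantiation blinfun :: (real_normed_vector, complex_normed_vector) complex_normed_vector
begin

lift_definition scaleC_blinfun :: "complex \<Rightarrow> ('a \<Rightarrow>\<^sub>L 'b) \<Rightarrow> ('a \<Rightarrow>\<^sub>L 'b)"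
  is "\<lambda>c T x. c *\<^sub>C T x"
  by (rule bounded_linear_compose[OF bounded_linear_scaleC])

instance
proof
  fix c d :: complex and r :: real and S T :: "'a \<Rightarrow>\<^sub>L 'b"
  show "c *\<^sub>C (S + T) = c *\<^sub>C S + c *\<^sub>C T"
    by transfer (simp add: scaleC_add_right fun_eq_iff)
  show "(c + d) *\<^sub>C T = c *\<^sub>C T + d *\<^sub>C T"
    by transfer (simp add: scaleC_add_left fun_eq_iff)
  show mult: "c *\<^sub>C d *\<^sub>C T = (c * d) *\<^sub>C T" for c d and T :: "'a \<Rightarrow>\<^sub>L 'b"
    by transfer (simp add: scaleC_scaleC fun_eq_iff)
  show "of_real r *\<^sub>C T = r *\<^sub>R T"
    by transfer (simp add: scaleC_of_real fun_eq_iff)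
  have le: "norm (c *\<^sub>C T) \<le> cmod c * norm T" for c and T :: "'a \<Rightarrow>\<^sub>L 'b"
  proof (rule norm_blinfun_bound)
    show "norm (blinfun_apply (c *\<^sub>C T) x) \<le> cmod c * norm T * norm x" for x
      using mult_left_mono[OF norm_blinfun[of T x], of "cmod c"]
      by (simp add: scaleC_blinfun.rep_eq norm_scaleC mult.assoc)
  qed simp
  show "norm (c *\<^sub>C T) = cmod c * norm T"
  proof (cases "c = 0")
    case True
    then show ?thesis using le[of c T] by simp
  next
    case False
    have "1 *\<^sub>C T = T"
      by transfer (simp add: scaleC_one)
    then have "norm T = norm (inverse c *\<^sub>C c *\<^sub>C T)"
      using False by (simp add: mult)
    also have "\<dots> \<le> inverse (cmod c) * norm (c *\<^sub>C T)"
      using le[of "inverse c" "c *\<^sub>C T"] by (simp add: norm_inverse)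
    finally have "cmod c * norm T \<le> norm (c *\<^sub>C T)"
      using False by (simp add: field_simps)
    then show ?thesis using le[of c T] by simp
  qed
qed

end

lemma module_scaleC: "module (scaleC :: complex \<Rightarrow> 'a \<Rightarrow> 'a :: complex_normed_vector)"
  by standard (simp_all add: scaleC_add_right scaleC_add_left scaleC_scaleC scaleC_one)

abbreviation cspan :: "'a :: complex_normed_vector set \<Rightarrow> 'a set" where
  "cspan \<equiv> module.span scaleC"


section \<open>Hilbert modules and adjointable operators\<close>

record ('e, 'b) hilbmod =
  act :: "'e \<Rightarrow> 'b \<Rightarrow> 'e"
  ip :: "'e \<Rightarrow> 'e \<Rightarrow> 'b"

text \<open>
  Right Hilbert \<open>'b\<close>-modules.  The norm and the completeness of the module are those of the type
  \<open>'e\<close>.  Definiteness of the inner product follows from the last axiom.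
\<close>

locale hilbert_module =
  fixes E :: "('e :: {complex_normed_vector, banach}, 'b :: cstar_algebra) hilbmod"
  assumes act_add_left: "act E (x + y) b = act E x b + act E y b"
    and act_add_right: "act E x (b + c) = act E x b + act E x c"
    and act_mult: "act E x (b * c) = act E (act E x b) c"
    and act_scaleC_left: "act E (z *\<^sub>C x) b = z *\<^sub>C act E x b"
    and act_scaleC_right: "act E x (z *\<^sub>C b) = z *\<^sub>C act E x b"
    and ip_add_right: "ip E x (y + y') = ip E x y + ip E x y'"
    and ip_scaleC_right: "ip E x (z *\<^sub>C y) = z *\<^sub>C ip E x y"
    and ip_act_right: "ip E x (act E y b) = ip E x y * b"
    and ip_star: "ip E y x = star (ip E x y)"
    and ip_pos: "\<exists>b. ip E x x = star b * b"
    and norm_ip: "norm x = sqrt (norm (ip E x x))"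

text \<open>
  Adjointable maps are automatically bounded, so that \<open>End_star E\<close>, inside the space of bounded
  real-linear maps with its operator norm, is the C*-algebra of adjointable operators.
\<close>

definition is_adjoint ::
  "('e :: {complex_normed_vector, banach}, 'b :: cstar_algebra) hilbmod \<Rightarrow>
   ('f :: {complex_normed_vector, banach}, 'b) hilbmod \<Rightarrow> ('e \<Rightarrow>\<^sub>L 'f) \<Rightarrow> ('f \<Rightarrow>\<^sub>L 'e) \<Rightarrow> bool" where
  "is_adjoint E F T S \<longleftrightarrow> (\<forall>x y. ip F (blinfun_apply T x) y = ip E x (blinfun_apply S y))"

definition Hom_star ::
  "('e :: {complex_normed_vector, banach}, 'b :: cstar_algebra) hilbmod \<Rightarrow>
   ('f :: {complex_normed_vector, banach}, 'b) hilbmod \<Rightarrow> ('e \<Rightarrow>\<^sub>L 'f) set" where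
  "Hom_star E F = {T. \<exists>S. is_adjoint E F T S}"

abbreviation End_star ::
  "('e :: {complex_normed_vector, banach}, 'b :: cstar_algebra) hilbmod \<Rightarrow> ('e \<Rightarrow>\<^sub>L 'e) set" where
  "End_star E \<equiv> Hom_star E E"

definition adj ::
  "('e :: {complex_normed_vector, banach}, 'b :: cstar_algebra) hilbmod \<Rightarrow>
   ('f :: {complex_normed_vector, banach}, 'b) hilbmod \<Rightarrow> ('e \<Rightarrow>\<^sub>L 'f) \<Rightarrow> ('f \<Rightarrow>\<^sub>L 'e)" where
  "adj E F T = (THE S. is_adjoint E F T S)"

definition unitary ::
  "('e :: {complex_normed_vector, banach}, 'b :: cstar_algebra) hilbmod \<Rightarrow>
   ('f :: {complex_normed_vector, banach}, 'b) hilbmod \<Rightarrow> ('e \<Rightarrow>\<^sub>L 'f) \<Rightarrow> bool" where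
  "unitary E F U \<longleftrightarrow> U \<in> Hom_star E F \<and>
     adj E F U o\<^sub>L U = id_blinfun \<and> U o\<^sub>L adj E F U = id_blinfun"

definition invertible_in ::
  "('e :: {complex_normed_vector, banach}, 'b :: cstar_algebra) hilbmod \<Rightarrow> ('e \<Rightarrow>\<^sub>L 'e) \<Rightarrow> bool" where
  "invertible_in E \<mu> \<longleftrightarrow> \<mu> \<in> End_star E \<and>
     (\<exists>\<nu> \<in> End_star E. \<mu> o\<^sub>L \<nu> = id_blinfun \<and> \<nu> o\<^sub>L \<mu> = id_blinfun)"

definition inv_of :: "('e :: real_normed_vector \<Rightarrow>\<^sub>L 'e) \<Rightarrow> ('e \<Rightarrow>\<^sub>L 'e)" where
  "inv_of \<mu> = (THE \<nu>. \<mu> o\<^sub>L \<nu> = id_blinfun \<and> \<nu> o\<^sub>L \<mu> = id_blinfun)"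

definition compacts ::
  "('e :: {complex_normed_vector, banach}, 'b :: cstar_algebra) hilbmod \<Rightarrow> ('e \<Rightarrow>\<^sub>L 'e) set" where
  "compacts E = closure (cspan {T. \<exists>x y. \<forall>z. blinfun_apply T z = act E x (ip E y z)})"

definition star_representation ::
  "('e :: {complex_normed_vector, banach}, 'b :: cstar_algebra) hilbmod \<Rightarrow>
   ('a :: cstar_algebra \<Rightarrow> 'e \<Rightarrow>\<^sub>L 'e) \<Rightarrow> bool" where
  "star_representation E \<pi> \<longleftrightarrow>
     (\<forall>a b. \<pi> (a + b) = \<pi> a + \<pi> b) \<and> (\<forall>c a. \<pi> (c *\<^sub>C a) = c *\<^sub>C \<pi> a) \<and>
     (\<forall>a b. \<pi> (a * b) = \<pi> a o\<^sub>L \<pi> b) \<and> (\<forall>a. is_adjoint E E (\<pi> a) (\<pi> (star a)))"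


section \<open>Unbounded operators\<close>

text \<open>
  An unbounded operator is a partial function \<open>'e \<rightharpoonup> 'f\<close>, defined on \<open>dom D\<close>.  Thus \<open>S \<circ>\<^sub>m T\<close> is the
  composition on its natural domain \<open>{x \<in> dom T. T x \<in> dom S}\<close>, and \<open>S \<subseteq>\<^sub>m T\<close> says that \<open>T\<close>
  extends \<open>S\<close>.
\<close>

definition as_op :: "('e :: real_normed_vector \<Rightarrow>\<^sub>L 'f :: real_normed_vector) \<Rightarrow> 'e \<rightharpoonup> 'f" where
  "as_op T = (\<lambda>x. Some (blinfun_apply T x))"

text \<open>Sum and difference are defined on the intersection of the domains.\<close>

definition op_plus :: "('e \<rightharpoonup> 'f :: ab_group_add) \<Rightarrow> ('e \<rightharpoonup> 'f) \<Rightarrow> 'e \<rightharpoonup> 'f"  (infixl \<open>\<oplus>\<^sub>m\<close> 54) where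
  "S \<oplus>\<^sub>m T = (\<lambda>x. if x \<in> dom S \<inter> dom T then Some (the (S x) + the (T x)) else None)"

definition op_minus :: "('e \<rightharpoonup> 'f :: ab_group_add) \<Rightarrow> ('e \<rightharpoonup> 'f) \<Rightarrow> 'e \<rightharpoonup> 'f"  (infixl \<open>\<ominus>\<^sub>m\<close> 54) where
  "S \<ominus>\<^sub>m T = (\<lambda>x. if x \<in> dom S \<inter> dom T then Some (the (S x) - the (T x)) else None)"

definition op_of_graph :: "('e \<times> 'f) set \<Rightarrow> 'e \<rightharpoonup> 'f" where
  "op_of_graph G = (\<lambda>x. if \<exists>y. (x, y) \<in> G then Some (THE y. (x, y) \<in> G) else None)"

definition densely_defined :: "('e :: topological_space \<rightharpoonup> 'f) \<Rightarrow> bool" where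
  "densely_defined D \<longleftrightarrow> closure (dom D) = UNIV"

definition op_adjoint ::
  "('e :: {complex_normed_vector, banach}, 'b :: cstar_algebra) hilbmod \<Rightarrow>
   ('f :: {complex_normed_vector, banach}, 'b) hilbmod \<Rightarrow> ('e \<rightharpoonup> 'f) \<Rightarrow> 'f \<rightharpoonup> 'e" where
  "op_adjoint E F D = op_of_graph {(y, z). \<forall>x u. D x = Some u \<longrightarrow> ip F u y = ip E x z}"

definition module_linear ::
  "('e :: {complex_normed_vector, banach}, 'b :: cstar_algebra) hilbmod \<Rightarrow>
   ('f :: {complex_normed_vector, banach}, 'b) hilbmod \<Rightarrow> ('e \<rightharpoonup> 'f) \<Rightarrow> bool" where
  "module_linear E F D \<longleftrightarrow> D 0 = Some 0 \<and>
     (\<forall>x y u v. D x = Some u \<longrightarrow> D y = Some v \<longrightarrow> D (x + y) = Some (u + v)) \<and>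
     (\<forall>c x u. D x = Some u \<longrightarrow> D (c *\<^sub>C x) = Some (c *\<^sub>C u)) \<and>
     (\<forall>b x u. D x = Some u \<longrightarrow> D (act E x b) = Some (act F u b))"

definition regular ::
  "('e :: {complex_normed_vector, banach}, 'b :: cstar_algebra) hilbmod \<Rightarrow> ('e \<rightharpoonup> 'e) \<Rightarrow> bool" where
  "regular E D \<longleftrightarrow> module_linear E E D \<and> densely_defined D \<and> closed (Map.graph D) \<and>
     densely_defined (op_adjoint E E D) \<and>
     closure (ran (as_op id_blinfun \<oplus>\<^sub>m (op_adjoint E E D \<circ>\<^sub>m D))) = UNIV"

definition self_adjoint ::
  "('e :: {complex_normed_vector, banach}, 'b :: cstar_algebra) hilbmod \<Rightarrow> ('e \<rightharpoonup> 'e) \<Rightarrow> bool" where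
  "self_adjoint E D \<longleftrightarrow> op_adjoint E E D = D"

definition bounded_op ::
  "('e :: {complex_normed_vector, banach}, 'b :: cstar_algebra) hilbmod \<Rightarrow>
   ('f :: {complex_normed_vector, banach}, 'b) hilbmod \<Rightarrow> ('e \<rightharpoonup> 'f) \<Rightarrow> bool" where
  "bounded_op E F T \<longleftrightarrow> densely_defined T \<and> (\<exists>S \<in> Hom_star E F. T \<subseteq>\<^sub>m as_op S)"

definition commutator ::
  "('e :: real_normed_vector \<rightharpoonup> 'e) \<Rightarrow> ('e \<Rightarrow>\<^sub>L 'e) \<Rightarrow> 'e \<rightharpoonup> 'e" where
  "commutator D a = (D \<circ>\<^sub>m as_op a) \<ominus>\<^sub>m (as_op a \<circ>\<^sub>m D)"

definition preserves_dom :: "('e :: real_normed_vector \<Rightarrow>\<^sub>L 'e) \<Rightarrow> ('e \<rightharpoonup> 'e) \<Rightarrow> bool" where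
  "preserves_dom a D \<longleftrightarrow> blinfun_apply a ` dom D \<subseteq> dom D"


section \<open>Continuous functional calculus\<close>

definition C0 :: "(real \<Rightarrow> complex) set" where
  "C0 = {f. continuous_on UNIV f \<and> (f \<longlongrightarrow> 0) at_infinity}"

definition Cc :: "(real \<Rightarrow> complex) set" where
  "Cc = {f. continuous_on UNIV f \<and> (\<exists>R. \<forall>t. \<bar>t\<bar> > R \<longrightarrow> f t = 0)}"

text \<open>
  For self-adjoint regular \<open>D\<close> there is exactly one *-homomorphism from \<open>C\<^sub>0(\<real>)\<close> to the adjointable
  operators which sends \<open>t \<mapsto> (t + \<i>)\<^sup>-\<^sup>1\<close> to \<open>(D + \<i>)\<^sup>-\<^sup>1\<close>.  Its values outside \<open>C0\<close> are irrelevant.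
\<close>

definition is_C0_calculus ::
  "('e :: {complex_normed_vector, banach}, 'b :: cstar_algebra) hilbmod \<Rightarrow> ('e \<rightharpoonup> 'e) \<Rightarrow>
   ((real \<Rightarrow> complex) \<Rightarrow> 'e \<Rightarrow>\<^sub>L 'e) \<Rightarrow> bool" where
  "is_C0_calculus E D \<phi> \<longleftrightarrow>
     (\<forall>f \<in> C0. \<forall>g \<in> C0. \<phi> (\<lambda>t. f t + g t) = \<phi> f + \<phi> g) \<and>
     (\<forall>c. \<forall>f \<in> C0. \<phi> (\<lambda>t. c * f t) = c *\<^sub>C \<phi> f) \<and>
     (\<forall>f \<in> C0. \<forall>g \<in> C0. \<phi> (\<lambda>t. f t * g t) = \<phi> f o\<^sub>L \<phi> g) \<and>
     (\<forall>f \<in> C0. is_adjoint E E (\<phi> f) (\<phi> (\<lambda>t. cnj (f t)))) \<and>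
     (\<forall>x y. blinfun_apply (\<phi> (\<lambda>t. 1 / (of_real t + \<i>))) x = y \<longleftrightarrow>
            (D \<oplus>\<^sub>m as_op (\<i> *\<^sub>C id_blinfun)) y = Some x)"

definition C0_calculus ::
  "('e :: {complex_normed_vector, banach}, 'b :: cstar_algebra) hilbmod \<Rightarrow> ('e \<rightharpoonup> 'e) \<Rightarrow>
   (real \<Rightarrow> complex) \<Rightarrow> 'e \<Rightarrow>\<^sub>L 'e" where
  "C0_calculus E D = (SOME \<phi>. is_C0_calculus E D \<phi>)"

text \<open>
  For an arbitrary continuous function \<open>f\<close>, bounded or not, \<open>f(D)\<close> is the closure of the operator
  \<open>g(D) \<eta> \<mapsto> (f g)(D) \<eta>\<close>, where \<open>g\<close> has compact support.  It is everywhere defined if \<open>f\<close> is bounded.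
\<close>

definition fun_calc ::
  "('e :: {complex_normed_vector, banach}, 'b :: cstar_algebra) hilbmod \<Rightarrow> ('e \<rightharpoonup> 'e) \<Rightarrow>
   (real \<Rightarrow> complex) \<Rightarrow> 'e \<rightharpoonup> 'e" where
  "fun_calc E D f = op_of_graph (closure
     {(blinfun_apply (C0_calculus E D g) \<eta>,
       blinfun_apply (C0_calculus E D (\<lambda>t. f t * g t)) \<eta>) | g \<eta>. g \<in> Cc})"

text \<open>\<open>bracket_pow E D s\<close> is \<open>\<langle>D\<rangle>\<^sup>s\<close> with \<open>\<langle>D\<rangle> = (1 + D\<^sup>2)\<^sup>1\<^sup>/\<^sup>2\<close>.\<close>

definition bracket_pow ::
  "('e :: {complex_normed_vector, banach}, 'b :: cstar_algebra) hilbmod \<Rightarrow> ('e \<rightharpoonup> 'e) \<Rightarrow>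
   real \<Rightarrow> 'e \<rightharpoonup> 'e" where
  "bracket_pow E D s = fun_calc E D (\<lambda>t. of_real (sqrt (1 + t\<^sup>2) powr s))"

definition log_bracket ::
  "('e :: {complex_normed_vector, banach}, 'b :: cstar_algebra) hilbmod \<Rightarrow> ('e \<rightharpoonup> 'e) \<Rightarrow> 'e \<rightharpoonup> 'e" where
  "log_bracket E D = fun_calc E D (\<lambda>t. of_real (ln (sqrt (1 + t\<^sup>2))))"

definition bounded_transform ::
  "('e :: {complex_normed_vector, banach}, 'b :: cstar_algebra) hilbmod \<Rightarrow> ('e \<rightharpoonup> 'e) \<Rightarrow> 'e \<rightharpoonup> 'e" where
  "bounded_transform E D = D \<circ>\<^sub>m bracket_pow E D (-1)"

definition log_transform ::
  "('e :: {complex_normed_vector, banach}, 'b :: cstar_algebra) hilbmod \<Rightarrow> ('e \<rightharpoonup> 'e) \<Rightarrow> 'e \<rightharpoonup> 'e" where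
  "log_transform E D = bounded_transform E D \<circ>\<^sub>m log_bracket E D"


section \<open>Cycles and conformal transformations\<close>

definition Lip_star ::
  "real \<Rightarrow> ('e :: {complex_normed_vector, banach}, 'b :: cstar_algebra) hilbmod \<Rightarrow> ('e \<rightharpoonup> 'e) \<Rightarrow>
   ('e \<Rightarrow>\<^sub>L 'e) set" where
  "Lip_star \<alpha> E D = {a \<in> End_star E. preserves_dom a D \<and>
     bounded_op E E (commutator D a \<circ>\<^sub>m bracket_pow E D (-\<alpha>)) \<and>
     bounded_op E E (bracket_pow E D (-\<alpha>) \<circ>\<^sub>m commutator D a)}"

text \<open>
  The parity of a cycle is recorded by \<open>\<Gamma>\<close>: it is \<open>None\<close> for an odd cycle, and \<open>Some \<gamma>\<close>, with
  \<open>\<gamma>\<close> the grading operator of the module, for an even cycle.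
\<close>

definition is_grading ::
  "('e :: {complex_normed_vector, banach}, 'b :: cstar_algebra) hilbmod \<Rightarrow> ('e \<Rightarrow>\<^sub>L 'e) \<Rightarrow> bool" where
  "is_grading E \<gamma> \<longleftrightarrow> is_adjoint E E \<gamma> \<gamma> \<and> \<gamma> o\<^sub>L \<gamma> = id_blinfun"

definition order_cycle ::
  "real \<Rightarrow> ('e :: {complex_normed_vector, banach}, 'b :: cstar_algebra) hilbmod \<Rightarrow>
   ('e \<Rightarrow>\<^sub>L 'e) option \<Rightarrow> ('a :: cstar_algebra \<Rightarrow> 'e \<Rightarrow>\<^sub>L 'e) \<Rightarrow> ('e \<rightharpoonup> 'e) \<Rightarrow> bool" where
  "order_cycle \<alpha> E \<Gamma> \<pi> D \<longleftrightarrow>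
     hilbert_module E \<and> star_representation E \<pi> \<and> regular E D \<and> self_adjoint E D \<and>
     (\<forall>a. \<exists>K \<in> compacts E. bracket_pow E D (-2) \<circ>\<^sub>m as_op (\<pi> a) = as_op K) \<and>
     range \<pi> \<subseteq> closure (Lip_star \<alpha> E D) \<and>
     (\<forall>\<gamma>. \<Gamma> = Some \<gamma> \<longrightarrow> is_grading E \<gamma> \<and> (\<forall>a. \<gamma> o\<^sub>L \<pi> a = \<pi> a o\<^sub>L \<gamma>) \<and>
        D \<circ>\<^sub>m as_op \<gamma> = as_op (- \<gamma>) \<circ>\<^sub>m D)"

definition unitary_intertwiner ::
  "('e :: {complex_normed_vector, banach}, 'b :: cstar_algebra) hilbmod \<Rightarrow>
   ('a :: cstar_algebra \<Rightarrow> 'e \<Rightarrow>\<^sub>L 'e) \<Rightarrow>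
   ('f :: {complex_normed_vector, banach}, 'b) hilbmod \<Rightarrow> ('a \<Rightarrow> 'f \<Rightarrow>\<^sub>L 'f) \<Rightarrow>
   ('e \<Rightarrow>\<^sub>L 'f) \<Rightarrow> bool" where
  "unitary_intertwiner E \<pi> E' \<pi>' U \<longleftrightarrow> unitary E E' U \<and> (\<forall>a. U o\<^sub>L \<pi> a = \<pi>' a o\<^sub>L U)"

text \<open>\<open>pullback E E' U D\<close> is \<open>U\<^sup>* D U\<close>.\<close>

definition pullback ::
  "('e :: {complex_normed_vector, banach}, 'b :: cstar_algebra) hilbmod \<Rightarrow>
   ('f :: {complex_normed_vector, banach}, 'b) hilbmod \<Rightarrow> ('e \<Rightarrow>\<^sub>L 'f) \<Rightarrow> ('f \<rightharpoonup> 'f) \<Rightarrow> 'e \<rightharpoonup> 'e" where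
  "pullback E E' U D = as_op (adj E E' U) \<circ>\<^sub>m D \<circ>\<^sub>m as_op U"

text \<open>\<open>conf_diff E E' D1 D2 U \<mu> a\<close> is \<open>U\<^sup>* D2 U a - a \<mu> D1 \<mu>\<^sup>*\<close>.\<close>

definition conf_diff ::
  "('e :: {complex_normed_vector, banach}, 'b :: cstar_algebra) hilbmod \<Rightarrow>
   ('f :: {complex_normed_vector, banach}, 'b) hilbmod \<Rightarrow> ('e \<rightharpoonup> 'e) \<Rightarrow> ('f \<rightharpoonup> 'f) \<Rightarrow>
   ('e \<Rightarrow>\<^sub>L 'f) \<Rightarrow> ('e \<Rightarrow>\<^sub>L 'e) \<Rightarrow> ('e \<Rightarrow>\<^sub>L 'e) \<Rightarrow> 'e \<rightharpoonup> 'e" where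
  "conf_diff E E' D1 D2 U \<mu> a =
     (pullback E E' U D2 \<circ>\<^sub>m as_op a) \<ominus>\<^sub>m (as_op (a o\<^sub>L \<mu>) \<circ>\<^sub>m D1 \<circ>\<^sub>m as_op (adj E E \<mu>))"

text \<open>
  As for the commutators in \<^const>\<open>Lip_star\<close>, the difference \<open>U\<^sup>* D2 U a - a (\<mu> D1 \<mu>\<^sup>*)\<close> is understood
  to be defined on all of \<open>dom (\<mu> D1 \<mu>\<^sup>*)\<close>, that is, \<open>a\<close> maps \<open>dom (\<mu> D1 \<mu>\<^sup>*) = dom (D1 \<mu>\<^sup>*)\<close> into
  \<open>dom (U\<^sup>* D2 U)\<close>.  Density of its natural domain alone would not do: two
  different self-adjoint extensions of one symmetric operator have difference zero on a dense
  subspace (take \<open>U\<close>, \<open>\<mu>\<close> and \<open>a\<close> to be identities).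
\<close>

definition conf_multipliers ::
  "real \<Rightarrow> ('e :: {complex_normed_vector, banach}, 'b :: cstar_algebra) hilbmod \<Rightarrow>
   ('f :: {complex_normed_vector, banach}, 'b) hilbmod \<Rightarrow> ('e \<rightharpoonup> 'e) \<Rightarrow> ('f \<rightharpoonup> 'f) \<Rightarrow>
   ('e \<Rightarrow>\<^sub>L 'f) \<Rightarrow> ('e \<Rightarrow>\<^sub>L 'e) \<Rightarrow> ('e \<Rightarrow>\<^sub>L 'e) set" where
  "conf_multipliers \<alpha> E E' D1 D2 U \<mu> = {a \<in> End_star E.
     blinfun_apply a ` dom (D1 \<circ>\<^sub>m as_op (adj E E \<mu>)) \<subseteq> dom (pullback E E' U D2) \<and>
     bounded_op E E
       (conf_diff E E' D1 D2 U \<mu> a \<circ>\<^sub>m as_op (adj E E (inv_of \<mu>)) \<circ>\<^sub>m bracket_pow E D1 (-\<alpha>)) \<and>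
     bounded_op E E'
       (bracket_pow E' D2 (-\<alpha>) \<circ>\<^sub>m as_op U \<circ>\<^sub>m conf_diff E E' D1 D2 U \<mu> a) \<and>
     a \<in> Lip_star \<alpha> E D1 \<and> a o\<^sub>L \<mu> \<in> Lip_star \<alpha> E D1 \<and>
     a o\<^sub>L adj E E (inv_of \<mu>) \<in> Lip_star \<alpha> E D1}"

definition conformal_transformation ::
  "real \<Rightarrow> ('e :: {complex_normed_vector, banach}, 'b :: cstar_algebra) hilbmod \<Rightarrow>
   ('e \<Rightarrow>\<^sub>L 'e) option \<Rightarrow> ('a :: cstar_algebra \<Rightarrow> 'e \<Rightarrow>\<^sub>L 'e) \<Rightarrow> ('e \<rightharpoonup> 'e) \<Rightarrow>
   ('f :: {complex_normed_vector, banach}, 'b) hilbmod \<Rightarrow> ('a \<Rightarrow> 'f \<Rightarrow>\<^sub>L 'f) \<Rightarrow> ('f \<rightharpoonup> 'f) \<Rightarrow>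
   ('e \<Rightarrow>\<^sub>L 'f) \<Rightarrow> ('e \<Rightarrow>\<^sub>L 'e) \<Rightarrow> bool" where
  "conformal_transformation \<alpha> E \<Gamma> \<pi> D1 E' \<pi>' D2 U \<mu> \<longleftrightarrow>
     unitary_intertwiner E \<pi> E' \<pi>' U \<and> invertible_in E \<mu> \<and>
     (\<forall>\<gamma>. \<Gamma> = Some \<gamma> \<longrightarrow> \<gamma> o\<^sub>L \<mu> = \<mu> o\<^sub>L \<gamma>) \<and>
     (let M = conf_multipliers \<alpha> E E' D1 D2 U \<mu> in
        range \<pi> \<subseteq> closure (cspan {\<pi> b o\<^sub>L m | b m. m \<in> M}) \<inter>
                  closure (cspan {m o\<^sub>L \<pi> b | b m. m \<in> M}))"

text \<open>
  The elements \<open>a\<close> for which \<open>(U\<^sup>* L2 U - L1) a\<close>, \<open>[L1, a]\<close> and \<open>[L2, U a U\<^sup>*]\<close> are bounded.  Again a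
  commutator \<open>[L, a]\<close> is understood on \<open>dom L\<close>, which \<open>a\<close> has to preserve, and \<open>a\<close> has to map
  \<open>dom L1\<close> into \<open>dom (U\<^sup>* L2 U)\<close>.
\<close>

definition locally_bounded_multipliers ::
  "('e :: {complex_normed_vector, banach}, 'b :: cstar_algebra) hilbmod \<Rightarrow> ('e \<rightharpoonup> 'e) \<Rightarrow>
   ('f :: {complex_normed_vector, banach}, 'b) hilbmod \<Rightarrow> ('f \<rightharpoonup> 'f) \<Rightarrow>
   ('e \<Rightarrow>\<^sub>L 'f) \<Rightarrow> ('e \<Rightarrow>\<^sub>L 'e) set" where
  "locally_bounded_multipliers E L1 E' L2 U = {a \<in> End_star E.
     blinfun_apply a ` dom L1 \<subseteq> dom (pullback E E' U L2) \<and>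
     bounded_op E E ((pullback E E' U L2 \<ominus>\<^sub>m L1) \<circ>\<^sub>m as_op a) \<and>
     preserves_dom a L1 \<and> bounded_op E E (commutator L1 a) \<and>
     preserves_dom (U o\<^sub>L a o\<^sub>L adj E E' U) L2 \<and>
     bounded_op E' E' (commutator L2 (U o\<^sub>L a o\<^sub>L adj E E' U))}"

definition related_up_to_locally_bounded ::
  "('e :: {complex_normed_vector, banach}, 'b :: cstar_algebra) hilbmod \<Rightarrow>
   ('a :: cstar_algebra \<Rightarrow> 'e \<Rightarrow>\<^sub>L 'e) \<Rightarrow> ('e \<rightharpoonup> 'e) \<Rightarrow>
   ('f :: {complex_normed_vector, banach}, 'b) hilbmod \<Rightarrow> ('a \<Rightarrow> 'f \<Rightarrow>\<^sub>L 'f) \<Rightarrow> ('f \<rightharpoonup> 'f) \<Rightarrow>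
   ('e \<Rightarrow>\<^sub>L 'f) \<Rightarrow> bool" where
  "related_up_to_locally_bounded E \<pi> L1 E' \<pi>' L2 U \<longleftrightarrow> unitary_intertwiner E \<pi> E' \<pi>' U \<and>
     range \<pi> \<subseteq> closure (locally_bounded_multipliers E L1 E' L2 U)"

end

theory Submission
 imports Defs "HOL-Computational_Algebra.Polynomial"
begin

text \<open>
 For a multiplier \<open>a\<close> of the conformal transformation put \<open>c = a \<mu>\<^sup>-\<^sup>1\<^sup>*\<close> and \<open>d = a \<mu>\<close>, and write \<open>D\<^sub>2\<close>, \<open>L\<^sub>2\<close> for the operators
 pulled back by \<open>U\<close>.  By hypothesis \<open>D\<^sub>2 c - d D\<^sub>1\<close> and the commutators of \<open>D\<^sub>1\<close> with \<open>a\<close>, \<open>c\<close>, \<open>d\<close> are operators of order \<open>\<alpha>\<close>,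
 and \<open>a\<^sup>* = \<mu> c\<^sup>* = \<mu>\<^sup>-\<^sup>1\<^sup>* d\<^sup>*\<close>.  The core of the proof (\<open>log_fun_represented\<close>) is that then \<open>L\<^sub>1 a\<^sup>* - a\<^sup>* L\<^sub>2\<close> is bounded.
 With \<open>D\<^sub>1 = D\<^sub>2\<close> and \<open>\<mu> = 1\<close> it also says that \<open>[L\<^sub>1, b]\<close> is bounded for \<open>b\<close> in the Lipschitz algebra.  Hence all words
 \<open>a b a'\<^sup>*\<close> with multipliers \<open>a\<close>, \<open>a'\<close> have bounded commutators with \<open>L\<^sub>1\<close> and \<open>L\<^sub>2\<close>, and \<open>(L\<^sub>2 - L\<^sub>1) a b a'\<^sup>*\<close> is bounded; the
 closed span of these words contains \<open>A\<close> (\<open>range_subset_closure\<close>).  As \<open>L(t) = F(t) log \<langle>t\<rangle>\<close> with \<open>F(t) = t / \<langle>t\<rangle>\<close>, called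
 \<open>phase\<close> below, logarithm and sign can be treated separately.

 The logarithm (\<open>log_represented\<close>).  Heuristically, a conformal factor changes \<open>log \<langle>D\<rangle>\<close> by a bounded amount.  Up to a bounded
 function, \<open>log\<^sub>2 \<langle>t\<rangle>\<close> is the sum of \<open>1 - n\<^sup>2 (n\<^sup>2 + t\<^sup>2)\<^sup>-\<^sup>1\<close> over \<open>n = 2\<^sup>k\<close>.  For each \<open>n\<close> the resolvent identity gives
 \<open>n\<^sup>2 (n\<^sup>2 + D\<^sub>1\<^sup>2)\<^sup>-\<^sup>1 a\<^sup>* - a\<^sup>* n\<^sup>2 (n\<^sup>2 + D\<^sub>2\<^sup>2)\<^sup>-\<^sup>1 = \<mu> S\<^sub>1 d\<^sup>* S\<^sub>2 - \<mu>\<^sup>-\<^sup>1\<^sup>* S\<^sub>1 c\<^sup>* S\<^sub>2 + O(n\<^bsup>\<alpha> - 1\<^esup>)\<close> with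
 \<open>S\<^sub>i = n D\<^sub>i (n\<^sup>2 + D\<^sub>i\<^sup>2)\<^sup>-\<^sup>1\<close>.  The errors are summable.  The main terms are not small, but the functions \<open>S\<close> for different
 \<open>k\<close> are almost orthogonal: the sum of their absolute values is bounded uniformly in \<open>t\<close>.  Writing \<open>\<Sum> S\<^sub>1 X S\<^sub>2\<close> as an average over
 signs then bounds it by a multiple of \<open>\<parallel>X\<parallel>\<close> (\<open>norm_sum_sandwich_le\<close>).

 The sign (\<open>phase_log_represented\<close>).  Here \<open>F(D\<^sub>1) a\<^sup>* - a\<^sup>* F(D\<^sub>2)\<close> has to be shown to decay on high spectral subspaces of \<open>D\<^sub>2\<close>,
 fast enough to compensate \<open>log \<langle>D\<^sub>2\<rangle>\<close>.  Let \<open>\<beta>\<close> be a cutoff to \<open>- D\<^sub>2 \<approx> N\<^sup>2\<close>, where \<open>F(D\<^sub>2) \<approx> - 1\<close>, and let \<open>f\<close> be a sign function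
 smoothed at scale \<open>N\<close>.  The form \<open>d (1 + f(D\<^sub>1))\<^sup>2 D\<^sub>1 d\<^sup>*\<close> is at least of order \<open>- N\<close>, since \<open>1 + f\<close> is small on the negative axis.
 By the intertwining relation it agrees with \<open>a (1 + f(D\<^sub>1))\<^sup>2 a\<^sup>* D\<^sub>2\<close> on the band, up to \<open>O(N\<^sup>2 N\<^bsup>\<alpha> - 1\<^esup>)\<close>, and there
 \<open>D\<^sub>2 \<le> - N\<^sup>2\<close>.  So \<open>(1 + f(D\<^sub>1)) a\<^sup>* \<beta>(D\<^sub>2)\<close> has norm \<open>O(N\<^bsup>(\<alpha> - 1) / 2\<^esup>)\<close> (\<open>norm_wrong_sign\<close>).  The difference between \<open>f\<close> and
 \<open>F\<close> lives where \<open>|D\<^sub>1| \<lesssim> N\<close>, and there \<open>a\<^sup>* \<beta>(D\<^sub>2)\<close> is small, again by the intertwining relation (\<open>norm_low_frequency\<close>).  The bounds for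
 \<open>N = 2\<^sup>k\<close>, multiplied by \<open>k\<close>, are summable.

 All of this is expressed through functional calculi.  A calculus of a self-adjoint regular operator is any homomorphism on
 \<open>C\<^sub>0\<close> with the right resolvent.  Existence comes from the Cayley transform and polynomials in a unitary.  Contractivity and
 the extension to bounded functions rest on the positivity of \<open>T\<^sup>*T\<close>, which is derived from norm estimates; it also yields the
 Cauchy-Schwarz inequality in Hilbert modules.
\<close>

(* The notation is used for adjoints below. *)
no_notation rtrancl  (\<open>(\<open>notation=\<open>postfix *\<close>\<close>_\<^sup>*)\<close> [1000] 999)
no_notation rtranclp  (\<open>(\<open>notation=\<open>postfix **\<close>\<close>_\<^sup>*\<^sup>*)\<close> [1000] 1000)
notation blinfun_compose (infixl \<open>\<cdot>\<close> 70)
notation id_blinfun (\<open>\<one>\<close>)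

type_synonym 'e endo = "('e, 'e) blinfun"
type_synonym 'e calculus = "(real \<Rightarrow> complex) \<Rightarrow> 'e endo"

section \<open>Hilbert modules and adjointable operators\<close>

lemma scaleC_zero_left [simp]: "0 *\<^sub>C x = (0 :: 'a :: complex_normed_vector)"
 using norm_scaleC[of 0 x] by simp

lemma scaleC_zero_right [simp]: "c *\<^sub>C 0 = (0 :: 'a :: complex_normed_vector)"
 using norm_scaleC[of c 0] by simp

lemma scaleC_one' [simp]: "1 *\<^sub>C x = (x :: 'a :: complex_normed_vector)"
 by (rule scaleC_one)

lemma scaleC_minus_left: "(- c) *\<^sub>C x = - (c *\<^sub>C (x :: 'a :: complex_normed_vector))"
 using scaleC_add_left[of "- c" c x] by (simp add: eq_neg_iff_add_eq_0)

lemma scaleC_minus_right: "c *\<^sub>C (- x) = - (c *\<^sub>C (x :: 'a :: complex_normed_vector))"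
 using scaleC_add_right[of c "- x" x] by (simp add: eq_neg_iff_add_eq_0)

lemma scaleC_diff_right: "c *\<^sub>C (x - y) = c *\<^sub>C x - c *\<^sub>C (y :: 'a :: complex_normed_vector)"
 using scaleC_add_right[of c x "- y"] by (simp add: scaleC_minus_right)

lemma scaleC_diff_left: "(c - d) *\<^sub>C x = c *\<^sub>C x - d *\<^sub>C (x :: 'a :: complex_normed_vector)"
 using scaleC_add_left[of c "- d" x] by (simp add: scaleC_minus_left)

lemma scaleC_sum_right: "c *\<^sub>C (\<Sum>i\<in>A. f i) = (\<Sum>i\<in>A. c *\<^sub>C (f i :: 'a :: complex_normed_vector))"
 by (induction A rule: infinite_finite_induct) (auto simp: scaleC_add_right)

lemma scaleR_eq_scaleC: "r *\<^sub>R x = complex_of_real r *\<^sub>C (x :: 'a :: complex_normed_vector)"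
 by (simp add: scaleC_of_real)

lemma tendsto_scaleC [tendsto_intros]:
 "(f \<longlongrightarrow> l) F \<Longrightarrow> ((\<lambda>x. c *\<^sub>C f x) \<longlongrightarrow> c *\<^sub>C (l :: 'a :: complex_normed_vector)) F"
 by (rule bounded_linear.tendsto[OF bounded_linear_scaleC])

lemma scaleC_blinfun_apply [simp]: "blinfun_apply (c *\<^sub>C T) x = c *\<^sub>C blinfun_apply T x"
 by (simp add: scaleC_blinfun.rep_eq)

lemma star_zero [simp]: "star (0 :: 'a :: cstar_algebra) = 0"
 using star_scaleC[of 0 "0 :: 'a"] by simp

lemma star_minus: "star (- x) = - star (x :: 'a :: cstar_algebra)"
 using star_scaleC[of "-1" x] by (simp add: scaleC_minus_left)

lemma star_diff: "star (x - y) = star x - star (y :: 'a :: cstar_algebra)"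
 using star_add[of x "- y"] by (simp add: star_minus)

lemma norm_star [simp]: "norm (star x) = norm (x :: 'a :: cstar_algebra)"
proof -
 have le: "norm y \<le> norm (star y)" for y :: 'a
  using cstar_identity[of y] norm_mult_ineq[of "star y" y]
  by (cases "norm y = 0") (auto simp: power2_eq_square)
 show ?thesis using le[of x] le[of "star x"] by (simp add: star_star)
qed

text \<open>For self-adjoint \<open>h\<close> and \<open>k\<close>, \<open>k\<close> is the imaginary part of \<open>h + ik\<close>.\<close>

lemma norm_imaginary_part_le:
 fixes h k :: "'a :: cstar_algebra"
 assumes "star h = h" "star k = k"
 shows "norm k \<le> norm (h + \<i> *\<^sub>C k)"
proof -
 let ?z = "h + \<i> *\<^sub>C k"
 have "2 *\<^sub>R k = (- \<i>) *\<^sub>C (?z - star ?z)"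
  by (simp add: assms star_add star_scaleC scaleC_minus_left scaleC_scaleC scaleC_add_right scaleR_2)
 then have "2 * norm k = norm (?z - star ?z)"
  by (metis norm_scaleC norm_scaleR abs_numeral norm_minus_cancel norm_ii mult_1)
 also have "\<dots> \<le> 2 * norm ?z"
  using norm_triangle_ineq4[of ?z "star ?z"] by simp
 finally show ?thesis by simp
qed

interpretation blinfun_compose: bounded_bilinear "(o\<^sub>L)"
 by (rule bounded_bilinear_blinfun_compose)

lemma op_assoc: "(S \<cdot> T) \<cdot> R = S \<cdot> (T \<cdot> R)"
 by (rule blinfun_eqI) simp

lemma blinfun_compose_id [simp]: "T \<cdot> \<one> = T" "\<one> \<cdot> T = T"
 by (rule blinfun_eqI, simp)+

lemmas op_simps = op_assoc blinfun_compose.add_left blinfun_compose.add_right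
 blinfun_compose.diff_left blinfun_compose.diff_right
 blinfun_compose.minus_left blinfun_compose.minus_right

lemmas op_scaleR = blinfun_compose.scaleR_left blinfun_compose.scaleR_right
lemmas op_sum = blinfun_compose.sum_left blinfun_compose.sum_right

lemma scaleC_compose_left: "(c *\<^sub>C S) \<cdot> T = c *\<^sub>C (S \<cdot> T)"
 by (rule blinfun_eqI) simp

lemma norm_compose_le: "norm S \<le> a \<Longrightarrow> norm T \<le> b \<Longrightarrow> norm (S \<cdot> T) \<le> a * b"
 by (meson mult_mono norm_blinfun_compose norm_ge_zero order_trans)

context hilbert_module
begin

lemma ip_zero_right [simp]: "ip E x 0 = 0"
 using ip_scaleC_right[of x 0 0] by simp

lemma ip_zero_left [simp]: "ip E 0 x = 0"
 using ip_star[of 0 x] by simp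

lemma ip_add_left: "ip E (x + y) z = ip E x z + ip E y z"
 by (metis ip_star ip_add_right star_add)

lemma ip_scaleC_left: "ip E (c *\<^sub>C x) y = cnj c *\<^sub>C ip E x y"
 by (metis ip_star ip_scaleC_right star_scaleC)

lemma ip_minus_right: "ip E x (- y) = - ip E x y"
 using ip_scaleC_right[of x "-1" y] by (simp add: scaleC_minus_left)

lemma ip_minus_left: "ip E (- x) y = - ip E x y"
 by (metis ip_star ip_minus_right star_minus)

lemma ip_diff_right: "ip E x (y - z) = ip E x y - ip E x z"
 using ip_add_right[of x y "- z"] by (simp add: ip_minus_right)

lemma ip_diff_left: "ip E (x - y) z = ip E x z - ip E y z"
 using ip_add_left[of x "- y" z] by (simp add: ip_minus_left)

lemma ip_scaleR_right: "ip E x (r *\<^sub>R y) = r *\<^sub>R ip E x y"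
 by (simp add: scaleR_eq_scaleC ip_scaleC_right)

lemma ip_scaleR_left: "ip E (r *\<^sub>R x) y = r *\<^sub>R ip E x y"
 by (simp add: scaleR_eq_scaleC ip_scaleC_left)

lemma ip_act_left: "ip E (act E x b) y = star b * ip E x y"
 by (metis ip_star ip_act_right star_mult)

lemma norm_ip_self: "norm (ip E x x) = (norm x)\<^sup>2"
 by (metis norm_ip norm_ge_zero real_sqrt_pow2_iff)

lemma ip_self_star: "star (ip E x x) = ip E x x"
 by (metis ip_star)

lemma ip_left_eqI: "(\<And>z. ip E z x = ip E z y) \<Longrightarrow> x = y"
 using norm_ip_self[of "x - y"] by (simp add: ip_diff_left ip_diff_right)

end

text \<open>
 The inequality depends on positivity in the coefficient algebra, and positivity is a consequence of the functional
 calculus of adjointable operators.  The circle is broken by applying the calculus to the algebra as a module over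
 itself, where the inequality is submultiplicativity of the norm; until then it is an assumption.
\<close>

locale cauchy_schwarz_module = hilbert_module E
 for E :: "('e :: {complex_normed_vector, banach}, 'b :: cstar_algebra) hilbmod" +
 assumes cauchy_schwarz: "norm (ip E x y) \<le> norm x * norm y"
begin

lemma bounded_bilinear_ip: "bounded_bilinear (ip E)"
 by unfold_locales
  (auto simp: ip_add_left ip_add_right ip_scaleR_left ip_scaleR_right
   intro!: exI[of _ 1] cauchy_schwarz)

lemmas tendsto_ip [tendsto_intros] = bounded_bilinear.tendsto[OF bounded_bilinear_ip]

end

subsection \<open>Adjoints\<close>

lemma is_adjointD: "is_adjoint E F T S \<Longrightarrow> ip F (T x) y = ip E x (S y)"
 by (simp add: is_adjoint_def)

lemma is_adjoint_compose:
 "is_adjoint E F T T' \<Longrightarrow> is_adjoint F G S S' \<Longrightarrow> is_adjoint E G (S \<cdot> T) (T' \<cdot> S')"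
 by (simp add: is_adjoint_def)

lemma is_adjoint_id: "is_adjoint E E \<one> \<one>"
 by (simp add: is_adjoint_def)

lemma is_adjoint_sym:
 assumes "hilbert_module E" "hilbert_module F" "is_adjoint E F T S"
 shows "is_adjoint F E S T"
 using assms unfolding is_adjoint_def by (metis hilbert_module.ip_star)

lemma is_adjoint_unique:
 assumes "hilbert_module E" "is_adjoint E F T S" "is_adjoint E F T S'"
 shows "S = S'"
 by (rule blinfun_eqI, rule hilbert_module.ip_left_eqI[OF assms(1)])
  (metis assms(2,3) is_adjointD)

lemma adj_eqI: "hilbert_module E \<Longrightarrow> is_adjoint E F T S \<Longrightarrow> adj E F T = S"
 unfolding adj_def by (rule the_equality) (auto intro: is_adjoint_unique)

lemma is_adjoint_adj: "hilbert_module E \<Longrightarrow> T \<in> Hom_star E F \<Longrightarrow> is_adjoint E F T (adj E F T)"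
 by (auto simp: Hom_star_def adj_eqI)

lemma Hom_starI: "is_adjoint E F T S \<Longrightarrow> T \<in> Hom_star E F"
 by (auto simp: Hom_star_def)

lemma adj_Hom_star:
 "hilbert_module E \<Longrightarrow> hilbert_module F \<Longrightarrow> T \<in> Hom_star E F \<Longrightarrow> adj E F T \<in> Hom_star F E"
 using is_adjoint_adj is_adjoint_sym Hom_starI by metis

lemma Hom_star_compose: "T \<in> Hom_star E F \<Longrightarrow> S \<in> Hom_star F G \<Longrightarrow> S \<cdot> T \<in> Hom_star E G"
 using is_adjoint_compose unfolding Hom_star_def by blast

lemma adj_adj:
 "hilbert_module E \<Longrightarrow> hilbert_module F \<Longrightarrow> T \<in> Hom_star E F \<Longrightarrow> adj F E (adj E F T) = T"
 by (simp add: adj_eqI is_adjoint_adj is_adjoint_sym)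

lemma adj_compose:
 "hilbert_module E \<Longrightarrow> hilbert_module F \<Longrightarrow> T \<in> Hom_star E F \<Longrightarrow> S \<in> Hom_star F G \<Longrightarrow>
  adj E G (S \<cdot> T) = adj E F T \<cdot> adj F G S"
 by (rule adj_eqI, assumption, rule is_adjoint_compose) (erule (1) is_adjoint_adj)+

text \<open>Adjointable maps are complex linear, which the type of bounded real-linear maps does not record.\<close>

lemma adjointable_scaleC:
 assumes "hilbert_module E" "hilbert_module F" "is_adjoint E F T S"
 shows "T (c *\<^sub>C x) = c *\<^sub>C T x"
proof -
 interpret E: hilbert_module E by fact
 interpret F: hilbert_module F by fact
 show ?thesis
 proof (rule F.ip_left_eqI)
  fix z
  have "is_adjoint F E S T" using assms by (rule is_adjoint_sym)
  then show "ip F z (T (c *\<^sub>C x)) = ip F z (c *\<^sub>C T x)"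
   by (metis is_adjointD E.ip_scaleC_right F.ip_scaleC_right)
 qed
qed

context hilbert_module
begin

abbreviation dag :: "'e endo \<Rightarrow> 'e endo"  (\<open>_\<^sup>*\<close> [1000] 1000) where
 "T\<^sup>* \<equiv> adj E E T"

lemma is_adjoint_dag: "T \<in> End_star E \<Longrightarrow> is_adjoint E E T (T\<^sup>*)"
 by (rule is_adjoint_adj[OF hilbert_module_axioms])

lemma ip_dag: "T \<in> End_star E \<Longrightarrow> ip E (T x) y = ip E x ((T\<^sup>*) y)"
 by (rule is_adjointD[OF is_adjoint_dag])

lemma dag_eqI: "is_adjoint E E T S \<Longrightarrow> T\<^sup>* = S"
 by (rule adj_eqI[OF hilbert_module_axioms])

lemma End_star_dag [simp, intro]: "T \<in> End_star E \<Longrightarrow> T\<^sup>* \<in> End_star E"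
 by (rule adj_Hom_star[OF hilbert_module_axioms hilbert_module_axioms])

lemma dag_dag [simp]: "T \<in> End_star E \<Longrightarrow> T\<^sup>*\<^sup>* = T"
 by (rule adj_adj[OF hilbert_module_axioms hilbert_module_axioms])

lemma End_star_compose [simp, intro]: "S \<in> End_star E \<Longrightarrow> T \<in> End_star E \<Longrightarrow> S \<cdot> T \<in> End_star E"
 by (rule Hom_star_compose)

lemma dag_compose [simp]:
 "S \<in> End_star E \<Longrightarrow> T \<in> End_star E \<Longrightarrow> (S \<cdot> T)\<^sup>* = T\<^sup>* \<cdot> S\<^sup>*"
 by (rule adj_compose[OF hilbert_module_axioms hilbert_module_axioms])

lemma End_star_id [simp, intro]: "\<one> \<in> End_star E"
 by (rule Hom_starI[OF is_adjoint_id])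

lemma dag_id [simp]: "\<one>\<^sup>* = \<one>"
 by (rule dag_eqI[OF is_adjoint_id])

lemma is_adjoint_add:
 "is_adjoint E E S S' \<Longrightarrow> is_adjoint E E T T' \<Longrightarrow> is_adjoint E E (S + T) (S' + T')"
 by (simp add: is_adjoint_def plus_blinfun.rep_eq ip_add_left ip_add_right)

lemma is_adjoint_diff:
 "is_adjoint E E S S' \<Longrightarrow> is_adjoint E E T T' \<Longrightarrow> is_adjoint E E (S - T) (S' - T')"
 by (simp add: is_adjoint_def minus_blinfun.rep_eq ip_diff_left ip_diff_right)

lemma is_adjoint_scaleC: "is_adjoint E E T T' \<Longrightarrow> is_adjoint E E (c *\<^sub>C T) (cnj c *\<^sub>C T')"
 by (simp add: is_adjoint_def ip_scaleC_left ip_scaleC_right)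

lemma is_adjoint_scaleR: "is_adjoint E E T T' \<Longrightarrow> is_adjoint E E (r *\<^sub>R T) (r *\<^sub>R T')"
 by (simp add: is_adjoint_def scaleR_blinfun.rep_eq ip_scaleR_left ip_scaleR_right)

lemma is_adjoint_minus: "is_adjoint E E T T' \<Longrightarrow> is_adjoint E E (- T) (- T')"
 by (simp add: is_adjoint_def uminus_blinfun.rep_eq ip_minus_left ip_minus_right)

lemma is_adjoint_zero: "is_adjoint E E 0 0"
 by (simp add: is_adjoint_def zero_blinfun.rep_eq)

lemma End_star_add [simp, intro]: "S \<in> End_star E \<Longrightarrow> T \<in> End_star E \<Longrightarrow> S + T \<in> End_star E"
 by (meson Hom_starI is_adjoint_add is_adjoint_dag)

lemma End_star_diff [simp, intro]: "S \<in> End_star E \<Longrightarrow> T \<in> End_star E \<Longrightarrow> S - T \<in> End_star E"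
 by (meson Hom_starI is_adjoint_diff is_adjoint_dag)

lemma End_star_minus [simp, intro]: "T \<in> End_star E \<Longrightarrow> - T \<in> End_star E"
 by (meson Hom_starI is_adjoint_minus is_adjoint_dag)

lemma End_star_scaleC [simp, intro]: "T \<in> End_star E \<Longrightarrow> c *\<^sub>C T \<in> End_star E"
 by (meson Hom_starI is_adjoint_scaleC is_adjoint_dag)

lemma End_star_scaleR [simp, intro]: "T \<in> End_star E \<Longrightarrow> r *\<^sub>R T \<in> End_star E"
 by (meson Hom_starI is_adjoint_scaleR is_adjoint_dag)

lemma End_star_zero [simp, intro]: "0 \<in> End_star E"
 by (rule Hom_starI[OF is_adjoint_zero])

lemma End_star_sum [intro]: "(\<And>i. i \<in> I \<Longrightarrow> T i \<in> End_star E) \<Longrightarrow> (\<Sum>i\<in>I. T i) \<in> End_star E"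
 by (induction I rule: infinite_finite_induct) auto

lemma dag_add [simp]: "S \<in> End_star E \<Longrightarrow> T \<in> End_star E \<Longrightarrow> (S + T)\<^sup>* = S\<^sup>* + T\<^sup>*"
 by (intro dag_eqI is_adjoint_add is_adjoint_dag)

lemma dag_diff [simp]: "S \<in> End_star E \<Longrightarrow> T \<in> End_star E \<Longrightarrow> (S - T)\<^sup>* = S\<^sup>* - T\<^sup>*"
 by (intro dag_eqI is_adjoint_diff is_adjoint_dag)

lemma dag_minus [simp]: "T \<in> End_star E \<Longrightarrow> (- T)\<^sup>* = - T\<^sup>*"
 by (intro dag_eqI is_adjoint_minus is_adjoint_dag)

lemma dag_scaleC [simp]: "T \<in> End_star E \<Longrightarrow> (c *\<^sub>C T)\<^sup>* = cnj c *\<^sub>C T\<^sup>*"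
 by (intro dag_eqI is_adjoint_scaleC is_adjoint_dag)

lemma dag_scaleR [simp]: "T \<in> End_star E \<Longrightarrow> (r *\<^sub>R T)\<^sup>* = r *\<^sub>R T\<^sup>*"
 by (intro dag_eqI is_adjoint_scaleR is_adjoint_dag)

lemma dag_zero [simp]: "0\<^sup>* = 0"
 by (intro dag_eqI is_adjoint_zero)

lemma dag_sum: "(\<And>i. i \<in> I \<Longrightarrow> T i \<in> End_star E) \<Longrightarrow> (\<Sum>i\<in>I. T i)\<^sup>* = (\<Sum>i\<in>I. (T i)\<^sup>*)"
 by (induction I rule: infinite_finite_induct) (auto simp: End_star_sum)

lemma compose_scaleC_right: "S \<in> End_star E \<Longrightarrow> S \<cdot> (c *\<^sub>C T) = c *\<^sub>C (S \<cdot> T)"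
 by (rule blinfun_eqI)
  (simp add: adjointable_scaleC[OF hilbert_module_axioms hilbert_module_axioms is_adjoint_dag])

lemma apply_scaleC: "S \<in> End_star E \<Longrightarrow> S (c *\<^sub>C x) = c *\<^sub>C S x"
 by (simp add: adjointable_scaleC[OF hilbert_module_axioms hilbert_module_axioms is_adjoint_dag])

end

context cauchy_schwarz_module
begin

lemma norm_dag [simp]:
 assumes "T \<in> End_star E" shows "norm (T\<^sup>*) = norm T"
proof -
 have le: "norm (S\<^sup>*) \<le> norm S" if "S \<in> End_star E" for S
 proof (rule norm_blinfun_bound)
  fix y
  let ?z = "(S\<^sup>*) y"
  have "(norm ?z)\<^sup>2 = norm (ip E (S ?z) y)"
   by (simp add: norm_ip_self[symmetric] ip_dag that)
  also have "\<dots> \<le> norm S * norm ?z * norm y"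
   by (meson cauchy_schwarz mult_right_mono norm_blinfun norm_ge_zero order_trans)
  finally show "norm ?z \<le> norm S * norm y"
   by (cases "norm ?z = 0") (auto simp: power2_eq_square)
 qed simp
 show ?thesis using le[OF assms] le[of "T\<^sup>*"] assms by simp
qed

lemma norm_dag_compose:
 assumes "T \<in> End_star E" shows "norm (T\<^sup>* \<cdot> T) = (norm T)\<^sup>2"
proof (rule antisym)
 show "norm (T\<^sup>* \<cdot> T) \<le> (norm T)\<^sup>2"
  using norm_blinfun_compose[of "T\<^sup>*" T] assms by (simp add: power2_eq_square)
 have "norm T \<le> sqrt (norm (T\<^sup>* \<cdot> T))"
 proof (rule norm_blinfun_bound)
  fix x
  have "(norm (T x))\<^sup>2 = norm (ip E x ((T\<^sup>* \<cdot> T) x))"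
   by (simp add: norm_ip_self[symmetric] ip_dag assms)
  also have "\<dots> \<le> norm x * (norm (T\<^sup>* \<cdot> T) * norm x)"
   by (meson cauchy_schwarz mult_left_mono norm_blinfun norm_ge_zero order_trans)
  also have "\<dots> = (sqrt (norm (T\<^sup>* \<cdot> T)) * norm x)\<^sup>2"
   by (simp add: power_mult_distrib power2_eq_square)
  finally show "norm (T x) \<le> sqrt (norm (T\<^sup>* \<cdot> T)) * norm x"
   by (rule power2_le_imp_le) simp
 qed simp
 then show "(norm T)\<^sup>2 \<le> norm (T\<^sup>* \<cdot> T)"
  using power_mono[of "norm T" "sqrt (norm (T\<^sup>* \<cdot> T))" 2] by simp
qed

text \<open>The two limits are adjoint to each other because the inner product is continuous.\<close>

lemma strong_limit_adjointable:
 assumes T: "\<And>n. T n \<in> End_star E" and M: "\<And>n. norm (T n) \<le> M"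
  and cT: "\<And>x. (\<lambda>n. (T n) x) \<longlonglongrightarrow> t x"
  and cS: "\<And>x. (\<lambda>n. ((T n)\<^sup>*) x) \<longlonglongrightarrow> s x"
 obtains R where "R \<in> End_star E" "norm R \<le> M" "\<And>x. R x = t x" "\<And>x. (R\<^sup>*) x = s x"
proof -
 have M0: "0 \<le> M" using M[of 0] norm_ge_zero order_trans by blast
 have bl: "bounded_linear f \<and> (\<forall>x. norm (f x) \<le> M * norm x)"
  if V: "\<And>n. norm (V n) \<le> M" and c: "\<And>x. (\<lambda>n. (V n) x) \<longlonglongrightarrow> f x"
  for V :: "nat \<Rightarrow> 'e endo" and f
 proof -
  have b: "norm (f x) \<le> M * norm x" for x
  proof (rule LIMSEQ_le_const2[OF tendsto_norm[OF c]])
   show "\<exists>N. \<forall>n\<ge>N. norm ((V n) x) \<le> M * norm x"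
    by (meson V mult_right_mono norm_blinfun norm_ge_zero order_trans)
  qed
  have "bounded_linear f"
  proof (rule bounded_linear_intro[where K = M])
   show "f (x + y) = f x + f y" for x y
    by (rule LIMSEQ_unique[OF c]) (simp add: blinfun.add_right tendsto_add[OF c c])
   show "f (r *\<^sub>R x) = r *\<^sub>R f x" for r x
    by (rule LIMSEQ_unique[OF c]) (simp add: blinfun.scaleR_right tendsto_scaleR[OF tendsto_const c])
  qed (use b in \<open>simp add: mult.commute\<close>)
  then show ?thesis using b by blast
 qed
 have t: "bounded_linear t \<and> (\<forall>x. norm (t x) \<le> M * norm x)" by (rule bl[OF M cT])
 have s: "bounded_linear s \<and> (\<forall>x. norm (s x) \<le> M * norm x)"
  by (rule bl[OF _ cS]) (simp add: T M)
 define R S where "R = Blinfun t" and "S = Blinfun s"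
 have R: "R x = t x" and S: "S x = s x" for x
  using t s by (simp_all add: R_def S_def bounded_linear_Blinfun_apply)
 have "is_adjoint E E R S"
  unfolding is_adjoint_def R S
 proof (intro allI)
  fix x y
  have "(\<lambda>n. ip E ((T n) x) y) \<longlonglongrightarrow> ip E (t x) y"
   by (intro tendsto_intros cT)
  moreover have "(\<lambda>n. ip E x (((T n)\<^sup>*) y)) \<longlonglongrightarrow> ip E x (s y)"
   by (intro tendsto_intros cS)
  ultimately show "ip E (t x) y = ip E x (s y)"
   using LIMSEQ_unique by (simp add: ip_dag T)
 qed
 moreover have "norm R \<le> M"
  by (rule norm_blinfun_bound[OF M0]) (use t R in auto)
 ultimately show ?thesis using that R S by (metis Hom_starI dag_eqI)
qed

lemma norm_limit_adjointable:
 assumes T: "\<And>n. T n \<in> End_star E" and R: "T \<longlonglongrightarrow> R"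
 shows "R \<in> End_star E" "(\<lambda>n. (T n)\<^sup>*) \<longlonglongrightarrow> R\<^sup>*"
proof -
 have "Cauchy (\<lambda>n. (T n)\<^sup>*)"
  using LIMSEQ_imp_Cauchy[OF R] T
  by (simp add: Cauchy_def dist_norm dag_diff[symmetric] del: dag_diff)
 then obtain S where S: "(\<lambda>n. (T n)\<^sup>*) \<longlonglongrightarrow> S" by (auto simp: Cauchy_convergent_iff convergent_def)
 have "is_adjoint E E R S"
  unfolding is_adjoint_def
 proof (intro allI)
  fix x y
  have "(\<lambda>n. ip E ((T n) x) y) \<longlonglongrightarrow> ip E (R x) y"
   by (intro tendsto_intros R)
  moreover have "(\<lambda>n. ip E x (((T n)\<^sup>*) y)) \<longlonglongrightarrow> ip E x (S y)"
   by (intro tendsto_intros S)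
  ultimately show "ip E (R x) y = ip E x (S y)"
   using LIMSEQ_unique by (simp add: ip_dag T)
 qed
 then show "R \<in> End_star E" "(\<lambda>n. (T n)\<^sup>*) \<longlonglongrightarrow> R\<^sup>*"
  using S by (auto simp: Hom_starI dag_eqI)
qed

end

section \<open>Continuous functional calculus of a unitary\<close>

subsection \<open>Roots of unity\<close>

lemma sum_roots_of_unity:
 fixes m :: int
 assumes "\<bar>m\<bar> < int N"
 shows "(\<Sum>j<N. cis (2 * pi * of_int m * real j / real N)) = (if m = 0 then of_nat N else 0)"
proof (cases "m = 0")
 case False
 define z where "z = cis (2 * pi * of_int m / real N)"
 have N: "0 < N" using assms by linarith
 have "z \<noteq> 1"
 proof
  assume "z = 1"
  then have "cos (2 * pi * of_int m / real N) = 1"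
   by (metis z_def cis.simps(1) one_complex.simps(1))
  then obtain k :: int where "2 * pi * of_int m / real N = of_int k * 2 * pi"
   by (auto simp: cos_one_2pi_int)
  then have "of_int m = of_int k * real N" using N by (simp add: field_simps)
  then have "m = k * int N" by (metis of_int_eq_iff of_int_mult of_int_of_nat_eq)
  then have "\<bar>k\<bar> * int N < int N" using assms by (simp add: abs_mult)
  moreover have "k \<noteq> 0" using \<open>m = k * int N\<close> False by auto
  then have "1 * int N \<le> \<bar>k\<bar> * int N" by (intro mult_right_mono) auto
  ultimately show False by simp
 qed
 moreover have "z ^ N = 1"
 proof -
  have "real N * (2 * pi * of_int m / real N) = 2 * pi * of_int m" using N by simp
  then have "z ^ N = cis (2 * pi * of_int m)" by (simp only: z_def Complex.DeMoivre)
  then show ?thesis by simp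
 qed
 moreover have "cis (2 * pi * of_int m * real j / real N) = z ^ j" for j
  by (simp add: z_def Complex.DeMoivre field_simps)
 ultimately show ?thesis using False by (simp add: geometric_sum)
qed simp

text \<open>The coefficient of \<open>z\<^sup>k\<close> is the average of \<open>z\<^sup>-\<^sup>k q(z)\<close> over the \<open>N\<close>-th roots of unity, for \<open>N\<close> beyond \<open>k\<close> and the degree.\<close>

lemma norm_coeff_le_sup_circle:
 fixes q :: "complex poly"
 assumes M: "\<And>z. cmod z = 1 \<Longrightarrow> cmod (poly q z) \<le> M"
 shows "cmod (poly.coeff q k) \<le> M"
proof -
 define N where "N = Suc (max (degree q) k)"
 have N: "0 < N" "k < N" "degree q < N" by (auto simp: N_def)
 define w where "w j = cis (2 * pi * real j / real N)" for j
 have w: "w j ^ i * cis (- (2 * pi * real k * real j / real N))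
   = cis (2 * pi * of_int (int i - int k) * real j / real N)" for i j
  unfolding w_def Complex.DeMoivre cis_mult using N by (intro arg_cong[where f = cis]) (simp add: field_simps)
 have distr: "poly q (w j) * c = (\<Sum>i\<le>degree q. poly.coeff q i * (w j ^ i * c))" for j c
  by (simp add: poly_altdef sum_distrib_right mult.assoc)
 have "(\<Sum>j<N. poly q (w j) * cis (- (2 * pi * real k * real j / real N)))
   = (\<Sum>j<N. \<Sum>i\<le>degree q. poly.coeff q i * cis (2 * pi * of_int (int i - int k) * real j / real N))"
  by (simp only: distr w)
 also have "\<dots> = (\<Sum>i\<le>degree q. poly.coeff q i * (\<Sum>j<N. cis (2 * pi * of_int (int i - int k) * real j / real N)))"
  by (subst sum.swap) (simp add: sum_distrib_left)
 also have "\<dots> = (\<Sum>i\<le>degree q. poly.coeff q i * (if int i - int k = 0 then of_nat N else 0))"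
  by (intro sum.cong refl arg_cong2[where f = "(*)"] sum_roots_of_unity) (use N in auto)
 also have "\<dots> = (\<Sum>i\<le>degree q. if i = k then poly.coeff q i * of_nat N else 0)"
  by (intro sum.cong) auto
 also have "\<dots> = poly.coeff q k * of_nat N"
  by (auto simp: sum.delta coeff_eq_0)
 finally have "real N * cmod (poly.coeff q k)
   = cmod (\<Sum>j<N. poly q (w j) * cis (- (2 * pi * real k * real j / real N)))"
  by (simp add: norm_mult mult.commute)
 also have "\<dots> \<le> (\<Sum>j<N. M)"
  by (intro order_trans[OF norm_sum] sum_mono) (simp add: norm_mult M w_def)
 finally show ?thesis using N by simp
qed

text \<open>
 A factor that grows linearly in the exponent disappears after taking roots.  Exponents are powers of \<open>2\<close> because
 norms of powers of normal operators are computed by repeated squaring.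
\<close>

lemma power_le_linear_times_power_imp_le:
 fixes x M :: real
 assumes "0 < M" and le: "\<And>k. x ^ (2 ^ k) \<le> (d * 2 ^ k + 1) * M ^ (2 ^ k)"
 shows "x \<le> M"
proof (rule ccontr)
 assume "\<not> x \<le> M"
 define r where "r = x / M"
 have r: "1 < r" using \<open>\<not> x \<le> M\<close> \<open>0 < M\<close> by (simp add: r_def)
 have "r ^ (2 ^ k) \<le> d * 2 ^ k + 1" for k
  using le[of k] \<open>0 < M\<close> by (simp add: r_def power_divide field_simps)
 then have "(d * 2 ^ k + 1) / r ^ (2 ^ k) \<ge> 1" for k
  using r by (simp add: field_simps)
 moreover have "(\<lambda>n. (d * real n + 1) / r ^ n) \<longlonglongrightarrow> 0"
 proof -
  have 1: "(\<lambda>n. real n * (1 / r) ^ n) \<longlonglongrightarrow> 0" using r by (intro powser_times_n_limit_0) auto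
  have 2: "(\<lambda>n. (1 / r) ^ n) \<longlonglongrightarrow> 0" using r by (intro LIMSEQ_power_zero) auto
  have "(\<lambda>n. d * (real n * (1 / r) ^ n) + (1 / r) ^ n) \<longlonglongrightarrow> d * 0 + 0"
   by (intro tendsto_intros 1 2)
  then show ?thesis by (simp add: field_simps power_divide add_divide_distrib)
 qed
 then have "(\<lambda>k. (d * real (2 ^ k) + 1) / r ^ (2 ^ k)) \<longlonglongrightarrow> 0"
  by (rule filterlim_compose) (auto intro!: filterlim_subseq simp: strict_mono_def)
 ultimately show False
  using LIMSEQ_le_const[of _ 0 1] by fastforce
qed

subsection \<open>Polynomials of an operator\<close>

definition op_pow :: "('e :: real_normed_vector) endo \<Rightarrow> nat \<Rightarrow> 'e endo" where
 "op_pow u n = ((\<cdot>) u ^^ n) \<one>"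

lemma op_pow_0 [simp]: "op_pow u 0 = \<one>"
 and op_pow_Suc: "op_pow u (Suc n) = u \<cdot> op_pow u n"
 by (simp_all add: op_pow_def)

lemma op_pow_add: "op_pow u (m + n) = op_pow u m \<cdot> op_pow u n"
 by (induction m) (simp_all add: op_pow_Suc op_assoc)

lemma compose_commute:
 assumes "X \<cdot> S = S \<cdot> X" "Y \<cdot> S = S \<cdot> Y"
 shows "X \<cdot> Y \<cdot> S = S \<cdot> (X \<cdot> Y)"
proof -
 have "X \<cdot> Y \<cdot> S = X \<cdot> S \<cdot> Y" by (simp only: op_assoc assms(2))
 then show ?thesis by (simp only: assms(1) op_assoc)
qed

lemma op_pow_commute: "S \<cdot> u = u \<cdot> S \<Longrightarrow> S \<cdot> op_pow u n = op_pow u n \<cdot> S"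
proof (induction n)
 case (Suc n)
 have "S \<cdot> op_pow u (Suc n) = (S \<cdot> u) \<cdot> op_pow u n" by (simp only: op_pow_Suc op_assoc)
 also have "\<dots> = u \<cdot> (S \<cdot> op_pow u n)" by (simp only: Suc.prems op_assoc)
 also have "\<dots> = op_pow u (Suc n) \<cdot> S" by (simp only: Suc op_pow_Suc op_assoc)
 finally show ?case .
qed simp

lemma op_pow_cancel: "v \<cdot> u = \<one> \<Longrightarrow> op_pow v n \<cdot> op_pow u n = \<one>"
proof (induction n)
 case (Suc n)
 have "op_pow v (Suc n) \<cdot> op_pow u (Suc n) = op_pow v n \<cdot> (v \<cdot> u) \<cdot> op_pow u n"
  using op_pow_add[of v n 1] by (simp add: op_pow_Suc op_assoc)
 then show ?case using Suc by simp
qed simp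

definition op_poly :: "('e :: complex_normed_vector) endo \<Rightarrow> complex poly \<Rightarrow> 'e endo" where
 "op_poly u q = (\<Sum>i\<le>degree q. poly.coeff q i *\<^sub>C op_pow u i)"

lemma op_poly_altdef: "degree q \<le> n \<Longrightarrow> op_poly u q = (\<Sum>i\<le>n. poly.coeff q i *\<^sub>C op_pow u i)"
 unfolding op_poly_def by (intro sum.mono_neutral_left) (auto simp: coeff_eq_0)

lemma op_poly_0 [simp]: "op_poly u 0 = 0"
 by (simp add: op_poly_def)

lemma op_poly_1 [simp]: "op_poly u 1 = \<one>"
 by (simp add: op_poly_def)

lemma op_poly_add: "op_poly u (p + q) = op_poly u p + op_poly u q"
proof -
 let ?n = "max (degree p) (degree q)"
 show ?thesis
  using op_poly_altdef[of "p + q" ?n u] op_poly_altdef[of p ?n u] op_poly_altdef[of q ?n u]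
  by (simp add: degree_add_le scaleC_add_left sum.distrib)
qed

lemma op_poly_smult: "op_poly u (Polynomial.smult c p) = c *\<^sub>C op_poly u p"
 using op_poly_altdef[of "Polynomial.smult c p" "degree p" u]
 by (simp add: degree_smult_le op_poly_def scaleC_scaleC scaleC_sum_right)

context hilbert_module
begin

lemma op_pow_End [simp, intro]: "u \<in> End_star E \<Longrightarrow> op_pow u n \<in> End_star E"
 by (induction n) (auto simp: op_pow_Suc)

lemma dag_op_pow: "u \<in> End_star E \<Longrightarrow> (op_pow u n)\<^sup>* = op_pow (u\<^sup>*) n"
proof (induction n)
 case (Suc n)
 then show ?case using op_pow_add[of "u\<^sup>*" n 1] by (simp add: op_pow_Suc)
qed simp

lemma op_poly_End [simp, intro]: "u \<in> End_star E \<Longrightarrow> op_poly u q \<in> End_star E"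
 unfolding op_poly_def by (intro End_star_sum End_star_scaleC op_pow_End)

lemma op_poly_pCons:
 assumes "u \<in> End_star E"
 shows "op_poly u (pCons a q) = a *\<^sub>C \<one> + u \<cdot> op_poly u q"
proof -
 have "op_poly u (pCons a q) = (\<Sum>i\<le>Suc (degree q). poly.coeff (pCons a q) i *\<^sub>C op_pow u i)"
  by (rule op_poly_altdef) (simp add: degree_pCons_le)
 also have "\<dots> = a *\<^sub>C \<one> + (\<Sum>i\<le>degree q. poly.coeff q i *\<^sub>C op_pow u (Suc i))"
  by (subst sum.atMost_Suc_shift) simp
 also have "(\<Sum>i\<le>degree q. poly.coeff q i *\<^sub>C op_pow u (Suc i)) = u \<cdot> op_poly u q"
  by (simp add: op_poly_def op_pow_Suc blinfun_compose.sum_right compose_scaleC_right assms)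
 finally show ?thesis .
qed

lemma op_poly_mult: "u \<in> End_star E \<Longrightarrow> op_poly u (p * q) = op_poly u p \<cdot> op_poly u q"
proof (induction p)
 case (pCons a p)
 have "op_poly u (pCons a p * q) = a *\<^sub>C op_poly u q + u \<cdot> op_poly u (p * q)"
  using op_poly_pCons[OF pCons.prems, of 0 "p * q"]
  by (simp add: mult_pCons_left op_poly_add op_poly_smult)
 also have "\<dots> = op_poly u (pCons a p) \<cdot> op_poly u q"
  by (simp add: pCons op_poly_pCons op_simps scaleC_compose_left)
 finally show ?case .
qed simp

lemma op_poly_power: "u \<in> End_star E \<Longrightarrow> op_poly u (q ^ n) = op_pow (op_poly u q) n"
 by (induction n) (simp_all add: op_poly_mult op_pow_Suc)

lemma op_poly_commute:
 assumes "S \<in> End_star E" "S \<cdot> u = u \<cdot> S"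
 shows "S \<cdot> op_poly u q = op_poly u q \<cdot> S"
 by (simp add: op_poly_def op_sum assms
   compose_scaleC_right scaleC_compose_left op_pow_commute)

definition unitary_op :: "'e endo \<Rightarrow> bool" where
 "unitary_op u \<longleftrightarrow> u \<in> End_star E \<and> u\<^sup>* \<cdot> u = \<one> \<and> u \<cdot> u\<^sup>* = \<one>"

end

context cauchy_schwarz_module
begin

lemma norm_unitary_le: "unitary_op u \<Longrightarrow> norm u \<le> 1"
proof -
 assume u: "unitary_op u"
 have "(norm u)\<^sup>2 \<le> 1\<^sup>2"
  using norm_dag_compose[of u] norm_blinfun_id_le[where ?'a = 'e] u by (simp add: unitary_op_def)
 then show ?thesis by (rule power2_le_imp_le) simp
qed

lemma norm_op_pow_unitary_le: "unitary_op u \<Longrightarrow> norm (op_pow u n) \<le> 1"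
proof (induction n)
 case (Suc n)
 then show ?case
  using norm_compose_le[OF norm_unitary_le Suc(1)] by (simp add: op_pow_Suc)
qed (simp add: norm_blinfun_id_le)

text \<open>
 For a normal \<open>S\<close> the C*-identity, applied to \<open>S\<^sup>2\<close>, to \<open>S\<^sup>*S\<close> and to \<open>S\<close>, gives
 \<open>\<parallel>S\<^sup>2\<parallel>\<^sup>2 = \<parallel>(S\<^sup>*S)\<^sup>2\<parallel> = \<parallel>S\<parallel>\<^sup>4\<close>.
\<close>

lemma norm_op_pow_normal:
 assumes T: "T \<in> End_star E" and normal: "T\<^sup>* \<cdot> T = T \<cdot> T\<^sup>*"
 shows "norm (op_pow T (2 ^ k)) = norm T ^ (2 ^ k)"
proof (induction k)
 case (Suc k)
 let ?S = "op_pow T (2 ^ k)"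
 have S: "?S \<in> End_star E" using T by simp
 have comm: "?S\<^sup>* \<cdot> ?S = ?S \<cdot> ?S\<^sup>*"
 proof -
  have "T \<cdot> ?S\<^sup>* = ?S\<^sup>* \<cdot> T"
   using op_pow_commute[of T "T\<^sup>*" "2 ^ k"] normal T by (simp add: dag_op_pow)
  then show ?thesis using op_pow_commute[of "?S\<^sup>*" T "2 ^ k"] by simp
 qed
 have "(norm (?S \<cdot> ?S))\<^sup>2 = norm (?S\<^sup>* \<cdot> (?S\<^sup>* \<cdot> ?S) \<cdot> ?S)"
  using norm_dag_compose[of "?S \<cdot> ?S"] S by (simp add: op_assoc)
 also have "?S\<^sup>* \<cdot> (?S\<^sup>* \<cdot> ?S) \<cdot> ?S = (?S\<^sup>* \<cdot> ?S)\<^sup>* \<cdot> (?S\<^sup>* \<cdot> ?S)"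
  by (subst (1) comm) (use S in \<open>simp add: op_assoc\<close>)
 also have "norm \<dots> = ((norm ?S)\<^sup>2)\<^sup>2"
  by (subst norm_dag_compose) (use S in \<open>simp_all add: norm_dag_compose\<close>)
 finally have "norm (?S \<cdot> ?S) = (norm ?S)\<^sup>2" by (rule power2_eq_imp_eq) auto
 then show ?case using Suc op_pow_add[of T "2 ^ k" "2 ^ k"]
  by (simp add: mult_2 power_add power2_eq_square)
qed (simp add: op_pow_Suc)

text \<open>
 The coefficients of a polynomial of degree \<open>d\<close> are bounded by its supremum on the circle, so that
 \<open>\<parallel>q(u)\<parallel> \<le> (d + 1) sup |q|\<close>.  As \<open>q(u)\<close> is normal, the bound for the powers of \<open>q\<close>, whose degree
 grows only linearly, removes the factor \<open>d + 1\<close>.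
\<close>

lemma norm_op_poly_unitary_le:
 assumes u: "unitary_op u" and M: "\<And>z. cmod z = 1 \<Longrightarrow> cmod (poly q z) \<le> M"
 shows "norm (op_poly u q) \<le> M"
proof (rule field_le_epsilon)
 fix e :: real assume "0 < e"
 have M0: "0 \<le> M" using M[of 1] norm_ge_zero order_trans by (metis norm_one)
 have uE: "u \<in> End_star E" using u by (simp add: unitary_op_def)
 have crude: "norm (op_poly u p) \<le> (real (degree p) + 1) * K"
  if K: "\<And>z. cmod z = 1 \<Longrightarrow> cmod (poly p z) \<le> K" for p K
 proof -
  have "norm (op_poly u p) \<le> (\<Sum>i\<le>degree p. K * 1)"
   unfolding op_poly_def
  proof (intro order_trans[OF norm_sum] sum_mono)
   fix i
   show "norm (poly.coeff p i *\<^sub>C op_pow u i) \<le> K * 1"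
    unfolding norm_scaleC
    by (intro mult_mono norm_coeff_le_sup_circle K norm_op_pow_unitary_le u)
     (use order_trans[OF norm_ge_zero K[of 1]] in auto)
  qed
  then show ?thesis by (simp add: algebra_simps)
 qed
 let ?T = "op_poly u q"
 have TE: "?T \<in> End_star E" by (simp add: uE)
 have normal: "?T\<^sup>* \<cdot> ?T = ?T \<cdot> ?T\<^sup>*"
 proof (rule op_poly_commute)
  have "u\<^sup>* \<cdot> ?T = ?T \<cdot> u\<^sup>*"
   by (rule op_poly_commute) (use u in \<open>auto simp: unitary_op_def\<close>)
  then have "(u\<^sup>* \<cdot> ?T)\<^sup>* = (?T \<cdot> u\<^sup>*)\<^sup>*" by simp
  then show "?T\<^sup>* \<cdot> u = u \<cdot> ?T\<^sup>*" using uE by simp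
 qed (simp add: TE)
 show "norm ?T \<le> M + e"
 proof (rule power_le_linear_times_power_imp_le[where d = "real (degree q)"])
  fix k :: nat
  have "norm ?T ^ (2 ^ k) = norm (op_poly u (q ^ (2 ^ k)))"
   by (simp add: op_poly_power uE norm_op_pow_normal[OF TE normal])
  also have "\<dots> \<le> (real (degree (q ^ (2 ^ k))) + 1) * (M + e) ^ (2 ^ k)"
  proof (rule crude)
   fix z :: complex assume "cmod z = 1"
   then have "cmod (poly q z) \<le> M + e" using M[of z] \<open>0 < e\<close> by simp
   then show "cmod (poly (q ^ 2 ^ k) z) \<le> (M + e) ^ 2 ^ k"
    by (simp add: norm_power power_mono)
  qed
  also have "\<dots> \<le> (real (degree q) * 2 ^ k + 1) * (M + e) ^ (2 ^ k)"
  proof -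
   have "real (degree (q ^ 2 ^ k)) \<le> real (degree q * 2 ^ k)"
    by (simp only: of_nat_le_iff degree_power_le)
   then show ?thesis using M0 \<open>0 < e\<close> by (intro mult_right_mono) auto
  qed
  finally show "norm ?T ^ (2 ^ k) \<le> (real (degree q) * 2 ^ k + 1) * (M + e) ^ (2 ^ k)" .
 qed (use M0 \<open>0 < e\<close> in auto)
qed

subsection \<open>Laurent polynomials and their closure\<close>

text \<open>On the circle \<open>cnj z\<close> is \<open>z\<^sup>-\<^sup>1\<close>, which becomes \<open>u\<^sup>*\<close>; the exponent \<open>n\<close> of the denominator is not unique.\<close>

definition laurent :: "'e endo \<Rightarrow> (complex \<Rightarrow> complex) \<Rightarrow> 'e endo \<Rightarrow> bool" where
 "laurent u F T \<longleftrightarrow> (\<exists>n q. (\<forall>z. cmod z = 1 \<longrightarrow> F z = cnj z ^ n * poly q z) \<and>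
   T = op_pow (u\<^sup>*) n \<cdot> op_poly u q)"

context
 fixes u assumes u: "unitary_op u"
begin

lemma uE: "u \<in> End_star E" using u by (simp add: unitary_op_def)

lemma unitary_dag: "unitary_op (u\<^sup>*)"
 using u by (simp add: unitary_op_def)

lemma laurent_End: "laurent u F T \<Longrightarrow> T \<in> End_star E"
 using uE by (auto simp: laurent_def)

lemma laurent_norm_le:
 assumes "laurent u F T" and M: "\<And>z. cmod z = 1 \<Longrightarrow> cmod (F z) \<le> M"
 shows "norm T \<le> M"
proof -
 obtain n q where F: "\<And>z. cmod z = 1 \<Longrightarrow> F z = cnj z ^ n * poly q z"
  and T: "T = op_pow (u\<^sup>*) n \<cdot> op_poly u q"
  using assms(1) by (auto simp: laurent_def)
 have "norm (op_poly u q) \<le> M"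
 proof (rule norm_op_poly_unitary_le[OF u])
  show "cmod (poly q z) \<le> M" if "cmod z = 1" for z
   using M[OF that] F[OF that] that by (simp add: norm_mult norm_power)
 qed
 then show ?thesis
  using norm_compose_le[OF norm_op_pow_unitary_le[OF unitary_dag, of n], of "op_poly u q" M]
  by (simp add: T)
qed

text \<open>
 Laurent polynomials are added over a common denominator \<open>z\<^sup>n\<close>: multiplying \<open>q\<close> by \<open>z\<^sup>k\<close> is compensated by
 \<open>u\<^sup>*u = 1\<close>.
\<close>

lemma laurent_raise:
 assumes "laurent u F T"
 shows "\<exists>N. \<forall>n\<ge>N. \<exists>q. (\<forall>z. cmod z = 1 \<longrightarrow> F z = cnj z ^ n * poly q z) \<and>
   T = op_pow (u\<^sup>*) n \<cdot> op_poly u q"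
proof -
 obtain N q where F: "\<And>z. cmod z = 1 \<Longrightarrow> F z = cnj z ^ N * poly q z"
  and T: "T = op_pow (u\<^sup>*) N \<cdot> op_poly u q"
  using assms by (auto simp: laurent_def)
 show ?thesis
 proof (rule exI[of _ N], intro allI impI exI conjI)
  fix n assume n: "n \<ge> N"
  let ?q = "monom 1 (n - N) * q"
  show "F z = cnj z ^ n * poly ?q z" if z: "cmod z = 1" for z
  proof -
   have "cnj z ^ (n - N) * z ^ (n - N) = 1"
    using z complex_norm_square[of z] by (simp add: power_mult_distrib[symmetric] mult.commute)
   moreover have "cnj z ^ n = cnj z ^ N * cnj z ^ (n - N)"
    using n by (simp add: power_add[symmetric])
   ultimately show ?thesis by (simp add: F[OF z] poly_monom mult_ac)
  qed
  have mon: "op_poly u (monom 1 k) = op_pow u k" for k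
   by (induction k) (simp_all add: op_poly_pCons uE monom_Suc op_pow_Suc monom_0)
  have "op_pow (u\<^sup>*) n \<cdot> op_poly u ?q
    = op_pow (u\<^sup>*) N \<cdot> (op_pow (u\<^sup>*) (n - N) \<cdot> op_pow u (n - N)) \<cdot> op_poly u q"
   using op_pow_add[of "u\<^sup>*" N "n - N"] n by (simp add: op_poly_mult uE mon op_assoc)
  then show "T = op_pow (u\<^sup>*) n \<cdot> op_poly u ?q"
   using u by (simp add: op_pow_cancel T unitary_op_def)
 qed
qed

lemma laurent_add:
 assumes "laurent u F S" "laurent u G T" shows "laurent u (\<lambda>z. F z + G z) (S + T)"
proof -
 obtain N where N: "\<And>n. n \<ge> N \<Longrightarrow> \<exists>q. (\<forall>z. cmod z = 1 \<longrightarrow> F z = cnj z ^ n * poly q z) \<and>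
   S = op_pow (u\<^sup>*) n \<cdot> op_poly u q" using laurent_raise[OF assms(1)] by blast
 obtain N' where N': "\<And>n. n \<ge> N' \<Longrightarrow> \<exists>q. (\<forall>z. cmod z = 1 \<longrightarrow> G z = cnj z ^ n * poly q z) \<and>
   T = op_pow (u\<^sup>*) n \<cdot> op_poly u q" using laurent_raise[OF assms(2)] by blast
 let ?n = "max N N'"
 obtain q where q: "\<And>z. cmod z = 1 \<Longrightarrow> F z = cnj z ^ ?n * poly q z" "S = op_pow (u\<^sup>*) ?n \<cdot> op_poly u q"
  using N[of ?n] by auto
 obtain q' where q': "\<And>z. cmod z = 1 \<Longrightarrow> G z = cnj z ^ ?n * poly q' z" "T = op_pow (u\<^sup>*) ?n \<cdot> op_poly u q'"
  using N'[of ?n] by auto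
 show ?thesis unfolding laurent_def
  by (rule exI[of _ ?n], rule exI[of _ "q + q'"])
   (simp add: q(1) q'(1) ring_distribs, simp add: q(2) q'(2) op_poly_add op_simps)
qed

lemma laurent_mult:
 assumes "laurent u F S" "laurent u G T" shows "laurent u (\<lambda>z. F z * G z) (S \<cdot> T)"
proof -
 obtain n q where F: "\<And>z. cmod z = 1 \<Longrightarrow> F z = cnj z ^ n * poly q z"
  and S: "S = op_pow (u\<^sup>*) n \<cdot> op_poly u q" using assms by (auto simp: laurent_def)
 obtain m p where G: "\<And>z. cmod z = 1 \<Longrightarrow> G z = cnj z ^ m * poly p z"
  and T: "T = op_pow (u\<^sup>*) m \<cdot> op_poly u p" using assms by (auto simp: laurent_def)
 have "op_poly u q \<cdot> op_pow (u\<^sup>*) m = op_pow (u\<^sup>*) m \<cdot> op_poly u q"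
  by (rule op_pow_commute, rule op_poly_commute[symmetric]) (use u in \<open>auto simp: unitary_op_def\<close>)
 then have "S \<cdot> T = op_pow (u\<^sup>*) n \<cdot> (op_pow (u\<^sup>*) m \<cdot> op_poly u q) \<cdot> op_poly u p"
  unfolding S T by (metis op_assoc)
 then have "S \<cdot> T = op_pow (u\<^sup>*) (n + m) \<cdot> op_poly u (q * p)"
  by (simp only: op_pow_add op_poly_mult uE op_assoc)
 then show ?thesis unfolding laurent_def
  by (intro exI[of _ "n + m"] exI[of _ "q * p"]) (simp add: F G power_add mult_ac)
qed

lemma laurent_commute: "laurent u F S \<Longrightarrow> laurent u G T \<Longrightarrow> S \<cdot> T = T \<cdot> S"
proof -
 assume *: "laurent u F S" "laurent u G T"
 have 1: "op_poly u q \<cdot> u\<^sup>* = u\<^sup>* \<cdot> op_poly u q" "op_poly u q \<cdot> u = u \<cdot> op_poly u q" for q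
  by (rule op_poly_commute[symmetric]; use u in \<open>auto simp: unitary_op_def\<close>)+
 have 2: "op_pow (u\<^sup>*) n \<cdot> u\<^sup>* = u\<^sup>* \<cdot> op_pow (u\<^sup>*) n" "op_pow (u\<^sup>*) n \<cdot> u = u \<cdot> op_pow (u\<^sup>*) n" for n
  by (rule op_pow_commute[symmetric]; use u in \<open>auto simp: unitary_op_def\<close>)+
 from *(1) obtain n q where S: "S = op_pow (u\<^sup>*) n \<cdot> op_poly u q" by (auto simp: laurent_def)
 from *(2) obtain m p where T: "T = op_pow (u\<^sup>*) m \<cdot> op_poly u p" by (auto simp: laurent_def)
 have "S \<cdot> u\<^sup>* = u\<^sup>* \<cdot> S" "S \<cdot> u = u \<cdot> S" unfolding S by (intro compose_commute 1 2)+
 then have "op_pow (u\<^sup>*) m \<cdot> S = S \<cdot> op_pow (u\<^sup>*) m" "op_poly u p \<cdot> S = S \<cdot> op_poly u p"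
  using laurent_End[OF *(1)] op_pow_commute op_poly_commute by metis+
 then show ?thesis unfolding T by (rule compose_commute[symmetric])
qed

lemma laurent_const: "laurent u (\<lambda>z. c) (c *\<^sub>C \<one>)"
 unfolding laurent_def
 by (rule exI[of _ 0], rule exI[of _ "[:c:]"]) (simp add: op_poly_pCons uE)

lemma laurent_ident: "laurent u (\<lambda>z. z) u"
 unfolding laurent_def
 by (rule exI[of _ 0], rule exI[of _ "[:0, 1:]"]) (simp add: op_poly_pCons uE)

lemma laurent_cnj: "laurent u cnj (u\<^sup>*)"
 unfolding laurent_def
 by (rule exI[of _ 1], rule exI[of _ "[:1:]"]) (simp add: op_poly_pCons uE op_pow_Suc)

lemma laurent_scaleC: "laurent u F T \<Longrightarrow> laurent u (\<lambda>z. c * F z) (c *\<^sub>C T)"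
 using laurent_mult[OF laurent_const[of c], of F T] by (simp add: scaleC_compose_left)

lemma laurent_real_polynomial:
 assumes "real_polynomial_function g"
 shows "\<exists>T. laurent u (\<lambda>z. of_real (g z)) T \<and> T\<^sup>* = T"
 using assms
proof induction
 case (linear f)
 define w where "w = Complex (f 1) (- f \<i>) / 2"
 have f: "of_real (f z) = w * z + cnj w * cnj z" for z
 proof -
  interpret f: bounded_linear f by fact
  have "f z = f (Re z *\<^sub>R 1 + Im z *\<^sub>R \<i>)"
   by (rule arg_cong[where f = f]) (simp add: complex_eq_iff)
  also have "\<dots> = Re z * f 1 + Im z * f \<i>" by (simp only: f.add f.scaleR real_scaleR_def)
  finally show ?thesis by (simp add: complex_eq_iff w_def field_simps)
 qed
 have "laurent u (\<lambda>z. w * z + cnj w * cnj z) (w *\<^sub>C u + cnj w *\<^sub>C u\<^sup>*)"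
  by (intro laurent_add laurent_scaleC laurent_ident laurent_cnj)
 moreover have "(w *\<^sub>C u + cnj w *\<^sub>C u\<^sup>*)\<^sup>* = w *\<^sub>C u + cnj w *\<^sub>C u\<^sup>*" using uE by simp
 ultimately show ?case by (auto simp: f)
next
 case (const c)
 show ?case using laurent_const[of "of_real c"] by (intro exI[of _ "of_real c *\<^sub>C \<one>"]) auto
next
 case (add f g)
 then obtain S T where "laurent u (\<lambda>z. of_real (f z)) S" "S\<^sup>* = S" "laurent u (\<lambda>z. of_real (g z)) T" "T\<^sup>* = T"
  by blast
 then show ?case
  using laurent_add[of "\<lambda>z. of_real (f z)" S "\<lambda>z. of_real (g z)" T]
  by (intro exI[of _ "S + T"]) (auto simp: laurent_End)
next
 case (mult f g)
 then obtain S T where "laurent u (\<lambda>z. of_real (f z)) S" "S\<^sup>* = S" "laurent u (\<lambda>z. of_real (g z)) T" "T\<^sup>* = T"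
  by blast
 then show ?case
  using laurent_mult[of "\<lambda>z. of_real (f z)" S "\<lambda>z. of_real (g z)" T] laurent_commute
  by (intro exI[of _ "S \<cdot> T"]) (auto simp: laurent_End)
qed

text \<open>\<open>circle_value u F T\<close> says that \<open>T = F(u)\<close> for a continuous function \<open>F\<close> on the circle.\<close>

definition circle_value :: "(complex \<Rightarrow> complex) \<Rightarrow> 'e endo \<Rightarrow> bool" where
 "circle_value F T \<longleftrightarrow> (\<forall>e>0. \<exists>F' T'. laurent u F' T' \<and>
   (\<forall>z. cmod z = 1 \<longrightarrow> cmod (F z - F' z) \<le> e) \<and> norm (T - T') \<le> e)"

lemma circle_valueD:
 assumes "circle_value F T" "0 < e"
 obtains F' T' where "laurent u F' T'" "\<And>z. cmod z = 1 \<Longrightarrow> cmod (F z - F' z) \<le> e" "norm (T - T') \<le> e"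
 using assms unfolding circle_value_def by metis

lemma laurent_circle_value: "laurent u F T \<Longrightarrow> circle_value F T"
 unfolding circle_value_def by (auto intro!: exI[of _ F] exI[of _ T])

lemma circle_value_norm_le:
 assumes "circle_value F T" and M: "\<And>z. cmod z = 1 \<Longrightarrow> cmod (F z) \<le> M"
 shows "norm T \<le> M"
proof (rule field_le_epsilon)
 fix e :: real assume e: "0 < e"
 obtain F' T' where *: "laurent u F' T'" "\<And>z. cmod z = 1 \<Longrightarrow> cmod (F z - F' z) \<le> e / 2"
  "norm (T - T') \<le> e / 2"
  using circle_valueD[OF assms(1), of "e / 2"] e by auto
 have "norm T' \<le> M + e / 2"
 proof (rule laurent_norm_le[OF *(1)])
  show "cmod (F' z) \<le> M + e / 2" if "cmod z = 1" for z
   using M[OF that] *(2)[OF that] norm_triangle_sub[of "F' z" "F z"] by (simp add: norm_minus_commute)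
 qed
 then show "norm T \<le> M + e" using *(3) norm_triangle_sub[of T T'] by simp
qed

lemma circle_value_add:
 assumes "circle_value F S" "circle_value G T" shows "circle_value (\<lambda>z. F z + G z) (S + T)"
 unfolding circle_value_def
proof (intro allI impI)
 fix e :: real assume e: "0 < e"
 obtain F' S' where F: "laurent u F' S'" "\<And>z. cmod z = 1 \<Longrightarrow> cmod (F z - F' z) \<le> e / 2"
  "norm (S - S') \<le> e / 2" using circle_valueD[OF assms(1), of "e / 2"] e by auto
 obtain G' T' where G: "laurent u G' T'" "\<And>z. cmod z = 1 \<Longrightarrow> cmod (G z - G' z) \<le> e / 2"
  "norm (T - T') \<le> e / 2" using circle_valueD[OF assms(2), of "e / 2"] e by auto
 have "cmod (F z + G z - (F' z + G' z)) \<le> e" if "cmod z = 1" for z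
  using F(2)[OF that] G(2)[OF that] norm_triangle_ineq[of "F z - F' z" "G z - G' z"]
  by (simp add: algebra_simps)
 moreover have "norm (S + T - (S' + T')) \<le> e"
  using F(3) G(3) norm_triangle_ineq[of "S - S'" "T - T'"] by (simp add: algebra_simps)
 ultimately show "\<exists>F' T'. laurent u F' T' \<and> (\<forall>z. cmod z = 1 \<longrightarrow> cmod (F z + G z - F' z) \<le> e) \<and>
   norm (S + T - T') \<le> e"
  using laurent_add[OF F(1) G(1)] by blast
qed

lemma circle_value_mult:
 assumes F: "circle_value F S" and G: "circle_value G T"
  and A: "\<And>z. cmod z = 1 \<Longrightarrow> cmod (F z) \<le> A" and B: "\<And>z. cmod z = 1 \<Longrightarrow> cmod (G z) \<le> B"
 shows "circle_value (\<lambda>z. F z * G z) (S \<cdot> T)"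
 unfolding circle_value_def
proof (intro allI impI)
 fix e :: real assume e: "0 < e"
 have A0: "0 \<le> A" "0 \<le> B" using A[of 1] B[of 1] norm_ge_zero order_trans by (metis norm_one)+
 define d where "d = min 1 (e / (A + B + 1))"
 have d: "0 < d" "d \<le> 1" using e A0 by (auto simp: d_def)
 have "d \<le> e / (A + B + 1)" by (simp add: d_def)
 then have d3: "d * (A + B + 1) \<le> e" using A0 by (simp add: pos_le_divide_eq)
 obtain F' S' where F': "laurent u F' S'" "\<And>z. cmod z = 1 \<Longrightarrow> cmod (F z - F' z) \<le> d"
  "norm (S - S') \<le> d" using circle_valueD[OF F d(1)] by auto
 obtain G' T' where G': "laurent u G' T'" "\<And>z. cmod z = 1 \<Longrightarrow> cmod (G z - G' z) \<le> d"
  "norm (T - T') \<le> d" using circle_valueD[OF G d(1)] by auto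
 have fin: "d * B + (A + d) * d \<le> e"
 proof -
  have "d * d \<le> d * 1" using d by (intro mult_left_mono) auto
  then show ?thesis using d3 by (simp add: algebra_simps)
 qed
 have "cmod (F z * G z - F' z * G' z) \<le> e" if z: "cmod z = 1" for z
 proof -
  have "F z * G z - F' z * G' z = (F z - F' z) * G z + F' z * (G z - G' z)" by (simp add: algebra_simps)
  also have "cmod \<dots> \<le> d * B + (A + d) * d"
  proof (intro order_trans[OF norm_triangle_ineq] add_mono)
   have "cmod (F' z) \<le> A + d"
    using A[OF z] F'(2)[OF z] norm_triangle_sub[of "F' z" "F z"] by (simp add: norm_minus_commute)
   then show "cmod (F' z * (G z - G' z)) \<le> (A + d) * d"
    unfolding norm_mult using G'(2)[OF z] A0 d by (intro mult_mono) auto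
   show "cmod ((F z - F' z) * G z) \<le> d * B"
    unfolding norm_mult using F'(2)[OF z] B[OF z] d by (intro mult_mono) auto
  qed
  finally show ?thesis using fin by simp
 qed
 moreover have "norm (S \<cdot> T - S' \<cdot> T') \<le> e"
 proof -
  have "S \<cdot> T - S' \<cdot> T' = (S - S') \<cdot> T + S' \<cdot> (T - T')" by (simp add: op_simps)
  also have "norm \<dots> \<le> d * B + (A + d) * d"
  proof (intro order_trans[OF norm_triangle_ineq] add_mono norm_compose_le F'(3) G'(3))
   show "norm T \<le> B" by (rule circle_value_norm_le[OF G B])
   have "norm S \<le> A" by (rule circle_value_norm_le[OF F A])
   then show "norm S' \<le> A + d"
    using F'(3) norm_triangle_sub[of S' S] by (simp add: norm_minus_commute)
  qed
  finally show ?thesis using fin by simp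
 qed
 ultimately show "\<exists>F' T'. laurent u F' T' \<and> (\<forall>z. cmod z = 1 \<longrightarrow> cmod (F z * G z - F' z) \<le> e) \<and>
   norm (S \<cdot> T - T') \<le> e"
  using laurent_mult[OF F'(1) G'(1)] by blast
qed

lemma circle_value_scaleC:
 assumes "circle_value F T" shows "circle_value (\<lambda>z. c * F z) (c *\<^sub>C T)"
 unfolding circle_value_def
proof (intro allI impI)
 fix e :: real assume e: "0 < e"
 define d where "d = e / (cmod c + 1)"
 have d: "0 < d" "cmod c * d \<le> e"
 proof -
  show "0 < d" using e by (simp add: d_def add_nonneg_pos)
  have "cmod c * d \<le> (cmod c + 1) * d" using \<open>0 < d\<close> by (intro mult_right_mono) auto
  also have "\<dots> = e" using norm_ge_zero[of c] by (simp add: d_def add_nonneg_eq_0_iff)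
  finally show "cmod c * d \<le> e" .
 qed
 obtain F' T' where *: "laurent u F' T'" "\<And>z. cmod z = 1 \<Longrightarrow> cmod (F z - F' z) \<le> d" "norm (T - T') \<le> d"
  using circle_valueD[OF assms d(1)] by auto
 have "cmod (c * F z - c * F' z) \<le> e" if "cmod z = 1" for z
  using mult_left_mono[OF *(2)[OF that], of "cmod c"] d(2)
  by (simp add: right_diff_distrib[symmetric] norm_mult)
 moreover have "norm (c *\<^sub>C T - c *\<^sub>C T') \<le> e"
  using mult_left_mono[OF *(3), of "cmod c"] d(2) by (simp add: scaleC_diff_right[symmetric] norm_scaleC)
 ultimately show "\<exists>F' T'. laurent u F' T' \<and> (\<forall>z. cmod z = 1 \<longrightarrow> cmod (c * F z - F' z) \<le> e) \<and>
   norm (c *\<^sub>C T - T') \<le> e"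
  using laurent_scaleC[OF *(1)] by blast
qed

lemma circle_value_unique:
 assumes "circle_value F S" "circle_value F T" shows "S = T"
proof -
 have "circle_value (\<lambda>z. F z + (-1) * F z) (S + (-1) *\<^sub>C T)"
  by (intro circle_value_add circle_value_scaleC assms)
 then have "norm (S + (-1) *\<^sub>C T) \<le> 0" by (rule circle_value_norm_le) simp
 then show ?thesis by (simp add: scaleC_minus_left)
qed

text \<open>
 By the Stone-Weierstrass theorem \<open>F\<close> is a uniform limit of real polynomials in \<open>Re z\<close> and \<open>Im z\<close>, which are Laurent
 polynomials on the circle; by the norm estimate their values form a Cauchy sequence.
\<close>

lemma circle_value_real_exists:
 fixes F :: "complex \<Rightarrow> real"
 assumes cont: "continuous_on (sphere 0 1) F"
 shows "\<exists>T \<in> End_star E. T\<^sup>* = T \<and> circle_value (\<lambda>z. of_real (F z)) T"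
proof -
 have "\<exists>g. real_polynomial_function g \<and> (\<forall>z. cmod z = 1 \<longrightarrow> \<bar>F z - g z\<bar> < inverse (real (Suc n)))" for n
  by (rule Stone_Weierstrass_real_polynomial_function[OF compact_sphere cont, of "inverse (real (Suc n))"])
   (auto simp: dist_norm)
 then obtain g where g: "\<And>n. real_polynomial_function (g n)"
  "\<And>n z. cmod z = 1 \<Longrightarrow> \<bar>F z - g n z\<bar> < inverse (real (Suc n))" by metis
 obtain T where T: "\<And>n. laurent u (\<lambda>z. of_real (g n z)) (T n)" "\<And>n. (T n)\<^sup>* = T n"
  using laurent_real_polynomial[OF g(1)] by metis
 have TE: "T n \<in> End_star E" for n by (rule laurent_End[OF T(1)])
 have lim: "(\<lambda>n. 2 * inverse (real (Suc n))) \<longlonglongrightarrow> 0"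
  using tendsto_mult[OF tendsto_const LIMSEQ_inverse_real_of_nat, of 2] by simp
 have dist: "norm (T m - T n) \<le> inverse (real (Suc m)) + inverse (real (Suc n))" for m n
 proof -
  have "laurent u (\<lambda>z. of_real (g m z) + (-1) * of_real (g n z)) (T m + (-1) *\<^sub>C T n)"
   by (intro laurent_add laurent_scaleC T)
  then have "norm (T m + (-1) *\<^sub>C T n) \<le> inverse (real (Suc m)) + inverse (real (Suc n))"
  proof (rule laurent_norm_le)
   show "cmod (of_real (g m z) + (-1) * of_real (g n z)) \<le> inverse (real (Suc m)) + inverse (real (Suc n))"
    if "cmod z = 1" for z
   proof -
    have "cmod (of_real (g m z) + (-1) * of_real (g n z)) = \<bar>g m z - g n z\<bar>"
     by (simp flip: of_real_diff)
    then show ?thesis using g(2)[OF that, of m] g(2)[OF that, of n] by linarith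
   qed
  qed
  then show ?thesis by (simp add: scaleC_minus_left)
 qed
 have "Cauchy T"
  unfolding Cauchy_def
 proof (intro allI impI)
  fix e :: real assume "0 < e"
  then obtain N where N: "\<And>n. n \<ge> N \<Longrightarrow> 2 * inverse (real (Suc n)) < e"
   using order_tendstoD(2)[OF lim, of e] by (auto simp: eventually_sequentially)
  show "\<exists>N. \<forall>m\<ge>N. \<forall>n\<ge>N. dist (T m) (T n) < e"
  proof (intro exI allI impI)
   fix m n assume "N \<le> m" "N \<le> n"
   then show "dist (T m) (T n) < e"
    using dist[of m n] N[of m] N[of n] by (simp add: dist_norm)
  qed
 qed
 then obtain R where R: "T \<longlonglongrightarrow> R" by (auto simp: Cauchy_convergent_iff convergent_def)
 have RE: "R \<in> End_star E" "R\<^sup>* = R"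
  using norm_limit_adjointable[OF TE R] R LIMSEQ_unique by (auto simp: T)
 have "circle_value (\<lambda>z. of_real (F z)) R"
  unfolding circle_value_def
 proof (intro allI impI)
  fix e :: real assume e: "0 < e"
  have "eventually (\<lambda>n. norm (T n - R) < e \<and> inverse (real (Suc n)) < e) sequentially"
   using tendstoD[OF R e] order_tendstoD(2)[OF LIMSEQ_inverse_real_of_nat e]
   by eventually_elim (simp add: dist_norm)
  then obtain n where n: "norm (T n - R) < e" "inverse (real (Suc n)) < e"
   by (auto simp: eventually_sequentially)
  have "cmod (of_real (F z) - of_real (g n z)) \<le> e" if "cmod z = 1" for z
   using g(2)[OF that, of n] n(2) by (simp flip: of_real_diff)
  then show "\<exists>F' T'. laurent u F' T' \<and> (\<forall>z. cmod z = 1 \<longrightarrow> cmod (of_real (F z) - F' z) \<le> e) \<and>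
    norm (R - T') \<le> e"
   using T(1)[of n] n(1) by (intro exI[of _ "\<lambda>z. of_real (g n z)"] exI[of _ "T n"]) (auto simp: norm_minus_commute)
 qed
 then show ?thesis using RE by blast
qed

lemma circle_value_exists:
 assumes cont: "continuous_on (sphere 0 1) F"
 obtains T where "T \<in> End_star E" "circle_value F T" "circle_value (\<lambda>z. cnj (F z)) (T\<^sup>*)"
proof -
 obtain S where S: "S \<in> End_star E" "S\<^sup>* = S" "circle_value (\<lambda>z. of_real (Re (F z))) S"
  using circle_value_real_exists[of "\<lambda>z. Re (F z)"] cont by (auto intro!: continuous_intros)
 obtain T where T: "T \<in> End_star E" "T\<^sup>* = T" "circle_value (\<lambda>z. of_real (Im (F z))) T"
  using circle_value_real_exists[of "\<lambda>z. Im (F z)"] cont by (auto intro!: continuous_intros)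
 have "circle_value (\<lambda>z. of_real (Re (F z)) + \<i> * of_real (Im (F z))) (S + \<i> *\<^sub>C T)"
  "circle_value (\<lambda>z. of_real (Re (F z)) + (-\<i>) * of_real (Im (F z))) (S + (-\<i>) *\<^sub>C T)"
  by (intro circle_value_add circle_value_scaleC S T)+
 moreover have "(\<lambda>z. of_real (Re (F z)) + \<i> * of_real (Im (F z))) = F"
  "(\<lambda>z. of_real (Re (F z)) + (-\<i>) * of_real (Im (F z))) = (\<lambda>z. cnj (F z))"
  by (auto simp: complex_eq_iff)
 ultimately show ?thesis using that[of "S + \<i> *\<^sub>C T"] S T by simp
qed

end

end

section \<open>Functional calculus from a resolvent\<close>

abbreviation cr :: "(real \<Rightarrow> real) \<Rightarrow> real \<Rightarrow> complex" where
 "cr f \<equiv> \<lambda>t. complex_of_real (f t)"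

lemma C0_cont: "f \<in> C0 \<Longrightarrow> continuous_on UNIV f"
 and Cc_cont: "f \<in> Cc \<Longrightarrow> continuous_on UNIV f"
 by (simp_all add: C0_def Cc_def)

lemma CcI: "continuous_on UNIV f \<Longrightarrow> (\<And>t. \<bar>t\<bar> > R \<Longrightarrow> f t = 0) \<Longrightarrow> f \<in> Cc"
 by (auto simp: Cc_def)

lemma Cc_C0: "f \<in> Cc \<Longrightarrow> f \<in> C0"
proof -
 assume f: "f \<in> Cc"
 then obtain R where R: "\<And>t. \<bar>t\<bar> > R \<Longrightarrow> f t = 0" by (auto simp: Cc_def)
 have "eventually (\<lambda>t. f t = 0) at_infinity"
  unfolding eventually_at_infinity using R by (intro exI[of _ "R + 1"]) auto
 then show "f \<in> C0" using f by (auto simp: C0_def Cc_def intro: tendsto_eventually)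
qed

lemma C0_add: "f \<in> C0 \<Longrightarrow> g \<in> C0 \<Longrightarrow> (\<lambda>t. f t + g t) \<in> C0"
 by (auto simp: C0_def intro!: continuous_intros tendsto_add_zero)

lemma C0_scale: "f \<in> C0 \<Longrightarrow> (\<lambda>t. c * f t) \<in> C0"
 by (auto simp: C0_def intro!: continuous_intros tendsto_mult_right_zero)

lemma C0_diff: "f \<in> C0 \<Longrightarrow> g \<in> C0 \<Longrightarrow> (\<lambda>t. f t - g t) \<in> C0"
 using C0_add[of f "\<lambda>t. (-1) * g t"] C0_scale[of g "-1"] by simp

lemma C0_mult_bounded:
 assumes f: "f \<in> C0" and g: "continuous_on UNIV g" "\<And>t. cmod (g t) \<le> B"
 shows "(\<lambda>t. f t * g t) \<in> C0"
proof -
 have "((\<lambda>t. f t * g t) \<longlongrightarrow> 0) at_infinity"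
 proof (rule Lim_null_comparison)
  show "eventually (\<lambda>t. norm (f t * g t) \<le> norm (f t) * B) at_infinity"
   by (auto simp: norm_mult g(2) intro!: always_eventually mult_left_mono)
  show "((\<lambda>t. norm (f t) * B) \<longlongrightarrow> 0) at_infinity"
   using f by (auto simp: C0_def intro!: tendsto_mult_left_zero tendsto_norm_zero)
 qed
 then show ?thesis using f g by (auto simp: C0_def intro!: continuous_intros)
qed

lemma C0_cnj: "f \<in> C0 \<Longrightarrow> (\<lambda>t. cnj (f t)) \<in> C0"
 using tendsto_cnj[of f 0 at_infinity] by (auto simp: C0_def intro!: continuous_intros)

lemma C0_bounded:
 assumes "f \<in> C0" shows "\<exists>B. \<forall>t. cmod (f t) \<le> B"
proof -
 have "eventually (\<lambda>t. cmod (f t) < 1) at_infinity"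
  using assms order_tendstoD(2)[of "\<lambda>t. cmod (f t)" 0 at_infinity 1] tendsto_norm_zero
  by (auto simp: C0_def)
 then obtain R where R: "\<And>t. R \<le> \<bar>t\<bar> \<Longrightarrow> cmod (f t) < 1" by (auto simp: eventually_at_infinity)
 have "compact ((\<lambda>t. cmod (f t)) ` {-\<bar>R\<bar>..\<bar>R\<bar>})"
  using assms by (intro compact_continuous_image continuous_on_subset[OF continuous_on_norm]) (auto simp: C0_def)
 then have "bounded ((\<lambda>t. cmod (f t)) ` {-\<bar>R\<bar>..\<bar>R\<bar>})" by (rule compact_imp_bounded)
 then obtain B where B: "\<And>t. t \<in> {-\<bar>R\<bar>..\<bar>R\<bar>} \<Longrightarrow> cmod (f t) \<le> B"
  unfolding bounded_iff by fastforce
 show ?thesis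
 proof (intro exI[of _ "max 1 B"] allI)
  fix t show "cmod (f t) \<le> max 1 B"
  proof (cases "R \<le> \<bar>t\<bar>")
   case False
   then have "t \<in> {-\<bar>R\<bar>..\<bar>R\<bar>}" by auto
   then show ?thesis using B by (simp add: le_max_iff_disj)
  qed (use R[of t] in simp)
 qed
qed

lemma C0_mult: "f \<in> C0 \<Longrightarrow> g \<in> C0 \<Longrightarrow> (\<lambda>t. f t * g t) \<in> C0"
 using C0_bounded[of g] by (auto intro: C0_mult_bounded C0_cont)

lemma Cc_mult_right: "f \<in> Cc \<Longrightarrow> continuous_on UNIV g \<Longrightarrow> (\<lambda>t. f t * g t) \<in> Cc"
 by (fastforce simp: Cc_def intro!: continuous_intros)

lemma Cc_mult_left: "f \<in> Cc \<Longrightarrow> continuous_on UNIV g \<Longrightarrow> (\<lambda>t. g t * f t) \<in> Cc"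
 by (fastforce simp: Cc_def intro!: continuous_intros)

definition resolvent :: "real \<Rightarrow> complex" where
 "resolvent t = 1 / (of_real t + \<i>)"

lemma of_real_plus_i_neq_0 [simp]: "complex_of_real t + \<i> \<noteq> 0" "\<i> + complex_of_real t \<noteq> 0"
 "complex_of_real t - \<i> \<noteq> 0"
 by (simp_all add: complex_eq_iff)

lemma resolvent_C0: "resolvent \<in> C0"
proof -
 have "((\<lambda>t. 1 / (complex_of_real t + \<i>)) \<longlongrightarrow> 0) at_infinity"
 proof (rule Lim_null_comparison)
  show "((\<lambda>t::real. inverse (norm t)) \<longlongrightarrow> 0) at_infinity"
   by (intro tendsto_inverse_0_at_top filterlim_norm_at_top)
  have "norm (1 / (complex_of_real t + \<i>)) \<le> inverse (norm t)" if "1 \<le> norm t" for t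
  proof -
   have "\<bar>t\<bar> \<le> cmod (complex_of_real t + \<i>)"
    using abs_Re_le_cmod[of "complex_of_real t + \<i>"] by simp
   then show ?thesis using that by (simp add: norm_divide divide_simps)
  qed
  then show "eventually (\<lambda>t. norm (1 / (complex_of_real t + \<i>)) \<le> inverse (norm t)) at_infinity"
   unfolding eventually_at_infinity by blast
 qed
 then show ?thesis by (auto simp: C0_def resolvent_def[abs_def] intro!: continuous_intros)
qed

definition C0_hom ::
 "('e :: {complex_normed_vector, banach}, 'b :: cstar_algebra) hilbmod \<Rightarrow>
  'e calculus \<Rightarrow> bool" where
 "C0_hom E \<phi> \<longleftrightarrow>
   (\<forall>f \<in> C0. \<forall>g \<in> C0. \<phi> (\<lambda>t. f t + g t) = \<phi> f + \<phi> g) \<and>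
   (\<forall>c. \<forall>f \<in> C0. \<phi> (\<lambda>t. c * f t) = c *\<^sub>C \<phi> f) \<and>
   (\<forall>f \<in> C0. \<forall>g \<in> C0. \<phi> (\<lambda>t. f t * g t) = \<phi> f \<cdot> \<phi> g) \<and>
   (\<forall>f \<in> C0. is_adjoint E E (\<phi> f) (\<phi> (\<lambda>t. cnj (f t))))"

lemma C0_homD:
 assumes "C0_hom E \<phi>"
 shows C0_hom_add: "f \<in> C0 \<Longrightarrow> g \<in> C0 \<Longrightarrow> \<phi> (\<lambda>t. f t + g t) = \<phi> f + \<phi> g"
  and C0_hom_scale: "f \<in> C0 \<Longrightarrow> \<phi> (\<lambda>t. c * f t) = c *\<^sub>C \<phi> f"
  and C0_hom_mult: "f \<in> C0 \<Longrightarrow> g \<in> C0 \<Longrightarrow> \<phi> (\<lambda>t. f t * g t) = \<phi> f \<cdot> \<phi> g"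
  and C0_hom_adjoint: "f \<in> C0 \<Longrightarrow> is_adjoint E E (\<phi> f) (\<phi> (\<lambda>t. cnj (f t)))"
  and C0_hom_End: "f \<in> C0 \<Longrightarrow> \<phi> f \<in> End_star E"
 using assms by (auto simp: C0_hom_def intro: Hom_starI)

text \<open>\<open>circle_lift f\<close> is \<open>f\<close> transported to the circle by the inverse Cayley transform.\<close>

definition circle_lift :: "(real \<Rightarrow> complex) \<Rightarrow> complex \<Rightarrow> complex" where
 "circle_lift f z = (if z = 1 then 0 else f (Re (\<i> * (1 + z) / (1 - z))))"

lemma inverse_cayley_real:
 assumes "cmod z = 1" "z \<noteq> 1"
 shows "complex_of_real (Re (\<i> * (1 + z) / (1 - z))) = \<i> * (1 + z) / (1 - z)"
proof -
 have "z * cnj z = 1" using assms(1) complex_norm_square[of z] by simp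
 then have "(- \<i> * (1 + cnj z)) * (1 - z) = (\<i> * (1 + z)) * (1 - cnj z)"
  by (simp add: algebra_simps)
 moreover have "1 - cnj z \<noteq> 0" using assms(2) by (metis complex_cnj_cnj complex_cnj_one right_minus_eq)
 ultimately have "cnj (\<i> * (1 + z) / (1 - z)) = \<i> * (1 + z) / (1 - z)"
  using assms(2) frac_eq_eq[of "1 - cnj z" "1 - z" "- \<i> * (1 + cnj z)" "\<i> * (1 + z)"] by simp
 then show ?thesis by (metis Reals_cnj_iff complex_is_Real_iff of_real_Re)
qed

text \<open>
 At the point \<open>1\<close> continuity expresses that \<open>f\<close> vanishes at infinity: \<open>|\<i> (1 + w) / (1 - w)| \<ge> 1 / |1 - w|\<close> for
 \<open>w\<close> on the circle near \<open>1\<close>.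
\<close>

lemma continuous_on_circle_lift:
 assumes f: "f \<in> C0"
 shows "continuous_on (sphere 0 1) (circle_lift f)"
 unfolding continuous_on_eq_continuous_within
proof
 fix z :: complex assume z: "z \<in> sphere 0 1"
 show "continuous (at z within sphere 0 1) (circle_lift f)"
 proof (cases "z = 1")
  case False
  let ?h = "\<lambda>z. f (Re (\<i> * (1 + z) / (1 - z)))"
  have "isCont f x" for x using C0_cont[OF f] by (simp add: continuous_on_eq_continuous_at)
  then have "isCont ?h z"
  proof (rule isCont_o2[rotated])
   show "isCont (\<lambda>z. Re (\<i> * (1 + z) / (1 - z))) z"
    using False by (intro isCont_Re isCont_divide isCont_mult isCont_add isCont_diff) auto
  qed
  moreover have "eventually (\<lambda>w. ?h w = circle_lift f w) (nhds z)"
   using t1_space_nhds[OF False] by (rule eventually_mono) (simp add: circle_lift_def)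
  ultimately have "isCont (circle_lift f) z"
   using isCont_cong[of ?h "circle_lift f" z] by blast
  then show ?thesis by (rule continuous_at_imp_continuous_at_within)
 next
  case True
  show ?thesis unfolding True continuous_within_eps_delta
  proof (intro allI impI)
   fix e :: real assume e: "0 < e"
   have "eventually (\<lambda>t. dist (f t) 0 < e) at_infinity"
    using f e by (auto simp: C0_def dest: tendstoD)
   then obtain R where R: "\<And>t. R \<le> \<bar>t\<bar> \<Longrightarrow> cmod (f t) < e" by (auto simp: eventually_at_infinity)
   define d where "d = min 1 (1 / (\<bar>R\<bar> + 1))"
   have "dist (circle_lift f w) (circle_lift f 1) < e" if w: "w \<in> sphere 0 1" "dist w 1 < d" for w
   proof (cases "w = 1")
    case False
    have w1: "cmod w = 1" using w by simp
    have n: "0 < cmod (1 - w)" "cmod (1 - w) < d"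
     using False w(2) by (auto simp: dist_norm norm_minus_commute)
    have "1 \<le> cmod (1 + w)"
    proof -
     have "2 - cmod (1 - w) \<le> cmod (2 - (1 - w))" using norm_triangle_ineq2[of 2 "1 - w"] by simp
     moreover have "d \<le> 1" by (simp add: d_def)
     then have "cmod (1 - w) < 1" using n(2) by linarith
     moreover have "cmod (2 - (1 - w)) = cmod (1 + w)" by (simp add: algebra_simps)
     ultimately show ?thesis by linarith
    qed
    have "\<bar>Re (\<i> * (1 + w) / (1 - w))\<bar> = cmod (complex_of_real (Re (\<i> * (1 + w) / (1 - w))))"
     by simp
    also have "\<dots> = cmod (1 + w) / cmod (1 - w)"
     by (simp only: inverse_cayley_real[OF w1 False]) (simp add: norm_mult norm_divide)
    also have "\<dots> \<ge> 1 / cmod (1 - w)"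
     using \<open>1 \<le> cmod (1 + w)\<close> n by (intro divide_right_mono) auto
    moreover have "\<bar>R\<bar> \<le> 1 / cmod (1 - w)"
    proof -
     have "cmod (1 - w) \<le> 1 / (\<bar>R\<bar> + 1)" using n(2) by (simp add: d_def)
     then have "cmod (1 - w) * (\<bar>R\<bar> + 1) \<le> 1" by (simp add: pos_le_divide_eq)
     then have "cmod (1 - w) * \<bar>R\<bar> \<le> 1"
      using norm_ge_zero[of "1 - w"] by (simp only: distrib_left mult_1_right)
     then show ?thesis using n(1) by (simp add: pos_le_divide_eq mult.commute)
    qed
    ultimately have "R \<le> \<bar>Re (\<i> * (1 + w) / (1 - w))\<bar>" by linarith
    then show ?thesis using R False by (simp add: circle_lift_def)
   qed (use e in simp)
   moreover have "0 < d" by (simp add: d_def)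
   ultimately show "\<exists>d>0. \<forall>x'\<in>sphere 0 1. dist x' 1 < d \<longrightarrow> dist (circle_lift f x') (circle_lift f 1) < e"
    by blast
  qed
 qed
qed

context cauchy_schwarz_module
begin

text \<open>
 The identity \<open>r\<^sup>* - r = 2\<i> r r\<^sup>*\<close> is the resolvent identity for \<open>r = (D + \<i>)\<^sup>-\<^sup>1\<close>; it says that the
 Cayley transform \<open>1 - 2\<i> r\<close> is unitary.
\<close>

lemma C0_hom_exists:
 assumes r: "r \<in> End_star E" and id1: "r\<^sup>* - r = (2 * \<i>) *\<^sub>C (r \<cdot> r\<^sup>*)" and comm: "r \<cdot> r\<^sup>* = r\<^sup>* \<cdot> r"
 obtains \<phi> where "C0_hom E \<phi>" "\<phi> resolvent = r"
  "\<And>f M. f \<in> C0 \<Longrightarrow> (\<And>t. cmod (f t) \<le> M) \<Longrightarrow> norm (\<phi> f) \<le> M"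
proof -
 define u where "u = \<one> - (2 * \<i>) *\<^sub>C r"
 have uE: "u \<in> End_star E" by (simp add: u_def r)
 have ud: "u\<^sup>* = \<one> + (2 * \<i>) *\<^sub>C r\<^sup>*" by (simp add: u_def r scaleC_minus_left)
 have "r\<^sup>* = r + (2 * \<i>) *\<^sub>C (r \<cdot> r\<^sup>*)" using id1 by (simp add: algebra_simps)
 then have E1: "(2 * \<i>) *\<^sub>C r\<^sup>* = (2 * \<i>) *\<^sub>C r - 4 *\<^sub>C (r \<cdot> r\<^sup>*)"
 proof -
  have "(2 * \<i>) *\<^sub>C r\<^sup>* = (2 * \<i>) *\<^sub>C r + ((2 * \<i>) * (2 * \<i>)) *\<^sub>C (r \<cdot> r\<^sup>*)"
   by (subst \<open>r\<^sup>* = r + _\<close>) (simp only: scaleC_add_right scaleC_scaleC)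
  moreover have "(2 * \<i>) * (2 * \<i>) = (- 4 :: complex)" by (simp add: complex_eq_iff)
  ultimately show ?thesis by (simp add: scaleC_minus_left)
 qed
 have "unitary_op u"
  unfolding unitary_op_def
 proof (intro conjI uE)
  have "u\<^sup>* \<cdot> u = \<one> + (2 * \<i>) *\<^sub>C r\<^sup>* - (2 * \<i>) *\<^sub>C r + 4 *\<^sub>C (r\<^sup>* \<cdot> r)"
   unfolding ud by (simp add: u_def op_simps scaleC_compose_left compose_scaleC_right r scaleC_scaleC
     scaleC_minus_left)
  then show "u\<^sup>* \<cdot> u = \<one>" unfolding E1 comm by simp
  have "u \<cdot> u\<^sup>* = \<one> + (2 * \<i>) *\<^sub>C r\<^sup>* - (2 * \<i>) *\<^sub>C r + 4 *\<^sub>C (r \<cdot> r\<^sup>*)"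
   unfolding ud by (simp add: u_def op_simps scaleC_compose_left compose_scaleC_right r scaleC_scaleC
     scaleC_minus_left)
  then show "u \<cdot> u\<^sup>* = \<one>" unfolding E1 by simp
 qed
 note u = this
 have "\<exists>T. T \<in> End_star E \<and> circle_value u (circle_lift f) T \<and> circle_value u (\<lambda>z. cnj (circle_lift f z)) (T\<^sup>*)"
  if "f \<in> C0" for f
  using circle_value_exists[OF u continuous_on_circle_lift[OF that]] by metis
 then obtain \<phi> where \<phi>: "\<And>f. f \<in> C0 \<Longrightarrow> \<phi> f \<in> End_star E" "\<And>f. f \<in> C0 \<Longrightarrow> circle_value u (circle_lift f) (\<phi> f)"
   "\<And>f. f \<in> C0 \<Longrightarrow> circle_value u (\<lambda>z. cnj (circle_lift f z)) ((\<phi> f)\<^sup>*)" by metis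
 note uniq = circle_value_unique[OF u \<phi>(2)]
 have bd: "\<exists>B. \<forall>z. cmod z = 1 \<longrightarrow> cmod (circle_lift f z) \<le> B" if f: "f \<in> C0" for f
 proof -
  obtain B where B: "\<And>t. cmod (f t) \<le> B" using C0_bounded[OF f] by blast
  then show ?thesis using order_trans[OF norm_ge_zero B] by (intro exI[of _ B]) (simp add: circle_lift_def)
 qed
 show ?thesis
 proof (rule that)
  show "C0_hom E \<phi>"
   unfolding C0_hom_def
  proof (intro conjI ballI allI)
   fix f g assume f: "f \<in> C0" and g: "g \<in> C0"
   have "circle_lift (\<lambda>t. f t + g t) = (\<lambda>z. circle_lift f z + circle_lift g z)"
    by (auto simp: circle_lift_def)
   then show "\<phi> (\<lambda>t. f t + g t) = \<phi> f + \<phi> g"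
    using circle_value_add[OF u \<phi>(2)[OF f] \<phi>(2)[OF g]] by (intro uniq C0_add f g) simp
   have "circle_lift (\<lambda>t. f t * g t) = (\<lambda>z. circle_lift f z * circle_lift g z)"
    by (auto simp: circle_lift_def)
   moreover obtain A B where A: "\<And>z. cmod z = 1 \<Longrightarrow> cmod (circle_lift f z) \<le> A"
    and B: "\<And>z. cmod z = 1 \<Longrightarrow> cmod (circle_lift g z) \<le> B" using bd f g by metis
   ultimately show "\<phi> (\<lambda>t. f t * g t) = \<phi> f \<cdot> \<phi> g"
    using circle_value_mult[OF u \<phi>(2)[OF f] \<phi>(2)[OF g] A B] by (intro uniq C0_mult f g) simp
  next
   fix c f assume f: "f \<in> C0"
   have "circle_lift (\<lambda>t. c * f t) = (\<lambda>z. c * circle_lift f z)"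
    by (auto simp: circle_lift_def)
   then show "\<phi> (\<lambda>t. c * f t) = c *\<^sub>C \<phi> f"
    using circle_value_scaleC[OF u \<phi>(2)[OF f]] by (intro uniq C0_scale f) simp
  next
   fix f assume f: "f \<in> C0"
   have "circle_lift (\<lambda>t. cnj (f t)) = (\<lambda>z. cnj (circle_lift f z))"
    by (auto simp: circle_lift_def)
   then have "\<phi> (\<lambda>t. cnj (f t)) = (\<phi> f)\<^sup>*"
    using \<phi>(3)[OF f] by (intro uniq C0_cnj f) simp
   then show "is_adjoint E E (\<phi> f) (\<phi> (\<lambda>t. cnj (f t)))"
    using is_adjoint_dag \<phi>(1)[OF f] by simp
  qed
  show "\<phi> resolvent = r"
  proof (rule uniq[OF resolvent_C0])
   have "laurent u (\<lambda>z. 1 / (2 * \<i>) + (-1 / (2 * \<i>)) * z) ((1 / (2 * \<i>)) *\<^sub>C \<one> + (-1 / (2 * \<i>)) *\<^sub>C u)"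
    by (intro laurent_add laurent_const laurent_scaleC laurent_ident u)
   moreover have "(1 / (2 * \<i>)) *\<^sub>C \<one> + (-1 / (2 * \<i>)) *\<^sub>C u = r"
    by (simp add: u_def scaleC_diff_right scaleC_scaleC scaleC_minus_left)
   moreover have "circle_lift resolvent z = 1 / (2 * \<i>) + (-1 / (2 * \<i>)) * z" if z: "cmod z = 1" for z
   proof (cases "z = 1")
    case False
    have "circle_lift resolvent z = 1 / (\<i> * (1 + z) / (1 - z) + \<i>)"
     unfolding circle_lift_def resolvent_def inverse_cayley_real[OF z False] using False by simp
    also have "\<i> * (1 + z) / (1 - z) + \<i> = (2 * \<i>) / (1 - z)" using False by (simp add: field_simps)
    finally show ?thesis by (simp add: field_simps)
   qed (simp add: circle_lift_def)
   ultimately show "circle_value u (circle_lift resolvent) r"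
    using laurent_circle_value[OF u, of "circle_lift resolvent" r] by (auto simp: laurent_def)
  qed
  show "norm (\<phi> f) \<le> M" if "f \<in> C0" "\<And>t. cmod (f t) \<le> M" for f M
   using circle_value_norm_le[OF u \<phi>(2)[OF that(1)], of M] that(2) order_trans[OF norm_ge_zero that(2)[of 0]]
   by (simp add: circle_lift_def)
 qed
qed

end

section \<open>Positivity\<close>

definition cut :: "real \<Rightarrow> real \<Rightarrow> real" where
 "cut a t = max 0 (min 1 (a + 1 - \<bar>t\<bar>))"

lemma cut_eq_1: "\<bar>t\<bar> \<le> a \<Longrightarrow> cut a t = 1"
 and cut_eq_0: "a + 1 \<le> \<bar>t\<bar> \<Longrightarrow> cut a t = 0"
 and cut_bounds [simp]: "0 \<le> cut a t" "cut a t \<le> 1"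
 by (auto simp: cut_def)

lemma continuous_on_cut [continuous_intros]:
 "continuous_on S f \<Longrightarrow> continuous_on S (\<lambda>x. cut a (f x))"
 unfolding cut_def by (intro continuous_intros)

lemma cut_Cc: "continuous_on UNIV f \<Longrightarrow> cr (\<lambda>t. f t * cut a t) \<in> Cc"
 by (rule CcI[of _ "a + 1"]) (auto intro!: continuous_intros simp: cut_eq_0)

context cauchy_schwarz_module
begin

lemma neumann:
 assumes T: "T \<in> End_star E" "norm T < 1"
 shows "\<exists>G \<in> End_star E. (\<one> - T) \<cdot> G = \<one> \<and> G \<cdot> (\<one> - T) = \<one>"
proof -
 have n: "norm (op_pow T n) \<le> norm T ^ n" for n
  by (induction n) (use norm_blinfun_id_le norm_compose_le in \<open>auto simp: op_pow_Suc\<close>)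
 have "summable (op_pow T)"
  by (rule summable_comparison_test[of _ "\<lambda>n. norm T ^ n"]) (use n T(2) in \<open>auto intro!: summable_geometric\<close>)
 then have lim: "(\<lambda>n. \<Sum>i<n. op_pow T i) \<longlonglongrightarrow> (\<Sum>i. op_pow T i)"
  by (rule summable_LIMSEQ)
 define G where "G = (\<Sum>i. op_pow T i)"
 have GE: "G \<in> End_star E"
  unfolding G_def by (rule norm_limit_adjointable[OF _ lim]) (auto intro!: End_star_sum simp: T)
 have z: "op_pow T \<longlonglongrightarrow> 0"
  by (rule Lim_null_comparison[OF _ LIMSEQ_power_zero[of "norm T"]]) (use n T in auto)
 have comm: "op_pow T n \<cdot> T = T \<cdot> op_pow T n" for n by (rule op_pow_commute[symmetric]) simp
 have s: "(\<one> - T) \<cdot> (\<Sum>i<n. op_pow T i) = \<one> - op_pow T n"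
  "(\<Sum>i<n. op_pow T i) \<cdot> (\<one> - T) = \<one> - op_pow T n" for n
 proof (induction n)
  case (Suc n)
  { case 1 show ?case
    by (simp only: sum.lessThan_Suc blinfun_compose.add_right Suc op_pow_Suc) (simp add: op_simps) }
  { case 2 show ?case
    by (simp only: sum.lessThan_Suc blinfun_compose.add_left Suc op_pow_Suc) (simp add: op_simps comm) }
 qed simp_all
 have "(\<lambda>n. (\<one> - T) \<cdot> (\<Sum>i<n. op_pow T i)) \<longlonglongrightarrow> (\<one> - T) \<cdot> G"
  "(\<lambda>n. (\<Sum>i<n. op_pow T i) \<cdot> (\<one> - T)) \<longlonglongrightarrow> G \<cdot> (\<one> - T)"
  unfolding G_def by (intro blinfun_compose.tendsto tendsto_const lim)+
 moreover have "(\<lambda>n. \<one> - op_pow T n) \<longlonglongrightarrow> \<one> - 0" by (intro tendsto_intros z)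
 ultimately show ?thesis using GE LIMSEQ_unique unfolding s by (metis diff_zero)
qed

text \<open>
 The calculus of a self-adjoint \<open>S\<close> with \<open>\<parallel>S\<parallel> < 1\<close>.  As the spectrum of \<open>S\<close> is contained in \<open>[-1, 1]\<close>, the function
 \<open>cut 1\<close> plays the part of the constant \<open>1\<close>, which does not belong to \<open>C\<^sub>0\<close>.
\<close>

definition small_calculus :: "'e endo \<Rightarrow> 'e calculus \<Rightarrow> bool" where
 "small_calculus S \<phi> \<longleftrightarrow> C0_hom E \<phi> \<and>
   (\<forall>f\<in>C0. \<forall>M. (\<forall>t. cmod (f t) \<le> M) \<longrightarrow> norm (\<phi> f) \<le> M) \<and>
   (\<forall>f\<in>C0. (\<lambda>t. of_real t * f t) \<in> C0 \<longrightarrow> \<phi> (\<lambda>t. of_real t * f t) = S \<cdot> \<phi> f) \<and>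
   (\<forall>f\<in>C0. (\<forall>t. cut 1 t = 1 \<longrightarrow> f t = 0) \<longrightarrow> \<phi> f = 0) \<and>
   \<phi> (cr (cut 1)) = \<one>"

text \<open>Pointwise, \<open>f = (a + b t)\<^sup>n (f w\<^sup>n)\<close>, and \<open>a + b t\<close> becomes \<open>a + b S\<close>.\<close>

lemma calculus_factor_power:
 assumes hom: "C0_hom E \<phi>"
  and mul: "\<And>f. f \<in> C0 \<Longrightarrow> (\<lambda>t. of_real t * f t) \<in> C0 \<Longrightarrow> \<phi> (\<lambda>t. of_real t * f t) = S \<cdot> \<phi> f"
  and f: "f \<in> C0" and w: "continuous_on UNIV w" "\<And>t. \<bar>w t\<bar> \<le> q"
  and w1: "\<And>t. f t \<noteq> 0 \<Longrightarrow> (a + b * t) * w t = 1"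
 shows "\<phi> f = op_pow (of_real a *\<^sub>C \<one> + of_real b *\<^sub>C S) n \<cdot> \<phi> (\<lambda>t. f t * of_real (w t ^ n))"
proof (induction n)
 case (Suc n)
 let ?f = "\<lambda>n t. f t * of_real (w t ^ n)"
 have q: "0 \<le> q" using w(2)[of 0] by linarith
 have c: "?f n \<in> C0" for n
  by (rule C0_mult_bounded[OF f, of _ "q ^ n"])
   (use w q in \<open>auto intro!: continuous_intros power_mono simp: norm_power\<close>)
 have eq: "?f n = (\<lambda>t. of_real a * ?f (Suc n) t + of_real b * (of_real t * ?f (Suc n) t))"
 proof
  fix t
  have "f t * of_real (w t ^ n) = f t * of_real (((a + b * t) * w t) * w t ^ n)"
   using w1[of t] by (cases "f t = 0") simp_all
  then show "?f n t = of_real a * ?f (Suc n) t + of_real b * (of_real t * ?f (Suc n) t)"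
   by (simp add: algebra_simps)
 qed
 have wt: "(\<lambda>t. of_real t * ?f (Suc n) t) \<in> C0" if "b \<noteq> 0"
 proof -
  have "(\<lambda>t. of_real t * ?f (Suc n) t) = (\<lambda>t. of_real (1 / b) * (?f n t - of_real a * ?f (Suc n) t))"
  proof
   fix t show "of_real t * ?f (Suc n) t = of_real (1 / b) * (?f n t - of_real a * ?f (Suc n) t)"
    using that fun_cong[OF eq, of t] by simp
  qed
  then show ?thesis by (simp only:) (intro C0_scale C0_diff c)
 qed
 have "\<phi> (?f n) = of_real a *\<^sub>C \<phi> (?f (Suc n)) + of_real b *\<^sub>C (S \<cdot> \<phi> (?f (Suc n)))"
 proof (cases "b = 0")
  case True
  then show ?thesis
   by (subst eq) (simp only: of_real_0 mult_zero_left add_0_right C0_hom_scale[OF hom c] scaleC_zero_left)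
 next
  case False
  show ?thesis
   by (subst eq) (simp only: C0_hom_add[OF hom C0_scale[OF c] C0_scale[OF wt[OF False]]]
    C0_hom_scale[OF hom c] C0_hom_scale[OF hom wt[OF False]] mul[OF c wt[OF False]])
 qed
 then have "\<phi> (?f n) = (of_real a *\<^sub>C \<one> + of_real b *\<^sub>C S) \<cdot> \<phi> (?f (Suc n))"
  by (simp add: op_simps scaleC_compose_left)
 then show ?case using Suc.IH
  op_pow_add[of "of_real a *\<^sub>C \<one> + of_real b *\<^sub>C S" n 1]
  by (simp add: op_pow_Suc op_assoc)
qed simp

text \<open>
 The hypotheses say that \<open>f\<close> is supported outside the spectrum: there \<open>|a + b t| \<ge> 1 / q > \<parallel>a + b S\<parallel>\<close>.  The norm of the
 factorisation with the \<open>n\<close>-th power tends to \<open>0\<close>.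
\<close>

lemma calculus_vanishes:
 assumes hom: "C0_hom E \<phi>"
  and mul: "\<And>f. f \<in> C0 \<Longrightarrow> (\<lambda>t. of_real t * f t) \<in> C0 \<Longrightarrow> \<phi> (\<lambda>t. of_real t * f t) = S \<cdot> \<phi> f"
  and nrm: "\<And>f M. f \<in> C0 \<Longrightarrow> (\<And>t. cmod (f t) \<le> M) \<Longrightarrow> norm (\<phi> f) \<le> M"
  and f: "f \<in> C0" and w: "continuous_on UNIV w" "\<And>t. \<bar>w t\<bar> \<le> q"
  and w1: "\<And>t. f t \<noteq> 0 \<Longrightarrow> (a + b * t) * w t = 1"
  and small: "norm (of_real a *\<^sub>C \<one> + of_real b *\<^sub>C S) * q < 1"
 shows "\<phi> f = 0"
proof -
 let ?A = "of_real a *\<^sub>C \<one> + of_real b *\<^sub>C S"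
 obtain B where B: "\<And>t. cmod (f t) \<le> B" using C0_bounded[OF f] by blast
 have q: "0 \<le> q" using w(2)[of 0] by linarith
 have B0: "0 \<le> B" using order_trans[OF norm_ge_zero B] .
 have nA: "norm (op_pow ?A n) \<le> norm ?A ^ n" for n
  by (induction n) (use norm_blinfun_id_le norm_compose_le in \<open>auto simp: op_pow_Suc\<close>)
 have eq: "\<phi> f = op_pow ?A n \<cdot> \<phi> (\<lambda>t. f t * of_real (w t ^ n))" for n
  by (rule calculus_factor_power[OF hom mul f w w1])
 have "norm (\<phi> f) \<le> norm ?A ^ n * (B * q ^ n)" for n
 proof (subst eq[of n], rule norm_compose_le[OF nA])
  show "norm (\<phi> (\<lambda>t. f t * of_real (w t ^ n))) \<le> B * q ^ n"
  proof (rule nrm)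
   show "(\<lambda>t. f t * of_real (w t ^ n)) \<in> C0"
    by (rule C0_mult_bounded[OF f, of _ "q ^ n"])
     (use w q in \<open>auto intro!: continuous_intros power_mono simp: norm_power\<close>)
   show "cmod (f t * of_real (w t ^ n)) \<le> B * q ^ n" for t
    unfolding norm_mult using B B0 w(2) by (intro mult_mono) (auto simp: norm_power intro!: power_mono)
  qed
 qed
 then have "norm (\<phi> f) \<le> B * (norm ?A * q) ^ n" for n by (simp add: power_mult_distrib mult_ac)
 moreover have "(\<lambda>n. B * (norm ?A * q) ^ n) \<longlonglongrightarrow> B * 0"
  using small q by (intro tendsto_intros LIMSEQ_power_zero) auto
 ultimately have "norm (\<phi> f) \<le> B * 0" by (intro LIMSEQ_le_const) auto
 then show ?thesis by simp
qed

text \<open>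
 The resolvent \<open>(S + \<i>)\<^sup>-\<^sup>1\<close> is given by a Neumann series, and functions that vanish on \<open>[-1, 1]\<close> are annihilated
 because \<open>\<parallel>S\<parallel> < 1\<close>.
\<close>

lemma small_calculus_exists:
 assumes S: "S \<in> End_star E" "S\<^sup>* = S" "norm S < 1"
 obtains \<phi> where "small_calculus S \<phi>"
proof -
 have "norm ((- \<i>) *\<^sub>C (- S)) < 1" using S by (simp add: norm_scaleC)
 moreover have "(- \<i>) *\<^sub>C (- S) \<in> End_star E" using S by simp
 ultimately obtain G where G: "G \<in> End_star E" "(\<one> - (- \<i>) *\<^sub>C (- S)) \<cdot> G = \<one>"
  "G \<cdot> (\<one> - (- \<i>) *\<^sub>C (- S)) = \<one>" using neumann by metis
 define r where "r = (- \<i>) *\<^sub>C G"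
 have rE: "r \<in> End_star E" by (simp add: r_def G)
 define A where "A = S + \<i> *\<^sub>C \<one>"
 define B where "B = S - \<i> *\<^sub>C \<one>"
 have AE: "A \<in> End_star E" and Ad: "A\<^sup>* = B"
  using S by (simp_all add: A_def B_def scaleC_minus_left)
 have AB: "A - B = (2 * \<i>) *\<^sub>C \<one>"
  by (simp add: A_def B_def scaleC_add_left[symmetric])
 have A: "A = \<i> *\<^sub>C (\<one> - (- \<i>) *\<^sub>C (- S))"
  by (simp add: A_def scaleC_diff_right scaleC_minus_left scaleC_minus_right scaleC_scaleC)
 have r1: "A \<cdot> r = \<one>" "r \<cdot> A = \<one>"
  unfolding A r_def using G S
  by (simp_all only: scaleC_compose_left compose_scaleC_right scaleC_scaleC End_star_diff End_star_id
    End_star_scaleC End_star_minus) (simp_all)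
 have r2: "r\<^sup>* \<cdot> B = \<one>" "B \<cdot> r\<^sup>* = \<one>"
  using arg_cong[OF r1(1), of dag] arg_cong[OF r1(2), of dag] rE AE by (simp_all add: Ad)
 have "r \<cdot> (A - B) \<cdot> r\<^sup>* = r\<^sup>* - r"
  unfolding blinfun_compose.diff_right blinfun_compose.diff_left r1
  unfolding op_assoc r2 by simp
 moreover have "r\<^sup>* \<cdot> (A - B) \<cdot> r = r\<^sup>* - r"
  unfolding blinfun_compose.diff_right blinfun_compose.diff_left r2
  unfolding op_assoc r1 by simp
 ultimately have eqs: "(2 * \<i>) *\<^sub>C (r \<cdot> r\<^sup>*) = r\<^sup>* - r" "(2 * \<i>) *\<^sub>C (r\<^sup>* \<cdot> r) = r\<^sup>* - r"
  using rE unfolding AB by (simp_all add: compose_scaleC_right scaleC_compose_left)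
 have "r \<cdot> r\<^sup>* = r\<^sup>* \<cdot> r"
 proof -
  have "(1 / (2 * \<i>)) *\<^sub>C (2 * \<i>) *\<^sub>C (r \<cdot> r\<^sup>*) = (1 / (2 * \<i>)) *\<^sub>C (2 * \<i>) *\<^sub>C (r\<^sup>* \<cdot> r)"
   unfolding eqs ..
  then show ?thesis by (simp add: scaleC_scaleC)
 qed
 then obtain \<phi> where hom: "C0_hom E \<phi>" and res: "\<phi> resolvent = r"
  and nrm: "\<And>f M. f \<in> C0 \<Longrightarrow> (\<And>t. cmod (f t) \<le> M) \<Longrightarrow> norm (\<phi> f) \<le> M"
  using C0_hom_exists[OF rE eqs(1)[symmetric]] by metis
 have mul: "\<phi> (\<lambda>t. of_real t * f t) = S \<cdot> \<phi> f" if f: "f \<in> C0" "(\<lambda>t. of_real t * f t) \<in> C0" for f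
 proof -
  let ?g = "\<lambda>t. of_real t * f t + \<i> * f t"
  have g: "?g \<in> C0" by (intro C0_add C0_scale f)
  have "f = (\<lambda>t. resolvent t * ?g t)"
   by (auto simp: resolvent_def distrib_right[symmetric])
  then have "\<phi> f = r \<cdot> \<phi> ?g" using C0_hom_mult[OF hom resolvent_C0 g] res by simp
  then have "A \<cdot> \<phi> f = \<phi> ?g"
   by (simp add: op_assoc[symmetric] r1)
  also have "\<phi> ?g = \<phi> (\<lambda>t. of_real t * f t) + \<i> *\<^sub>C \<phi> f"
   using C0_hom_add[OF hom f(2) C0_scale[OF f(1)]] C0_hom_scale[OF hom f(1)] by simp
  finally show ?thesis by (simp add: A_def op_simps scaleC_compose_left)
 qed
 have van: "\<phi> f = 0" if f: "f \<in> C0" "\<And>t. cut 1 t = 1 \<Longrightarrow> f t = 0" for f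
 proof (rule calculus_vanishes[OF hom mul nrm f(1), of "\<lambda>t. t / (max 1 \<bar>t\<bar>)\<^sup>2" 1 0 1])
  show "continuous_on UNIV (\<lambda>t :: real. t / (max 1 \<bar>t\<bar>)\<^sup>2)"
   by (intro continuous_on_divide continuous_intros) (auto simp: max_def split: if_splits)
  show "\<bar>t / (max 1 \<bar>t\<bar>)\<^sup>2\<bar> \<le> 1" for t :: real
  proof -
   have le: "\<bar>t\<bar> \<le> (max 1 \<bar>t\<bar>)\<^sup>2"
   proof -
    have "max 1 \<bar>t\<bar> \<le> (max 1 \<bar>t\<bar>)\<^sup>2" by (rule self_le_power) simp_all
    then show ?thesis by (rule order_trans[OF max.cobounded2])
   qed
   have pos: "0 < (max 1 \<bar>t\<bar>)\<^sup>2" by (rule zero_less_power) simp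
   show ?thesis
    unfolding abs_divide abs_power2 by (rule divide_le_eq_1_pos[OF pos, THEN iffD2, OF le])
  qed
  show "(0 + 1 * t) * (t / (max 1 \<bar>t\<bar>)\<^sup>2) = 1" if "f t \<noteq> 0" for t
   using that f(2)[of t] cut_eq_1[of t 1] by (auto simp: max_def power2_eq_square divide_simps)
 qed (use S in auto)
 have cutC: "cr (cut 1) \<in> C0" using Cc_C0[OF cut_Cc[of "\<lambda>_. 1" 1]] by simp
 have "\<phi> (cr (cut 1)) \<cdot> r = r"
 proof -
  let ?f = "\<lambda>t. resolvent t - cr (cut 1) t * resolvent t"
  have m: "(\<lambda>t. cr (cut 1) t * resolvent t) \<in> C0" by (intro C0_mult cutC resolvent_C0)
  have "\<phi> ?f = 0" by (rule van) (auto intro!: C0_diff m resolvent_C0)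
  moreover have "\<phi> (\<lambda>t. ?f t + cr (cut 1) t * resolvent t) = \<phi> ?f + \<phi> (\<lambda>t. cr (cut 1) t * resolvent t)"
   by (intro C0_hom_add[OF hom] C0_diff m resolvent_C0)
  ultimately show ?thesis using C0_hom_mult[OF hom cutC resolvent_C0] res by simp
 qed
 then have "\<phi> (cr (cut 1)) \<cdot> (r \<cdot> A) = r \<cdot> A"
  by (simp add: op_assoc[symmetric])
 then have one: "\<phi> (cr (cut 1)) = \<one>" by (simp add: r1)
 show ?thesis
 proof (rule that)
  show "small_calculus S \<phi>"
   unfolding small_calculus_def by (intro conjI ballI allI impI hom nrm mul van one) simp_all
 qed
qed

end

context cauchy_schwarz_module
begin

lemma small_calculusD:
 assumes "small_calculus S \<phi>"
 shows "C0_hom E \<phi>"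
  and "\<And>f M. f \<in> C0 \<Longrightarrow> (\<And>t. cmod (f t) \<le> M) \<Longrightarrow> norm (\<phi> f) \<le> M"
  and "\<And>f. f \<in> C0 \<Longrightarrow> (\<lambda>t. of_real t * f t) \<in> C0 \<Longrightarrow> \<phi> (\<lambda>t. of_real t * f t) = S \<cdot> \<phi> f"
  and "\<phi> (cr (cut 1)) = \<one>"
 using assms unfolding small_calculus_def by blast+

lemma cut_C0: "cr (cut a) \<in> C0"
 using Cc_C0[OF cut_Cc[of "\<lambda>_. 1" a]] by simp

lemma small_calculus_affine:
 assumes S: "small_calculus S \<phi>"
 shows "a *\<^sub>R \<one> + b *\<^sub>R S = \<phi> (cr (\<lambda>t. (a + b * t) * cut 1 t))"
proof -
 note c = small_calculusD[OF S]
 have t: "(\<lambda>t. of_real t * cr (cut 1) t) \<in> C0"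
  using Cc_C0[OF cut_Cc[of "\<lambda>t. t" 1]] by simp
 have "cr (\<lambda>t. (a + b * t) * cut 1 t)
   = (\<lambda>t. of_real a * cr (cut 1) t + of_real b * (of_real t * cr (cut 1) t))"
  by (auto simp: algebra_simps)
 then have "\<phi> (cr (\<lambda>t. (a + b * t) * cut 1 t))
   = of_real a *\<^sub>C \<phi> (cr (cut 1)) + of_real b *\<^sub>C (S \<cdot> \<phi> (cr (cut 1)))"
  by (simp only: C0_hom_add[OF c(1) C0_scale[OF cut_C0] C0_scale[OF t]]
    C0_hom_scale[OF c(1) cut_C0] C0_hom_scale[OF c(1) t] c(3)[OF cut_C0 t])
 then show ?thesis by (simp add: c(4) scaleC_of_real)
qed

text \<open>
 \<open>bounded_below S M\<close> expresses \<open>S \<ge> - M\<close> for a self-adjoint \<open>S\<close> by norms only, in a form which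
 makes subadditivity obvious.
\<close>

definition bounded_below :: "'e endo \<Rightarrow> real \<Rightarrow> bool" where
 "bounded_below S M \<longleftrightarrow> (\<forall>e>0. \<exists>t0. \<forall>t\<ge>t0. norm (t *\<^sub>R \<one> - S) \<le> t + M + e)"

lemma bounded_below_add:
 assumes "bounded_below S M" "bounded_below T N" shows "bounded_below (S + T) (M + N)"
 unfolding bounded_below_def
proof (intro allI impI)
 fix e :: real assume e: "0 < e"
 obtain t0 where t0: "\<And>t. t \<ge> t0 \<Longrightarrow> norm (t *\<^sub>R \<one> - S) \<le> t + M + e / 2"
  using assms(1) e unfolding bounded_below_def by (meson half_gt_zero)
 obtain t1 where t1: "\<And>t. t \<ge> t1 \<Longrightarrow> norm (t *\<^sub>R \<one> - T) \<le> t + N + e / 2"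
  using assms(2) e unfolding bounded_below_def by (meson half_gt_zero)
 show "\<exists>t0. \<forall>t\<ge>t0. norm (t *\<^sub>R \<one> - (S + T)) \<le> t + (M + N) + e"
 proof (intro exI allI impI)
  fix t assume t: "2 * max t0 t1 \<le> t"
  have "t *\<^sub>R \<one> - (S + T) = ((t / 2) *\<^sub>R \<one> - S) + ((t / 2) *\<^sub>R \<one> - T)"
   by (simp add: algebra_simps scaleR_half_double flip: scaleR_add_left)
  then have "norm (t *\<^sub>R \<one> - (S + T))
    \<le> norm ((t / 2) *\<^sub>R \<one> - S) + norm ((t / 2) *\<^sub>R \<one> - T)"
   using norm_triangle_ineq by metis
  moreover have "2 * t0 \<le> t" "2 * t1 \<le> t" using t by auto
  then have "norm ((t / 2) *\<^sub>R \<one> - S) \<le> t / 2 + M + e / 2"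
   "norm ((t / 2) *\<^sub>R \<one> - T) \<le> t / 2 + N + e / 2" by (intro t0 t1; linarith)+
  ultimately show "norm (t *\<^sub>R \<one> - (S + T)) \<le> t + (M + N) + e" by linarith
 qed
qed

lemma bounded_below_norm: "bounded_below S (norm S)"
 unfolding bounded_below_def
proof (intro allI impI exI)
 fix e t :: real assume "0 < e" "0 \<le> t"
 then have "norm (t *\<^sub>R (\<one> :: 'e endo)) \<le> t"
  using mult_left_mono[OF norm_blinfun_id_le, of t] by simp
 then show "norm (t *\<^sub>R \<one> - S) \<le> t + norm S + e"
  using norm_triangle_ineq4[of "t *\<^sub>R \<one>" S] \<open>0 < e\<close> by simp
qed

lemma bounded_below_mono: "bounded_below S M \<Longrightarrow> M \<le> N \<Longrightarrow> bounded_below S N"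
 unfolding bounded_below_def
proof (intro allI impI)
 fix e :: real
 assume *: "\<forall>e>0. \<exists>t0. \<forall>t\<ge>t0. norm (t *\<^sub>R \<one> - S) \<le> t + M + e" "M \<le> N" "0 < e"
 then obtain t0 where "\<And>t. t \<ge> t0 \<Longrightarrow> norm (t *\<^sub>R \<one> - S) \<le> t + M + e" by blast
 with *(2) show "\<exists>t0. \<forall>t\<ge>t0. norm (t *\<^sub>R \<one> - S) \<le> t + N + e"
  by (intro exI[of _ t0]) (smt (verit, best))
qed

lemma bounded_below_scale:
 assumes "bounded_below S M" "0 < r" shows "bounded_below (r *\<^sub>R S) (r * M)"
 unfolding bounded_below_def
proof (intro allI impI)
 fix e :: real assume e: "0 < e"
 obtain t0 where t0: "\<And>t. t \<ge> t0 \<Longrightarrow> norm (t *\<^sub>R \<one> - S) \<le> t + M + e / r"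
  using assms e unfolding bounded_below_def by (meson divide_pos_pos)
 show "\<exists>t0. \<forall>t\<ge>t0. norm (t *\<^sub>R \<one> - r *\<^sub>R S) \<le> t + r * M + e"
 proof (intro exI allI impI)
  fix t assume t: "r * t0 \<le> t"
  have "t *\<^sub>R \<one> - r *\<^sub>R S = r *\<^sub>R ((t / r) *\<^sub>R \<one> - S)"
   using assms(2) by (simp add: scaleR_diff_right)
  then have "norm (t *\<^sub>R \<one> - r *\<^sub>R S) = r * norm ((t / r) *\<^sub>R \<one> - S)"
   using assms(2) by simp
  also have "\<dots> \<le> r * (t / r + M + e / r)"
   using assms(2) t by (intro mult_left_mono t0) (auto simp: field_simps)
  also have "\<dots> = t + r * M + e" using assms(2) by (simp add: field_simps)
  finally show "norm (t *\<^sub>R \<one> - r *\<^sub>R S) \<le> t + r * M + e" .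
 qed
qed

text \<open>
 For large \<open>s\<close> the hypotheses bound \<open>\<parallel>s \<plusminus> S\<parallel>\<close> by \<open>s + M + \<epsilon>\<close>, so that functions supported outside \<open>[- M - \<epsilon>, M + \<epsilon>]\<close>
 are annihilated; hence \<open>S = f(S)\<close> with \<open>|f| \<le> M + \<epsilon>\<close>.
\<close>

lemma norm_le_if_bounded_below_small:
 assumes S: "S \<in> End_star E" "S\<^sup>* = S" "norm S < 1" and M: "0 \<le> M"
  and l: "bounded_below S M" and u: "bounded_below (- S) M"
 shows "norm S \<le> M"
proof (rule field_le_epsilon)
 fix e :: real assume e: "0 < e"
 obtain \<phi> where phi: "small_calculus S \<phi>" using small_calculus_exists[OF S] .
 note c = small_calculusD[OF phi]
 obtain t0 where t0: "\<And>t. t \<ge> t0 \<Longrightarrow> norm (t *\<^sub>R \<one> - S) \<le> t + M + e / 2"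
  using l e unfolding bounded_below_def by (meson half_gt_zero)
 obtain t1 where t1: "\<And>t. t \<ge> t1 \<Longrightarrow> norm (t *\<^sub>R \<one> - (- S)) \<le> t + M + e / 2"
  using u e unfolding bounded_below_def by (meson half_gt_zero)
 define s where "s = max 1 (max t0 t1)"
 have s: "norm (s *\<^sub>R \<one> - S) \<le> s + M + e / 2" "norm (s *\<^sub>R \<one> + S) \<le> s + M + e / 2" "1 \<le> s"
  using t0[of s] t1[of s] by (auto simp: s_def)
 define q where "q = 1 / (s + (M + e))"
 have q: "(s + M + e / 2) * q < 1" "0 < q" using s(3) M e by (auto simp: q_def field_simps)
 let ?c = "\<lambda>t. max (- (M + e)) (min (M + e) t)"
 let ?p = "\<lambda>t. max 0 (t - (M + e))"
 let ?n = "\<lambda>t. max 0 (- t - (M + e))"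
 have C: "cr (\<lambda>t. ?c t * cut 1 t) \<in> C0" "cr (\<lambda>t. ?p t * cut 1 t) \<in> C0" "cr (\<lambda>t. ?n t * cut 1 t) \<in> C0"
  by (intro Cc_C0 cut_Cc continuous_intros)+
 have "\<phi> (cr (\<lambda>t. ?p t * cut 1 t)) = 0"
 proof (rule calculus_vanishes[OF c(1) c(3) c(2) C(2), of "\<lambda>t. 1 / (s + max t (M + e))" q s 1])
  show "continuous_on UNIV (\<lambda>t. 1 / (s + max t (M + e)))"
   using s(3) M e by (intro continuous_intros) (auto simp: max_def split: if_splits)
  show "\<bar>1 / (s + max t (M + e))\<bar> \<le> q" for t
   using s(3) M e by (auto simp: q_def max_def divide_simps)
  show "(s + 1 * t) * (1 / (s + max t (M + e))) = 1"
   if "cr (\<lambda>t. ?p t * cut 1 t) t \<noteq> 0" for t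
   using that s(3) M e by (auto simp: max_def split: if_splits)
  have "norm (of_real s *\<^sub>C \<one> + of_real 1 *\<^sub>C S) * q \<le> (s + M + e / 2) * q"
   using s(2) q(2) by (intro mult_right_mono) (auto simp: scaleC_of_real)
  then show "norm (of_real s *\<^sub>C \<one> + of_real 1 *\<^sub>C S) * q < 1" using q(1) by linarith
 qed
 moreover have "\<phi> (cr (\<lambda>t. ?n t * cut 1 t)) = 0"
 proof (rule calculus_vanishes[OF c(1) c(3) c(2) C(3), of "\<lambda>t. 1 / (s + max (- t) (M + e))" q s "-1"])
  show "continuous_on UNIV (\<lambda>t. 1 / (s + max (- t) (M + e)))"
   using s(3) M e by (intro continuous_intros) (auto simp: max_def split: if_splits)
  show "\<bar>1 / (s + max (- t) (M + e))\<bar> \<le> q" for t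
   using s(3) M e by (auto simp: q_def max_def divide_simps)
  show "(s + -1 * t) * (1 / (s + max (- t) (M + e))) = 1"
   if "cr (\<lambda>t. ?n t * cut 1 t) t \<noteq> 0" for t
   using that s(3) M e by (auto simp: max_def split: if_splits)
  have "of_real s *\<^sub>C \<one> + of_real (-1) *\<^sub>C S = s *\<^sub>R \<one> - S"
   by (simp only: scaleC_of_real) simp
  then have "norm (of_real s *\<^sub>C \<one> + of_real (-1) *\<^sub>C S) * q \<le> (s + M + e / 2) * q"
   using s(1) q(2) by (intro mult_right_mono) simp_all
  then show "norm (of_real s *\<^sub>C \<one> + of_real (-1) *\<^sub>C S) * q < 1" using q(1) by linarith
 qed
 moreover have "norm (\<phi> (cr (\<lambda>t. ?c t * cut 1 t))) \<le> M + e"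
 proof (rule c(2)[OF C(1)])
  fix t
  have "\<bar>?c t\<bar> * cut 1 t \<le> (M + e) * 1" using M e by (intro mult_mono) auto
  then show "cmod (cr (\<lambda>t. ?c t * cut 1 t) t) \<le> M + e" by (simp only: norm_of_real abs_mult) simp
 qed
 moreover have "S = \<phi> (cr (\<lambda>t. ?c t * cut 1 t)) + \<phi> (cr (\<lambda>t. ?p t * cut 1 t)) + (-1) *\<^sub>C \<phi> (cr (\<lambda>t. ?n t * cut 1 t))"
 proof -
  have "S = \<phi> (cr (\<lambda>t. (0 + 1 * t) * cut 1 t))"
   using small_calculus_affine[OF phi, of 0 1] by simp
  also have "cr (\<lambda>t. (0 + 1 * t) * cut 1 t) = (\<lambda>t. (cr (\<lambda>t. ?c t * cut 1 t) t + cr (\<lambda>t. ?p t * cut 1 t) t)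
    + (-1) * cr (\<lambda>t. ?n t * cut 1 t) t)"
  proof
   fix t
   have "t = ?c t + ?p t - ?n t" using M e by (auto simp: max_def min_def)
   then have "t * cut 1 t = (?c t + ?p t - ?n t) * cut 1 t" by (rule arg_cong)
   also have "\<dots> = ?c t * cut 1 t + ?p t * cut 1 t + (- 1) * (?n t * cut 1 t)"
    by (simp only: left_diff_distrib distrib_right mult_minus1 diff_conv_add_uminus)
   finally show "cr (\<lambda>t. (0 + 1 * t) * cut 1 t) t = (cr (\<lambda>t. ?c t * cut 1 t) t + cr (\<lambda>t. ?p t * cut 1 t) t)
    + (-1) * cr (\<lambda>t. ?n t * cut 1 t) t"
    by (simp only: add_0 mult_1 of_real_add of_real_mult of_real_minus of_real_1)
  qed
  also have "\<phi> \<dots> = \<phi> (cr (\<lambda>t. ?c t * cut 1 t)) + \<phi> (cr (\<lambda>t. ?p t * cut 1 t)) + (-1) *\<^sub>C \<phi> (cr (\<lambda>t. ?n t * cut 1 t))"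
   by (simp only: C0_hom_add[OF c(1) C0_add[OF C(1,2)] C0_scale[OF C(3)]] C0_hom_add[OF c(1) C(1,2)]
     C0_hom_scale[OF c(1) C(3)])
  finally show ?thesis .
 qed
 ultimately show "norm S \<le> M + e" by simp
qed

lemma norm_le_if_bounded_below:
 assumes S: "S \<in> End_star E" "S\<^sup>* = S" and M: "0 \<le> M"
  and l: "bounded_below S M" and u: "bounded_below (- S) M"
 shows "norm S \<le> M"
proof -
 define r where "r = 1 / (norm S + 1)"
 have r: "0 < r" by (simp add: r_def add_nonneg_pos)
 have n1: "norm (r *\<^sub>R S) = r * norm S" using r by simp
 also have "\<dots> < 1" by (simp add: r_def divide_less_eq_1 add_nonneg_pos)
 finally have "norm (r *\<^sub>R S) \<le> r * M"
  using S M r bounded_below_scale[OF l r] bounded_below_scale[OF u r]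
  by (intro norm_le_if_bounded_below_small) (auto simp: scaleR_minus_right)
 then show ?thesis using r n1 by simp
qed

text \<open>The function \<open>t - x\<^sup>2\<close> of \<open>x\<close> is bounded by \<open>t\<close> on the support \<open>[-2, 2]\<close> of \<open>cut 1\<close> once \<open>t \<ge> 4\<close>.\<close>

lemma bounded_below_square:
 assumes X: "X \<in> End_star E" "X\<^sup>* = X" "norm X < 1"
 shows "bounded_below (X \<cdot> X) 0"
 unfolding bounded_below_def
proof (intro allI impI exI)
 fix e t :: real assume e: "0 < e" and t: "4 \<le> t"
 obtain \<phi> where phi: "small_calculus X \<phi>" using small_calculus_exists[OF X] .
 note c = small_calculusD[OF phi]
 have C: "(\<lambda>t. of_real t * cr (cut 1) t) \<in> C0" "(\<lambda>t. of_real t * (of_real t * cr (cut 1) t)) \<in> C0"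
 proof -
  have "continuous_on UNIV (\<lambda>t :: real. t)" "continuous_on UNIV (\<lambda>t :: real. t * t)"
   by (intro continuous_intros)+
  then show "(\<lambda>t. of_real t * cr (cut 1) t) \<in> C0" "(\<lambda>t. of_real t * (of_real t * cr (cut 1) t)) \<in> C0"
   using Cc_C0[OF cut_Cc[of "\<lambda>t. t" 1]] Cc_C0[OF cut_Cc[of "\<lambda>t. t * t" 1]] by (simp_all add: mult.assoc)
 qed
 have D: "(\<lambda>x. of_real t * cr (cut 1) x + (-1) * (of_real x * (of_real x * cr (cut 1) x))) \<in> C0"
  by (intro C0_add C0_scale C cut_C0)
 have "t *\<^sub>R \<one> - X \<cdot> X
   = \<phi> (\<lambda>x. of_real t * cr (cut 1) x + (-1) * (of_real x * (of_real x * cr (cut 1) x)))"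
  unfolding C0_hom_add[OF c(1) C0_scale[OF cut_C0] C0_scale[OF C(2)]]
   C0_hom_scale[OF c(1) cut_C0] C0_hom_scale[OF c(1) C(2)] c(3)[OF C] c(3)[OF cut_C0 C(1)] c(4)
  by (simp add: scaleC_of_real scaleC_minus_left)
 also have "norm \<dots> \<le> t"
 proof (rule c(2)[OF D])
  fix x
  have eq: "of_real t * cr (cut 1) x + (-1) * (of_real x * (of_real x * cr (cut 1) x)) = of_real ((t - x * x) * cut 1 x)"
   by (simp add: left_diff_distrib mult.assoc)
  have "\<bar>(t - x * x) * cut 1 x\<bar> \<le> t"
  proof (cases "\<bar>x\<bar> \<ge> 2")
   case False
   then have "\<bar>x\<bar> * \<bar>x\<bar> \<le> 2 * 2" by (intro mult_mono) auto
   then have "x * x \<le> 4" by simp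
   then have "\<bar>t - x * x\<bar> * cut 1 x \<le> t * 1" using t by (intro mult_mono) auto
   then show ?thesis by (simp add: abs_mult)
  qed (use t in \<open>simp add: cut_eq_0\<close>)
  then show "cmod (of_real t * cr (cut 1) x + (-1) * (of_real x * (of_real x * cr (cut 1) x))) \<le> t"
   by (simp only: eq norm_of_real)
 qed
 finally show "norm (t *\<^sub>R \<one> - X \<cdot> X) \<le> t + 0 + e" using e by simp
qed

text \<open>
 Apart from \<open>0\<close>, \<open>c\<^sup>*c\<close> and \<open>c c\<^sup>*\<close> have the same spectrum; here only the upper bound is transferred,
 by means of \<open>(t + cc\<^sup>*)\<^sup>n c = c (t + c\<^sup>*c)\<^sup>n\<close>.
\<close>

lemma bounded_above_compose_dag:
 assumes c: "c \<in> End_star E" "norm c < 1" and s: "0 < s"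
  and bd: "norm (s *\<^sub>R \<one> + c\<^sup>* \<cdot> c) \<le> s"
 shows "bounded_below (- (c \<cdot> c\<^sup>*)) 0"
 unfolding bounded_below_def
proof (intro allI impI exI)
 fix e t :: real assume e: "0 < e" and t: "2 \<le> t"
 define Q where "Q = c \<cdot> c\<^sup>*"
 have Q: "Q \<in> End_star E" "Q\<^sup>* = Q" using c by (simp_all add: Q_def)
 have "norm Q \<le> norm c * norm c"
  unfolding Q_def using c by (metis norm_blinfun_compose norm_dag)
 also have "\<dots> \<le> norm c * 1" using c by (intro mult_left_mono) auto
 finally have Q1: "norm Q < 1" using c by simp
 obtain \<phi> where phi: "small_calculus Q \<phi>" using small_calculus_exists[OF Q Q1] .
 note cc = small_calculusD[OF phi]
 let ?h = "\<lambda>x. max 0 (x - e) * cut 1 x"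
 let ?w = "\<lambda>x. 1 / (s + max x e)"
 have hC: "cr ?h \<in> Cc" by (intro cut_Cc continuous_intros)
 obtain B where B: "\<And>t. cmod (cr ?h t) \<le> B" using C0_bounded[OF Cc_C0[OF hC]] by blast
 have B0: "0 \<le> B" using order_trans[OF norm_ge_zero B] .
 have wcont: "continuous_on UNIV ?w"
  using s e by (intro continuous_intros) (auto simp: max_def split: if_splits)
 have wbd: "\<bar>?w x\<bar> \<le> 1 / (s + e)" for x using s e by (auto simp: max_def divide_simps)
 let ?A = "of_real s *\<^sub>C \<one> + of_real 1 *\<^sub>C Q"
 have A: "?A = s *\<^sub>R \<one> + Q" by (simp add: scaleC_of_real)
 have inter: "op_pow ?A n \<cdot> c = c \<cdot> op_pow (s *\<^sub>R \<one> + c\<^sup>* \<cdot> c) n" for n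
 proof (induction n)
  case (Suc n)
  have "op_pow ?A (Suc n) \<cdot> c = ?A \<cdot> c \<cdot> op_pow (s *\<^sub>R \<one> + c\<^sup>* \<cdot> c) n"
   by (simp only: op_pow_Suc op_assoc Suc)
  also have "?A \<cdot> c = c \<cdot> (s *\<^sub>R \<one> + c\<^sup>* \<cdot> c)"
   unfolding A by (simp add: Q_def op_simps op_scaleR)
  finally show ?case by (simp only: op_pow_Suc op_assoc)
 qed simp
 have pow: "norm (op_pow (s *\<^sub>R \<one> + c\<^sup>* \<cdot> c) n) \<le> s ^ n" for n
  by (induction n) (use norm_blinfun_id_le norm_compose_le[OF bd] in \<open>auto simp: op_pow_Suc\<close>)
 have est: "norm (\<phi> (cr ?h)) \<le> (B / e) * (s * (1 / (s + e))) ^ n" for n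
 proof -
  let ?k = "\<lambda>x. cr ?h x * of_real (?w x ^ n * (1 / max x e))"
  have kcont: "continuous_on UNIV (\<lambda>x. complex_of_real (?w x ^ n * (1 / max x e)))"
   using e by (intro continuous_on_of_real continuous_on_mult continuous_on_power wcont continuous_intros)
    (auto simp: max_def split: if_splits)
  have kC: "?k \<in> Cc" by (rule Cc_mult_right[OF hC kcont])
  have tk: "(\<lambda>x. cr ?h x * of_real (?w x ^ n)) = (\<lambda>x. of_real x * ?k x)"
  proof
   fix x show "cr ?h x * of_real (?w x ^ n) = of_real x * ?k x"
    using e by (cases "x \<le> e") (auto simp: max_def)
  qed
  have "\<phi> (cr ?h) = op_pow ?A n \<cdot> \<phi> (\<lambda>x. cr ?h x * of_real (?w x ^ n))"
   by (rule calculus_factor_power[OF cc(1) cc(3) Cc_C0[OF hC] wcont wbd])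
    (use e s in \<open>auto simp: max_def split: if_splits\<close>)
  also have "\<phi> (\<lambda>x. cr ?h x * of_real (?w x ^ n)) = Q \<cdot> \<phi> ?k"
   unfolding tk by (rule cc(3)[OF Cc_C0[OF kC]], rule Cc_C0, rule Cc_mult_left[OF kC]) (intro continuous_intros)
  also have "op_pow ?A n \<cdot> (Q \<cdot> \<phi> ?k) = op_pow ?A n \<cdot> c \<cdot> c\<^sup>* \<cdot> \<phi> ?k"
   by (simp only: Q_def op_assoc)
  also have "norm \<dots> \<le> 1 * s ^ n * 1 * (B * ((1 / (s + e)) ^ n * (1 / e)))"
  proof (unfold inter, intro norm_compose_le pow)
   show "norm c \<le> 1" "norm (c\<^sup>*) \<le> 1" using c by simp_all
   show "norm (\<phi> ?k) \<le> B * ((1 / (s + e)) ^ n * (1 / e))"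
   proof (rule cc(2)[OF Cc_C0[OF kC]])
    fix x
    have "\<bar>?w x ^ n * (1 / max x e)\<bar> \<le> (1 / (s + e)) ^ n * (1 / e)"
     unfolding abs_mult power_abs using e s
     by (intro mult_mono power_mono wbd) (auto simp: max_def divide_simps)
    then show "cmod (?k x) \<le> B * ((1 / (s + e)) ^ n * (1 / e))"
     unfolding norm_mult norm_of_real using B[of x] B0
     by (intro mult_mono) (auto simp: norm_mult)
   qed
  qed
  finally show ?thesis by (simp add: power_mult_distrib power_divide mult_ac)
 qed
 have "(\<lambda>n. (B / e) * (s * (1 / (s + e))) ^ n) \<longlonglongrightarrow> (B / e) * 0"
  by (intro tendsto_intros LIMSEQ_power_zero) (use s e in \<open>simp add: abs_of_pos\<close>)
 then have "norm (\<phi> (cr ?h)) \<le> 0" using est by (intro LIMSEQ_le_const) auto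
 then have h0: "\<phi> (cr ?h) = 0" by simp
 let ?g = "\<lambda>x. (t + min x e) * cut 1 x"
 have gC: "cr ?g \<in> C0" by (intro Cc_C0 cut_Cc continuous_intros)
 have "t *\<^sub>R \<one> - (- Q) = \<phi> (cr (\<lambda>x. (t + 1 * x) * cut 1 x))"
  using small_calculus_affine[OF phi, of t 1] by simp
 also have "cr (\<lambda>x. (t + 1 * x) * cut 1 x) = (\<lambda>x. cr ?g x + cr ?h x)"
  by (auto simp: max_def min_def algebra_simps)
 also have "\<phi> \<dots> = \<phi> (cr ?g)"
  by (simp only: C0_hom_add[OF cc(1) gC Cc_C0[OF hC]] h0 add_0_right)
 also have "norm \<dots> \<le> t + e"
 proof (rule cc(2)[OF gC])
  fix x
  have "\<bar>?g x\<bar> \<le> t + e"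
  proof (cases "\<bar>x\<bar> \<ge> 2")
   case False
   then have "\<bar>t + min x e\<bar> * cut 1 x \<le> (t + e) * 1" using t e by (intro mult_mono) auto
   then show ?thesis by (simp add: abs_mult)
  qed (use t e in \<open>simp add: cut_eq_0\<close>)
  then show "cmod (cr ?g x) \<le> t + e" by (simp only: norm_of_real)
 qed
 finally show "norm (t *\<^sub>R \<one> - - (c \<cdot> c\<^sup>*)) \<le> t + 0 + e" by (simp add: Q_def)
qed

text \<open>
 The theorem that \<open>T\<^sup>*T\<close> is positive.  If \<open>c = T g(T\<^sup>*T)\<close> with \<open>g\<close> supported on the negative axis,
 then \<open>c\<^sup>*c\<close> is negative, hence \<open>cc\<^sup>*\<close> is negative by the preceding lemma; but \<open>c\<^sup>*c + cc\<^sup>*\<close> is a sum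
 of squares of self-adjoint operators, so that \<open>c\<^sup>*c\<close> is also positive, and \<open>c = 0\<close>.
\<close>

lemma bounded_below_dag_compose_small:
 assumes T: "T \<in> End_star E" "norm T \<le> 1 / 4"
 shows "bounded_below (T\<^sup>* \<cdot> T) 0"
 unfolding bounded_below_def
proof (intro allI impI exI)
 fix e t :: real assume e: "0 < e" and t: "2 \<le> t"
 define S where "S = T\<^sup>* \<cdot> T"
 have S: "S \<in> End_star E" "S\<^sup>* = S" using T by (simp_all add: S_def)
 have "norm S \<le> 1/4 * (1/4)" unfolding S_def using T by (intro norm_compose_le) simp_all
 then have S1: "norm S < 1" by simp
 obtain \<phi> where phi: "small_calculus S \<phi>" using small_calculus_exists[OF S S1] .
 note cc = small_calculusD[OF phi]
 (* g starts at - e / 2, so that it can be divided out below - e. *)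
 define d where "d = e / 2"
 have d: "0 < d" "e - d = d" using e by (simp_all add: d_def)
 define g where "g = (\<lambda>x. max 0 (- x - d) * cut 2 x)"
 have gcont: "continuous_on UNIV g" unfolding g_def by (intro continuous_intros)
 have gC: "cr g \<in> Cc" unfolding g_def by (intro cut_Cc continuous_intros)
 have g0: "0 \<le> g x" "g x \<le> 3" "x < - d \<and> \<bar>x\<bar> < 3 \<or> g x = 0" for x
 proof -
  show "0 \<le> g x" by (simp add: g_def)
  show A: "x < - d \<and> \<bar>x\<bar> < 3 \<or> g x = 0" using cut_eq_0[of 2 x] by (cases "\<bar>x\<bar> < 3") (auto simp: g_def max_def)
  show "g x \<le> 3"
  proof (cases "g x = 0")
   case False
   then have "max 0 (- x - d) * cut 2 x \<le> 3 * 1" using A d by (intro mult_mono) auto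
   then show ?thesis by (simp add: g_def)
  qed simp
 qed
 define G where "G = \<phi> (cr g)"
 have GE: "G \<in> End_star E" unfolding G_def by (rule C0_hom_End[OF cc(1) Cc_C0[OF gC]])
 have Gd: "G\<^sup>* = G"
  using C0_hom_adjoint[OF cc(1) Cc_C0[OF gC]] by (auto simp: G_def intro: dag_eqI)
 have G3: "norm G \<le> 3" unfolding G_def
  by (rule cc(2)[OF Cc_C0[OF gC]]) (use g0 in \<open>simp add: abs_of_nonneg\<close>)
 define c where "c = T \<cdot> G"
 have cE: "c \<in> End_star E" using T GE by (simp add: c_def)
 have "norm c \<le> 1 / 4 * 3" unfolding c_def by (intro norm_compose_le T G3)
 then have c1: "norm c < 1" by simp
 let ?v = "\<lambda>x. x * (g x)\<^sup>2"
 have tgC: "(\<lambda>x. of_real x * cr g x) \<in> Cc" by (rule Cc_mult_left[OF gC]) (intro continuous_intros)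
 have vC: "cr ?v \<in> Cc"
  using Cc_mult_right[OF tgC continuous_on_of_real[OF gcont]] by (simp add: power2_eq_square mult_ac)
 have v: "\<phi> (cr ?v) = c\<^sup>* \<cdot> c"
 proof -
  have "cr ?v = (\<lambda>x. cr g x * (of_real x * cr g x))" by (simp add: power2_eq_square mult_ac)
  then have "\<phi> (cr ?v) = G \<cdot> (S \<cdot> G)"
   using C0_hom_mult[OF cc(1) Cc_C0[OF gC] Cc_C0[OF tgC]] cc(3)[OF Cc_C0[OF gC] Cc_C0[OF tgC]] by (simp add: G_def)
  then show ?thesis using T GE Gd by (simp add: c_def S_def op_assoc)
 qed
 (* cut 2 is supported in [-3, 3], whence 0 \<le> g \<le> 3 and |x g(x)^2| \<le> 27. *)
 have vb: "- 27 \<le> ?v x" "?v x \<le> 0" for x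
 proof -
  have "(g x)\<^sup>2 \<le> 3\<^sup>2" using g0 by (intro power_mono) auto
  have "- ?v x \<le> 27 \<and> ?v x \<le> 0"
  proof (cases "g x = 0")
   case False
   then have x: "x < 0" "- x \<le> 3" using g0(3)[of x] d by auto
   then have "- x * (g x)\<^sup>2 \<le> 3 * 3\<^sup>2" by (intro mult_mono \<open>(g x)\<^sup>2 \<le> 3\<^sup>2\<close>) auto
   then show ?thesis using x by (simp add: mult_le_0_iff)
  qed simp
  then show "- 27 \<le> ?v x" "?v x \<le> 0" by simp_all
 qed
 have upper: "norm (s *\<^sub>R \<one> + c\<^sup>* \<cdot> c) \<le> s" if s: "27 \<le> s" for s
 proof -
  have C: "(\<lambda>x. of_real s * cr (cut 1) x + cr ?v x) \<in> C0" by (intro C0_add C0_scale cut_C0 Cc_C0 vC)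
  have "s *\<^sub>R \<one> + c\<^sup>* \<cdot> c = \<phi> (\<lambda>x. of_real s * cr (cut 1) x + cr ?v x)"
   unfolding C0_hom_add[OF cc(1) C0_scale[OF cut_C0] Cc_C0[OF vC]] C0_hom_scale[OF cc(1) cut_C0] cc(4) v
   by (simp add: scaleC_of_real)
  also have "norm \<dots> \<le> s"
  proof (rule cc(2)[OF C])
   fix x
   have "s * cut 1 x \<le> s * 1" using s by (intro mult_left_mono) auto
   moreover have "0 \<le> s * cut 1 x" using s by simp
   ultimately have "\<bar>s * cut 1 x + ?v x\<bar> \<le> s" using vb[of x] s by linarith
   then show "cmod (of_real s * cr (cut 1) x + cr ?v x) \<le> s"
    by (simp only: of_real_mult[symmetric] of_real_add[symmetric] norm_of_real)
  qed
  finally show ?thesis .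
 qed
 define X where "X = (1 / 2) *\<^sub>R (c + c\<^sup>*)"
 define Y where "Y = (- \<i> / 2) *\<^sub>C (c - c\<^sup>*)"
 have X: "X \<in> End_star E" "X\<^sup>* = X" using cE by (simp_all add: X_def add.commute)
 have Y: "Y \<in> End_star E" "Y\<^sup>* = Y"
  using cE by (simp_all add: Y_def scaleC_diff_right scaleC_minus_left)
 have X1: "norm X < 1" and Y1: "norm Y < 1"
  using norm_triangle_ineq[of c "c\<^sup>*"] norm_triangle_ineq4[of c "c\<^sup>*"] c1 cE
  by (simp_all add: X_def Y_def norm_scaleC norm_divide)
 (* c = X + \<i> Y, and c\<^sup>* c + c c\<^sup>* = 2 X^2 + 2 Y^2. *)
 have sum: "c\<^sup>* \<cdot> c = (X \<cdot> X + X \<cdot> X) + (Y \<cdot> Y + Y \<cdot> Y) + - (c \<cdot> c\<^sup>*)"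
 proof -
  have XX: "X \<cdot> X = (1 / 4) *\<^sub>R ((c + c\<^sup>*) \<cdot> (c + c\<^sup>*))"
   by (simp add: X_def op_scaleR)
  have "Y \<cdot> Y = (- \<i> / 2 * (- \<i> / 2)) *\<^sub>C ((c - c\<^sup>*) \<cdot> (c - c\<^sup>*))"
   by (simp only: Y_def scaleC_compose_left compose_scaleC_right scaleC_scaleC End_star_diff End_star_dag cE)
  also have "- \<i> / 2 * (- \<i> / 2) = complex_of_real (- (1 / 4))" by (simp add: complex_eq_iff)
  finally have YY: "Y \<cdot> Y = - ((1 / 4) *\<^sub>R ((c - c\<^sup>*) \<cdot> (c - c\<^sup>*)))" by (simp only: scaleC_of_real) simp
  have quarter: "(1 / 4) *\<^sub>R Z + (1 / 4) *\<^sub>R Z = (1 / 2) *\<^sub>R Z" for Z :: "'e endo"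
   by (simp flip: scaleR_add_left)
  have "(X \<cdot> X + X \<cdot> X) + (Y \<cdot> Y + Y \<cdot> Y)
    = (1 / 2) *\<^sub>R ((c + c\<^sup>*) \<cdot> (c + c\<^sup>*) - (c - c\<^sup>*) \<cdot> (c - c\<^sup>*))"
   unfolding XX YY minus_add_distrib[symmetric] quarter by (simp add: scaleR_diff_right)
  also have "(c + c\<^sup>*) \<cdot> (c + c\<^sup>*) - (c - c\<^sup>*) \<cdot> (c - c\<^sup>*) = 2 *\<^sub>R (c \<cdot> c\<^sup>* + c\<^sup>* \<cdot> c)"
   by (simp add: op_simps scaleR_2)
  finally show ?thesis by simp
 qed
 have "bounded_below (c\<^sup>* \<cdot> c) (0 + 0 + (0 + 0) + 0)"
  unfolding sum
  by (intro bounded_below_add bounded_below_square X Y X1 Y1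
    bounded_above_compose_dag[OF cE c1, of 27] upper) auto
 moreover have "bounded_below (- (c\<^sup>* \<cdot> c)) 0"
  unfolding bounded_below_def
 proof (intro allI impI exI[of _ 27])
  fix e t :: real assume "0 < e" "27 \<le> t"
  then show "norm (t *\<^sub>R \<one> - - (c\<^sup>* \<cdot> c)) \<le> t + 0 + e" using upper[of t] by simp
 qed
 ultimately have "norm (c\<^sup>* \<cdot> c) \<le> 0"
  using cE by (intro norm_le_if_bounded_below) simp_all
 then have v0: "\<phi> (cr ?v) = 0" using v by simp
 let ?f = "\<lambda>x. min (x + e) 0 * cut 1 x"
 have fC: "cr ?f \<in> C0" by (intro Cc_C0 cut_Cc continuous_intros)
 have "\<phi> (cr ?f) = 0"
 proof -
  (* On the support of f this is f / v; the minimum and the maximum keep the denominator away from 0 elsewhere. *)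
  let ?k = "\<lambda>x. min (x + e) 0 / (min x (- e) * (max d (- x - d))\<^sup>2) * cut 1 x"
  have kC: "cr ?k \<in> C0"
  proof (intro Cc_C0 cut_Cc continuous_on_divide continuous_intros ballI)
   fix x
   have "min x (- e) < 0" "0 < max d (- x - d)" using e d by auto
   then show "min x (- e) * (max d (- x - d))\<^sup>2 \<noteq> 0" by auto
  qed
  have fk: "?f x = ?v x * ?k x" for x
  proof (cases "x < - e \<and> \<bar>x\<bar> < 2")
   case True
   then have "g x = - x - d" using d cut_eq_1[of x 2] by (auto simp: g_def max_def)
   moreover have "max d (- x - d) = - x - d" "min x (- e) = x" using True d by (auto simp: max_def)
   moreover have "- x - d \<noteq> 0" "x \<noteq> 0" using True d e by auto
   ultimately show ?thesis by simp
  next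
   case False
   then have "min (x + e) 0 = 0 \<or> cut 1 x = 0" using cut_eq_0[of 1 x] by (auto simp: min_def)
   then show ?thesis
   proof
    assume "min (x + e) 0 = 0"
    then show ?thesis by (simp only: mult_zero_left mult_zero_right div_0)
   next
    assume "cut 1 x = 0"
    then show ?thesis by (simp only: mult_zero_left mult_zero_right)
   qed
  qed
  have "cr ?f = (\<lambda>x. cr ?v x * cr ?k x)"
   by (rule ext, subst fk) (rule of_real_mult)
  then show ?thesis using C0_hom_mult[OF cc(1) Cc_C0[OF vC] kC] v0 by simp
 qed
 note f0 = this
 let ?h = "\<lambda>x. (t - max x (- e)) * cut 1 x"
 have hC: "cr ?h \<in> C0" by (intro Cc_C0 cut_Cc continuous_intros)
 have "t *\<^sub>R \<one> - S = \<phi> (cr (\<lambda>x. (t + (-1) * x) * cut 1 x))"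
  using small_calculus_affine[OF phi, of t "-1"] by simp
 also have "cr (\<lambda>x. (t + (-1) * x) * cut 1 x) = (\<lambda>x. cr ?h x + (-1) * cr ?f x)"
  by (auto simp: max_def min_def algebra_simps)
 also have "\<phi> \<dots> = \<phi> (cr ?h)"
  by (simp only: C0_hom_add[OF cc(1) hC C0_scale[OF fC]] C0_hom_scale[OF cc(1) fC] f0) simp
 also have "norm \<dots> \<le> t + e"
 proof (rule cc(2)[OF hC])
  fix x
  have "\<bar>?h x\<bar> \<le> t + e"
  proof (cases "\<bar>x\<bar> \<ge> 2")
   case False
   then have "\<bar>t - max x (- e)\<bar> * cut 1 x \<le> (t + e) * 1" using t e by (intro mult_mono) auto
   then show ?thesis by (simp add: abs_mult)
  qed (use t e in \<open>simp add: cut_eq_0\<close>)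
  then show "cmod (cr ?h x) \<le> t + e" by (simp only: norm_of_real)
 qed
 finally show "norm (t *\<^sub>R \<one> - T\<^sup>* \<cdot> T) \<le> t + 0 + e" by (simp add: S_def)
qed

lemma bounded_below_dag_compose:
 assumes T: "T \<in> End_star E"
 shows "bounded_below (T\<^sup>* \<cdot> T) 0"
proof -
 define r where "r = 1 / (4 * norm T + 4)"
 have r: "0 < r" by (simp add: r_def add_nonneg_pos)
 have "norm (r *\<^sub>R T) = norm T / (4 * norm T + 4)" using r by (simp add: r_def)
 also have "\<dots> \<le> 1 / 4" using add_nonneg_pos[of "4 * norm T" 4] by (simp add: pos_divide_le_eq)
 finally have "norm (r *\<^sub>R T) \<le> 1 / 4" .
 then have "bounded_below ((r *\<^sub>R T)\<^sup>* \<cdot> (r *\<^sub>R T)) 0"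
  using T by (intro bounded_below_dag_compose_small) auto
 then have "bounded_below ((r * r) *\<^sub>R (T\<^sup>* \<cdot> T)) 0"
  using T by (simp add: op_scaleR)
 from bounded_below_scale[OF this, of "1 / (r * r)"] show ?thesis using r by simp
qed

end

subsection \<open>The Cauchy-Schwarz inequality in Hilbert modules\<close>

lemma star_scaleR: "star (r *\<^sub>R x) = r *\<^sub>R star (x :: 'a :: cstar_algebra)"
 by (simp add: scaleR_eq_scaleC star_scaleC)

definition self_module :: "('b :: cstar_algebra, 'b) hilbmod" where
 "self_module = \<lparr>act = (*), ip = (\<lambda>x y. star x * y)\<rparr>"

interpretation self_module: cauchy_schwarz_module self_module
proof
 fix x y :: 'a
 show "\<exists>b. ip self_module x x = star b * b" by (auto simp: self_module_def)
 show "norm x = sqrt (norm (ip self_module x x))" by (simp add: self_module_def cstar_identity)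
 show "norm (ip self_module x y) \<le> norm x * norm y"
  using norm_mult_ineq[of "star x" y] by (simp add: self_module_def)
qed (simp_all add: self_module_def distrib_left distrib_right mult.assoc scaleC_mult_left scaleC_mult_right
  star_mult star_star)

text \<open>
 Left multiplication embeds the algebra isometrically into the adjointable operators on itself, where \<open>T\<^sup>*T\<close> is known
 to be positive.
\<close>

lemma norm_square_le_norm_sum_squares:
 fixes b c :: "'b :: cstar_algebra"
 shows "norm (star b * b) \<le> norm (star b * b + star c * c)"
proof -
 let ?L = "blinfun_mult_right :: 'b \<Rightarrow> _"
 have adj: "is_adjoint self_module self_module (?L x) (?L (star x))" for x
  by (simp add: is_adjoint_def self_module_def star_mult mult.assoc)
 have LE: "?L x \<in> End_star self_module" for x by (rule Hom_starI[OF adj])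
 have Ld: "adj self_module self_module (?L x) = ?L (star x)" for x by (rule self_module.dag_eqI[OF adj])
 have Lm: "?L x \<cdot> ?L y = ?L (x * y)" for x y by (rule blinfun_eqI) (simp add: mult.assoc)
 have La: "?L (x + y) = ?L x + ?L y" for x y
  by (rule blinfun_eqI) (simp add: plus_blinfun.rep_eq distrib_right)
 have Ln: "norm (?L x) = norm x" for x
 proof (rule antisym)
  show "norm (?L x) \<le> norm x" by (rule norm_blinfun_bound) (simp_all add: norm_mult_ineq)
  have "norm x * norm x = norm (?L x (star x))"
   using cstar_identity[of "star x"] by (simp add: star_star power2_eq_square)
  also have "\<dots> \<le> norm (?L x) * norm x" using norm_blinfun[of "?L x" "star x"] by simp
  finally show "norm x \<le> norm (?L x)"
   by (cases "norm x = 0") auto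
 qed
 let ?p = "star b * b" and ?q = "star c * c"
 have pos: "self_module.bounded_below (?L (star x * x)) 0" for x
  using self_module.bounded_below_dag_compose[OF LE, of x] by (simp add: Ld Lm)
 have "norm (?L ?p) \<le> norm (?p + ?q)"
 proof (rule self_module.norm_le_if_bounded_below)
  show "self_module.bounded_below (?L ?p) (norm (?p + ?q))"
   by (rule self_module.bounded_below_mono[OF pos]) simp
  have "self_module.bounded_below (?L ?q + - ?L (?p + ?q)) (0 + norm (- ?L (?p + ?q)))"
   by (intro self_module.bounded_below_add pos self_module.bounded_below_norm)
  then show "self_module.bounded_below (- ?L ?p) (norm (?p + ?q))"
   by (simp only: norm_minus_cancel Ln add_0) (simp add: La)
 qed (simp_all add: LE Ld star_mult star_star)
 then show ?thesis by (simp add: Ln)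
qed

context hilbert_module
begin

lemma norm_ip_self_le_add: "norm (ip E x x) \<le> norm (ip E x x + ip E y y)"
 using norm_square_le_norm_sum_squares ip_pos[of x] ip_pos[of y] by metis

text \<open>
 For \<open>\<parallel>x\<parallel> = 1\<close> and \<open>b = \<langle>x, y\<rangle>\<close>, positivity of the inner product of \<open>y - x b\<close> with itself bounds
 \<open>2 b\<^sup>*b\<close> by \<open>\<langle>y, y\<rangle> + b\<^sup>*\<langle>x, x\<rangle>b\<close>, whose norm is at most \<open>\<parallel>y\<parallel>\<^sup>2 + \<parallel>b\<parallel>\<^sup>2\<close>.
\<close>

lemma cauchy_schwarz_unit:
 assumes "norm x = 1" shows "norm (ip E x y) \<le> norm y"
proof -
 define b where "b = ip E x y"
 define z where "z = y - act E x b"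
 have zz: "ip E z z = ip E y y - star b * b - star b * b + star b * ip E x x * b"
  by (simp add: z_def ip_diff_left ip_diff_right ip_act_left ip_act_right b_def mult.assoc)
   (simp add: ip_star[of y x] algebra_simps)
 obtain c where c: "ip E z z = star c * c" using ip_pos by blast
 let ?b = "complex_of_real (sqrt 2) *\<^sub>C b"
 have bb: "star ?b * ?b = star b * b + star b * b"
  by (simp add: scaleC_of_real star_scaleR flip: scaleR_2)
 have "2 * (norm b)\<^sup>2 = norm (2 *\<^sub>R (star b * b))" by (simp add: cstar_identity)
 also have "\<dots> = norm (star ?b * ?b)" by (simp only: bb scaleR_2)
 also have "\<dots> \<le> norm (star ?b * ?b + star c * c)" by (rule norm_square_le_norm_sum_squares)
 also have "star ?b * ?b + star c * c = ip E y y + star b * ip E x x * b"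
  unfolding bb c[symmetric] zz by simp
 also have "norm \<dots> \<le> (norm y)\<^sup>2 + norm b * 1 * norm b"
 proof (intro order_trans[OF norm_triangle_ineq] add_mono)
  show "norm (ip E y y) \<le> (norm y)\<^sup>2" by (simp add: norm_ip_self)
  have "norm (star b * ip E x x * b) \<le> norm (star b) * norm (ip E x x) * norm b"
   by (meson mult_right_mono norm_ge_zero norm_mult_ineq order_trans)
  then show "norm (star b * ip E x x * b) \<le> norm b * 1 * norm b" using assms by (simp add: norm_ip_self)
 qed
 finally have "(norm b)\<^sup>2 \<le> (norm y)\<^sup>2" by (simp add: power2_eq_square)
 then show ?thesis unfolding b_def by (rule power2_le_imp_le) simp
qed

lemma cauchy_schwarz_module: "cauchy_schwarz_module E"
proof
 fix x y
 show "norm (ip E x y) \<le> norm x * norm y"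
 proof (cases "x = 0")
  case False
  then have "norm (ip E ((1 / norm x) *\<^sub>R x) y) \<le> norm y" by (intro cauchy_schwarz_unit) simp
  then show ?thesis using False by (simp add: ip_scaleR_left divide_simps mult.commute)
 qed simp
qed

end

sublocale hilbert_module \<subseteq> cauchy_schwarz_module
 by (rule cauchy_schwarz_module)

section \<open>Calculus of bounded continuous functions\<close>

subsection \<open>Contractivity\<close>

context hilbert_module
begin

text \<open>
 For \<open>|f| \<le> M\<close> the function \<open>h = M - (M\<^sup>2 - |f|\<^sup>2)\<^sup>1\<^sup>/\<^sup>2\<close> belongs to \<open>C\<^sub>0\<close>, and \<open>(M - \<phi>(h))\<^sup>2 = M\<^sup>2 - \<phi>(|f|\<^sup>2)\<close>.
\<close>

lemma C0_hom_contractive: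
 assumes hom: "C0_hom E \<phi>" and f: "f \<in> C0" and M: "\<And>t. cmod (f t) \<le> M"
 shows "norm (\<phi> f) \<le> M"
proof -
 have M0: "0 \<le> M" using order_trans[OF norm_ge_zero M] .
 define h where "h t = M - sqrt (M\<^sup>2 - (cmod (f t))\<^sup>2)" for t
 have le: "(cmod (f t))\<^sup>2 \<le> M\<^sup>2" for t using M by (intro power_mono) auto
 have hh: "2 * M * h t - (h t)\<^sup>2 = (cmod (f t))\<^sup>2" for t
  using le[of t] by (simp add: h_def power2_diff right_diff_distrib) (simp add: power2_eq_square)
 have hC: "cr h \<in> C0"
 proof -
  have "((\<lambda>t. M - sqrt (M\<^sup>2 - (cmod (f t))\<^sup>2)) \<longlongrightarrow> M - sqrt (M\<^sup>2 - (cmod 0)\<^sup>2)) at_infinity"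
   using f by (intro tendsto_intros) (simp add: C0_def)
  then have "(h \<longlongrightarrow> 0) at_infinity" using M0 by (simp add: h_def[abs_def])
  then have "((\<lambda>t. complex_of_real (h t)) \<longlongrightarrow> complex_of_real 0) at_infinity" by (rule tendsto_of_real)
  moreover have "continuous_on UNIV (\<lambda>t. complex_of_real (h t))"
   unfolding h_def using C0_cont[OF f] by (intro continuous_intros)
  ultimately show ?thesis by (simp add: C0_def)
 qed
 define T where "T = M *\<^sub>R \<one> - \<phi> (cr h)"
 have phE: "\<phi> (cr h) \<in> End_star E" "\<phi> f \<in> End_star E" by (intro C0_hom_End[OF hom] hC f)+
 have "(\<phi> (cr h))\<^sup>* = \<phi> (cr h)" using C0_hom_adjoint[OF hom hC] by (intro dag_eqI) simp
 then have TE: "T \<in> End_star E" "T\<^sup>* = T" using phE by (simp_all add: T_def)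
 have fd: "(\<phi> f)\<^sup>* = \<phi> (\<lambda>t. cnj (f t))" using C0_hom_adjoint[OF hom f] by (rule dag_eqI)
 have two: "(2 * M) *\<^sub>R \<phi> (cr h) = M *\<^sub>R \<phi> (cr h) + M *\<^sub>R \<phi> (cr h)"
  by (simp flip: scaleR_add_left)
 have "(\<phi> f)\<^sup>* \<cdot> \<phi> f = \<phi> (\<lambda>t. cnj (f t) * f t)"
  by (simp only: fd C0_hom_mult[OF hom C0_cnj[OF f] f])
 also have "(\<lambda>t. cnj (f t) * f t) = (\<lambda>t. of_real (2 * M) * cr h t + (-1) * (cr h t * cr h t))"
 proof
  fix t
  have "of_real (2 * M * h t - (h t)\<^sup>2) = f t * cnj (f t)"
   unfolding hh by (rule complex_norm_square)
  then have "cnj (f t) * f t = of_real (2 * M * h t - (h t)\<^sup>2)"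
   by (simp only: mult.commute)
  then show "cnj (f t) * f t = of_real (2 * M) * cr h t + (-1) * (cr h t * cr h t)"
   by (simp add: power2_eq_square)
 qed
 also have "\<phi> \<dots> = of_real (2 * M) *\<^sub>C \<phi> (cr h) + (-1) *\<^sub>C (\<phi> (cr h) \<cdot> \<phi> (cr h))"
  by (simp only: C0_hom_add[OF hom C0_scale[OF hC] C0_scale[OF C0_mult[OF hC hC]]]
    C0_hom_scale[OF hom hC] C0_hom_scale[OF hom C0_mult[OF hC hC]] C0_hom_mult[OF hom hC hC])
 also have "\<dots> = (2 * M) *\<^sub>R \<phi> (cr h) - \<phi> (cr h) \<cdot> \<phi> (cr h)"
  by (simp only: scaleC_of_real) (simp add: scaleC_minus_left)
 finally have "(\<phi> f)\<^sup>* \<cdot> \<phi> f + T \<cdot> T = (M * M) *\<^sub>R \<one>"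
  unfolding two
  by (simp add: T_def op_simps op_scaleR scaleR_diff_right)
 then have sum: "((\<phi> f)\<^sup>* \<cdot> \<phi> f + T \<cdot> T) x = (M * M) *\<^sub>R x" for x
  by (simp add: scaleR_blinfun.rep_eq)
 show ?thesis
 proof (rule norm_blinfun_bound[OF M0])
  fix x
  have "(norm (\<phi> f x))\<^sup>2
    \<le> norm (ip E (\<phi> f x) (\<phi> f x) + ip E (T x) (T x))"
   unfolding norm_ip_self[symmetric] by (rule norm_ip_self_le_add)
  also have "ip E (\<phi> f x) (\<phi> f x) + ip E (T x) (T x)
    = ip E x (((\<phi> f)\<^sup>* \<cdot> \<phi> f + T \<cdot> T) x)"
   by (simp add: ip_dag phE TE plus_blinfun.rep_eq ip_add_right)
  also have "norm \<dots> = (M * norm x)\<^sup>2"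
   unfolding sum ip_scaleR_right norm_scaleR norm_ip_self power_mult_distrib power2_eq_square[of M] by simp
  finally show "norm (\<phi> f x) \<le> M * norm x"
   by (rule power2_le_imp_le) (simp add: M0)
 qed
qed

end

subsection \<open>Extension to bounded functions\<close>

definition Cb :: "(real \<Rightarrow> complex) set" where
 "Cb = {f. continuous_on UNIV f \<and> (\<exists>B. \<forall>t. cmod (f t) \<le> B)}"

lemma CbI: "continuous_on UNIV f \<Longrightarrow> (\<And>t. cmod (f t) \<le> B) \<Longrightarrow> f \<in> Cb"
 by (auto simp: Cb_def)

lemma Cb_cont: "f \<in> Cb \<Longrightarrow> continuous_on UNIV f"
 by (simp add: Cb_def)

lemma Cb_bounded: "f \<in> Cb \<Longrightarrow> \<exists>B\<ge>0. \<forall>t. cmod (f t) \<le> B"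
 unfolding Cb_def using order_trans[OF norm_ge_zero] by blast

lemma C0_Cb: "f \<in> C0 \<Longrightarrow> f \<in> Cb"
 using C0_bounded[of f] C0_cont[of f] by (auto simp: Cb_def)

lemma Cc_Cb: "f \<in> Cc \<Longrightarrow> f \<in> Cb"
 by (intro C0_Cb Cc_C0)

lemma Cb_const [simp]: "(\<lambda>_. c) \<in> Cb"
 by (rule CbI[of _ "cmod c"]) auto

lemma Cb_add [intro]: "f \<in> Cb \<Longrightarrow> g \<in> Cb \<Longrightarrow> (\<lambda>t. f t + g t) \<in> Cb"
proof -
 assume fg: "f \<in> Cb" "g \<in> Cb"
 then obtain A B where "\<And>t. cmod (f t) \<le> A" "\<And>t. cmod (g t) \<le> B" unfolding Cb_def by blast
 then show ?thesis
  using fg by (intro CbI[of _ "A + B"] continuous_intros norm_triangle_mono) (auto simp: Cb_def)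
qed

lemma Cb_mult [intro]:
 assumes "f \<in> Cb" "g \<in> Cb" shows "(\<lambda>t. f t * g t) \<in> Cb"
proof -
 obtain A B where "0 \<le> A" "\<And>t. cmod (f t) \<le> A" "0 \<le> B" "\<And>t. cmod (g t) \<le> B"
  using Cb_bounded[OF assms(1)] Cb_bounded[OF assms(2)] by blast
 then show ?thesis
  using assms by (intro CbI[of _ "A * B"]) (auto simp: norm_mult Cb_cont intro!: continuous_intros mult_mono)
qed

lemma Cb_diff [intro]: "f \<in> Cb \<Longrightarrow> g \<in> Cb \<Longrightarrow> (\<lambda>t. f t - g t) \<in> Cb"
 using Cb_add[of f "\<lambda>t. (-1) * g t"] by (simp add: Cb_mult[of "\<lambda>_. -1" g, simplified])

lemma Cb_cnj [intro]: "f \<in> Cb \<Longrightarrow> (\<lambda>t. cnj (f t)) \<in> Cb"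
 by (auto simp: Cb_def intro!: continuous_intros)

lemma C0_mult_Cb: "f \<in> C0 \<Longrightarrow> g \<in> Cb \<Longrightarrow> (\<lambda>t. f t * g t) \<in> C0"
 using C0_mult_bounded unfolding Cb_def by blast

lemma C0_mult_Cb': "f \<in> C0 \<Longrightarrow> g \<in> Cb \<Longrightarrow> (\<lambda>t. g t * f t) \<in> C0"
 using C0_mult_Cb[of f g] by (simp add: mult.commute)

lemma Cc_cut: "cr (cut a) \<in> Cc"
 using cut_Cc[of "\<lambda>_. 1" a] by simp

lemma bounded_strongly_convergent:
 fixes T :: "nat \<Rightarrow> 'e :: real_normed_vector \<Rightarrow>\<^sub>L 'f :: banach"
 assumes M: "\<And>n. norm (T n) \<le> M"
  and dense: "\<And>x e. 0 < e \<Longrightarrow> \<exists>y. norm (x - y) < e \<and> convergent (\<lambda>n. T n y)"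
 shows "convergent (\<lambda>n. T n x)"
proof -
 have M0: "0 \<le> M" using order_trans[OF norm_ge_zero M] .
 have "Cauchy (\<lambda>n. T n x)"
  unfolding Cauchy_def
 proof (intro allI impI)
  fix e :: real assume e: "0 < e"
  define d where "d = e / (3 * (M + 1))"
  have d: "0 < d" "M * d \<le> e / 3"
  proof -
   show "0 < d" using e M0 by (simp add: d_def)
   have "M * d \<le> (M + 1) * d" using \<open>0 < d\<close> by (intro mult_right_mono) auto
   also have "\<dots> = e / 3" using M0 by (simp add: d_def field_simps)
   finally show "M * d \<le> e / 3" .
  qed
  obtain y where y: "norm (x - y) < d" "convergent (\<lambda>n. T n y)" using dense d by blast
  obtain N where N: "\<And>m n. m \<ge> N \<Longrightarrow> n \<ge> N \<Longrightarrow> dist (T m y) (T n y) < e / 3"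
   using convergent_Cauchy[OF y(2)] e unfolding Cauchy_def by (metis divide_pos_pos zero_less_numeral)
  have near: "norm (T n (x - y)) \<le> e / 3" for n
  proof -
   have "norm (T n (x - y)) \<le> norm (T n) * norm (x - y)" by (rule norm_blinfun)
   also have "\<dots> \<le> M * d" using M y M0 by (intro mult_mono) auto
   finally show ?thesis using d by simp
  qed
  show "\<exists>N. \<forall>m\<ge>N. \<forall>n\<ge>N. dist (T m x) (T n x) < e"
  proof (intro exI allI impI)
   fix m n assume mn: "N \<le> m" "N \<le> n"
   have "T m x - T n x = T m (x - y)
     + (T m y - T n y) - T n (x - y)"
    by (simp add: blinfun.diff_right)
   also have "norm \<dots> \<le> norm (T m (x - y))
     + norm (T m y - T n y) + norm (T n (x - y))"
    by (intro order_trans[OF norm_triangle_ineq4] add_right_mono norm_triangle_ineq)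
   also have "\<dots> < e" using near[of m] near[of n] N[OF mn] by (simp add: dist_norm)
   finally show "dist (T m x) (T n x) < e" by (simp add: dist_norm)
  qed
 qed
 then show ?thesis by (simp add: Cauchy_convergent_iff)
qed

definition nondegenerate :: "('e :: real_normed_vector) calculus \<Rightarrow> bool" where
 "nondegenerate \<phi> \<longleftrightarrow> (\<forall>x. (\<lambda>n. blinfun_apply (\<phi> (cr (cut (real n)))) x) \<longlonglongrightarrow> x)"

lemma nondegenerate_eqI:
 assumes nd: "nondegenerate \<phi>" and eq: "\<And>g. g \<in> Cc \<Longrightarrow> R \<cdot> \<phi> g = S \<cdot> \<phi> g"
 shows "R = S"
proof (rule blinfun_eqI)
 fix x
 have x: "(\<lambda>n. \<phi> (cr (cut (real n))) x) \<longlonglongrightarrow> x" using nd by (simp add: nondegenerate_def)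
 have "(\<lambda>n. R (\<phi> (cr (cut (real n))) x)) \<longlonglongrightarrow> R x"
  "(\<lambda>n. S (\<phi> (cr (cut (real n))) x)) \<longlonglongrightarrow> S x"
  by (intro tendsto_intros x)+
 moreover have "R (\<phi> g x) = S (\<phi> g x)" if "g \<in> Cc" for g
  using arg_cong[OF eq[OF that], of "\<lambda>T. T x"] by simp
 ultimately show "R x = S x"
  using LIMSEQ_unique by (simp add: Cc_cut)
qed

lemma nondegenerate_eqI':
 assumes nd: "nondegenerate \<phi>" and eq: "\<And>g. g \<in> Cc \<Longrightarrow> \<phi> g x = \<phi> g y"
 shows "x = y"
 by (rule LIMSEQ_unique[of "\<lambda>n. \<phi> (cr (cut (real n))) x"])
  (use nd in \<open>simp_all add: nondegenerate_def\<close>, simp add: eq[OF Cc_cut])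

locale bounded_calculus = hilbert_module E
 for E :: "('e :: {complex_normed_vector, banach}, 'b :: cstar_algebra) hilbmod" +
 fixes \<Phi> :: "'e calculus"
 assumes calc_add: "f \<in> Cb \<Longrightarrow> g \<in> Cb \<Longrightarrow> \<Phi> (\<lambda>t. f t + g t) = \<Phi> f + \<Phi> g"
  and calc_scale: "f \<in> Cb \<Longrightarrow> \<Phi> (\<lambda>t. c * f t) = c *\<^sub>C \<Phi> f"
  and calc_mult: "f \<in> Cb \<Longrightarrow> g \<in> Cb \<Longrightarrow> \<Phi> (\<lambda>t. f t * g t) = \<Phi> f \<cdot> \<Phi> g"
  and calc_adjoint: "f \<in> Cb \<Longrightarrow> is_adjoint E E (\<Phi> f) (\<Phi> (\<lambda>t. cnj (f t)))"
  and calc_one: "\<Phi> (\<lambda>_. 1) = \<one>"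
  and calc_norm_le: "f \<in> Cb \<Longrightarrow> (\<And>t. cmod (f t) \<le> M) \<Longrightarrow> norm (\<Phi> f) \<le> M"
  and calc_nondegenerate: "nondegenerate \<Phi>"

text \<open>The multiplier extension: \<open>f(D)\<close> is determined by the products \<open>f(D) g(D) = (f g)(D)\<close> with compactly supported \<open>g\<close>.\<close>

definition extend_calculus ::
 "('e :: {complex_normed_vector, banach}, 'b :: cstar_algebra) hilbmod \<Rightarrow>
  'e calculus \<Rightarrow> 'e calculus" where
 "extend_calculus E \<phi> f = (THE R. R \<in> End_star E \<and> (\<forall>g\<in>Cc. R \<cdot> \<phi> g = \<phi> (\<lambda>t. f t * g t)))"

context hilbert_module
begin

text \<open>
 \<open>f(D)\<close> is the strong limit of \<open>(f \<cdot> cut n)(D)\<close>; on a vector \<open>g(D) x\<close> with compactly supported \<open>g\<close> this sequence is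
 eventually constant.
\<close>

lemma extend_calculus_exists:
 assumes hom: "C0_hom E \<phi>" and nd: "nondegenerate \<phi>" and f: "f \<in> Cb" and B: "\<And>t. cmod (f t) \<le> B"
 shows "\<exists>R \<in> End_star E. norm R \<le> B \<and> (\<forall>g\<in>Cc. R \<cdot> \<phi> g = \<phi> (\<lambda>t. f t * g t))"
proof -
 define T where "T h n = \<phi> (\<lambda>t. h t * cr (cut (real n)) t)" for h n
 have hC: "(\<lambda>t. h t * cr (cut (real n)) t) \<in> C0" if "h \<in> Cb" for h n
  by (rule C0_mult_Cb'[OF Cc_C0[OF Cc_cut] that])
 have nT: "norm (T h n) \<le> B" if h: "h \<in> Cb" "\<And>t. cmod (h t) \<le> B" for h n
  unfolding T_def
 proof (rule C0_hom_contractive[OF hom hC[OF h(1)]])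
  fix t
  have "cmod (h t) * \<bar>cut (real n) t\<bar> \<le> B * 1"
   using h(2)[of t] order_trans[OF norm_ge_zero h(2)] by (intro mult_mono) auto
  then show "cmod (h t * cr (cut (real n)) t) \<le> B" by (simp add: norm_mult)
 qed
 have ev: "\<forall>\<^sub>F n in sequentially. T h n \<cdot> \<phi> g = \<phi> (\<lambda>t. h t * g t)" if h: "h \<in> Cb" and g: "g \<in> Cc" for h g
 proof -
  obtain R where R: "\<And>t. \<bar>t\<bar> > R \<Longrightarrow> g t = 0" using g by (auto simp: Cc_def)
  have "T h n \<cdot> \<phi> g = \<phi> (\<lambda>t. h t * g t)" if n: "nat \<lceil>R\<rceil> \<le> n" for n
  proof -
   have "h t * cr (cut (real n)) t * g t = h t * g t" for t
   proof (cases "\<bar>t\<bar> > R")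
    case False
    then have "\<bar>t\<bar> \<le> real n" using n by linarith
    then show ?thesis by (simp add: cut_eq_1)
   qed (simp add: R)
   then show ?thesis unfolding T_def by (simp only: C0_hom_mult[OF hom hC[OF h] Cc_C0[OF g], symmetric])
  qed
  then show ?thesis unfolding eventually_sequentially by blast
 qed
 have conv: "convergent (\<lambda>n. T h n x)" if h: "h \<in> Cb" "\<And>t. cmod (h t) \<le> B" for h x
 proof (rule bounded_strongly_convergent[OF nT[OF h]])
  fix x e assume e: "(0::real) < e"
  have "\<forall>\<^sub>F n in sequentially. dist (\<phi> (cr (cut (real n))) x) x < e"
   using nd e by (simp add: nondegenerate_def tendstoD)
  then obtain n where n: "dist (\<phi> (cr (cut (real n))) x) x < e"
   by (auto simp: eventually_sequentially)
  have "\<forall>\<^sub>F k in sequentially. T h k (\<phi> (cr (cut (real n))) x)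
    = \<phi> (\<lambda>t. h t * cr (cut (real n)) t) x"
   using ev[OF h(1) Cc_cut[of "real n"]]
   by (rule eventually_mono) (simp flip: blinfun_apply_blinfun_compose)
  then have "convergent (\<lambda>k. T h k (\<phi> (cr (cut (real n))) x))"
   by (rule convergentI[OF tendsto_eventually])
  then show "\<exists>y. norm (x - y) < e \<and> convergent (\<lambda>n. T h n y)"
   using n by (intro exI[of _ "\<phi> (cr (cut (real n))) x"])
    (simp add: dist_norm norm_minus_commute)
 qed
 have f': "(\<lambda>t. cnj (f t)) \<in> Cb" "\<And>t. cmod (cnj (f t)) \<le> B" using f B by auto
 have TE: "T f n \<in> End_star E" for n unfolding T_def by (rule C0_hom_End[OF hom hC[OF f]])
 have Td: "(T f n)\<^sup>* = T (\<lambda>t. cnj (f t)) n" for n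
  using C0_hom_adjoint[OF hom hC[OF f, of n]] by (intro dag_eqI) (simp add: T_def)
 obtain R where R: "R \<in> End_star E" "norm R \<le> B" "\<And>x. R x = lim (\<lambda>n. T f n x)"
 proof (rule strong_limit_adjointable[OF TE nT[OF f B]])
  show "(\<lambda>n. T f n x) \<longlonglongrightarrow> lim (\<lambda>n. T f n x)" for x
   using conv[OF f B] by (simp add: convergent_LIMSEQ_iff)
  show "(\<lambda>n. ((T f n)\<^sup>*) x) \<longlonglongrightarrow> lim (\<lambda>n. T (\<lambda>t. cnj (f t)) n x)" for x
   unfolding Td using conv[OF f'] by (simp add: convergent_LIMSEQ_iff)
 qed blast
 have "R \<cdot> \<phi> g = \<phi> (\<lambda>t. f t * g t)" if g: "g \<in> Cc" for g
 proof (rule blinfun_eqI)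
  fix x
  have "\<forall>\<^sub>F n in sequentially. T f n (\<phi> g x) = \<phi> (\<lambda>t. f t * g t) x"
   using ev[OF f g] by (rule eventually_mono) (simp flip: blinfun_apply_blinfun_compose)
  then have "(\<lambda>n. T f n (\<phi> g x)) \<longlonglongrightarrow> \<phi> (\<lambda>t. f t * g t) x"
   by (rule tendsto_eventually)
  then show "(R \<cdot> \<phi> g) x = \<phi> (\<lambda>t. f t * g t) x"
   by (simp add: R(3) limI)
 qed
 then show ?thesis using R by blast
qed

lemma extend_calculus_eqI:
 assumes nd: "nondegenerate \<phi>" and R: "R \<in> End_star E" "\<And>g. g \<in> Cc \<Longrightarrow> R \<cdot> \<phi> g = \<phi> (\<lambda>t. f t * g t)"
 shows "extend_calculus E \<phi> f = R"
 unfolding extend_calculus_def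
proof (rule the_equality)
 show "R \<in> End_star E \<and> (\<forall>g\<in>Cc. R \<cdot> \<phi> g = \<phi> (\<lambda>t. f t * g t))" using R by simp
 fix S assume S: "S \<in> End_star E \<and> (\<forall>g\<in>Cc. S \<cdot> \<phi> g = \<phi> (\<lambda>t. f t * g t))"
 show "S = R" by (rule nondegenerate_eqI[OF nd]) (simp add: S R(2))
qed

lemma extend_calculusD:
 assumes hom: "C0_hom E \<phi>" and nd: "nondegenerate \<phi>" and f: "f \<in> Cb"
 shows "extend_calculus E \<phi> f \<in> End_star E"
  and "g \<in> Cc \<Longrightarrow> extend_calculus E \<phi> f \<cdot> \<phi> g = \<phi> (\<lambda>t. f t * g t)"
  and "(\<And>t. cmod (f t) \<le> B) \<Longrightarrow> norm (extend_calculus E \<phi> f) \<le> B"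
proof -
 obtain C where C: "\<And>t. cmod (f t) \<le> C" using f Cb_bounded by blast
 obtain R where R: "R \<in> End_star E" "\<And>g. g \<in> Cc \<Longrightarrow> R \<cdot> \<phi> g = \<phi> (\<lambda>t. f t * g t)"
  using extend_calculus_exists[OF hom nd f C] by blast
 note eq = extend_calculus_eqI[OF nd R]
 show "extend_calculus E \<phi> f \<in> End_star E" "g \<in> Cc \<Longrightarrow> extend_calculus E \<phi> f \<cdot> \<phi> g = \<phi> (\<lambda>t. f t * g t)"
  using eq R by simp_all
 show "norm (extend_calculus E \<phi> f) \<le> B" if B: "\<And>t. cmod (f t) \<le> B"
 proof -
  obtain R where R: "R \<in> End_star E" "\<And>g. g \<in> Cc \<Longrightarrow> R \<cdot> \<phi> g = \<phi> (\<lambda>t. f t * g t)" "norm R \<le> B"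
   using extend_calculus_exists[OF hom nd f B] by blast
  show ?thesis using extend_calculus_eqI[OF nd R(1,2)] R(3) by simp
 qed
qed

lemma extend_calculus_C0:
 assumes hom: "C0_hom E \<phi>" and nd: "nondegenerate \<phi>" and f: "f \<in> C0"
 shows "extend_calculus E \<phi> f = \<phi> f"
 by (rule extend_calculus_eqI[OF nd C0_hom_End[OF hom f]]) (simp add: C0_hom_mult[OF hom f Cc_C0])

lemma bounded_calculus_extend:
 assumes hom: "C0_hom E \<phi>" and nd: "nondegenerate \<phi>"
 shows "bounded_calculus E (extend_calculus E \<phi>)"
proof
 note D = extend_calculusD[OF hom nd]
 fix f g assume f: "f \<in> Cb" and g: "g \<in> Cb"
 have c: "(\<lambda>t. h t * k t) \<in> Cc" if "h \<in> Cb" "k \<in> Cc" for h k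
  using Cc_mult_left[OF that(2) Cb_cont[OF that(1)]] .
 show "extend_calculus E \<phi> (\<lambda>t. f t + g t) = extend_calculus E \<phi> f + extend_calculus E \<phi> g"
 proof (rule extend_calculus_eqI[OF nd])
  fix k assume k: "k \<in> Cc"
  have "(\<lambda>t. (f t + g t) * k t) = (\<lambda>t. f t * k t + g t * k t)" by (auto simp: distrib_right)
  then show "(extend_calculus E \<phi> f + extend_calculus E \<phi> g) \<cdot> \<phi> k = \<phi> (\<lambda>t. (f t + g t) * k t)"
   using C0_hom_add[OF hom Cc_C0[OF c[OF f k]] Cc_C0[OF c[OF g k]]]
   by (simp add: op_simps D(2)[OF f k] D(2)[OF g k])
 qed (intro End_star_add D f g)
 show "extend_calculus E \<phi> (\<lambda>t. f t * g t) = extend_calculus E \<phi> f \<cdot> extend_calculus E \<phi> g"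
 proof (rule extend_calculus_eqI[OF nd])
  fix k assume k: "k \<in> Cc"
  show "extend_calculus E \<phi> f \<cdot> extend_calculus E \<phi> g \<cdot> \<phi> k = \<phi> (\<lambda>t. f t * g t * k t)"
   using D(2)[OF f c[OF g k]] by (simp add: op_assoc D(2)[OF g k] mult.assoc)
 qed (intro End_star_compose D f g)
next
 note D = extend_calculusD[OF hom nd]
 fix f :: "real \<Rightarrow> complex" and z assume f: "f \<in> Cb"
 have c: "(\<lambda>t. f t * k t) \<in> Cc" if "k \<in> Cc" for k
  using Cc_mult_left[OF that Cb_cont[OF f]] .
 show "extend_calculus E \<phi> (\<lambda>t. z * f t) = z *\<^sub>C extend_calculus E \<phi> f"
 proof (rule extend_calculus_eqI[OF nd])
  fix k assume k: "k \<in> Cc"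
  show "(z *\<^sub>C extend_calculus E \<phi> f) \<cdot> \<phi> k = \<phi> (\<lambda>t. z * f t * k t)"
   using C0_hom_scale[OF hom Cc_C0[OF c[OF k]], of z] by (simp add: scaleC_compose_left D(2)[OF f k] mult.assoc)
 qed (intro End_star_scaleC D f)
 show "is_adjoint E E (extend_calculus E \<phi> f) (extend_calculus E \<phi> (\<lambda>t. cnj (f t)))"
  unfolding is_adjoint_def
 proof (intro allI)
  fix x y
  let ?R = "extend_calculus E \<phi> f" and ?S = "extend_calculus E \<phi> (\<lambda>t. cnj (f t))"
  let ?c = "\<lambda>n x. \<phi> (cr (cut (real n))) x"
  have lim: "(\<lambda>n. ?c n x) \<longlonglongrightarrow> x" for x using nd by (simp add: nondegenerate_def)
  have eq: "ip E (?R (?c n x)) (?c n y) = ip E (?c n x) (?S (?c n y))" for n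
  proof -
   let ?g = "cr (cut (real n))"
   have fg: "(\<lambda>t. f t * ?g t) \<in> Cc" "(\<lambda>t. cnj (f t) * ?g t) \<in> Cc"
    by (rule Cc_mult_left[OF Cc_cut Cb_cont[OF f]] Cc_mult_left[OF Cc_cut Cb_cont[OF Cb_cnj[OF f]]])+
   have "ip E (?R (?c n x)) (?c n y)
     = ip E ((?R \<cdot> \<phi> ?g) x) (?c n y)" by simp
   also have "\<dots> = ip E x ((\<phi> (\<lambda>t. cnj (f t * ?g t)) \<cdot> \<phi> ?g) y)"
    using is_adjointD[OF C0_hom_adjoint[OF hom Cc_C0[OF fg(1)]]] by (simp only: D(2)[OF f Cc_cut]) simp
   also have "\<phi> (\<lambda>t. cnj (f t * ?g t)) \<cdot> \<phi> ?g = \<phi> (\<lambda>t. cnj (f t * ?g t) * ?g t)"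
    by (rule C0_hom_mult[OF hom C0_cnj[OF Cc_C0[OF fg(1)]] Cc_C0[OF Cc_cut], symmetric])
   also have "(\<lambda>t. cnj (f t * ?g t) * ?g t) = (\<lambda>t. cnj (?g t) * (cnj (f t) * ?g t))"
    by (auto simp: mult_ac)
   also have "\<phi> \<dots> = \<phi> (\<lambda>t. cnj (?g t)) \<cdot> \<phi> (\<lambda>t. cnj (f t) * ?g t)"
    by (rule C0_hom_mult[OF hom C0_cnj[OF Cc_C0[OF Cc_cut]] Cc_C0[OF fg(2)]])
   also have "ip E x (\<dots> y) = ip E (?c n x) (\<phi> (\<lambda>t. cnj (f t) * ?g t) y)"
    using is_adjointD[OF C0_hom_adjoint[OF hom Cc_C0[OF Cc_cut]]] by simp
   also have "\<dots> = ip E (?c n x) (?S (?c n y))"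
    by (simp flip: D(2)[OF Cb_cnj[OF f] Cc_cut])
   finally show ?thesis .
  qed
  have "(\<lambda>n. ip E (?R (?c n x)) (?c n y)) \<longlonglongrightarrow> ip E (?R x) y"
   by (intro tendsto_intros lim)
  moreover have "(\<lambda>n. ip E (?c n x) (?S (?c n y))) \<longlonglongrightarrow> ip E x (?S y)"
   by (intro tendsto_intros lim)
  ultimately show "ip E (?R x) y = ip E x (?S y)"
   unfolding eq by (rule LIMSEQ_unique)
 qed
 show "norm (extend_calculus E \<phi> f) \<le> M" if "\<And>t. cmod (f t) \<le> M" for M
  by (rule D(3)[OF f that])
next
 show "extend_calculus E \<phi> (\<lambda>_. 1) = \<one>"
  by (rule extend_calculus_eqI[OF nd]) simp_all
 show "nondegenerate (extend_calculus E \<phi>)"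
  using nd by (simp add: nondegenerate_def extend_calculus_C0[OF hom nd Cc_C0[OF Cc_cut]])
qed

end

subsection \<open>Elementary properties\<close>

context bounded_calculus
begin

lemma calc_End [simp, intro]: "f \<in> Cb \<Longrightarrow> \<Phi> f \<in> End_star E"
 using calc_adjoint by (rule Hom_starI)

lemma calc_dag: "f \<in> Cb \<Longrightarrow> (\<Phi> f)\<^sup>* = \<Phi> (\<lambda>t. cnj (f t))"
 by (rule dag_eqI[OF calc_adjoint])

lemma calc_dag_real: "cr f \<in> Cb \<Longrightarrow> (\<Phi> (cr f))\<^sup>* = \<Phi> (cr f)"
 using calc_dag[of "cr f"] by simp

lemma calc_diff: "f \<in> Cb \<Longrightarrow> g \<in> Cb \<Longrightarrow> \<Phi> (\<lambda>t. f t - g t) = \<Phi> f - \<Phi> g"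
proof -
 assume f: "f \<in> Cb" and g: "g \<in> Cb"
 have "(\<lambda>t. (-1) * g t) \<in> Cb" using Cb_mult[OF Cb_const[of "-1"] g] .
 then have "\<Phi> (\<lambda>t. f t + (-1) * g t) = \<Phi> f + (-1) *\<^sub>C \<Phi> g"
  by (simp only: calc_add[OF f] calc_scale[OF g])
 then show ?thesis by (simp add: scaleC_minus_left)
qed

lemma calc_commute: "f \<in> Cb \<Longrightarrow> g \<in> Cb \<Longrightarrow> \<Phi> f \<cdot> \<Phi> g = \<Phi> g \<cdot> \<Phi> f"
 using calc_mult[of f g] calc_mult[of g f] by (simp add: mult.commute)

text \<open>Bounded, locally uniform convergence of functions gives strong convergence of operators.\<close>

lemma calc_strong_limit:
 assumes F: "\<And>n. F n \<in> Cb" and f: "f \<in> Cb" and B: "\<And>n t. cmod (F n t) \<le> B"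
  and lim: "\<And>R e. 0 < e \<Longrightarrow> \<exists>N. \<forall>n\<ge>N. \<forall>t. \<bar>t\<bar> \<le> R \<longrightarrow> cmod (F n t - f t) \<le> e"
 shows "(\<lambda>n. \<Phi> (F n) x) \<longlonglongrightarrow> \<Phi> f x"
proof -
 have B0: "0 \<le> B" using order_trans[OF norm_ge_zero B] .
 obtain A where A: "\<And>t. cmod (f t) \<le> A" "0 \<le> A" using Cb_bounded[OF f] by blast
 have d: "(\<lambda>t. F n t - f t) \<in> Cb" for n using F f by blast
 have nd: "norm (\<Phi> (\<lambda>t. F n t - f t)) \<le> A + B" for n
  by (rule calc_norm_le[OF d]) (smt (verit) A B norm_triangle_ineq4)
 have "(\<lambda>n. \<Phi> (\<lambda>t. F n t - f t) x) \<longlonglongrightarrow> 0"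
 proof (rule LIMSEQ_I)
  fix e :: real assume e: "0 < e"
  define K where "K = A + B + 1"
  have K: "0 < K" "A + B < K" using A(2) B0 by (simp_all add: K_def)
  define c where "c = e / (2 * K)"
  have c: "0 < c" "(A + B) * c < e / 2"
  proof -
   show "0 < c" using e K by (simp add: c_def)
   have "(A + B) * c < K * c" using \<open>0 < c\<close> K by (intro mult_strict_right_mono)
   also have "\<dots> = e / 2" using K by (simp add: c_def)
   finally show "(A + B) * c < e / 2" .
  qed
  have "\<forall>\<^sub>F n in sequentially. dist (\<Phi> (cr (cut (real n))) x) x < c"
   using calc_nondegenerate c by (simp add: nondegenerate_def tendstoD)
  then obtain m where m: "dist (\<Phi> (cr (cut (real m))) x) x < c"
   by (auto simp: eventually_sequentially)
  let ?y = "\<Phi> (cr (cut (real m))) x"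
  define L where "L = norm x + 1"
  have L: "0 < L" "norm x < L" by (simp_all add: L_def add_nonneg_pos)
  define c' where "c' = e / (2 * L)"
  have c': "0 < c'" "c' * norm x < e / 2"
  proof -
   show "0 < c'" using e L by (simp add: c'_def)
   have "c' * norm x < c' * L" using \<open>0 < c'\<close> L by (intro mult_strict_left_mono)
   also have "\<dots> = e / 2" using L by (simp add: c'_def)
   finally show "c' * norm x < e / 2" .
  qed
  obtain N where N: "\<And>n t. n \<ge> N \<Longrightarrow> \<bar>t\<bar> \<le> real m + 1 \<Longrightarrow> cmod (F n t - f t) \<le> c'" using lim c' by meson
  have "norm (\<Phi> (\<lambda>t. F n t - f t) x) < e" if n: "n \<ge> N" for n
  proof -
   have "\<Phi> (\<lambda>t. F n t - f t) x = \<Phi> (\<lambda>t. F n t - f t) (x - ?y)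
     + \<Phi> (\<lambda>t. (F n t - f t) * cr (cut (real m)) t) x"
    by (simp add: calc_mult[OF d Cc_Cb[OF Cc_cut]] blinfun.diff_right)
   also have "norm \<dots> \<le> (A + B) * c + c' * norm x"
   proof (intro order_trans[OF norm_triangle_ineq] add_mono)
    have "norm (\<Phi> (\<lambda>t. F n t - f t) (x - ?y)) \<le> norm (\<Phi> (\<lambda>t. F n t - f t)) * norm (x - ?y)"
     by (rule norm_blinfun)
    also have "\<dots> \<le> (A + B) * c"
     using nd m A B0 by (intro mult_mono) (auto simp: dist_norm norm_minus_commute)
    finally show "norm (\<Phi> (\<lambda>t. F n t - f t) (x - ?y)) \<le> (A + B) * c" .
    have "norm (\<Phi> (\<lambda>t. (F n t - f t) * cr (cut (real m)) t)) \<le> c'"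
    proof (rule calc_norm_le[OF Cb_mult[OF d Cc_Cb[OF Cc_cut]]])
     fix t
     show "cmod ((F n t - f t) * cr (cut (real m)) t) \<le> c'"
     proof (cases "\<bar>t\<bar> \<le> real m + 1")
      case True
      have "cmod (F n t - f t) * \<bar>cut (real m) t\<bar> \<le> c' * 1"
       using N[OF n True] c' by (intro mult_mono) auto
      then show ?thesis by (simp add: norm_mult)
     qed (use c' in \<open>simp add: cut_eq_0\<close>)
    qed
    then show "norm (\<Phi> (\<lambda>t. (F n t - f t) * cr (cut (real m)) t) x) \<le> c' * norm x"
     by (meson mult_right_mono norm_blinfun norm_ge_zero order_trans)
   qed
   finally show ?thesis using c c' by simp
  qed
  then show "\<exists>N. \<forall>n\<ge>N. norm (\<Phi> (\<lambda>t. F n t - f t) x - 0) < e" by auto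
 qed
 then show ?thesis
  using LIM_zero_iff[of "\<lambda>n. \<Phi> (F n) x"] by (simp add: calc_diff F f minus_blinfun.rep_eq)
qed

end

section \<open>Self-adjoint regular operators\<close>

lemma op_of_graph_eq:
 assumes "\<And>x y y'. (x, y) \<in> G \<Longrightarrow> (x, y') \<in> G \<Longrightarrow> y = y'"
 shows "op_of_graph G x = Some y \<longleftrightarrow> (x, y) \<in> G"
proof
 assume "(x, y) \<in> G"
 moreover from this have "(THE y. (x, y) \<in> G) = y" by (metis assms the_equality)
 ultimately show "op_of_graph G x = Some y" by (auto simp: op_of_graph_def)
next
 assume *: "op_of_graph G x = Some y"
 then have "\<exists>y. (x, y) \<in> G" by (auto simp: op_of_graph_def split: if_splits)
 then obtain z where z: "(x, z) \<in> G" ..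
 then have "(THE y. (x, y) \<in> G) = z" by (metis assms the_equality)
 with * z show "(x, y) \<in> G" by (auto simp: op_of_graph_def split: if_splits)
qed

lemma densely_definedD:
 assumes "densely_defined D"
 shows "\<exists>f. (\<forall>n. f n \<in> dom D) \<and> f \<longlonglongrightarrow> (x :: 'e :: metric_space)"
 using assms closure_sequential[of x "dom D"] unfolding densely_defined_def by auto

context hilbert_module
begin

context
 fixes D :: "'e \<rightharpoonup> 'e"
 assumes reg: "regular E D" and sa: "self_adjoint E D"
begin

lemma self_adjoint_iff: "D y = Some z \<longleftrightarrow> (\<forall>x u. D x = Some u \<longrightarrow> ip E u y = ip E x z)"
proof -
 let ?G = "{(y, z). \<forall>x u. D x = Some u \<longrightarrow> ip E u y = ip E x z}"
 have "z = z'" if "(y, z) \<in> ?G" "(y, z') \<in> ?G" for y z z'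
 proof -
  have d: "densely_defined D" using reg by (simp add: regular_def)
  obtain f where f: "\<And>n. f n \<in> dom D" "f \<longlonglongrightarrow> z - z'" using densely_definedD[OF d] by metis
  have "ip E (f n) (z - z') = 0" for n
  proof -
   obtain u where u: "D (f n) = Some u" using f(1)[of n] by auto
   have "ip E u y = ip E (f n) z" "ip E u y = ip E (f n) z'" using that u by auto
   then show ?thesis by (simp add: ip_diff_right)
  qed
  moreover have "(\<lambda>n. ip E (f n) (z - z')) \<longlonglongrightarrow> ip E (z - z') (z - z')" by (intro tendsto_intros f)
  ultimately have "ip E (z - z') (z - z') = 0" using LIMSEQ_unique[OF _ tendsto_const] by fastforce
  then show ?thesis using norm_ip_self[of "z - z'"] by simp
 qed
 then have "op_of_graph ?G y = Some z \<longleftrightarrow> (y, z) \<in> ?G" by (rule op_of_graph_eq)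
 moreover have "op_of_graph ?G = D" using sa by (simp add: self_adjoint_def op_adjoint_def)
 ultimately show ?thesis by simp
qed

lemma sa_add: "D x = Some u \<Longrightarrow> D y = Some v \<Longrightarrow> D (x + y) = Some (u + v)"
 using reg by (auto simp: regular_def module_linear_def)

lemma sa_scale: "D x = Some u \<Longrightarrow> D (c *\<^sub>C x) = Some (c *\<^sub>C u)"
 using reg by (auto simp: regular_def module_linear_def)

lemma sa_diff: "D x = Some u \<Longrightarrow> D y = Some v \<Longrightarrow> D (x - y) = Some (u - v)"
 using sa_add[of x u "(-1) *\<^sub>C y" "(-1) *\<^sub>C v"] sa_scale[of y v "-1"] by (simp add: scaleC_minus_left)

text \<open>As \<open>\<langle>x, D x\<rangle>\<close> is self-adjoint, \<open>\<plusminus> \<langle>x, x\<rangle>\<close> is the imaginary part of \<open>\<langle>x, (D \<plusminus> \<i>) x\<rangle>\<close>.\<close>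

lemma shift_bounded_below:
 assumes x: "D x = Some u" and c: "c = \<i> \<or> c = - \<i>"
 shows "norm x \<le> norm (u + c *\<^sub>C x)"
proof -
 have h: "star (ip E x u) = ip E x u" using self_adjoint_iff[of x u] x ip_star[of u x] by simp
 have "(norm x)\<^sup>2 \<le> norm (ip E x u + c *\<^sub>C ip E x x)"
 proof (cases "c = \<i>")
  case True
  then show ?thesis using norm_imaginary_part_le[OF h ip_self_star] by (simp add: norm_ip_self)
 next
  case False
  then have "c = - \<i>" using c by simp
  then show ?thesis
   using norm_imaginary_part_le[OF h, of "- ip E x x"]
   by (simp add: norm_ip_self star_minus ip_self_star scaleC_minus_left scaleC_minus_right)
 qed
 also have "\<dots> = norm (ip E x (u + c *\<^sub>C x))" by (simp add: ip_add_right ip_scaleC_right)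
 also have "\<dots> \<le> norm x * norm (u + c *\<^sub>C x)" by (rule cauchy_schwarz)
 finally show ?thesis by (cases "norm x = 0") (auto simp: power2_eq_square)
qed

text \<open>
 The range of \<open>D + c\<close> is closed by the preceding estimate, and dense because \<open>1 + D\<^sup>2 = (D + c) (D - c)\<close> has dense range,
 which is what regularity provides.
\<close>

lemma shift_surj:
 assumes c: "c = \<i> \<or> c = - \<i>"
 shows "\<exists>x. D x = Some (y - c *\<^sub>C x)"
proof -
 let ?R = "{u + c *\<^sub>C x | x u. D x = Some u}"
 have cc: "c * c = -1" using c by auto
 have "ran (as_op \<one> \<oplus>\<^sub>m (op_adjoint E E D \<circ>\<^sub>m D)) \<subseteq> ?R"
 proof
  fix w assume "w \<in> ran (as_op \<one> \<oplus>\<^sub>m (op_adjoint E E D \<circ>\<^sub>m D))"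
  then obtain x where "(as_op \<one> \<oplus>\<^sub>m (op_adjoint E E D \<circ>\<^sub>m D)) x = Some w" by (auto simp: ran_def)
  then obtain v z where v: "D x = Some v" "D v = Some z" "w = x + z"
   using sa by (auto simp: op_plus_def as_op_def self_adjoint_def map_comp_def split: if_splits option.splits)
  have "D (v - c *\<^sub>C x) = Some (z - c *\<^sub>C v)" by (intro sa_diff v sa_scale)
  moreover have "w = (z - c *\<^sub>C v) + c *\<^sub>C (v - c *\<^sub>C x)"
   by (simp add: v scaleC_diff_right scaleC_scaleC cc scaleC_minus_left)
  ultimately show "w \<in> ?R" by blast
 qed
 then have "closure (ran (as_op \<one> \<oplus>\<^sub>m (op_adjoint E E D \<circ>\<^sub>m D))) \<subseteq> closure ?R" by (rule closure_mono)
 moreover have "closure (ran (as_op \<one> \<oplus>\<^sub>m (op_adjoint E E D \<circ>\<^sub>m D))) = UNIV"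
  using reg by (simp add: regular_def)
 ultimately have "y \<in> closure ?R" by auto
 then have "\<exists>w. (\<forall>n. w n \<in> ?R) \<and> w \<longlonglongrightarrow> y" by (simp only: closure_sequential)
 then obtain w where w: "\<And>n. w n \<in> ?R" "w \<longlonglongrightarrow> y" by blast
 have "\<forall>n. \<exists>x u. D x = Some u \<and> w n = u + c *\<^sub>C x" using w(1) by blast
 then obtain x u where xu: "\<And>n. D (x n) = Some (u n)" "\<And>n. w n = u n + c *\<^sub>C x n" by metis
 have le: "dist (x m) (x n) \<le> dist (w m) (w n)" for m n
  using shift_bounded_below[OF sa_diff[OF xu(1)[of m] xu(1)[of n]] c]
  by (simp add: dist_norm xu(2) scaleC_diff_right algebra_simps)
 have "Cauchy x"
  unfolding Cauchy_def
 proof (intro allI impI)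
  fix e :: real assume "0 < e"
  then obtain N where "\<And>m n. m \<ge> N \<Longrightarrow> n \<ge> N \<Longrightarrow> dist (w m) (w n) < e"
   using LIMSEQ_imp_Cauchy[OF w(2)] unfolding Cauchy_def by blast
  then show "\<exists>N. \<forall>m\<ge>N. \<forall>n\<ge>N. dist (x m) (x n) < e" using le by (meson le_less_trans)
 qed
 then obtain x0 where x0: "x \<longlonglongrightarrow> x0" by (auto simp: Cauchy_convergent_iff convergent_def)
 have "(\<lambda>n. w n - c *\<^sub>C x n) \<longlonglongrightarrow> y - c *\<^sub>C x0" by (intro tendsto_intros w x0)
 then have "u \<longlonglongrightarrow> y - c *\<^sub>C x0" by (simp add: xu(2))
 then have "(\<lambda>n. (x n, u n)) \<longlonglongrightarrow> (x0, y - c *\<^sub>C x0)" by (intro tendsto_Pair x0)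
 moreover have "(x n, u n) \<in> Map.graph D" for n using xu(1) by (simp add: Map.graph_def)
 moreover have "closed (Map.graph D)" using reg by (simp add: regular_def)
 ultimately have "(x0, y - c *\<^sub>C x0) \<in> Map.graph D"
  using closed_sequentially[of "Map.graph D" "\<lambda>n. (x n, u n)"] by simp
 then show ?thesis by (auto simp: Map.graph_def)
qed

lemma shift_inverse:
 assumes c: "c = \<i> \<or> c = - \<i>"
 obtains r :: "'e endo" where "\<And>x y. r x = y \<longleftrightarrow> D y = Some (x - c *\<^sub>C y)"
proof -
 obtain g where g: "\<And>x. D (g x) = Some (x - c *\<^sub>C g x)" using shift_surj[OF c] by metis
 have uniq: "y = g x" if "D y = Some (x - c *\<^sub>C y)" for x y
  using shift_bounded_below[OF sa_diff[OF that g[of x]] c] by (simp add: scaleC_diff_right)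
 have "bounded_linear g"
 proof (rule bounded_linear_intro[where K = 1])
  show "g (x + y) = g x + g y" for x y
   by (rule uniq[symmetric]) (simp add: sa_add[OF g g] scaleC_add_right algebra_simps)
  show "g (a *\<^sub>R x) = a *\<^sub>R g x" for a x
   unfolding scaleR_eq_scaleC
   by (rule uniq[symmetric])
    (simp add: sa_scale[OF g] scaleC_diff_right scaleC_scaleC mult.commute)
  show "norm (g x) \<le> norm x * 1" for x using shift_bounded_below[OF g c, of x] by simp
 qed
 then have a: "Blinfun g x = g x" for x by (simp add: bounded_linear_Blinfun_apply)
 show ?thesis
 proof (rule that)
  show "Blinfun g x = y \<longleftrightarrow> D y = Some (x - c *\<^sub>C y)" for x y
   unfolding a using g[of x] uniq[of y x] by auto
 qed
qed

lemma C0_calculus_exists: "\<exists>\<phi>. is_C0_calculus E D \<phi>"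
proof -
 obtain r where r: "\<And>x y. blinfun_apply r x = y \<longleftrightarrow> D y = Some (x - \<i> *\<^sub>C y)"
  using shift_inverse[of \<i>] by metis
 obtain q where q: "\<And>x y. blinfun_apply q x = y \<longleftrightarrow> D y = Some (x - (- \<i>) *\<^sub>C y)"
  using shift_inverse[of "- \<i>"] by metis
 have Dr: "D (r x) = Some (x - \<i> *\<^sub>C r x)" for x using r by blast
 have Dq: "D (q x) = Some (x + \<i> *\<^sub>C q x)" for x
  using q[of x "q x"] by (simp add: scaleC_minus_left)
 have adj: "is_adjoint E E r q"
  unfolding is_adjoint_def
 proof (intro allI)
  fix x y
  let ?a = "r x" and ?b = "q y"
  have "ip E (x - \<i> *\<^sub>C ?a) ?b = ip E ?a (y + \<i> *\<^sub>C ?b)"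
   using self_adjoint_iff[of ?b "y + \<i> *\<^sub>C ?b"] Dq Dr by blast
  then show "ip E ?a y = ip E x ?b"
   by (simp add: ip_diff_left ip_add_right ip_scaleC_left ip_scaleC_right scaleC_minus_left)
 qed
 then have rE: "r \<in> End_star E" and rd: "r\<^sup>* = q" by (auto intro: Hom_starI dag_eqI)
 have qr: "q y = r y + (2 * \<i>) *\<^sub>C r (q y)" for y
 proof -
  have "r (y + (2 * \<i>) *\<^sub>C q y) = q y"
   by (subst r) (simp add: Dq flip: scaleC_diff_left)
  then show ?thesis using apply_scaleC[OF rE] by (simp add: blinfun.add_right)
 qed
 have rq: "r y = q y - (2 * \<i>) *\<^sub>C q (r y)" for y
 proof -
  have "q (y - (2 * \<i>) *\<^sub>C r y) = r y"
  proof (subst q)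
   have "(2 * \<i>) *\<^sub>C r y = \<i> *\<^sub>C r y + \<i> *\<^sub>C r y"
    by (simp flip: scaleC_add_left)
   then show "D (r y) = Some (y - (2 * \<i>) *\<^sub>C r y - (- \<i>) *\<^sub>C r y)"
    by (simp add: Dr scaleC_minus_left)
  qed
  then show ?thesis using apply_scaleC[of q] rE rd by (metis End_star_dag blinfun.diff_right)
 qed
 have id1: "q - r = (2 * \<i>) *\<^sub>C (r \<cdot> q)"
  by (rule blinfun_eqI) (use qr in \<open>simp add: minus_blinfun.rep_eq algebra_simps\<close>)
 have id2: "q - r = (2 * \<i>) *\<^sub>C (q \<cdot> r)"
  by (rule blinfun_eqI) (use rq in \<open>simp add: minus_blinfun.rep_eq algebra_simps\<close>)
 have "(1 / (2 * \<i>)) *\<^sub>C (2 * \<i>) *\<^sub>C (r \<cdot> q) = (1 / (2 * \<i>)) *\<^sub>C (2 * \<i>) *\<^sub>C (q \<cdot> r)"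
  by (simp only: id1[symmetric] id2[symmetric])
 then have "r \<cdot> q = q \<cdot> r" by (simp add: scaleC_scaleC)
 then obtain \<phi> where hom: "C0_hom E \<phi>" and res: "\<phi> resolvent = r"
  using C0_hom_exists[OF rE, unfolded rd, OF id1] by metis
 have "is_C0_calculus E D \<phi>"
  unfolding is_C0_calculus_def
 proof (intro conjI hom[unfolded C0_hom_def, THEN conjunct1] hom[unfolded C0_hom_def, THEN conjunct2, THEN conjunct1]
   hom[unfolded C0_hom_def, THEN conjunct2, THEN conjunct2, THEN conjunct1]
   hom[unfolded C0_hom_def, THEN conjunct2, THEN conjunct2, THEN conjunct2] allI)
  fix x y
  have "(\<lambda>t. 1 / (complex_of_real t + \<i>)) = resolvent" by (simp add: resolvent_def fun_eq_iff)
  then have "\<phi> (\<lambda>t. 1 / (complex_of_real t + \<i>)) x = y \<longleftrightarrow> D y = Some (x - \<i> *\<^sub>C y)"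
   by (simp add: res r)
  also have "\<dots> \<longleftrightarrow> (D \<oplus>\<^sub>m as_op (\<i> *\<^sub>C \<one>)) y = Some x"
   by (auto simp: op_plus_def as_op_def)
  finally show "\<phi> (\<lambda>t. 1 / (complex_of_real t + \<i>)) x = y \<longleftrightarrow>
    (D \<oplus>\<^sub>m as_op (\<i> *\<^sub>C \<one>)) y = Some x" .
 qed
 then show ?thesis by blast
qed

lemma C0_calculus_hom: "C0_hom E (C0_calculus E D)"
 and C0_calculus_resolvent:
  "C0_calculus E D resolvent x = y \<longleftrightarrow> D y = Some (x - \<i> *\<^sub>C y)"
proof -
 have c: "is_C0_calculus E D (C0_calculus E D)"
  unfolding C0_calculus_def by (rule someI_ex[OF C0_calculus_exists])
 then show "C0_hom E (C0_calculus E D)" unfolding is_C0_calculus_def C0_hom_def by blast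
 have "(\<lambda>t. 1 / (complex_of_real t + \<i>)) = resolvent" by (simp add: resolvent_def fun_eq_iff)
 then have "C0_calculus E D resolvent x = y \<longleftrightarrow> (D \<oplus>\<^sub>m as_op (\<i> *\<^sub>C \<one>)) y = Some x"
  using c by (simp add: is_C0_calculus_def)
 also have "\<dots> \<longleftrightarrow> D y = Some (x - \<i> *\<^sub>C y)" by (auto simp: op_plus_def as_op_def)
 finally show "C0_calculus E D resolvent x = y \<longleftrightarrow> D y = Some (x - \<i> *\<^sub>C y)" .
qed

text \<open>
 On \<open>dom D\<close>, the range of the resolvent, it follows from uniform convergence of \<open>cut n t / (t + \<i>)\<close>; the domain is dense
 and the operators \<open>(cut n)(D)\<close> are contractions.
\<close>

lemma C0_calculus_nondegenerate: "nondegenerate (C0_calculus E D)"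
 unfolding nondegenerate_def
proof
 fix x
 let ?\<phi> = "C0_calculus E D"
 let ?c = "\<lambda>n. cr (cut (real n))"
 have cC: "?c n \<in> C0" for n by (rule Cc_C0[OF Cc_cut])
 have n1: "norm (?\<phi> (?c n)) \<le> 1" for n
  by (rule C0_hom_contractive[OF C0_calculus_hom cC]) simp
 have key: "(\<lambda>n. ?\<phi> (?c n) y) \<longlonglongrightarrow> y" if yD: "y \<in> dom D" for y
 proof -
  obtain u where "D y = Some u" using yD by auto
  then have "?\<phi> resolvent (u + \<i> *\<^sub>C y) = y"
   by (simp add: C0_calculus_resolvent)
  then obtain w where y: "?\<phi> resolvent w = y" by blast
  have mC: "(\<lambda>t. ?c n t * resolvent t) \<in> C0" for n by (intro C0_mult cC resolvent_C0)
  have dC: "(\<lambda>t. resolvent t - ?c n t * resolvent t) \<in> C0" for n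
   by (intro C0_diff mC resolvent_C0)
  have "norm (?\<phi> (\<lambda>t. resolvent t - ?c n t * resolvent t)) \<le> inverse (real n)" if "0 < n" for n
  proof (rule C0_hom_contractive[OF C0_calculus_hom dC])
   fix t
   show "cmod (resolvent t - ?c n t * resolvent t) \<le> inverse (real n)"
   proof (cases "\<bar>t\<bar> \<le> real n")
    case False
    have "resolvent t - ?c n t * resolvent t = of_real (1 - cut (real n) t) * resolvent t"
     by (simp add: algebra_simps)
    also have "cmod \<dots> \<le> 1 * (1 / \<bar>t\<bar>)"
    proof (unfold norm_mult norm_of_real, intro mult_mono)
     show "\<bar>1 - cut (real n) t\<bar> \<le> 1" using cut_bounds[of "real n" t] by simp
     have "\<bar>t\<bar> \<le> cmod (complex_of_real t + \<i>)"
      using abs_Re_le_cmod[of "complex_of_real t + \<i>"] by simp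
     then show "cmod (resolvent t) \<le> 1 / \<bar>t\<bar>"
      using False by (simp add: resolvent_def norm_divide frac_le)
    qed simp_all
    also have "\<dots> \<le> inverse (real n)" using False \<open>0 < n\<close> by (simp add: divide_simps)
    finally show ?thesis .
   qed (simp add: cut_eq_1)
  qed
  then have lim: "(\<lambda>n. ?\<phi> (\<lambda>t. resolvent t - ?c n t * resolvent t)) \<longlonglongrightarrow> 0"
   by (intro Lim_null_comparison[OF _ lim_inverse_n]) (auto simp: eventually_sequentially intro!: exI[of _ 1])
  have split: "?\<phi> (?c n) \<cdot> ?\<phi> resolvent = ?\<phi> resolvent - ?\<phi> (\<lambda>t. resolvent t - ?c n t * resolvent t)" for n
  proof -
   have "(\<lambda>t. (resolvent t - ?c n t * resolvent t) + ?c n t * resolvent t) = resolvent" by simp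
   then have "?\<phi> resolvent = ?\<phi> (\<lambda>t. resolvent t - ?c n t * resolvent t) + ?\<phi> (\<lambda>t. ?c n t * resolvent t)"
    by (subst C0_hom_add[OF C0_calculus_hom dC mC, symmetric]) (simp only:)
   also have "?\<phi> (\<lambda>t. ?c n t * resolvent t) = ?\<phi> (?c n) \<cdot> ?\<phi> resolvent"
    by (rule C0_hom_mult[OF C0_calculus_hom cC resolvent_C0])
   finally have e: "?\<phi> resolvent = ?\<phi> (\<lambda>t. resolvent t - ?c n t * resolvent t) + ?\<phi> (?c n) \<cdot> ?\<phi> resolvent" .
   show ?thesis by (rule add_implies_diff, subst add.commute) (rule e[symmetric])
  qed
  have "(\<lambda>n. (?\<phi> resolvent - ?\<phi> (\<lambda>t. resolvent t - ?c n t * resolvent t)) w)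
    \<longlonglongrightarrow> (?\<phi> resolvent - 0) w"
   by (intro tendsto_intros lim)
  then show ?thesis unfolding split[symmetric] by (simp add: y)
 qed
 show "(\<lambda>n. ?\<phi> (?c n) x) \<longlonglongrightarrow> x"
 proof (rule LIMSEQ_I)
  fix e :: real assume e: "0 < e"
  have "x \<in> closure (dom D)" using reg by (simp add: regular_def densely_defined_def)
  then obtain y where y: "y \<in> dom D" "dist y x < e / 3"
   using e by (meson closure_approachable divide_pos_pos zero_less_numeral)
  obtain N where N: "\<And>n. n \<ge> N \<Longrightarrow> norm (?\<phi> (?c n) y - y) < e / 3"
   using LIMSEQ_D[OF key[OF y(1)], of "e / 3"] e by auto
  have "norm (?\<phi> (?c n) x - x) < e" if "n \<ge> N" for n
  proof -
   have "?\<phi> (?c n) x - x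
     = ?\<phi> (?c n) (x - y) + (?\<phi> (?c n) y - y) + (y - x)"
    by (simp add: blinfun.diff_right)
   also have "norm \<dots> \<le> norm (?\<phi> (?c n) (x - y)) + norm (?\<phi> (?c n) y - y) + norm (y - x)"
    by (intro order_trans[OF norm_triangle_ineq] add_right_mono norm_triangle_ineq)
   also have "norm (?\<phi> (?c n) (x - y)) \<le> 1 * norm (x - y)"
    using n1[of n] by (meson mult_right_mono norm_blinfun norm_ge_zero order_trans)
   finally show ?thesis using N[OF that] y(2) by (simp add: dist_norm norm_minus_commute)
  qed
  then show "\<exists>N. \<forall>n\<ge>N. norm (?\<phi> (?c n) x - x) < e" by blast
 qed
qed

end

end

subsection \<open>Functions of an operator, tested against compactly supported functions\<close>

text \<open>\<open>op_rel \<Phi> f y z\<close> says that \<open>y\<close> is in the domain of \<open>f(D)\<close> and \<open>f(D) y = z\<close>.\<close>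

definition op_rel :: "('e :: real_normed_vector) calculus \<Rightarrow> (real \<Rightarrow> complex) \<Rightarrow> 'e \<Rightarrow> 'e \<Rightarrow> bool" where
 "op_rel \<Phi> f y z \<longleftrightarrow> (\<forall>g\<in>Cc. blinfun_apply (\<Phi> (\<lambda>t. f t * g t)) y = blinfun_apply (\<Phi> g) z)"

lemma op_relD: "op_rel \<Phi> f y z \<Longrightarrow> g \<in> Cc \<Longrightarrow> \<Phi> (\<lambda>t. f t * g t) y = \<Phi> g z"
 by (simp add: op_rel_def)

lemma op_rel_unique: "nondegenerate \<Phi> \<Longrightarrow> op_rel \<Phi> f y z \<Longrightarrow> op_rel \<Phi> f y z' \<Longrightarrow> z = z'"
 by (rule nondegenerate_eqI'[of \<Phi>]) (simp_all flip: op_relD)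

text \<open>
 A pair \<open>(y, z)\<close> that satisfies the tested relation is the limit of the pairs \<open>((cut n)(D) y, (cut n)(D) z)\<close>, which belong
 to the graph whose closure defines \<open>fun_calc\<close>.
\<close>

lemma fun_calc_eq_op_rel:
 assumes hom: "C0_hom E (C0_calculus E D)" and nd: "nondegenerate (C0_calculus E D)"
  and f: "continuous_on UNIV f"
 shows "fun_calc E D f y = Some z \<longleftrightarrow> op_rel (C0_calculus E D) f y z"
proof -
 let ?\<phi> = "C0_calculus E D"
 let ?G = "{(?\<phi> g \<eta>, ?\<phi> (\<lambda>t. f t * g t) \<eta>) | g \<eta>. g \<in> Cc}"
 have fg: "(\<lambda>t. f t * g t) \<in> Cc" if "g \<in> Cc" for g by (rule Cc_mult_left[OF that f])
 have graph: "(y, z) \<in> closure ?G \<longleftrightarrow> op_rel ?\<phi> f y z" for y z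
 proof
  have "?G \<subseteq> {p. op_rel ?\<phi> f (fst p) (snd p)}"
  proof safe
   fix g \<eta> assume g: "g \<in> Cc"
   have "?\<phi> (\<lambda>t. f t * h t) \<cdot> ?\<phi> g = ?\<phi> h \<cdot> ?\<phi> (\<lambda>t. f t * g t)" if h: "h \<in> Cc" for h
    using C0_hom_mult[OF hom Cc_C0[OF fg[OF h]] Cc_C0[OF g]] C0_hom_mult[OF hom Cc_C0[OF h] Cc_C0[OF fg[OF g]]]
    by (simp add: mult_ac)
   then show "op_rel ?\<phi> f (fst (?\<phi> g \<eta>, ?\<phi> (\<lambda>t. f t * g t) \<eta>))
     (snd (?\<phi> g \<eta>, ?\<phi> (\<lambda>t. f t * g t) \<eta>))"
    by (simp add: op_rel_def flip: blinfun_apply_blinfun_compose)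
  qed
  moreover have "closed {p. op_rel ?\<phi> f (fst p) (snd p)}"
   unfolding op_rel_def Collect_ball_eq by (intro closed_INT ballI closed_Collect_eq continuous_intros)
  ultimately have "closure ?G \<subseteq> {p. op_rel ?\<phi> f (fst p) (snd p)}" by (rule closure_minimal)
  then show "(y, z) \<in> closure ?G \<Longrightarrow> op_rel ?\<phi> f y z" by auto
  assume r: "op_rel ?\<phi> f y z"
  let ?c = "\<lambda>n. cr (cut (real n))"
  have "(\<lambda>n. (?\<phi> (?c n) y, ?\<phi> (\<lambda>t. f t * ?c n t) y)) \<longlonglongrightarrow> (y, z)"
   using nd by (intro tendsto_Pair) (simp_all add: op_relD[OF r Cc_cut] nondegenerate_def)
  moreover have "(?\<phi> (?c n) y, ?\<phi> (\<lambda>t. f t * ?c n t) y) \<in> ?G" for n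
   using Cc_cut by blast
  ultimately show "(y, z) \<in> closure ?G" unfolding closure_sequential
   by (intro exI[of _ "\<lambda>n. (?\<phi> (?c n) y, ?\<phi> (\<lambda>t. f t * ?c n t) y)"] conjI allI)
 qed
 have "op_of_graph (closure ?G) y = Some z \<longleftrightarrow> (y, z) \<in> closure ?G"
 proof (rule op_of_graph_eq)
  fix x y y' assume "(x, y) \<in> closure ?G" "(x, y') \<in> closure ?G"
  then show "y = y'" unfolding graph by (rule op_rel_unique[OF nd])
 qed
 then show ?thesis unfolding fun_calc_def graph .
qed

lemma Cc_of_real_mult: "g \<in> Cc \<Longrightarrow> (\<lambda>t. of_real t * g t) \<in> Cc"
 by (erule Cc_mult_left) (rule continuous_on_of_real[OF continuous_on_id])

context bounded_calculus
begin

lemma op_rel_bounded: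
 assumes f: "f \<in> Cb" shows "op_rel \<Phi> f y z \<longleftrightarrow> z = \<Phi> f y"
proof -
 have e: "\<Phi> (\<lambda>t. f t * g t) = \<Phi> g \<cdot> \<Phi> f" if "g \<in> Cc" for g
  using calc_mult[OF f Cc_Cb[OF that]] calc_commute[OF f Cc_Cb[OF that]] by simp
 have "op_rel \<Phi> f y (\<Phi> f y)" by (simp add: op_rel_def e)
 then show ?thesis using op_rel_unique[OF calc_nondegenerate] by blast
qed

lemma op_rel_cut_Cc:
 assumes f: "continuous_on UNIV f" and g: "g \<in> Cc"
 shows "op_rel \<Phi> f (\<Phi> g y) (\<Phi> (\<lambda>t. f t * g t) y)"
 unfolding op_rel_def
proof
 fix h assume h: "h \<in> Cc"
 have fC: "(\<lambda>t. f t * k t) \<in> Cb" if "k \<in> Cc" for k by (rule Cc_Cb[OF Cc_mult_left[OF that f]])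
 have "\<Phi> (\<lambda>t. f t * h t) \<cdot> \<Phi> g = \<Phi> (\<lambda>t. f t * h t * g t)"
  by (rule calc_mult[OF fC[OF h] Cc_Cb[OF g], symmetric])
 also have "(\<lambda>t. f t * h t * g t) = (\<lambda>t. h t * (f t * g t))" by (simp add: mult_ac)
 also have "\<Phi> \<dots> = \<Phi> h \<cdot> \<Phi> (\<lambda>t. f t * g t)" by (rule calc_mult[OF Cc_Cb[OF h] fC[OF g]])
 finally show "\<Phi> (\<lambda>t. f t * h t) (\<Phi> g y)
   = \<Phi> h (\<Phi> (\<lambda>t. f t * g t) y)"
  by (metis blinfun_apply_blinfun_compose)
qed

lemma op_rel_closed:
 assumes "\<And>n. op_rel \<Phi> f (y n) (z n)" "y \<longlonglongrightarrow> y0" "z \<longlonglongrightarrow> z0"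
 shows "op_rel \<Phi> f y0 z0"
 unfolding op_rel_def
proof
 fix g assume g: "g \<in> Cc"
 have "(\<lambda>n. \<Phi> (\<lambda>t. f t * g t) (y n)) \<longlonglongrightarrow> \<Phi> (\<lambda>t. f t * g t) y0"
  "(\<lambda>n. \<Phi> g (z n)) \<longlonglongrightarrow> \<Phi> g z0"
  by (intro tendsto_intros assms)+
 then show "\<Phi> (\<lambda>t. f t * g t) y0 = \<Phi> g z0"
  using LIMSEQ_unique by (simp add: op_relD[OF assms(1) g])
qed

lemma op_rel_densely_defined:
 assumes f: "continuous_on UNIV f" shows "closure {y. \<exists>z. op_rel \<Phi> f y z} = UNIV"
proof -
 have "y \<in> closure {y. \<exists>z. op_rel \<Phi> f y z}" for y
  unfolding closure_sequential
 proof (intro exI conjI allI)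
  show "\<Phi> (cr (cut (real n))) y \<in> {y. \<exists>z. op_rel \<Phi> f y z}" for n
   using op_rel_cut_Cc[OF f Cc_cut] by blast
  show "(\<lambda>n. \<Phi> (cr (cut (real n))) y) \<longlonglongrightarrow> y"
   using calc_nondegenerate by (simp add: nondegenerate_def)
 qed
 then show ?thesis by blast
qed

end

subsection \<open>The operators of the statement\<close>

definition bracket :: "real \<Rightarrow> real" where
 "bracket t = sqrt (1 + t\<^sup>2)"

lemma bracket_ge_1: "1 \<le> bracket t"
 and bracket_pos [simp]: "0 < bracket t"
 and abs_le_bracket: "\<bar>t\<bar> \<le> bracket t"
 and bracket_neq_0 [simp]: "bracket t \<noteq> 0"
proof -
 show b: "1 \<le> bracket t" by (simp add: bracket_def)
 then show "0 < bracket t" "bracket t \<noteq> 0" by simp_all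
 show "\<bar>t\<bar> \<le> bracket t" unfolding bracket_def by (rule real_le_rsqrt) simp
qed

lemma abs_bracket [simp]: "\<bar>bracket t\<bar> = bracket t"
 by (rule abs_of_pos) simp

lemma continuous_on_bracket [continuous_intros]:
 "continuous_on S f \<Longrightarrow> continuous_on S (\<lambda>x. bracket (f x))"
 unfolding bracket_def by (intro continuous_intros)

definition log_fun :: "real \<Rightarrow> real" where
 "log_fun t = ln (bracket t) * (t / bracket t)"

lemma continuous_on_log_fun [continuous_intros]:
 "continuous_on S f \<Longrightarrow> continuous_on S (\<lambda>x. log_fun (f x))"
 unfolding log_fun_def by (intro continuous_intros) auto

lemma bounded_transform_fun_Cb: "cr (\<lambda>t. t / bracket t) \<in> Cb"
proof (rule CbI[of _ 1])
 show "continuous_on UNIV (cr (\<lambda>t. t / bracket t))" by (intro continuous_intros) auto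
 show "cmod (cr (\<lambda>t. t / bracket t) t) \<le> 1" for t
  unfolding norm_of_real using abs_le_bracket[of t] by (simp add: abs_divide)
qed

lemma bracket_pow_Cb:
 assumes "s \<le> 0" shows "cr (\<lambda>t. bracket t powr s) \<in> Cb"
proof (rule CbI[of _ 1])
 show "continuous_on UNIV (cr (\<lambda>t. bracket t powr s))" by (intro continuous_intros) auto
 show "cmod (cr (\<lambda>t. bracket t powr s) t) \<le> 1" for t
  using powr_mono[OF assms bracket_ge_1[of t]] by simp
qed

definition bcalc ::
 "('e :: {complex_normed_vector, banach}, 'b :: cstar_algebra) hilbmod \<Rightarrow> ('e \<rightharpoonup> 'e) \<Rightarrow>
  'e calculus" where
 "bcalc E D = extend_calculus E (C0_calculus E D)"

context hilbert_module
begin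

context
 fixes D :: "'e \<rightharpoonup> 'e"
 assumes reg: "regular E D" and sa: "self_adjoint E D"
begin

lemma bcalc_bounded_calculus: "bounded_calculus E (bcalc E D)"
 unfolding bcalc_def
 by (rule bounded_calculus_extend[OF C0_calculus_hom[OF reg sa] C0_calculus_nondegenerate[OF reg sa]])

lemma bcalc_C0: "f \<in> C0 \<Longrightarrow> bcalc E D f = C0_calculus E D f"
 unfolding bcalc_def
 by (rule extend_calculus_C0[OF C0_calculus_hom[OF reg sa] C0_calculus_nondegenerate[OF reg sa]])

lemma op_rel_bcalc:
 assumes f: "continuous_on UNIV f"
 shows "op_rel (bcalc E D) f y z \<longleftrightarrow> op_rel (C0_calculus E D) f y z"
 unfolding op_rel_def by (intro ball_cong refl) (simp add: bcalc_C0[OF Cc_C0] Cc_mult_left[OF _ f])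

lemma fun_calc_iff: "continuous_on UNIV f \<Longrightarrow> fun_calc E D f y = Some z \<longleftrightarrow> op_rel (bcalc E D) f y z"
 by (simp only: op_rel_bcalc fun_calc_eq_op_rel[OF C0_calculus_hom[OF reg sa] C0_calculus_nondegenerate[OF reg sa]])

text \<open>Multiplication by the resolvent turns both sides into \<open>(D + \<i>)\<^sup>-\<^sup>1 (z + \<i> y) = y\<close>.\<close>

lemma operator_iff_op_rel: "D y = Some z \<longleftrightarrow> op_rel (bcalc E D) of_real y z"
proof -
 interpret bounded_calculus E "bcalc E D" by (rule bcalc_bounded_calculus)
 have res: "bcalc E D resolvent = C0_calculus E D resolvent"
  by (rule bcalc_C0[OF resolvent_C0])
 have rC: "resolvent \<in> Cb" by (rule C0_Cb[OF resolvent_C0])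
 have gr: "(\<lambda>t. g t * resolvent t) \<in> Cc" if "g \<in> Cc" for g
  by (rule Cc_mult_right[OF that C0_cont[OF resolvent_C0]])
 have split: "bcalc E D g = bcalc E D (\<lambda>t. of_real t * (g t * resolvent t)) + \<i> *\<^sub>C (bcalc E D g \<cdot> bcalc E D resolvent)"
  if g: "g \<in> Cc" for g
 proof -
  have "g = (\<lambda>t. of_real t * (g t * resolvent t) + \<i> * (g t * resolvent t))"
  proof
   fix t
   have "g t = g t * ((of_real t + \<i>) * resolvent t)" by (simp add: resolvent_def)
   then show "g t = of_real t * (g t * resolvent t) + \<i> * (g t * resolvent t)"
    by (simp only: distrib_left distrib_right mult_ac)
  qed
  then have "bcalc E D g = bcalc E D (\<lambda>t. of_real t * (g t * resolvent t) + \<i> * (g t * resolvent t))"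
   by (rule arg_cong)
  also have "\<dots> = bcalc E D (\<lambda>t. of_real t * (g t * resolvent t)) + \<i> *\<^sub>C bcalc E D (\<lambda>t. g t * resolvent t)"
   using Cc_Cb[OF Cc_of_real_mult[OF gr[OF g]]] Cc_Cb[OF gr[OF g]]
   by (simp only: calc_add calc_scale Cb_mult[OF Cb_const])
  also have "bcalc E D (\<lambda>t. g t * resolvent t) = bcalc E D g \<cdot> bcalc E D resolvent"
   by (rule calc_mult[OF Cc_Cb[OF g] rC])
  finally show ?thesis .
 qed
 show ?thesis
 proof
  assume D: "D y = Some z"
  then have y: "bcalc E D resolvent (z + \<i> *\<^sub>C y) = y"
   unfolding res by (simp add: C0_calculus_resolvent[OF reg sa])
  show "op_rel (bcalc E D) of_real y z"
   unfolding op_rel_def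
  proof
   fix g assume g: "g \<in> Cc"
   have "bcalc E D g (z + \<i> *\<^sub>C y)
     = bcalc E D (\<lambda>t. of_real t * (g t * resolvent t)) (z + \<i> *\<^sub>C y)
      + \<i> *\<^sub>C bcalc E D g y"
    by (subst split[OF g]) (simp add: plus_blinfun.rep_eq y)
   also have "bcalc E D (\<lambda>t. of_real t * (g t * resolvent t))
     = bcalc E D (\<lambda>t. of_real t * g t) \<cdot> bcalc E D resolvent"
    using calc_mult[OF Cc_Cb[OF Cc_of_real_mult[OF g]] rC] by (simp add: mult.assoc)
   finally have e: "bcalc E D g (z + \<i> *\<^sub>C y)
     = bcalc E D (\<lambda>t. of_real t * g t) y + \<i> *\<^sub>C bcalc E D g y"
    by (simp only: blinfun_apply_blinfun_compose y)
   have "bcalc E D g (z + \<i> *\<^sub>C y)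
     = bcalc E D g z + \<i> *\<^sub>C bcalc E D g y"
    by (simp only: blinfun.add_right apply_scaleC[OF calc_End[OF Cc_Cb[OF g]]])
   with e show "bcalc E D (\<lambda>t. of_real t * g t) y = bcalc E D g z"
    by (metis add_right_imp_eq)
  qed
 next
  assume r: "op_rel (bcalc E D) of_real y z"
  have "bcalc E D resolvent (z + \<i> *\<^sub>C y) = y"
  proof (rule nondegenerate_eqI'[OF calc_nondegenerate])
   fix g assume g: "g \<in> Cc"
   have "bcalc E D g y = bcalc E D (\<lambda>t. of_real t * (g t * resolvent t)) y
     + \<i> *\<^sub>C (bcalc E D g \<cdot> bcalc E D resolvent) y"
    by (subst split[OF g]) (simp only: plus_blinfun.rep_eq scaleC_blinfun_apply)
   also have "bcalc E D (\<lambda>t. of_real t * (g t * resolvent t)) y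
     = bcalc E D (\<lambda>t. g t * resolvent t) z"
    by (rule op_relD[OF r gr[OF g]])
   also have "bcalc E D (\<lambda>t. g t * resolvent t) = bcalc E D g \<cdot> bcalc E D resolvent"
    by (rule calc_mult[OF Cc_Cb[OF g] rC])
   finally have e: "bcalc E D g y = (bcalc E D g \<cdot> bcalc E D resolvent) z
     + \<i> *\<^sub>C (bcalc E D g \<cdot> bcalc E D resolvent) y" .
   have E: "bcalc E D g \<cdot> bcalc E D resolvent \<in> End_star E" using g rC by (simp add: Cc_Cb)
   show "bcalc E D g (bcalc E D resolvent (z + \<i> *\<^sub>C y)) = bcalc E D g y"
    unfolding e using apply_scaleC[OF E]
    by (simp only: blinfun.add_right flip: blinfun_apply_blinfun_compose)
  qed
  then show "D y = Some z" unfolding res C0_calculus_resolvent[OF reg sa] by simp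
 qed
qed

lemma bracket_pow_eq:
 assumes "s \<le> 0"
 shows "bracket_pow E D s = (\<lambda>x. Some (bcalc E D (cr (\<lambda>t. bracket t powr s)) x))"
proof
 fix x
 interpret bounded_calculus E "bcalc E D" by (rule bcalc_bounded_calculus)
 have "fun_calc E D (cr (\<lambda>t. bracket t powr s)) x = Some (bcalc E D (cr (\<lambda>t. bracket t powr s)) x)"
  using fun_calc_iff[OF Cb_cont[OF bracket_pow_Cb[OF assms]]] op_rel_bounded[OF bracket_pow_Cb[OF assms]] by simp
 then show "bracket_pow E D s x = Some (bcalc E D (cr (\<lambda>t. bracket t powr s)) x)"
  by (simp add: bracket_pow_def bracket_def)
qed

text \<open>
 \<open>log_transform\<close> is defined by composing three operators; the domain of the composition is that of
 \<open>log_fun(D)\<close> because \<open>log \<langle>t\<rangle> = (t / \<langle>t\<rangle>) log_fun t + log \<langle>t\<rangle> / \<langle>t\<rangle>\<^sup>2\<close> with bounded coefficients.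
\<close>

lemma log_transform_iff: "log_transform E D y = Some z \<longleftrightarrow> op_rel (bcalc E D) (cr log_fun) y z"
proof -
 interpret bounded_calculus E "bcalc E D" by (rule bcalc_bounded_calculus)
 let ?\<Phi> = "bcalc E D"
 let ?l = "cr (\<lambda>t. ln (bracket t))"
 let ?i = "cr (\<lambda>t. bracket t powr (-1))"
 let ?F = "cr (\<lambda>t. t / bracket t)"
 have lc: "continuous_on UNIV ?l" by (intro continuous_intros) auto
 have Lc: "continuous_on UNIV (cr log_fun)" by (intro continuous_intros)
 have iC: "?i \<in> Cb" by (rule bracket_pow_Cb) simp
 have inv: "bracket t powr (-1) = 1 / bracket t" for t by (simp add: powr_minus_divide)
 have lb: "log_bracket E D y = Some v \<longleftrightarrow> op_rel ?\<Phi> ?l y v" for y v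
  unfolding log_bracket_def using fun_calc_iff[OF lc] by (simp add: bracket_def)
 have "log_transform E D y = Some z \<longleftrightarrow> (\<exists>v. op_rel ?\<Phi> ?l y v \<and> op_rel ?\<Phi> of_real (?\<Phi> ?i v) z)"
 proof -
  have "log_transform E D y = Some z \<longleftrightarrow> (\<exists>v. log_bracket E D y = Some v \<and> D (?\<Phi> ?i v) = Some z)"
   unfolding log_transform_def bounded_transform_def
   by (auto simp: map_comp_def bracket_pow_eq split: option.splits)
  then show ?thesis by (simp only: lb operator_iff_op_rel)
 qed
 also have "\<dots> \<longleftrightarrow> op_rel ?\<Phi> (cr log_fun) y z"
 proof
  assume "\<exists>v. op_rel ?\<Phi> ?l y v \<and> op_rel ?\<Phi> of_real (?\<Phi> ?i v) z"
  then obtain v where v: "op_rel ?\<Phi> ?l y v" "op_rel ?\<Phi> of_real (?\<Phi> ?i v) z" by blast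
  show "op_rel ?\<Phi> (cr log_fun) y z"
   unfolding op_rel_def
  proof
   fix g assume g: "g \<in> Cc"
   have Fg: "(\<lambda>t. ?F t * g t) \<in> Cc" by (rule Cc_mult_left[OF g Cb_cont[OF bounded_transform_fun_Cb]])
   have "(\<lambda>t. cr log_fun t * g t) = (\<lambda>t. ?l t * (?F t * g t))" by (simp add: log_fun_def mult_ac)
   then have "?\<Phi> (\<lambda>t. cr log_fun t * g t) y = ?\<Phi> (\<lambda>t. ?F t * g t) v"
    using op_relD[OF v(1) Fg] by simp
   also have "(\<lambda>t. ?F t * g t) = (\<lambda>t. (of_real t * g t) * ?i t)" by (simp add: inv)
   also have "?\<Phi> \<dots> = ?\<Phi> (\<lambda>t. of_real t * g t) \<cdot> ?\<Phi> ?i"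
    by (rule calc_mult[OF Cc_Cb[OF Cc_of_real_mult[OF g]] iC])
   also have "\<dots> v = ?\<Phi> g z" using op_relD[OF v(2) g] by simp
   finally show "?\<Phi> (\<lambda>t. cr log_fun t * g t) y = ?\<Phi> g z" .
  qed
 next
  assume r: "op_rel ?\<Phi> (cr log_fun) y z"
  let ?h = "cr (\<lambda>t. ln (bracket t) / (bracket t)\<^sup>2)"
  have hC: "?h \<in> Cb"
  proof (rule CbI[of _ 1])
   show "continuous_on UNIV ?h" by (intro continuous_intros) auto
   fix t
   have "ln (bracket t) \<le> bracket t - 1" by (rule ln_le_minus_one) simp
   also have "\<dots> \<le> (bracket t)\<^sup>2" using bracket_ge_1[of t] self_le_power[of "bracket t" 2] by simp
   finally show "cmod (?h t) \<le> 1" unfolding norm_of_real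
    using ln_ge_zero[OF bracket_ge_1[of t]] by (simp add: abs_divide)
  qed
  have FC: "?F \<in> Cb" by (rule bounded_transform_fun_Cb)
  have key: "ln (bracket t) = log_fun t * (t / bracket t) + ln (bracket t) / (bracket t)\<^sup>2" for t
  proof -
   have "(bracket t)\<^sup>2 = 1 + t\<^sup>2" by (simp add: bracket_def add_nonneg_nonneg)
   then have "t\<^sup>2 / (bracket t)\<^sup>2 + 1 / (bracket t)\<^sup>2 = 1"
    by (simp add: add_divide_distrib[symmetric] add.commute add_nonneg_eq_0_iff)
   then have "ln (bracket t) = ln (bracket t) * (t\<^sup>2 / (bracket t)\<^sup>2 + 1 / (bracket t)\<^sup>2)" by simp
   also have "\<dots> = log_fun t * (t / bracket t) + ln (bracket t) / (bracket t)\<^sup>2"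
    by (simp add: log_fun_def distrib_left power2_eq_square)
   finally show ?thesis .
  qed
  define v where "v = ?\<Phi> ?F z + ?\<Phi> ?h y"
  have v1: "op_rel ?\<Phi> ?l y v"
   unfolding op_rel_def
  proof
   fix g assume g: "g \<in> Cc"
   have gF: "(\<lambda>t. g t * ?F t) \<in> Cc" by (rule Cc_mult_right[OF g Cb_cont[OF FC]])
   have gh: "(\<lambda>t. g t * ?h t) \<in> Cb" by (rule Cc_Cb[OF Cc_mult_right[OF g Cb_cont[OF hC]]])
   have LgF: "(\<lambda>t. cr log_fun t * (g t * ?F t)) \<in> Cb" by (rule Cc_Cb[OF Cc_mult_left[OF gF Lc]])
   have "(\<lambda>t. ?l t * g t) = (\<lambda>t. cr log_fun t * (g t * ?F t) + g t * ?h t)"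
   proof
    fix t show "?l t * g t = cr log_fun t * (g t * ?F t) + g t * ?h t"
     by (subst key) (simp only: of_real_add of_real_mult distrib_right distrib_left mult_ac)
   qed
   then have "?\<Phi> (\<lambda>t. ?l t * g t) y
     = ?\<Phi> (\<lambda>t. cr log_fun t * (g t * ?F t)) y + ?\<Phi> (\<lambda>t. g t * ?h t) y"
    by (simp only: calc_add[OF LgF gh] plus_blinfun.rep_eq)
   also have "?\<Phi> (\<lambda>t. cr log_fun t * (g t * ?F t)) y = ?\<Phi> g (?\<Phi> ?F z)"
    by (simp only: op_relD[OF r gF] calc_mult[OF Cc_Cb[OF g] FC] blinfun_apply_blinfun_compose)
   also have "?\<Phi> (\<lambda>t. g t * ?h t) = ?\<Phi> g \<cdot> ?\<Phi> ?h" by (rule calc_mult[OF Cc_Cb[OF g] hC])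
   finally show "?\<Phi> (\<lambda>t. ?l t * g t) y = ?\<Phi> g v"
    by (simp add: v_def blinfun.add_right)
  qed
  have "op_rel ?\<Phi> of_real (?\<Phi> ?i v) z"
   unfolding op_rel_def
  proof
   fix g assume g: "g \<in> Cc"
   have Fg: "(\<lambda>t. ?F t * g t) \<in> Cc" by (rule Cc_mult_left[OF g Cb_cont[OF FC]])
   have "?\<Phi> (\<lambda>t. of_real t * g t) \<cdot> ?\<Phi> ?i = ?\<Phi> (\<lambda>t. (of_real t * g t) * ?i t)"
    by (rule calc_mult[OF Cc_Cb[OF Cc_of_real_mult[OF g]] iC, symmetric])
   also have "(\<lambda>t. (of_real t * g t) * ?i t) = (\<lambda>t. ?F t * g t)" by (simp add: inv)
   finally have "?\<Phi> (\<lambda>t. of_real t * g t) (?\<Phi> ?i v) = ?\<Phi> (\<lambda>t. ?F t * g t) v"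
    by (metis blinfun_apply_blinfun_compose)
   also have "\<dots> = ?\<Phi> (\<lambda>t. ?l t * (?F t * g t)) y" by (rule op_relD[OF v1 Fg, symmetric])
   also have "(\<lambda>t. ?l t * (?F t * g t)) = (\<lambda>t. cr log_fun t * g t)" by (simp add: log_fun_def mult_ac)
   also have "(?\<Phi> \<dots>) y = ?\<Phi> g z" by (rule op_relD[OF r g])
   finally show "?\<Phi> (\<lambda>t. of_real t * g t) (?\<Phi> ?i v) = ?\<Phi> g z" .
  qed
  then show "\<exists>v. op_rel ?\<Phi> ?l y v \<and> op_rel ?\<Phi> of_real (?\<Phi> ?i v) z" using v1 by blast
 qed
 finally show ?thesis .
qed

end

end

subsection \<open>Transport along a unitary\<close>

definition transport ::
 "('e :: {complex_normed_vector, banach}, 'b :: cstar_algebra) hilbmod \<Rightarrow>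
  ('f :: {complex_normed_vector, banach}, 'b) hilbmod \<Rightarrow> ('e \<Rightarrow>\<^sub>L 'f) \<Rightarrow>
  'f calculus \<Rightarrow> 'e calculus" where
 "transport E F U \<Phi> f = adj E F U \<cdot> \<Phi> f \<cdot> U"

locale module_unitary = E: hilbert_module E + F: hilbert_module F
 for E :: "('e :: {complex_normed_vector, banach}, 'b :: cstar_algebra) hilbmod"
  and F :: "('f :: {complex_normed_vector, banach}, 'b) hilbmod" +
 fixes U :: "'e \<Rightarrow>\<^sub>L 'f"
 assumes unitary: "unitary E F U"
begin

lemma U_Hom: "U \<in> Hom_star E F" and adj_U: "adj E F U \<cdot> U = \<one>" and U_adj: "U \<cdot> adj E F U = \<one>"
 using unitary by (simp_all add: unitary_def)

lemma U_adjoint: "is_adjoint E F U (adj E F U)"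
 by (rule is_adjoint_adj[OF E.hilbert_module_axioms U_Hom])

lemma adj_U_adjoint: "is_adjoint F E (adj E F U) U"
 by (rule is_adjoint_sym[OF E.hilbert_module_axioms F.hilbert_module_axioms U_adjoint])

lemma adj_U_apply [simp]: "adj E F U (U x) = x"
 using arg_cong[OF adj_U, of "\<lambda>T. T x"] by simp

lemma U_adj_apply [simp]: "U (adj E F U y) = y"
 using arg_cong[OF U_adj, of "\<lambda>T. T y"] by simp

lemma norm_U_apply [simp]: "norm (U x) = norm x"
 using is_adjointD[OF U_adjoint, of x "U x"] by (simp add: E.norm_ip F.norm_ip)

lemma norm_adj_U_apply [simp]: "norm (adj E F U y) = norm y"
 using norm_U_apply[of "adj E F U y"] by simp

lemma norm_conj_le: "norm (adj E F U \<cdot> T \<cdot> U) \<le> norm T"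
proof (rule norm_blinfun_bound)
 show "norm ((adj E F U \<cdot> T \<cdot> U) x) \<le> norm T * norm x" for x
  using norm_blinfun[of T "U x"] by simp
qed simp

lemma bounded_calculus_transport:
 assumes "bounded_calculus F \<Phi>" shows "bounded_calculus E (transport E F U \<Phi>)"
proof -
 interpret bounded_calculus F \<Phi> by fact
 show ?thesis
 proof
  fix f g assume f: "f \<in> Cb" and g: "g \<in> Cb"
  show "transport E F U \<Phi> (\<lambda>t. f t + g t) = transport E F U \<Phi> f + transport E F U \<Phi> g"
   by (simp add: transport_def calc_add f g op_simps)
  show "transport E F U \<Phi> (\<lambda>t. f t * g t) = transport E F U \<Phi> f \<cdot> transport E F U \<Phi> g"
   by (rule blinfun_eqI) (simp add: transport_def calc_mult f g)
 next
  fix f :: "real \<Rightarrow> complex" and c assume f: "f \<in> Cb"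
  show "transport E F U \<Phi> (\<lambda>t. c * f t) = c *\<^sub>C transport E F U \<Phi> f"
   by (rule blinfun_eqI) (simp add: transport_def calc_scale f
     adjointable_scaleC[OF F.hilbert_module_axioms E.hilbert_module_axioms adj_U_adjoint])
  show "is_adjoint E E (transport E F U \<Phi> f) (transport E F U \<Phi> (\<lambda>t. cnj (f t)))"
   unfolding transport_def
   using is_adjoint_compose[OF is_adjoint_compose[OF U_adjoint calc_adjoint[OF f]] adj_U_adjoint]
   by (simp add: op_assoc)
  show "norm (transport E F U \<Phi> f) \<le> M" if "\<And>t. cmod (f t) \<le> M" for M
   unfolding transport_def using norm_conj_le calc_norm_le[OF f that] order_trans by blast
 next
  show "transport E F U \<Phi> (\<lambda>_. 1) = \<one>" by (simp add: transport_def calc_one adj_U)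
  show "nondegenerate (transport E F U \<Phi>)"
   unfolding nondegenerate_def transport_def
  proof
   fix x
   have "(\<lambda>n. adj E F U (\<Phi> (cr (cut (real n))) (U x)))
     \<longlonglongrightarrow> adj E F U (U x)"
    using calc_nondegenerate by (intro tendsto_intros) (simp add: nondegenerate_def)
   then show "(\<lambda>n. (adj E F U \<cdot> \<Phi> (cr (cut (real n))) \<cdot> U) x) \<longlonglongrightarrow> x" by simp
  qed
 qed
qed

lemma op_rel_transport: "op_rel (transport E F U \<Phi>) f y z \<longleftrightarrow> op_rel \<Phi> f (U y) (U z)"
proof -
 have "adj E F U a = adj E F U b \<longleftrightarrow> a = b" for a b
  by (metis U_adj_apply)
 then show ?thesis by (simp add: op_rel_def transport_def)
qed

lemma pullback_iff:
 assumes "\<And>y z. D y = Some z \<longleftrightarrow> op_rel \<Phi> f y z"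
 shows "pullback E F U D y = Some z \<longleftrightarrow> op_rel (transport E F U \<Phi>) f y z"
proof -
 have "pullback E F U D y = Some z \<longleftrightarrow> D (U y) = Some (U z)"
  by (auto simp: pullback_def map_comp_def as_op_def split: option.splits)
 then show ?thesis by (simp add: assms op_rel_transport)
qed

end

section \<open>Real functions and commutator estimates\<close>

definition Cbr :: "(real \<Rightarrow> real) set" where
 "Cbr = {f. continuous_on UNIV f \<and> (\<exists>B. \<forall>t. \<bar>f t\<bar> \<le> B)}"

lemma CbrI: "continuous_on UNIV f \<Longrightarrow> (\<And>t. \<bar>f t\<bar> \<le> B) \<Longrightarrow> f \<in> Cbr"
 by (auto simp: Cbr_def)

lemma Cbr_iff: "f \<in> Cbr \<longleftrightarrow> cr f \<in> Cb"
 using continuous_on_Re[of UNIV "cr f"] by (auto simp: Cbr_def Cb_def intro!: continuous_intros)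

lemma Cbr_Cb: "f \<in> Cbr \<Longrightarrow> cr f \<in> Cb"
 by (simp add: Cbr_iff)

lemma Cbr_cont: "f \<in> Cbr \<Longrightarrow> continuous_on UNIV f"
 by (simp add: Cbr_def)

lemma Cbr_bounded: "f \<in> Cbr \<Longrightarrow> \<exists>B\<ge>0. \<forall>t. \<bar>f t\<bar> \<le> B"
 unfolding Cbr_def using order_trans[OF abs_ge_zero] by blast

lemma Cbr_const [simp]: "(\<lambda>_. c) \<in> Cbr"
 by (rule CbrI[of _ "\<bar>c\<bar>"]) auto

lemma Cbr_add [intro]: "f \<in> Cbr \<Longrightarrow> g \<in> Cbr \<Longrightarrow> (\<lambda>t. f t + g t) \<in> Cbr"
 using Cb_add[of "cr f" "cr g"] by (simp add: Cbr_iff)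

lemma Cbr_mult [intro]: "f \<in> Cbr \<Longrightarrow> g \<in> Cbr \<Longrightarrow> (\<lambda>t. f t * g t) \<in> Cbr"
 using Cb_mult[of "cr f" "cr g"] by (simp add: Cbr_iff)

lemma Cbr_diff [intro]: "f \<in> Cbr \<Longrightarrow> g \<in> Cbr \<Longrightarrow> (\<lambda>t. f t - g t) \<in> Cbr"
 using Cbr_add[of f "\<lambda>t. (-1) * g t"] Cbr_mult[of "\<lambda>_. -1" g] by simp

lemma Cbr_scale [intro]: "f \<in> Cbr \<Longrightarrow> (\<lambda>t. c * f t) \<in> Cbr"
 using Cbr_mult[of "\<lambda>_. c" f] by simp

lemma cut_Cbr [simp, intro]: "cut a \<in> Cbr"
 by (rule CbrI[of _ 1]) (auto intro: continuous_intros)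

lemma cut_mult_Cbr: "continuous_on UNIV f \<Longrightarrow> (\<lambda>t. f t * cut a t) \<in> Cbr"
 using Cc_Cb[OF cut_Cc] by (simp add: Cbr_iff)

lemma continuous_on_locally_uniform_limit:
 fixes F :: "nat \<Rightarrow> real \<Rightarrow> real"
 assumes F: "\<And>n. continuous_on UNIV (F n)"
  and lim: "\<And>R e. 0 < e \<Longrightarrow> \<exists>N. \<forall>n\<ge>N. \<forall>t. \<bar>t\<bar> \<le> R \<longrightarrow> \<bar>F n t - f t\<bar> \<le> e"
 shows "continuous_on UNIV f"
proof -
 have "continuous_on {-R<..<R} f" for R
 proof (rule uniform_limit_theorem[of _ F sequentially])
  show "uniform_limit {-R<..<R} F f sequentially"
   unfolding uniform_limit_sequentially_iff
  proof (intro allI impI)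
   fix e :: real assume "0 < e"
   then obtain N where N: "\<And>n t. n \<ge> N \<Longrightarrow> \<bar>t\<bar> \<le> R \<Longrightarrow> \<bar>F n t - f t\<bar> \<le> e / 2"
    using lim[of "e / 2" R] by (metis half_gt_zero)
   show "\<exists>N. \<forall>n\<ge>N. \<forall>x\<in>{-R<..<R}. dist (F n x) (f x) < e"
   proof (intro exI allI impI ballI)
    fix n x assume "N \<le> n" "x \<in> {-R<..<R}"
    then have "\<bar>F n x - f x\<bar> \<le> e / 2" by (intro N) auto
    then show "dist (F n x) (f x) < e" using \<open>0 < e\<close> by (simp add: dist_real_def)
   qed
  qed
  show "\<forall>\<^sub>F n in sequentially. continuous_on {-R<..<R} (F n)"
   by (intro always_eventually allI continuous_on_subset[OF F]) simp
 qed simp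
 then have "continuous_on (\<Union>R. {-R<..<R}) f" by (intro continuous_on_open_UN) auto
 moreover have "(\<Union>R::real. {-R<..<R}) = UNIV"
 proof -
  have "t \<in> {-(\<bar>t\<bar> + 1)<..<\<bar>t\<bar> + 1}" for t :: real by auto
  then show ?thesis by blast
 qed
 ultimately show ?thesis by simp
qed

context bounded_calculus
begin

definition rc :: "(real \<Rightarrow> real) \<Rightarrow> 'e endo" where
 "rc f = \<Phi> (cr f)"

lemma rc_End [simp, intro]: "f \<in> Cbr \<Longrightarrow> rc f \<in> End_star E"
 unfolding rc_def by (intro calc_End Cbr_Cb)

lemma rc_dag [simp]: "f \<in> Cbr \<Longrightarrow> (rc f)\<^sup>* = rc f"
 unfolding rc_def by (intro calc_dag_real Cbr_Cb)

lemma rc_add: "f \<in> Cbr \<Longrightarrow> g \<in> Cbr \<Longrightarrow> rc (\<lambda>t. f t + g t) = rc f + rc g"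
 unfolding rc_def using calc_add[OF Cbr_Cb Cbr_Cb] by simp

lemma rc_diff: "f \<in> Cbr \<Longrightarrow> g \<in> Cbr \<Longrightarrow> rc (\<lambda>t. f t - g t) = rc f - rc g"
 unfolding rc_def using calc_diff[OF Cbr_Cb Cbr_Cb] by simp

lemma rc_mult: "f \<in> Cbr \<Longrightarrow> g \<in> Cbr \<Longrightarrow> rc (\<lambda>t. f t * g t) = rc f \<cdot> rc g"
 unfolding rc_def using calc_mult[OF Cbr_Cb Cbr_Cb] by simp

lemma rc_scale: "f \<in> Cbr \<Longrightarrow> rc (\<lambda>t. c * f t) = c *\<^sub>R rc f"
 unfolding rc_def using calc_scale[OF Cbr_Cb, of f "of_real c"] by (simp add: scaleC_of_real)

lemma rc_one [simp]: "rc (\<lambda>_. 1) = \<one>"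
 unfolding rc_def using calc_one by simp

lemma rc_commute: "f \<in> Cbr \<Longrightarrow> g \<in> Cbr \<Longrightarrow> rc f \<cdot> rc g = rc g \<cdot> rc f"
 unfolding rc_def by (intro calc_commute Cbr_Cb)

lemma rc_norm_le: "f \<in> Cbr \<Longrightarrow> (\<And>t. \<bar>f t\<bar> \<le> M) \<Longrightarrow> norm (rc f) \<le> M"
 unfolding rc_def by (intro calc_norm_le Cbr_Cb) simp_all

lemma rc_sum:
 assumes "\<And>i. i \<in> I \<Longrightarrow> f i \<in> Cbr"
 shows "(\<lambda>t. \<Sum>i\<in>I. f i t) \<in> Cbr" "rc (\<lambda>t. \<Sum>i\<in>I. f i t) = (\<Sum>i\<in>I. rc (f i))"
proof -
 have "(\<lambda>t. \<Sum>i\<in>I. f i t) \<in> Cbr \<and> rc (\<lambda>t. \<Sum>i\<in>I. f i t) = (\<Sum>i\<in>I. rc (f i))"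
  using assms
 proof (induction I rule: infinite_finite_induct)
  case (insert i I)
  then show ?case using rc_add[of "f i" "\<lambda>t. \<Sum>i\<in>I. f i t"] Cbr_add[of "f i" "\<lambda>t. \<Sum>i\<in>I. f i t"] by auto
 qed (use rc_scale[of "\<lambda>_. 0" 0] in auto)
 then show "(\<lambda>t. \<Sum>i\<in>I. f i t) \<in> Cbr" "rc (\<lambda>t. \<Sum>i\<in>I. f i t) = (\<Sum>i\<in>I. rc (f i))" by auto
qed

lemma rc_strong_limit:
 assumes F: "\<And>n. F n \<in> Cbr" and f: "f \<in> Cbr" and B: "\<And>n t. \<bar>F n t\<bar> \<le> B"
  and lim: "\<And>R e. 0 < e \<Longrightarrow> \<exists>N. \<forall>n\<ge>N. \<forall>t. \<bar>t\<bar> \<le> R \<longrightarrow> \<bar>F n t - f t\<bar> \<le> e"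
 shows "(\<lambda>n. rc (F n) x) \<longlonglongrightarrow> rc f x"
 unfolding rc_def
proof (rule calc_strong_limit)
 show "\<exists>N. \<forall>n\<ge>N. \<forall>t. \<bar>t\<bar> \<le> R \<longrightarrow> cmod (cr (F n) t - cr f t) \<le> e" if "0 < e" for R e
  using lim[OF that, of R] by (simp flip: of_real_diff)
qed (use F f B in \<open>auto intro: Cbr_Cb\<close>)

lemma rc_cut_tendsto: "(\<lambda>n. rc (cut (real n)) x) \<longlonglongrightarrow> x"
 using calc_nondegenerate by (simp add: rc_def nondegenerate_def)

end

subsection \<open>Rational functions\<close>

text \<open>At scale \<open>n\<close>, \<open>low n\<close> is a smooth indicator of \<open>|t| \<lesssim> n\<close>, and \<open>n * skew n\<close> is concentrated at \<open>|t| \<approx> n\<close>.\<close>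

definition low :: "real \<Rightarrow> real \<Rightarrow> real" where "low n t = n\<^sup>2 / (n\<^sup>2 + t\<^sup>2)"
definition skew :: "real \<Rightarrow> real \<Rightarrow> real" where "skew n t = t / (n\<^sup>2 + t\<^sup>2)"
definition inv_quad :: "real \<Rightarrow> real \<Rightarrow> real" where "inv_quad n t = 1 / (n\<^sup>2 + t\<^sup>2)"

lemma quad_pos: "0 < n \<Longrightarrow> 0 < n\<^sup>2 + (t :: real)\<^sup>2"
 by (simp add: add_pos_nonneg)

lemma low_inv_quad: "low n t = n\<^sup>2 * inv_quad n t"
 by (simp add: low_def inv_quad_def)

lemma one_minus_low: "0 < n \<Longrightarrow> 1 - low n t = t * skew n t"
 using quad_pos[of n t] by (simp add: low_def skew_def divide_simps power2_eq_square)

lemma low_bounds: "0 < n \<Longrightarrow> 0 \<le> low n t" "0 < n \<Longrightarrow> low n t \<le> 1"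
 using quad_pos[of n t] by (simp_all add: low_def divide_simps)

lemma continuous_on_low: "0 < n \<Longrightarrow> continuous_on UNIV (low n)"
 and continuous_on_skew: "0 < n \<Longrightarrow> continuous_on UNIV (skew n)"
 and continuous_on_inv_quad: "0 < n \<Longrightarrow> continuous_on UNIV (inv_quad n)"
proof -
 assume "0 < n"
 then have "n\<^sup>2 + t\<^sup>2 \<noteq> 0" for t :: real using quad_pos[of n t] by simp
 then show "continuous_on UNIV (low n)" "continuous_on UNIV (skew n)" "continuous_on UNIV (inv_quad n)"
  unfolding low_def[abs_def] skew_def[abs_def] inv_quad_def[abs_def] by (intro continuous_intros; simp)+
qed

lemma abs_le_sqrt_quad: "\<bar>t\<bar> \<le> sqrt (n\<^sup>2 + t\<^sup>2)" "0 < n \<Longrightarrow> n \<le> sqrt (n\<^sup>2 + t\<^sup>2)"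
 by (auto intro: real_le_rsqrt)

lemma bracket_powr_le_quad:
 assumes "1 \<le> n" "0 \<le> \<alpha>"
 shows "bracket t powr \<alpha> \<le> sqrt (n\<^sup>2 + t\<^sup>2) powr \<alpha>"
proof (rule powr_mono2[OF assms(2)])
 have "1\<^sup>2 \<le> n\<^sup>2" using assms by (intro power_mono) auto
 then show "bracket t \<le> sqrt (n\<^sup>2 + t\<^sup>2)" unfolding bracket_def by (intro real_sqrt_le_mono) simp
qed (use bracket_pos[of t] in linarith)

lemma skew_bound: assumes "0 < n" shows "\<bar>skew n t\<bar> \<le> 1 / n"
proof -
 have "n * \<bar>t\<bar> \<le> sqrt (n\<^sup>2 + t\<^sup>2) * sqrt (n\<^sup>2 + t\<^sup>2)"
  using abs_le_sqrt_quad[of t n] abs_le_sqrt_quad(2)[of n t] assms by (intro mult_mono) auto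
 then have "n * \<bar>t\<bar> \<le> n\<^sup>2 + t\<^sup>2" by simp
 then show ?thesis
  using quad_pos[OF assms, of t] assms by (simp add: skew_def abs_divide pos_divide_le_eq pos_le_divide_eq mult.commute)
qed

lemma inv_quad_bound: assumes "0 < n" shows "\<bar>inv_quad n t\<bar> \<le> 1 / n\<^sup>2"
 using quad_pos[OF assms, of t] assms by (simp add: inv_quad_def frac_le)

text \<open>The weight \<open>\<langle>t\<rangle>\<^sup>\<alpha>\<close> costs a factor \<open>n\<^sup>\<alpha>\<close>.\<close>

lemma weighted_bounds:
 assumes n: "1 \<le> n" and \<alpha>: "0 \<le> \<alpha>" "\<alpha> < 1"
 shows weighted_skew: "\<bar>bracket t powr \<alpha> * skew n t\<bar> \<le> n powr (\<alpha> - 1)"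
  and weighted_inv_quad: "\<bar>bracket t powr \<alpha> * inv_quad n t\<bar> \<le> n powr (\<alpha> - 2)"
  and weighted_low: "\<bar>bracket t powr \<alpha> * low n t\<bar> \<le> n powr \<alpha>"
proof -
 define q where "q = sqrt (n\<^sup>2 + t\<^sup>2)"
 have q: "0 < q" "n \<le> q" unfolding q_def using quad_pos[of n t] abs_le_sqrt_quad(2)[of n t] n by auto
 have qq: "n\<^sup>2 + t\<^sup>2 = q powr 2" using q quad_pos[of n t] n by (simp add: powr_numeral) (simp add: q_def)
 have w: "bracket t powr \<alpha> \<le> q powr \<alpha>"
  unfolding q_def by (rule bracket_powr_le_quad[OF n \<alpha>(1)])
 have tq: "\<bar>t\<bar> \<le> q" unfolding q_def by (rule abs_le_sqrt_quad)
 have p: "q powr (\<alpha> - 1) \<le> n powr (\<alpha> - 1)" "q powr (\<alpha> - 2) \<le> n powr (\<alpha> - 2)"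
  using q n \<alpha> by (auto intro!: powr_mono2')
 have i: "bracket t powr \<alpha> * (1 / (n\<^sup>2 + t\<^sup>2)) \<le> q powr (\<alpha> - 2)"
 proof -
  have "bracket t powr \<alpha> * (1 / (n\<^sup>2 + t\<^sup>2)) \<le> q powr \<alpha> * (1 / q powr 2)"
   unfolding qq using w by (intro mult_right_mono) auto
  then show ?thesis by (simp add: powr_diff)
 qed
 then show "\<bar>bracket t powr \<alpha> * inv_quad n t\<bar> \<le> n powr (\<alpha> - 2)"
  using p(2) quad_pos[of n t] n by (simp add: inv_quad_def abs_mult)
 have "bracket t powr \<alpha> * (1 / (n\<^sup>2 + t\<^sup>2)) * \<bar>t\<bar> \<le> q powr (\<alpha> - 2) * q"
  using i tq by (intro mult_mono) auto
 also have "\<dots> = q powr (\<alpha> - 1)" using q powr_add[of q "\<alpha> - 2" 1] by simp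
 finally show "\<bar>bracket t powr \<alpha> * skew n t\<bar> \<le> n powr (\<alpha> - 1)"
  using p(1) quad_pos[of n t] n by (simp add: skew_def abs_mult abs_divide)
 have "bracket t powr \<alpha> * (1 / (n\<^sup>2 + t\<^sup>2)) * n\<^sup>2 \<le> n powr (\<alpha> - 2) * n\<^sup>2"
  using order_trans[OF i p(2)] by (intro mult_right_mono) auto
 also have "\<dots> = n powr \<alpha>" using n powr_add[of n "\<alpha> - 2" 2] by (simp add: powr_numeral)
 finally show "\<bar>bracket t powr \<alpha> * low n t\<bar> \<le> n powr \<alpha>"
  using quad_pos[of n t] n by (simp add: low_def abs_mult abs_divide)
qed

lemma rational_Cbr [simp]:
 assumes "0 < n"
 shows "low n \<in> Cbr" "skew n \<in> Cbr" "inv_quad n \<in> Cbr" "(\<lambda>t. t * skew n t) \<in> Cbr" "(\<lambda>t. t * inv_quad n t) \<in> Cbr"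
  "(\<lambda>t. t * low n t) \<in> Cbr"
proof -
 show low: "low n \<in> Cbr" using low_bounds[OF assms] by (intro CbrI[of _ 1] continuous_on_low assms) auto
 show skew: "skew n \<in> Cbr" by (intro CbrI[of _ "1 / n"] continuous_on_skew skew_bound assms)
 show "inv_quad n \<in> Cbr" by (intro CbrI[of _ "1 / n\<^sup>2"] continuous_on_inv_quad inv_quad_bound assms)
 have "(\<lambda>t. t * skew n t) = (\<lambda>t. 1 - low n t)" using one_minus_low[OF assms] by simp
 then show "(\<lambda>t. t * skew n t) \<in> Cbr" using Cbr_diff[OF Cbr_const[of 1] low] by simp
 have "(\<lambda>t. t * inv_quad n t) = skew n" by (auto simp: inv_quad_def skew_def)
 then show "(\<lambda>t. t * inv_quad n t) \<in> Cbr" using skew by simp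
 have "(\<lambda>t. t * low n t) = (\<lambda>t. n\<^sup>2 * skew n t)" by (auto simp: low_def skew_def)
 then show "(\<lambda>t. t * low n t) \<in> Cbr" using Cbr_scale[OF skew] by simp
qed

text \<open>The functions \<open>g\<close> for which \<open>g(D)\<close> and \<open>D g(D)\<close> are bounded.\<close>

definition Cb1 :: "(real \<Rightarrow> real) set" where
 "Cb1 = {g \<in> Cbr. (\<lambda>t. t * g t) \<in> Cbr}"

lemma Cb1_Cbr: "g \<in> Cb1 \<Longrightarrow> g \<in> Cbr" "g \<in> Cb1 \<Longrightarrow> (\<lambda>t. t * g t) \<in> Cbr"
 by (auto simp: Cb1_def)

lemma rational_Cb1 [simp]: "0 < n \<Longrightarrow> low n \<in> Cb1" "0 < n \<Longrightarrow> skew n \<in> Cb1" "0 < n \<Longrightarrow> inv_quad n \<in> Cb1"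
 by (simp_all add: Cb1_def)

lemma Cb1_mult: "f \<in> Cbr \<Longrightarrow> g \<in> Cb1 \<Longrightarrow> (\<lambda>t. f t * g t) \<in> Cb1"
 using Cbr_mult[of f "\<lambda>t. t * g t"] by (auto simp: Cb1_def mult.left_commute)

lemma weighted_Cbr:
 assumes g: "g \<in> Cb1" and \<alpha>: "0 \<le> \<alpha>" "\<alpha> < 1"
 shows "(\<lambda>t. bracket t powr \<alpha> * g t) \<in> Cbr"
proof -
 obtain A where A: "\<And>t. \<bar>g t\<bar> \<le> A" using Cbr_bounded[OF Cb1_Cbr(1)[OF g]] by blast
 obtain B where B: "\<And>t. \<bar>t * g t\<bar> \<le> B" using Cbr_bounded[OF Cb1_Cbr(2)[OF g]] by blast
 show ?thesis
 proof (rule CbrI[of _ "A + B"])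
  show "continuous_on UNIV (\<lambda>t. bracket t powr \<alpha> * g t)"
   using Cbr_cont[OF Cb1_Cbr(1)[OF g]] by (intro continuous_intros) auto
  fix t
  have "bracket t powr \<alpha> \<le> bracket t powr 1" using \<alpha> by (intro powr_mono bracket_ge_1) auto
  also have "\<dots> \<le> 1 + \<bar>t\<bar>"
  proof -
   have "1 + t\<^sup>2 \<le> (1 + \<bar>t\<bar>)\<^sup>2" by (simp add: power2_sum)
   then show ?thesis using bracket_pos[of t] by (simp add: bracket_def real_le_lsqrt)
  qed
  finally have "bracket t powr \<alpha> * \<bar>g t\<bar> \<le> (1 + \<bar>t\<bar>) * \<bar>g t\<bar>" by (intro mult_right_mono) auto
  then show "\<bar>bracket t powr \<alpha> * g t\<bar> \<le> A + B"
   using A[of t] B[of t] by (simp add: abs_mult distrib_right)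
 qed
qed

subsection \<open>Intertwining up to order alpha\<close>

text \<open>
 For calculi \<open>\<Psi>\<^sub>2\<close> of \<open>D\<^sub>2\<close> and \<open>\<Psi>\<^sub>1\<close> of \<open>D\<^sub>1\<close> this says that \<open>D\<^sub>2 c - d D\<^sub>1 = \<langle>D\<^sub>2\<rangle>\<^sup>\<alpha> X\<close>, without mentioning
 domains.
\<close>

definition intertwines ::
 "real \<Rightarrow> ((real \<Rightarrow> real) \<Rightarrow> 'e endo) \<Rightarrow> ((real \<Rightarrow> real) \<Rightarrow> 'e endo) \<Rightarrow>
  ('e :: real_normed_vector) endo \<Rightarrow> 'e endo \<Rightarrow> 'e endo \<Rightarrow> bool" where
 "intertwines \<alpha> \<Psi>\<^sub>2 \<Psi>\<^sub>1 c d X \<longleftrightarrow> (\<forall>g\<in>Cb1. \<forall>h\<in>Cb1.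
   \<Psi>\<^sub>2 (\<lambda>t. t * g t) \<cdot> c \<cdot> \<Psi>\<^sub>1 h - \<Psi>\<^sub>2 g \<cdot> d \<cdot> \<Psi>\<^sub>1 (\<lambda>t. t * h t)
    = \<Psi>\<^sub>2 (\<lambda>t. bracket t powr \<alpha> * g t) \<cdot> X \<cdot> \<Psi>\<^sub>1 h)"

lemma intertwinesD:
 "intertwines \<alpha> \<Psi>\<^sub>2 \<Psi>\<^sub>1 c d X \<Longrightarrow> g \<in> Cb1 \<Longrightarrow> h \<in> Cb1 \<Longrightarrow>
   \<Psi>\<^sub>2 (\<lambda>t. t * g t) \<cdot> c \<cdot> \<Psi>\<^sub>1 h = \<Psi>\<^sub>2 g \<cdot> d \<cdot> \<Psi>\<^sub>1 (\<lambda>t. t * h t) + \<Psi>\<^sub>2 (\<lambda>t. bracket t powr \<alpha> * g t) \<cdot> X \<cdot> \<Psi>\<^sub>1 h"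
proof -
 assume "intertwines \<alpha> \<Psi>\<^sub>2 \<Psi>\<^sub>1 c d X" "g \<in> Cb1" "h \<in> Cb1"
 then have "\<Psi>\<^sub>2 (\<lambda>t. t * g t) \<cdot> c \<cdot> \<Psi>\<^sub>1 h - \<Psi>\<^sub>2 g \<cdot> d \<cdot> \<Psi>\<^sub>1 (\<lambda>t. t * h t)
    = \<Psi>\<^sub>2 (\<lambda>t. bracket t powr \<alpha> * g t) \<cdot> X \<cdot> \<Psi>\<^sub>1 h"
  unfolding intertwines_def by blast
 then show ?thesis by (simp only: diff_eq_eq add.commute)
qed

context bounded_calculus
begin

definition comm :: "(real \<Rightarrow> real) \<Rightarrow> 'e endo \<Rightarrow> 'e endo" where
 "comm f x = rc f \<cdot> x - x \<cdot> rc f"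

lemma comm_End [intro]: "f \<in> Cbr \<Longrightarrow> x \<in> End_star E \<Longrightarrow> comm f x \<in> End_star E"
 by (auto simp: comm_def)

lemma comm_dag: "f \<in> Cbr \<Longrightarrow> x \<in> End_star E \<Longrightarrow> comm f (x\<^sup>*) = - ((comm f x)\<^sup>*)"
 by (simp add: comm_def)

lemma norm_comm_dag: "f \<in> Cbr \<Longrightarrow> x \<in> End_star E \<Longrightarrow> norm (comm f (x\<^sup>*)) = norm (comm f x)"
 by (simp only: comm_dag norm_minus_cancel norm_dag comm_End)

lemma comm_mult:
 assumes "f \<in> Cbr" "g \<in> Cbr"
 shows "comm (\<lambda>t. f t * g t) x = rc f \<cdot> comm g x + comm f x \<cdot> rc g"
 by (simp add: comm_def rc_mult assms op_simps)

text \<open>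
 Tested with \<open>skew n\<close> and \<open>inv_quad n\<close>, the hypothesis gives four identities between products of \<open>x\<close> with
 \<open>S = D (n\<^sup>2 + D\<^sup>2)\<^sup>-\<^sup>1\<close> and \<open>G = (n\<^sup>2 + D\<^sup>2)\<^sup>-\<^sup>1\<close>.  They combine to formulas for \<open>[S, x]\<close> and \<open>[G, x]\<close> in which \<open>X\<close> stands
 between two of the factors \<open>S\<close>, \<open>G\<close>, one of them weighted by \<open>\<langle>D\<rangle>\<^sup>\<alpha>\<close>.
\<close>

lemma comm_skew_low:
 assumes x: "intertwines \<alpha> rc rc x x X" and n: "1 \<le> n" and \<alpha>: "0 \<le> \<alpha>" "\<alpha> < 1"
 shows norm_comm_skew: "norm (comm (skew n) x) \<le> 2 * norm X * n powr (\<alpha> - 2)"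
  and norm_comm_low: "norm (comm (low n) x) \<le> 2 * norm X * n powr (\<alpha> - 1)"
proof -
 have n0: "0 < n" using n by simp
 let ?G = "rc (inv_quad n)" and ?S = "rc (skew n)"
 let ?wG = "rc (\<lambda>t. bracket t powr \<alpha> * inv_quad n t)" and ?wS = "rc (\<lambda>t. bracket t powr \<alpha> * skew n t)"
 have tG: "(\<lambda>t. t * inv_quad n t) = skew n" by (auto simp: inv_quad_def skew_def)
 have tS: "rc (\<lambda>t. t * skew n t) = \<one> - n\<^sup>2 *\<^sub>R ?G"
 proof -
  have "(\<lambda>t. t * skew n t) = (\<lambda>t. 1 - n\<^sup>2 * inv_quad n t)"
   using one_minus_low[OF n0] by (simp add: low_inv_quad)
  then show ?thesis using n0 by (simp add: rc_diff rc_scale Cbr_scale)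
 qed
 have nwS: "norm ?wS \<le> n powr (\<alpha> - 1)" and nwG: "norm ?wG \<le> n powr (\<alpha> - 2)"
  using n0 by (auto intro!: rc_norm_le weighted_Cbr weighted_bounds n \<alpha>)
 have nS: "norm ?S \<le> 1 / n" and nG: "norm ?G \<le> 1 / n\<^sup>2"
  using n0 by (auto intro!: rc_norm_le skew_bound inv_quad_bound)
 have p1: "n powr (\<alpha> - 1) * (1 / n) = n powr (\<alpha> - 2)"
  using n0 powr_diff[of n "\<alpha> - 1" 1] by simp
 have p2: "n powr (\<alpha> - 2) * (1 / n\<^sup>2) * n\<^sup>2 = n powr (\<alpha> - 2)" using n0 by simp
 have i1: "(\<one> - n\<^sup>2 *\<^sub>R ?G) \<cdot> x \<cdot> ?S = ?S \<cdot> x \<cdot> (\<one> - n\<^sup>2 *\<^sub>R ?G) + ?wS \<cdot> X \<cdot> ?S"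
  using intertwinesD[OF x, of "skew n" "skew n"] n0 by (simp add: tS)
 have i2: "?S \<cdot> x \<cdot> ?G = ?G \<cdot> x \<cdot> ?S + ?wG \<cdot> X \<cdot> ?G"
  using intertwinesD[OF x, of "inv_quad n" "inv_quad n"] n0 by (simp add: tG)
 have i3: "(\<one> - n\<^sup>2 *\<^sub>R ?G) \<cdot> x \<cdot> ?G = ?S \<cdot> x \<cdot> ?S + ?wS \<cdot> X \<cdot> ?G"
  using intertwinesD[OF x, of "skew n" "inv_quad n"] n0 by (simp add: tS tG)
 have i4: "?S \<cdot> x \<cdot> ?S = ?G \<cdot> x \<cdot> (\<one> - n\<^sup>2 *\<^sub>R ?G) + ?wG \<cdot> X \<cdot> ?S"
  using intertwinesD[OF x, of "inv_quad n" "skew n"] n0 by (simp add: tS tG)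
 have "comm (skew n) x = n\<^sup>2 *\<^sub>R (?wG \<cdot> X \<cdot> ?G) - ?wS \<cdot> X \<cdot> ?S"
 proof -
  have "x \<cdot> ?S - n\<^sup>2 *\<^sub>R (?G \<cdot> x \<cdot> ?S) = ?S \<cdot> x - n\<^sup>2 *\<^sub>R (?S \<cdot> x \<cdot> ?G) + ?wS \<cdot> X \<cdot> ?S"
   using i1 by (simp add: op_simps op_scaleR)
  then show ?thesis unfolding i2 comm_def by (simp add: scaleR_add_right algebra_simps)
 qed
 also have "norm \<dots> \<le> n powr (\<alpha> - 2) * norm X + n powr (\<alpha> - 2) * norm X"
 proof (intro order_trans[OF norm_triangle_ineq4] add_mono)
  have "norm (?wG \<cdot> X \<cdot> ?G) \<le> n powr (\<alpha> - 2) * norm X * (1 / n\<^sup>2)"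
   by (intro norm_compose_le nwG nG order_refl)
  then have "norm (n\<^sup>2 *\<^sub>R (?wG \<cdot> X \<cdot> ?G)) \<le> n\<^sup>2 * (n powr (\<alpha> - 2) * norm X * (1 / n\<^sup>2))"
   by (simp only: norm_scaleR abs_power2) (intro mult_left_mono, auto)
  then show "norm (n\<^sup>2 *\<^sub>R (?wG \<cdot> X \<cdot> ?G)) \<le> n powr (\<alpha> - 2) * norm X" using n0 by simp
  have "norm (?wS \<cdot> X \<cdot> ?S) \<le> n powr (\<alpha> - 1) * norm X * (1 / n)"
   by (intro norm_compose_le nwS nS order_refl)
  then show "norm (?wS \<cdot> X \<cdot> ?S) \<le> n powr (\<alpha> - 2) * norm X"
   by (simp only: p1[symmetric] mult_ac)
 qed
 finally show "norm (comm (skew n) x) \<le> 2 * norm X * n powr (\<alpha> - 2)" by (simp add: mult_ac)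
 have lowG: "rc (low n) = n\<^sup>2 *\<^sub>R ?G"
  using n0 rc_scale[of "inv_quad n" "n\<^sup>2"] by (simp add: low_inv_quad[abs_def])
 have low: "comm (low n) x = - n\<^sup>2 *\<^sub>R (?wS \<cdot> X \<cdot> ?G + ?wG \<cdot> X \<cdot> ?S)"
 proof -
  have "x \<cdot> ?G - n\<^sup>2 *\<^sub>R (?G \<cdot> x \<cdot> ?G) = ?G \<cdot> x - n\<^sup>2 *\<^sub>R (?G \<cdot> x \<cdot> ?G) + ?wG \<cdot> X \<cdot> ?S + ?wS \<cdot> X \<cdot> ?G"
   using i3 unfolding i4 by (simp add: op_simps op_scaleR)
  then have "x \<cdot> ?G - ?G \<cdot> x = ?wS \<cdot> X \<cdot> ?G + ?wG \<cdot> X \<cdot> ?S" by (simp add: algebra_simps)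
  then have "- n\<^sup>2 *\<^sub>R (x \<cdot> ?G - ?G \<cdot> x) = - n\<^sup>2 *\<^sub>R (?wS \<cdot> X \<cdot> ?G + ?wG \<cdot> X \<cdot> ?S)" by (rule arg_cong)
  then show ?thesis
   unfolding comm_def lowG
   by (simp add: op_scaleR scaleR_diff_right algebra_simps)
 qed
 have "norm (comm (low n) x) = n\<^sup>2 * norm (?wS \<cdot> X \<cdot> ?G + ?wG \<cdot> X \<cdot> ?S)"
  unfolding low by (simp only: norm_scaleR abs_minus_cancel abs_power2)
 also have "\<dots> \<le> n\<^sup>2 * (n powr (\<alpha> - 1) * norm X * (1 / n\<^sup>2) + n powr (\<alpha> - 2) * norm X * (1 / n))"
 proof (intro mult_left_mono order_trans[OF norm_triangle_ineq] add_mono)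
  show "norm (?wS \<cdot> X \<cdot> ?G) \<le> n powr (\<alpha> - 1) * norm X * (1 / n\<^sup>2)"
   by (intro norm_compose_le nwS nG order_refl)
  show "norm (?wG \<cdot> X \<cdot> ?S) \<le> n powr (\<alpha> - 2) * norm X * (1 / n)"
   by (intro norm_compose_le nwG nS order_refl)
 qed simp
 also have "\<dots> = 2 * norm X * n powr (\<alpha> - 1)"
 proof -
  have "n powr (\<alpha> - 2) = n powr (\<alpha> - 1) / n" using p1 by simp
  then show ?thesis using n0 by (simp add: field_simps power2_eq_square)
 qed
 finally show "norm (comm (low n) x) \<le> 2 * norm X * n powr (\<alpha> - 1)" .
qed

end

section \<open>The logarithm\<close>

subsection \<open>Dyadic sums\<close>

definition mid :: "real \<Rightarrow> real \<Rightarrow> real" where "mid n t = n * skew n t"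

lemma mid_Cbr [simp]: "0 < n \<Longrightarrow> mid n \<in> Cbr"
 unfolding mid_def[abs_def] by (intro Cbr_scale rational_Cbr)

lemma abs_mid_le: "0 < n \<Longrightarrow> \<bar>mid n t\<bar> \<le> \<bar>t\<bar> / n"
proof -
 assume n: "0 < n"
 have "n * (n * \<bar>t\<bar>) \<le> \<bar>t\<bar> * (n\<^sup>2 + t\<^sup>2)"
 proof -
  have "0 \<le> \<bar>t\<bar> * t\<^sup>2" by simp
  then show ?thesis by (simp add: distrib_left power2_eq_square mult_ac)
 qed
 then show ?thesis
  using quad_pos[OF n, of t] n by (simp add: mid_def skew_def abs_mult divide_simps mult_ac)
qed

lemma abs_mid_le_1: "0 < n \<Longrightarrow> \<bar>mid n t\<bar> \<le> 1"
 using skew_bound[of n t] mult_left_mono[of "\<bar>skew n t\<bar>" "1 / n" n] by (simp add: mid_def abs_mult)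

text \<open>
 With \<open>s = |t|\<close> the bracket equals \<open>n s / ((n + 2 s) (n + s))\<close>, and \<open>(n + 2 s) (n + s) \<le> 7/2 (n\<^sup>2 + s\<^sup>2)\<close>.  For
 \<open>n = 2\<^sup>k\<close> the right-hand sides telescope.
\<close>

lemma abs_mid_telescope:
 assumes "0 < n"
 shows "\<bar>mid n t\<bar> \<le> 7/2 * (2 * \<bar>t\<bar> / (n + 2 * \<bar>t\<bar>) - \<bar>t\<bar> / (n + \<bar>t\<bar>))"
proof -
 define s where "s = \<bar>t\<bar>"
 have s: "0 \<le> s" "t\<^sup>2 = s\<^sup>2" by (auto simp: s_def)
 have "2 * s / (n + 2 * s) - s / (n + s) = n * s / ((n + 2 * s) * (n + s))"
  using assms s by (simp add: divide_simps) (simp add: algebra_simps)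
 moreover have "n * s / (n\<^sup>2 + s\<^sup>2) \<le> 7/2 * (n * s / ((n + 2 * s) * (n + s)))"
 proof -
  define P Q where "P = (n + 2 * s) * (n + s)" and "Q = n\<^sup>2 + s\<^sup>2"
  have "P \<le> 7/2 * Q"
   using zero_le_power2[of "n - s"] zero_le_power2[of n] unfolding P_def Q_def
   by (simp add: power2_eq_square algebra_simps del: zero_le_square)
  moreover have "0 < P" "0 < Q" using assms s by (auto simp: quad_pos P_def Q_def)
  ultimately have "1 / Q \<le> 7/2 / P" by (simp add: divide_simps mult.commute)
  then have "n * s * (1 / Q) \<le> n * s * (7/2 / P)" using assms s by (intro mult_left_mono) auto
  then show ?thesis unfolding P_def[symmetric] Q_def[symmetric] by simp
 qed
 ultimately show ?thesis
  using quad_pos[OF assms, of t] assms by (simp add: mid_def skew_def abs_mult s_def[symmetric] s(2))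
qed

lemma sum_abs_mid_le: "(\<Sum>k<K. \<bar>mid (2 ^ k) t\<bar>) \<le> 7/2"
proof -
 let ?h = "\<lambda>n. \<bar>t\<bar> / (n + \<bar>t\<bar>)"
 have "(\<Sum>k<K. \<bar>mid (2 ^ k) t\<bar>) \<le> 7/2 * (?h (1/2) - ?h (2 ^ K / 2))"
 proof (induction K)
  case (Suc K)
  have "2 * \<bar>t\<bar> / (2 ^ K + 2 * \<bar>t\<bar>) = 2 * \<bar>t\<bar> / (2 * (2 ^ K / 2 + \<bar>t\<bar>))"
   by (rule arg_cong[where f = "\<lambda>u. 2 * \<bar>t\<bar> / u"]) simp
  also have "\<dots> = ?h (2 ^ K / 2)" by (rule mult_divide_mult_cancel_left) simp
  finally have "2 * \<bar>t\<bar> / (2 ^ K + 2 * \<bar>t\<bar>) = ?h (2 ^ K / 2)" .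
  then show ?case using Suc abs_mid_telescope[of "2 ^ K" t] by simp
 qed simp
 also have "\<dots> \<le> 7/2"
 proof -
  have "?h (1/2) \<le> 1" by (simp add: divide_simps)
  moreover have "0 \<le> ?h (2 ^ K / 2)" by (intro divide_nonneg_nonneg add_nonneg_nonneg) auto
  ultimately have "?h (1/2) - ?h (2 ^ K / 2) \<le> 1" by linarith
  then have "7/2 * (?h (1/2) - ?h (2 ^ K / 2)) \<le> 7/2 * 1" by (intro mult_left_mono) auto
  then show ?thesis by (simp only: mult_1_right)
 qed
 finally show ?thesis .
qed

text \<open>The limit \<open>dyadic_log_lim\<close> equals \<open>log\<^sub>2 \<langle>t\<rangle>\<close> up to a bounded error, by comparison with a telescoping sum.\<close>

definition dyadic_log :: "nat \<Rightarrow> real \<Rightarrow> real" where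
 "dyadic_log K t = (\<Sum>k<K. 1 - low (2 ^ k) t)"

definition dyadic_log_lim :: "real \<Rightarrow> real" where
 "dyadic_log_lim t = (\<Sum>k. 1 - low (2 ^ k) t)"

lemma one_minus_low_bounds: "0 < n \<Longrightarrow> 0 \<le> 1 - low n t" "0 < n \<Longrightarrow> 1 - low n t \<le> t\<^sup>2 / n\<^sup>2"
proof -
 assume n: "0 < n"
 show "0 \<le> 1 - low n t" using low_bounds[OF n, of t] by simp
 have "1 - low n t = t\<^sup>2 / (n\<^sup>2 + t\<^sup>2)" using one_minus_low[OF n] by (simp add: skew_def power2_eq_square)
 also have "\<dots> \<le> t\<^sup>2 / n\<^sup>2" using n by (intro divide_left_mono) (auto simp: quad_pos)
 finally show "1 - low n t \<le> t\<^sup>2 / n\<^sup>2" .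
qed

lemma dyadic_log_sums:
 shows dyadic_log_tendsto: "(\<lambda>K. dyadic_log K t) \<longlonglongrightarrow> dyadic_log_lim t"
  and dyadic_log_le: "dyadic_log K t \<le> dyadic_log_lim t"
  and dyadic_log_tail: "dyadic_log_lim t - dyadic_log K t \<le> 2 * t\<^sup>2 / 4 ^ K"
proof -
 let ?f = "\<lambda>k. 1 - low (2 ^ k) t"
 have f: "0 \<le> ?f k" "?f k \<le> t\<^sup>2 * (1/4) ^ k" for k
  using one_minus_low_bounds[of "2 ^ k" t] by (auto simp: power_divide power_mult_distrib power2_eq_square simp flip: power_mult_distrib)
 have g: "(\<lambda>k. t\<^sup>2 * (1/4) ^ (k + K) :: real) sums (t\<^sup>2 * (1/4) ^ K * (1 / (1 - 1/4)))" for K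
  using sums_mult[OF geometric_sums[of "1/4 :: real"], of "t\<^sup>2 * (1/4) ^ K"] by (simp add: power_add mult_ac)
 have s: "summable ?f"
  using f sums_summable[OF g[of 0]] by (intro summable_comparison_test[of ?f "\<lambda>k. t\<^sup>2 * (1/4) ^ k"]) auto
 show "(\<lambda>K. dyadic_log K t) \<longlonglongrightarrow> dyadic_log_lim t"
  unfolding dyadic_log_def dyadic_log_lim_def by (rule summable_LIMSEQ[OF s])
 show "dyadic_log K t \<le> dyadic_log_lim t"
  unfolding dyadic_log_def dyadic_log_lim_def by (intro sum_le_suminf s ballI f) simp_all
 have "dyadic_log_lim t - dyadic_log K t = (\<Sum>k. ?f (k + K))"
  using suminf_minus_initial_segment[OF s, of K] by (simp add: dyadic_log_def dyadic_log_lim_def)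
 also have "\<dots> \<le> (\<Sum>k. t\<^sup>2 * (1/4) ^ (k + K))"
  by (intro suminf_le f summable_ignore_initial_segment s sums_summable[OF g])
 also have "\<dots> = t\<^sup>2 * (1/4) ^ K * (1 / (1 - 1/4))" by (rule sums_unique[OF g, symmetric])
 also have "\<dots> \<le> t\<^sup>2 * (1/4) ^ K * 2" by (intro mult_left_mono) auto
 also have "\<dots> = 2 * t\<^sup>2 / 4 ^ K" by (simp add: power_divide)
 finally show "dyadic_log_lim t - dyadic_log K t \<le> 2 * t\<^sup>2 / 4 ^ K" .
qed

lemma continuous_on_dyadic_log: "continuous_on UNIV (dyadic_log K)"
 unfolding dyadic_log_def[abs_def] by (intro continuous_on_sum continuous_intros continuous_on_low) simp

lemma dyadic_log_Cbr [simp]: "dyadic_log K \<in> Cbr"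
proof (rule CbrI[OF continuous_on_dyadic_log])
 fix t
 have "\<bar>dyadic_log K t\<bar> \<le> (\<Sum>k<K. \<bar>1 - low (2 ^ k) t\<bar>)" unfolding dyadic_log_def by (rule sum_abs)
 also have "\<dots> \<le> (\<Sum>k<K. 1)" using low_bounds by (intro sum_mono) (auto simp: abs_le_iff)
 finally show "\<bar>dyadic_log K t\<bar> \<le> real K" by simp
qed

lemma dyadic_log_locally_uniform:
 assumes "0 < e" shows "\<exists>N. \<forall>n\<ge>N. \<forall>t. \<bar>t\<bar> \<le> R \<longrightarrow> \<bar>dyadic_log n t - dyadic_log_lim t\<bar> \<le> e"
proof -
 have "(\<lambda>n. 2 * R\<^sup>2 * (1/4) ^ n) \<longlonglongrightarrow> 2 * R\<^sup>2 * 0" by (intro tendsto_intros LIMSEQ_realpow_zero) auto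
 then have "\<forall>\<^sub>F n in sequentially. 2 * R\<^sup>2 * (1/4) ^ n < e" using assms by (simp add: order_tendstoD)
 then obtain N where N: "\<And>n. N \<le> n \<Longrightarrow> 2 * R\<^sup>2 * (1/4) ^ n < e" by (auto simp: eventually_sequentially)
 have "\<bar>dyadic_log n t - dyadic_log_lim t\<bar> \<le> e" if "N \<le> n" "\<bar>t\<bar> \<le> R" for n t
 proof -
  have "t\<^sup>2 \<le> R\<^sup>2" using that(2) abs_le_square_iff[of t R] by simp
  then have "2 * t\<^sup>2 / 4 ^ n \<le> 2 * R\<^sup>2 * (1/4) ^ n" by (simp add: power_divide divide_right_mono)
  then show ?thesis using dyadic_log_tail[of t n] dyadic_log_le[of n t] N[OF that(1)] by linarith
 qed
 then show ?thesis by blast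
qed

lemma continuous_on_dyadic_log_lim: "continuous_on UNIV dyadic_log_lim"
 by (rule continuous_on_locally_uniform_limit[OF continuous_on_dyadic_log dyadic_log_locally_uniform])

text \<open>Both are the weighted inequality of arithmetic and geometric means with weights \<open>y / (1 + y)\<close> and \<open>1 / (1 + y)\<close>.\<close>

lemma log_steps:
 fixes y :: real assumes "0 \<le> y"
 shows "ln (1 + y) - ln (1 + y / 4) \<le> ln 4 * (y / (1 + y))"
  and "ln 4 * (y / (1 + y)) \<le> ln (1 + 4 * y) - ln (1 + y)"
proof -
 define u where "u = y / (1 + y)"
 have u: "0 \<le> u" "u \<le> 1" using assms by (auto simp: u_def)
 have "(1/4) powr u * 1 powr (1 - u) \<le> u * (1/4) + (1 - u) * 1" using u by (intro Youngs_inequality_0) auto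
 moreover have "u * (1/4) + (1 - u) * 1 = (1 + y / 4) / (1 + y)"
  using assms by (simp add: u_def divide_simps) (simp add: algebra_simps)
 ultimately have "ln ((1/4) powr u) \<le> ln ((1 + y / 4) / (1 + y))" using assms by (intro ln_mono) auto
 then have "- (u * ln 4) \<le> ln (1 + y / 4) - ln (1 + y)"
  using assms by (simp add: ln_powr ln_div)
 then show "ln (1 + y) - ln (1 + y / 4) \<le> ln 4 * (y / (1 + y))" unfolding u_def[symmetric] by (simp add: mult.commute)
 have "4 powr u * 1 powr (1 - u) \<le> u * 4 + (1 - u) * 1" using u by (intro Youngs_inequality_0) auto
 moreover have "u * 4 + (1 - u) * 1 = (1 + 4 * y) / (1 + y)"
  using assms by (simp add: u_def divide_simps)
 ultimately have "ln (4 powr u) \<le> ln ((1 + 4 * y) / (1 + y))" using assms by (intro ln_mono) auto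
 then have "u * ln 4 \<le> ln (1 + 4 * y) - ln (1 + y)"
  using assms by (simp add: ln_powr ln_div)
 then show "ln 4 * (y / (1 + y)) \<le> ln (1 + 4 * y) - ln (1 + y)" unfolding u_def[symmetric] by (simp add: mult.commute)
qed

lemma dyadic_log_bounds:
 shows dyadic_log_ge: "ln (1 + t\<^sup>2) - ln (1 + t\<^sup>2 / 4 ^ K) \<le> ln 4 * dyadic_log K t"
  and dyadic_log_le_ln: "ln 4 * dyadic_log K t \<le> ln (1 + t\<^sup>2) + ln 4"
proof -
 have step: "1 - low (2 ^ k) t = (t\<^sup>2 / 4 ^ k) / (1 + t\<^sup>2 / 4 ^ k)" for k
 proof -
  have "((2::real) ^ k)\<^sup>2 = 4 ^ k" by (simp add: power2_eq_square flip: power_mult_distrib)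
  then show ?thesis using quad_pos[of "2 ^ k" t] by (simp add: low_def divide_simps)
 qed
 show "ln (1 + t\<^sup>2) - ln (1 + t\<^sup>2 / 4 ^ K) \<le> ln 4 * dyadic_log K t"
 proof (induction K)
  case (Suc K)
  then show ?case using log_steps(1)[of "t\<^sup>2 / 4 ^ K"] by (simp add: dyadic_log_def step distrib_left mult.commute)
 qed (simp add: dyadic_log_def)
 have "ln 4 * dyadic_log (Suc K) t \<le> ln (1 + t\<^sup>2) + ln 4 - ln (1 + t\<^sup>2 / 4 ^ K)" for K
 proof (induction K)
  case 0
  have "ln 4 * (1 - low 1 t) \<le> ln 4 * 1" using low_bounds(1)[of 1 t] by (intro mult_left_mono) auto
  then show ?case by (simp add: dyadic_log_def)
 next
  case (Suc K)
  have "4 * (t\<^sup>2 / 4 ^ Suc K) = t\<^sup>2 / 4 ^ K" by simp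
  then have "ln 4 * (1 - low (2 ^ Suc K) t) \<le> ln (1 + t\<^sup>2 / 4 ^ K) - ln (1 + t\<^sup>2 / 4 ^ Suc K)"
   unfolding step using log_steps(2)[of "t\<^sup>2 / 4 ^ Suc K"] by simp
  moreover have "dyadic_log (Suc (Suc K)) t = dyadic_log (Suc K) t + (1 - low (2 ^ Suc K) t)"
   by (simp add: dyadic_log_def)
  ultimately show ?case using Suc by (simp only: distrib_left)
 qed
 note le = this
 have "ln 4 * dyadic_log (Suc K) t \<le> ln (1 + t\<^sup>2) + ln 4"
 proof -
  have "0 \<le> ln (1 + t\<^sup>2 / 4 ^ K)" by (intro ln_ge_zero) simp
  then show ?thesis using le[of K] by linarith
 qed
 moreover have "ln 4 * dyadic_log K t \<le> ln 4 * dyadic_log (Suc K) t"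
  using low_bounds(2)[of "2 ^ K" t] by (intro mult_left_mono) (auto simp: dyadic_log_def)
 ultimately show "ln 4 * dyadic_log K t \<le> ln (1 + t\<^sup>2) + ln 4" by linarith
qed

lemma dyadic_log_lim_Cbr: "(\<lambda>t. ln 2 * dyadic_log_lim t - ln (bracket t)) \<in> Cbr"
proof (rule CbrI)
 show "continuous_on UNIV (\<lambda>t. ln 2 * dyadic_log_lim t - ln (bracket t))"
  using bracket_pos by (intro continuous_intros continuous_on_dyadic_log_lim) (simp add: less_imp_neq[symmetric])
 fix t
 have l4: "ln 4 = 2 * ln (2 :: real)" using ln_realpow[of 2 2] by simp
 have lb: "ln (1 + t\<^sup>2) = 2 * ln (bracket t)"
  using add_pos_nonneg[of 1 "t\<^sup>2"] by (simp add: bracket_def ln_sqrt)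
 have lim: "(\<lambda>K. ln 4 * dyadic_log K t) \<longlonglongrightarrow> ln 4 * dyadic_log_lim t"
  by (intro tendsto_intros dyadic_log_tendsto)
 have u: "ln 4 * dyadic_log_lim t \<le> ln (1 + t\<^sup>2) + ln 4"
  by (rule LIMSEQ_le_const2[OF lim]) (auto intro: dyadic_log_le_ln)
 have "(\<lambda>K. ln (1 + t\<^sup>2) - ln (1 + t\<^sup>2 * (1/4) ^ K)) \<longlonglongrightarrow> ln (1 + t\<^sup>2) - ln (1 + t\<^sup>2 * 0)"
  by (intro tendsto_intros LIMSEQ_realpow_zero) auto
 then have "ln (1 + t\<^sup>2) \<le> ln 4 * dyadic_log_lim t"
  using lim dyadic_log_ge[of t] by (intro LIMSEQ_le[of "\<lambda>K. ln (1 + t\<^sup>2) - ln (1 + t\<^sup>2 * (1/4) ^ K)" _ "\<lambda>K. ln 4 * dyadic_log K t"]) (auto simp: power_divide)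
 with u show "\<bar>ln 2 * dyadic_log_lim t - ln (bracket t)\<bar> \<le> ln 2"
  unfolding l4 lb by simp
qed

subsection \<open>Square functions\<close>

text \<open>
 A randomisation argument: \<open>\<Sum> A\<^sub>k X B\<^sub>k\<close> is the average of \<open>(\<Sum> \<epsilon>\<^sub>k A\<^sub>k) X (\<Sum> \<epsilon>\<^sub>k B\<^sub>k)\<close> over all choices of signs.
\<close>

lemma norm_sum_sandwich_le:
 fixes X :: "'e :: real_normed_vector \<Rightarrow>\<^sub>L 'e"
 assumes "\<And>s :: nat \<Rightarrow> real. (\<And>k. s k = 1 \<or> s k = - 1) \<Longrightarrow> norm (A0 + (\<Sum>k<K. s k *\<^sub>R A k)) \<le> a"
  and "\<And>s :: nat \<Rightarrow> real. (\<And>k. s k = 1 \<or> s k = - 1) \<Longrightarrow> norm (B0 + (\<Sum>k<K. s k *\<^sub>R B k)) \<le> b"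
 shows "norm (A0 \<cdot> X \<cdot> B0 + (\<Sum>k<K. A k \<cdot> X \<cdot> B k)) \<le> a * norm X * b"
 using assms
proof (induction K arbitrary: A0 B0)
 case 0
 have "norm A0 \<le> a" "norm B0 \<le> b" using 0(1)[of "\<lambda>_. 1"] 0(2)[of "\<lambda>_. 1"] by simp_all
 then have "norm (A0 \<cdot> X \<cdot> B0) \<le> a * norm X * b" by (intro norm_compose_le order_refl)
 then show ?case by simp
next
 case (Suc K)
 let ?S = "\<Sum>k<K. A k \<cdot> X \<cdot> B k"
 have e: "norm ((A0 + e *\<^sub>R A K) \<cdot> X \<cdot> (B0 + e *\<^sub>R B K) + ?S) \<le> a * norm X * b" if e: "e = 1 \<or> e = - 1" for e
 proof (rule Suc.IH)
  fix s :: "nat \<Rightarrow> real" assume s: "\<And>k. s k = 1 \<or> s k = - 1"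
  define s' where "s' = s(K := e)"
  have s': "\<And>k. s' k = 1 \<or> s' k = - 1" "s' K = e" using e s by (auto simp: s'_def)
  have eq: "(\<Sum>k<K. s' k *\<^sub>R T k) = (\<Sum>k<K. s k *\<^sub>R T k)" for T :: "nat \<Rightarrow> 'c :: real_vector"
   by (rule sum.cong) (auto simp: s'_def)
  show "norm (A0 + e *\<^sub>R A K + (\<Sum>k<K. s k *\<^sub>R A k)) \<le> a"
   using Suc.prems(1)[of s', OF s'(1)] by (simp only: sum.lessThan_Suc s'(2) eq add_ac)
  show "norm (B0 + e *\<^sub>R B K + (\<Sum>k<K. s k *\<^sub>R B k)) \<le> b"
   using Suc.prems(2)[of s', OF s'(1)] by (simp only: sum.lessThan_Suc s'(2) eq add_ac)
 qed
 define P where "P = (A0 + A K) \<cdot> X \<cdot> (B0 + B K) + ?S"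
 define M where "M = (A0 - A K) \<cdot> X \<cdot> (B0 - B K) + ?S"
 have n: "norm P \<le> a * norm X * b" "norm M \<le> a * norm X * b"
  using e[of 1] e[of "- 1"] by (simp_all add: P_def M_def)
 have "P + M = 2 *\<^sub>R (A0 \<cdot> X \<cdot> B0 + (\<Sum>k<Suc K. A k \<cdot> X \<cdot> B k))"
  unfolding P_def M_def by (simp add: op_simps scaleR_2 algebra_simps)
 then have "2 * norm (A0 \<cdot> X \<cdot> B0 + (\<Sum>k<Suc K. A k \<cdot> X \<cdot> B k)) = norm (P + M)" by simp
 also have "\<dots> \<le> 2 * (a * norm X * b)" using norm_triangle_ineq[of P M] n by linarith
 finally show ?case by simp
qed

locale two_calculi = hilbert_module E + A: bounded_calculus E \<Phi>\<^sub>1 + B: bounded_calculus E \<Phi>\<^sub>2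
 for E :: "('e :: {complex_normed_vector, banach}, 'b :: cstar_algebra) hilbmod"
  and \<Phi>\<^sub>1 \<Phi>\<^sub>2 :: "'e calculus"

lemma (in bounded_calculus) norm_sum_mid_le:
 fixes s :: "nat \<Rightarrow> real"
 assumes "\<And>k. s k = 1 \<or> s k = - 1"
 shows "norm (\<Sum>k<K. s k *\<^sub>R rc (mid (2 ^ k))) \<le> 7/2"
proof -
 have C: "(\<lambda>t. s k * mid (2 ^ k) t) \<in> Cbr" for k by (intro Cbr_scale mid_Cbr) simp
 have "(\<Sum>k<K. s k *\<^sub>R rc (mid (2 ^ k))) = rc (\<lambda>t. \<Sum>k<K. s k * mid (2 ^ k) t)"
  by (simp add: rc_sum(2)[OF C] rc_scale)
 also have "norm \<dots> \<le> 7/2"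
 proof (rule rc_norm_le[OF rc_sum(1)[OF C]])
  fix t
  have "\<bar>s k\<bar> = 1" for k using assms[of k] by auto
  then have "\<bar>\<Sum>k<K. s k * mid (2 ^ k) t\<bar> \<le> (\<Sum>k<K. \<bar>mid (2 ^ k) t\<bar>)"
   by (intro order_trans[OF sum_abs]) (simp add: abs_mult)
  then show "\<bar>\<Sum>k<K. s k * mid (2 ^ k) t\<bar> \<le> 7/2" using sum_abs_mid_le[where K = K and t = t] by linarith
 qed
 finally show ?thesis .
qed

context two_calculi
begin

definition square_fun :: "'e endo \<Rightarrow> nat \<Rightarrow> 'e endo" where
 "square_fun X K = (\<Sum>k<K. A.rc (mid (2 ^ k)) \<cdot> X \<cdot> B.rc (mid (2 ^ k)))"

lemma norm_square_fun_le: "norm (square_fun X K) \<le> 7/2 * norm X * (7/2)"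
 using norm_sum_sandwich_le[of 0 "\<lambda>k. A.rc (mid (2 ^ k))" K "7/2" 0 "\<lambda>k. B.rc (mid (2 ^ k))" "7/2" X]
  A.norm_sum_mid_le B.norm_sum_mid_le
 by (simp add: square_fun_def)

text \<open>On vectors of the form \<open>cut n (D\<^sub>2) x\<close>, which are dense, the series converges geometrically.\<close>

lemma square_fun_convergent: "convergent (\<lambda>K. square_fun X K x)"
proof (rule bounded_strongly_convergent[OF norm_square_fun_le])
 fix x e assume "(0 :: real) < e"
 then have "\<forall>\<^sub>F n in sequentially. dist (B.rc (cut (real n)) x) x < e"
  using B.rc_cut_tendsto by (simp add: tendstoD)
 then obtain n where n: "dist (B.rc (cut (real n)) x) x < e"
  by (auto simp: eventually_sequentially)
 let ?y = "B.rc (cut (real n)) x"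
 let ?f = "\<lambda>k. (A.rc (mid (2 ^ k)) \<cdot> X \<cdot> B.rc (mid (2 ^ k))) ?y"
 have "norm (?f k) \<le> norm X * (real n + 1) * norm x * (1/2) ^ k" for k
 proof -
  have "norm (B.rc (\<lambda>t. mid (2 ^ k) t * cut (real n) t)) \<le> (real n + 1) / 2 ^ k"
  proof (rule B.rc_norm_le)
   show "(\<lambda>t. mid (2 ^ k) t * cut (real n) t) \<in> Cbr" by (intro Cbr_mult mid_Cbr cut_Cbr) simp
   fix t
   show "\<bar>mid (2 ^ k) t * cut (real n) t\<bar> \<le> (real n + 1) / 2 ^ k"
   proof (cases "real n + 1 \<le> \<bar>t\<bar>")
    case False
    have "\<bar>mid (2 ^ k) t * cut (real n) t\<bar> \<le> \<bar>t\<bar> / 2 ^ k * 1"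
     unfolding abs_mult by (intro mult_mono abs_mid_le) auto
    also have "\<dots> \<le> (real n + 1) / 2 ^ k" using False by (simp add: divide_right_mono)
    finally show ?thesis .
   qed (simp add: cut_eq_0)
  qed
  then have "norm (A.rc (mid (2 ^ k)) \<cdot> X \<cdot> B.rc (\<lambda>t. mid (2 ^ k) t * cut (real n) t)) \<le> 1 * norm X * ((real n + 1) / 2 ^ k)"
   by (intro norm_compose_le order_refl A.rc_norm_le abs_mid_le_1 mid_Cbr) simp_all
  moreover have "?f k = (A.rc (mid (2 ^ k)) \<cdot> X \<cdot> B.rc (\<lambda>t. mid (2 ^ k) t * cut (real n) t)) x"
   by (simp add: B.rc_mult)
  ultimately have "norm (?f k) \<le> 1 * norm X * ((real n + 1) / 2 ^ k) * norm x"
   by (simp only:) (rule order_trans[OF norm_blinfun mult_right_mono], simp_all)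
  then show ?thesis by (simp add: power_divide mult_ac)
 qed
 moreover have "summable (\<lambda>k. norm X * (real n + 1) * norm x * (1/2) ^ k)"
  by (intro summable_mult summable_geometric) simp
 ultimately have "summable ?f"
  by (intro summable_comparison_test[of ?f "\<lambda>k. norm X * (real n + 1) * norm x * (1/2) ^ k"]) blast+
 then have "convergent (\<lambda>K. square_fun X K ?y)"
  by (simp add: summable_iff_convergent square_fun_def blinfun.sum_left)
 then show "\<exists>y. norm (x - y) < e \<and> convergent (\<lambda>K. square_fun X K y)"
  using n by (intro exI[of _ ?y]) (simp add: dist_norm norm_minus_commute)
qed

text \<open>The adjoints of the partial sums are partial sums of the same kind, for \<open>X\<^sup>*\<close> and with the two calculi exchanged.\<close>

lemma square_fun_limit:
 assumes X: "X \<in> End_star E"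
 obtains R where "R \<in> End_star E" "\<And>x. (\<lambda>K. square_fun X K x) \<longlonglongrightarrow> R x"
proof -
 interpret swap: two_calculi E \<Phi>\<^sub>2 \<Phi>\<^sub>1 by unfold_locales
 have End: "square_fun X K \<in> End_star E" for K
  unfolding square_fun_def by (intro End_star_sum End_star_compose X A.rc_End B.rc_End mid_Cbr) simp_all
 have dag: "(square_fun X K)\<^sup>* = swap.square_fun (X\<^sup>*) K" for K
  unfolding square_fun_def swap.square_fun_def by (subst dag_sum) (simp_all add: X op_assoc)
 show ?thesis
 proof (rule strong_limit_adjointable[OF End norm_square_fun_le])
  show "(\<lambda>K. square_fun X K x) \<longlonglongrightarrow> lim (\<lambda>K. square_fun X K x)" for x
   using square_fun_convergent by (simp add: convergent_LIMSEQ_iff)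
  show "(\<lambda>K. ((square_fun X K)\<^sup>*) x) \<longlonglongrightarrow> lim (\<lambda>K. swap.square_fun (X\<^sup>*) K x)" for x
   unfolding dag using swap.square_fun_convergent by (simp add: convergent_LIMSEQ_iff)
  fix R assume "R \<in> End_star E" and R: "\<And>x. R x = lim (\<lambda>K. square_fun X K x)"
  moreover have "(\<lambda>K. square_fun X K x) \<longlonglongrightarrow> R x" for x
   unfolding R using square_fun_convergent by (simp add: convergent_LIMSEQ_iff)
  ultimately show thesis using that[of R] by blast
 qed
qed

end

subsection \<open>The commutator with the logarithm\<close>

text \<open>
 \<open>D\<^sub>1\<close> and \<open>D\<^sub>2\<close> enter through their calculi.  For a conformal transformation \<open>c = a \<mu>\<^sup>-\<^sup>1\<^sup>*\<close>, \<open>d = a \<mu>\<close>,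
 \<open>p = \<mu>\<close> and \<open>q = \<mu>\<^sup>-\<^sup>1\<^sup>*\<close>; for commutators with \<open>D\<^sub>1\<close> take \<open>c = d = a\<close> and \<open>p = q = 1\<close>.
\<close>

locale conformal_pair = two_calculi E \<Phi>\<^sub>1 \<Phi>\<^sub>2
 for E :: "('e :: {complex_normed_vector, banach}, 'b :: cstar_algebra) hilbmod" and \<Phi>\<^sub>1 \<Phi>\<^sub>2 +
 fixes \<alpha> :: real and a c d p q X X\<^sub>a X\<^sub>c X\<^sub>d :: "'e endo"
 assumes \<alpha>: "0 \<le> \<alpha>" "\<alpha> < 1"
  and End [simp]: "a \<in> End_star E" "c \<in> End_star E" "d \<in> End_star E" "p \<in> End_star E" "q \<in> End_star E"
   "X \<in> End_star E"
  and a_c: "a\<^sup>* = p \<cdot> c\<^sup>*" and a_d: "a\<^sup>* = q \<cdot> d\<^sup>*" and a_p: "a \<cdot> p = d"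
  and intertwines: "intertwines \<alpha> B.rc A.rc c d X"
  and comm_a: "intertwines \<alpha> A.rc A.rc a a X\<^sub>a"
  and comm_c: "intertwines \<alpha> A.rc A.rc c c X\<^sub>c"
  and comm_d: "intertwines \<alpha> A.rc A.rc d d X\<^sub>d"
begin

lemma intertwines_dag:
 assumes g: "g \<in> Cb1" and h: "h \<in> Cb1"
 shows "A.rc h \<cdot> c\<^sup>* \<cdot> B.rc (\<lambda>t. t * g t)
  = A.rc (\<lambda>t. t * h t) \<cdot> d\<^sup>* \<cdot> B.rc g + A.rc h \<cdot> X\<^sup>* \<cdot> B.rc (\<lambda>t. bracket t powr \<alpha> * g t)"
 using arg_cong[OF intertwinesD[OF intertwines g h], of "\<lambda>T. T\<^sup>*"]
 by (simp add: Cb1_Cbr g h weighted_Cbr \<alpha> op_assoc)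

definition diff :: "(real \<Rightarrow> real) \<Rightarrow> 'e endo" where
 "diff f = A.rc f \<cdot> a\<^sup>* - a\<^sup>* \<cdot> B.rc f"

lemma diff_End [intro]: "f \<in> Cbr \<Longrightarrow> diff f \<in> End_star E"
 unfolding diff_def by auto

text \<open>
 With \<open>K\<^sub>i = n\<^sup>2 (n\<^sup>2 + D\<^sub>i\<^sup>2)\<^sup>-\<^sup>1\<close>, the difference is \<open>K\<^sub>1 a\<^sup>* (1 - K\<^sub>2) - (1 - K\<^sub>1) a\<^sup>* K\<^sub>2\<close>.  In the first term \<open>a\<^sup>*\<close> is replaced by
 \<open>p c\<^sup>*\<close> and in the second by \<open>q d\<^sup>*\<close>; commutators with \<open>K\<^sub>1\<close> bring \<open>p\<close> and \<open>q\<close> to the left.  Since \<open>1 - K\<^sub>i\<close> is \<open>D\<^sub>i\<close> times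
 \<open>D\<^sub>i (n\<^sup>2 + D\<^sub>i\<^sup>2)\<^sup>-\<^sup>1\<close>, the intertwining relation moves one factor \<open>D\<^sub>i\<close> across and makes the two terms symmetric.
\<close>

lemma diff_low:
 assumes n: "1 \<le> n"
 shows "norm (diff (low n) - (p \<cdot> (A.rc (mid n) \<cdot> d\<^sup>* \<cdot> B.rc (mid n)) - q \<cdot> (A.rc (mid n) \<cdot> c\<^sup>* \<cdot> B.rc (mid n))))
  \<le> (norm p * norm X + norm q * norm X + (2 * norm X\<^sub>a + norm p * (2 * norm X\<^sub>c))
    + (norm q * (2 * norm X\<^sub>d) + 2 * norm X\<^sub>a)) * n powr (\<alpha> - 1)" (is "norm ?e \<le> ?C * ?r")
proof -
 have n0: "0 < n" using n by simp
 let ?K1 = "A.rc (low n)" and ?K2 = "B.rc (low n)"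
 let ?S1 = "A.rc (mid n)" and ?S2 = "B.rc (mid n)"
 let ?w = "\<lambda>f. B.rc (\<lambda>t. bracket t powr \<alpha> * f t)"
 have t_low: "(\<lambda>t. t * low n t) = (\<lambda>t. n * mid n t)"
  by (auto simp: low_def mid_def skew_def power2_eq_square)
 have t_skew: "(\<lambda>t. t * skew n t) = (\<lambda>t. 1 - low n t)" using one_minus_low[OF n0] by auto
 have skew: "A.rc (skew n) = (1 / n) *\<^sub>R ?S1" "B.rc (skew n) = (1 / n) *\<^sub>R ?S2"
  using n0 A.rc_scale[of "mid n" "1 / n"] B.rc_scale[of "mid n" "1 / n"] by (simp_all add: mid_def)
 have one: "A.rc (\<lambda>t. 1 - low n t) = \<one> - ?K1" "B.rc (\<lambda>t. 1 - low n t) = \<one> - ?K2"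
  using n0 by (simp_all add: A.rc_diff B.rc_diff)
 have nt: "A.rc (\<lambda>t. n * mid n t) = n *\<^sub>R ?S1" "B.rc (\<lambda>t. n * mid n t) = n *\<^sub>R ?S2"
  using n0 by (simp_all add: A.rc_scale B.rc_scale)
 have i1: "?K1 \<cdot> c\<^sup>* \<cdot> (\<one> - ?K2) = ?S1 \<cdot> d\<^sup>* \<cdot> ?S2 + ?K1 \<cdot> X\<^sup>* \<cdot> ?w (skew n)"
  using intertwines_dag[of "skew n" "low n"] n0
  by (simp add: t_low t_skew one nt skew op_scaleR)
 have i2: "?S1 \<cdot> c\<^sup>* \<cdot> ?S2 = (\<one> - ?K1) \<cdot> d\<^sup>* \<cdot> ?K2 + A.rc (skew n) \<cdot> X\<^sup>* \<cdot> ?w (low n)"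
  using intertwines_dag[of "low n" "skew n"] n0
  by (simp add: t_low t_skew one nt skew(1) op_scaleR)
 define k\<^sub>a k\<^sub>c k\<^sub>d where "k\<^sub>a = A.comm (low n) (a\<^sup>*)" and "k\<^sub>c = A.comm (low n) (c\<^sup>*)" and "k\<^sub>d = A.comm (low n) (d\<^sup>*)"
 have k: "norm k\<^sub>a \<le> 2 * norm X\<^sub>a * ?r" "norm k\<^sub>c \<le> 2 * norm X\<^sub>c * ?r" "norm k\<^sub>d \<le> 2 * norm X\<^sub>d * ?r"
  unfolding k\<^sub>a_def k\<^sub>c_def k\<^sub>d_def
  using A.norm_comm_low[OF comm_a n \<alpha>] A.norm_comm_low[OF comm_c n \<alpha>] A.norm_comm_low[OF comm_d n \<alpha>] n0
  by (simp_all only: A.norm_comm_dag rational_Cbr End)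
 have u1: "?K1 \<cdot> a\<^sup>* = p \<cdot> (?K1 \<cdot> c\<^sup>*) + (k\<^sub>a - p \<cdot> k\<^sub>c)"
  unfolding k\<^sub>a_def k\<^sub>c_def A.comm_def a_c by (simp add: op_simps)
 have u2: "a\<^sup>* - ?K1 \<cdot> a\<^sup>* = q \<cdot> ((\<one> - ?K1) \<cdot> d\<^sup>*) + (q \<cdot> k\<^sub>d - k\<^sub>a)"
  unfolding k\<^sub>a_def k\<^sub>d_def A.comm_def a_d by (simp add: op_simps)
 have "diff (low n) = ?K1 \<cdot> a\<^sup>* \<cdot> (\<one> - ?K2) - (a\<^sup>* - ?K1 \<cdot> a\<^sup>*) \<cdot> ?K2"
  unfolding diff_def by (simp add: op_simps)
 also have "\<dots> = p \<cdot> (?K1 \<cdot> c\<^sup>* \<cdot> (\<one> - ?K2)) + (k\<^sub>a - p \<cdot> k\<^sub>c) \<cdot> (\<one> - ?K2)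
   - (q \<cdot> ((\<one> - ?K1) \<cdot> d\<^sup>* \<cdot> ?K2) + (q \<cdot> k\<^sub>d - k\<^sub>a) \<cdot> ?K2)"
  unfolding u2 unfolding u1 by (simp only: blinfun_compose.add_left op_assoc)
 also have "\<dots> = p \<cdot> (?S1 \<cdot> d\<^sup>* \<cdot> ?S2) - q \<cdot> (?S1 \<cdot> c\<^sup>* \<cdot> ?S2)
   + (p \<cdot> (?K1 \<cdot> X\<^sup>* \<cdot> ?w (skew n)) + q \<cdot> (A.rc (skew n) \<cdot> X\<^sup>* \<cdot> ?w (low n))
     + (k\<^sub>a - p \<cdot> k\<^sub>c) \<cdot> (\<one> - ?K2) - (q \<cdot> k\<^sub>d - k\<^sub>a) \<cdot> ?K2)"
  unfolding i1 i2 by (simp only: blinfun_compose.add_right) (simp only: algebra_simps)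
 finally have "?e = p \<cdot> (?K1 \<cdot> X\<^sup>* \<cdot> ?w (skew n)) + q \<cdot> (A.rc (skew n) \<cdot> X\<^sup>* \<cdot> ?w (low n))
     + (k\<^sub>a - p \<cdot> k\<^sub>c) \<cdot> (\<one> - ?K2) - (q \<cdot> k\<^sub>d - k\<^sub>a) \<cdot> ?K2" (is "_ = ?e1 + ?e2 + ?e3 - ?e4")
  by (simp only: add_diff_cancel_left')
 moreover have "norm ?e1 \<le> norm p * (1 * norm X * ?r)"
 proof -
  have "norm ?K1 \<le> 1" by (intro A.rc_norm_le) (use n0 low_bounds[OF n0] in auto)
  moreover have "norm (?w (skew n)) \<le> ?r"
   using n0 by (intro B.rc_norm_le weighted_Cbr weighted_skew n \<alpha>) auto
  ultimately show ?thesis by (intro norm_compose_le order_refl) simp_all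
 qed
 moreover have "norm ?e2 \<le> norm q * (norm X * ?r)"
 proof -
  have "norm (A.rc (skew n)) \<le> 1 / n" using n0 by (intro A.rc_norm_le skew_bound) auto
  moreover have "norm (?w (low n)) \<le> n powr \<alpha>"
   using n0 by (intro B.rc_norm_le weighted_Cbr weighted_low n \<alpha>) auto
  ultimately have "norm ?e2 \<le> norm q * (1 / n * norm X * n powr \<alpha>)" by (intro norm_compose_le order_refl) simp_all
  moreover have "1 / n * norm X * n powr \<alpha> = norm X * ?r" using n0 by (simp add: powr_diff)
  ultimately show ?thesis by (simp only:)
 qed
 moreover have "norm ?e3 \<le> (2 * norm X\<^sub>a * ?r + norm p * (2 * norm X\<^sub>c * ?r)) * 1"
 proof (rule norm_compose_le)
  show "norm (\<one> - ?K2) \<le> 1"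
   unfolding one[symmetric] using n0 low_bounds[OF n0] by (intro B.rc_norm_le Cbr_diff) auto
  show "norm (k\<^sub>a - p \<cdot> k\<^sub>c) \<le> 2 * norm X\<^sub>a * ?r + norm p * (2 * norm X\<^sub>c * ?r)"
   by (intro order_trans[OF norm_triangle_ineq4] add_mono norm_compose_le k order_refl)
 qed
 moreover have "norm ?e4 \<le> (norm q * (2 * norm X\<^sub>d * ?r) + 2 * norm X\<^sub>a * ?r) * 1"
 proof (rule norm_compose_le)
  show "norm ?K2 \<le> 1" by (intro B.rc_norm_le) (use n0 low_bounds[OF n0] in auto)
  show "norm (q \<cdot> k\<^sub>d - k\<^sub>a) \<le> norm q * (2 * norm X\<^sub>d * ?r) + 2 * norm X\<^sub>a * ?r"
   by (intro order_trans[OF norm_triangle_ineq4] add_mono norm_compose_le k order_refl)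
 qed
 ultimately have "norm ?e \<le> norm p * (1 * norm X * ?r) + norm q * (norm X * ?r)
   + (2 * norm X\<^sub>a * ?r + norm p * (2 * norm X\<^sub>c * ?r)) * 1 + (norm q * (2 * norm X\<^sub>d * ?r) + 2 * norm X\<^sub>a * ?r) * 1"
  by (simp only:) (rule order_trans[OF norm_triangle_ineq4], intro add_mono norm_triangle_mono)
 also have "\<dots> = ?C * ?r" by (simp add: algebra_simps)
 finally show ?thesis .
qed

text \<open>The square functions converge strongly, and the errors, of order \<open>2\<^bsup>k(\<alpha> - 1)\<^esup>\<close>, are summable in norm because \<open>\<alpha> < 1\<close>.\<close>

lemma diff_dyadic_log:
 obtains T where "T \<in> End_star E" "\<And>x. (\<lambda>K. diff (dyadic_log K) x) \<longlonglongrightarrow> T x"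
proof -
 let ?M = "\<lambda>y n. A.rc (mid n) \<cdot> y\<^sup>* \<cdot> B.rc (mid n)"
 define err where "err k = diff (low (2 ^ k)) - (p \<cdot> ?M d (2 ^ k) - q \<cdot> ?M c (2 ^ k))" for k :: nat
 obtain R_d where d: "R_d \<in> End_star E" "\<And>x. (\<lambda>K. square_fun (d\<^sup>*) K x) \<longlonglongrightarrow> R_d x"
  using square_fun_limit[of "d\<^sup>*"] by auto
 obtain R_c where c: "R_c \<in> End_star E" "\<And>x. (\<lambda>K. square_fun (c\<^sup>*) K x) \<longlonglongrightarrow> R_c x"
  using square_fun_limit[of "c\<^sup>*"] by auto
 obtain C where C: "\<And>n. 1 \<le> n \<Longrightarrow> norm (diff (low n) - (p \<cdot> ?M d n - q \<cdot> ?M c n)) \<le> C * n powr (\<alpha> - 1)"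
  using diff_low by blast
 have err_End: "err k \<in> End_star E" for k
  unfolding err_def by (intro End_star_diff End_star_compose diff_End rational_Cbr A.rc_End B.rc_End mid_Cbr End_star_dag End) simp_all
 have "summable err"
 proof (rule summable_comparison_test)
  have "norm (err k) \<le> C * (2 powr (\<alpha> - 1)) ^ k" for k
  proof -
   have "((2 :: real) ^ k) powr (\<alpha> - 1) = (2 powr (\<alpha> - 1)) ^ k"
    by (simp add: powr_powr powr_power mult.commute flip: powr_realpow)
   then show ?thesis using C[of "2 ^ k"] by (simp only: err_def one_le_power one_le_numeral)
  qed
  then show "\<exists>N. \<forall>k\<ge>N. norm (err k) \<le> C * (2 powr (\<alpha> - 1)) ^ k" by blast
  have "(2 :: real) powr (\<alpha> - 1) < 2 powr 0" using \<alpha> by (intro powr_less_mono) auto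
  then show "summable (\<lambda>k. C * (2 powr (\<alpha> - 1)) ^ k)" by (intro summable_mult summable_geometric) simp
 qed
 then have lim: "(\<lambda>K. \<Sum>k<K. err k) \<longlonglongrightarrow> suminf err" by (rule summable_LIMSEQ)
 have R: "suminf err \<in> End_star E"
  by (rule norm_limit_adjointable(1)[OF _ lim]) (intro End_star_sum err_End)
 have "diff (dyadic_log K) = q \<cdot> square_fun (c\<^sup>*) K - p \<cdot> square_fun (d\<^sup>*) K - (\<Sum>k<K. err k)" for K
 proof -
  have one: "A.rc (\<lambda>t. 1 - low (2 ^ k) t) = \<one> - A.rc (low (2 ^ k))"
   "B.rc (\<lambda>t. 1 - low (2 ^ k) t) = \<one> - B.rc (low (2 ^ k))" for k :: nat
   by (simp_all add: A.rc_diff B.rc_diff)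
  have C: "(\<lambda>t. 1 - low (2 ^ k) t) \<in> Cbr" for k :: nat by (intro Cbr_diff) simp_all
  have "diff (dyadic_log K) = (\<Sum>k<K. - diff (low (2 ^ k)))"
   unfolding dyadic_log_def[abs_def] diff_def A.rc_sum(2)[OF C] B.rc_sum(2)[OF C] one
   by (simp add: op_sum op_simps flip: sum_subtractf)
  also have "\<dots> = (\<Sum>k<K. q \<cdot> ?M c (2 ^ k) - p \<cdot> ?M d (2 ^ k) - err k)"
   by (rule sum.cong) (simp_all add: err_def)
  also have "\<dots> = q \<cdot> square_fun (c\<^sup>*) K - p \<cdot> square_fun (d\<^sup>*) K - (\<Sum>k<K. err k)"
   by (simp add: square_fun_def blinfun_compose.sum_right sum_subtractf)
  finally show ?thesis .
 qed
 then have "(\<lambda>K. diff (dyadic_log K) x) \<longlonglongrightarrow> (q \<cdot> R_c - p \<cdot> R_d - suminf err) x" for x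
  by (simp add: minus_blinfun.rep_eq) (intro tendsto_intros c d lim)
 then show ?thesis by (intro that[of "q \<cdot> R_c - p \<cdot> R_d - suminf err"] End_star_diff End_star_compose End c(1) d(1) R)
qed

end

definition Ccr :: "(real \<Rightarrow> real) set" where
 "Ccr = {f. continuous_on UNIV f \<and> (\<exists>R. \<forall>t. R < \<bar>t\<bar> \<longrightarrow> f t = 0)}"

lemma Ccr_mult: "f \<in> Ccr \<Longrightarrow> continuous_on UNIV h \<Longrightarrow> (\<lambda>t. h t * f t) \<in> Ccr"
 by (auto simp: Ccr_def intro!: continuous_intros)

lemma Ccr_Cbr: "f \<in> Ccr \<Longrightarrow> f \<in> Cbr"
 using Cc_Cb[of "cr f"] by (auto simp: Cbr_iff Ccr_def Cc_def intro!: continuous_intros)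

lemma (in bounded_calculus) rc_locally_uniform_limit:
 assumes h: "\<And>n. continuous_on UNIV (h n)" "continuous_on UNIV l" and g: "g \<in> Ccr"
  and le: "\<And>n t. \<bar>h n t\<bar> \<le> \<bar>l t\<bar>"
  and lim: "\<And>R e. 0 < e \<Longrightarrow> \<exists>N. \<forall>n\<ge>N. \<forall>t. \<bar>t\<bar> \<le> R \<longrightarrow> \<bar>h n t - l t\<bar> \<le> e"
 shows "(\<lambda>n. rc (\<lambda>t. h n t * g t) x) \<longlonglongrightarrow> rc (\<lambda>t. l t * g t) x"
proof -
 obtain B where B: "\<And>t. \<bar>l t * g t\<bar> \<le> B" using Cbr_bounded[OF Ccr_Cbr[OF Ccr_mult[OF g h(2)]]] by blast
 obtain G where G: "0 \<le> G" "\<And>t. \<bar>g t\<bar> \<le> G" using Cbr_bounded[OF Ccr_Cbr[OF g]] by blast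
 show ?thesis
 proof (rule rc_strong_limit)
  show "(\<lambda>t. h n t * g t) \<in> Cbr" for n by (rule Ccr_Cbr[OF Ccr_mult[OF g h(1)]])
  show "(\<lambda>t. l t * g t) \<in> Cbr" by (rule Ccr_Cbr[OF Ccr_mult[OF g h(2)]])
  show "\<bar>h n t * g t\<bar> \<le> B" for n t
   using B[of t] mult_right_mono[OF le[of n t], of "\<bar>g t\<bar>"] by (simp add: abs_mult)
  fix R e assume e: "(0 :: real) < e"
  have "0 < e / (G + 1)" using e G(1) by simp
  from lim[OF this, of R] obtain N where N: "\<And>n t. N \<le> n \<Longrightarrow> \<bar>t\<bar> \<le> R \<Longrightarrow> \<bar>h n t - l t\<bar> \<le> e / (G + 1)" by blast
  have "\<bar>h n t * g t - l t * g t\<bar> \<le> e" if "N \<le> n" "\<bar>t\<bar> \<le> R" for n t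
  proof -
   have "\<bar>h n t * g t - l t * g t\<bar> = \<bar>h n t - l t\<bar> * \<bar>g t\<bar>" by (simp add: left_diff_distrib flip: abs_mult)
   also have "\<dots> \<le> e / (G + 1) * (G + 1)"
    using N[OF that] G(2)[of t] e G(1) by (intro mult_mono) auto
   finally show ?thesis using G(1) by simp
  qed
  then show "\<exists>N. \<forall>n\<ge>N. \<forall>t. \<bar>t\<bar> \<le> R \<longrightarrow> \<bar>h n t * g t - l t * g t\<bar> \<le> e" by blast
 qed
qed

context conformal_pair
begin

text \<open>\<open>represents L T\<close> says that \<open>T = L(D\<^sub>1) a\<^sup>* - a\<^sup>* L(D\<^sub>2)\<close> for a possibly unbounded function \<open>L\<close>.\<close>

definition represents :: "(real \<Rightarrow> real) \<Rightarrow> 'e endo \<Rightarrow> bool" where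
 "represents L T \<longleftrightarrow> (\<forall>g\<in>Ccr. \<forall>h\<in>Ccr.
   A.rc (\<lambda>t. L t * g t) \<cdot> a\<^sup>* \<cdot> B.rc h - A.rc g \<cdot> a\<^sup>* \<cdot> B.rc (\<lambda>t. L t * h t) = A.rc g \<cdot> T \<cdot> B.rc h)"

text \<open>
 Tested against compactly supported functions, \<open>dyadic_log K\<close> may be replaced by its limit, which differs from a multiple
 of \<open>log \<langle>t\<rangle>\<close> by a bounded function \<open>b\<close>; the latter contributes \<open>diff b\<close>.
\<close>

lemma log_represented: "\<exists>T \<in> End_star E. represents (\<lambda>t. ln (bracket t)) T"
proof -
 obtain T where T: "T \<in> End_star E"
  and lim: "\<And>x. (\<lambda>K. diff (dyadic_log K) x) \<longlonglongrightarrow> T x"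
  using diff_dyadic_log by blast
 define b where "b t = ln 2 * dyadic_log_lim t - ln (bracket t)" for t
 have b: "b \<in> Cbr" unfolding b_def[abs_def] by (rule dyadic_log_lim_Cbr)
 have nonneg: "0 \<le> dyadic_log K t" for K t
  unfolding dyadic_log_def by (intro sum_nonneg one_minus_low_bounds) simp
 have dl: "A.rc (\<lambda>t. dyadic_log_lim t * g t) \<cdot> a\<^sup>* \<cdot> B.rc h - A.rc g \<cdot> a\<^sup>* \<cdot> B.rc (\<lambda>t. dyadic_log_lim t * h t)
   = A.rc g \<cdot> T \<cdot> B.rc h" if g: "g \<in> Ccr" and h: "h \<in> Ccr" for g h
 proof (rule blinfun_eqI)
  fix x
  have le: "\<bar>dyadic_log n t\<bar> \<le> \<bar>dyadic_log_lim t\<bar>" for n t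
   using dyadic_log_le[of n t] nonneg[of n t] by simp
  note lu = continuous_on_dyadic_log continuous_on_dyadic_log_lim _ le dyadic_log_locally_uniform
  let ?l = "\<lambda>K. (A.rc (\<lambda>t. dyadic_log K t * g t) \<cdot> a\<^sup>* \<cdot> B.rc h - A.rc g \<cdot> a\<^sup>* \<cdot> B.rc (\<lambda>t. dyadic_log K t * h t)) x"
  have "?l \<longlonglongrightarrow> (A.rc (\<lambda>t. dyadic_log_lim t * g t) \<cdot> a\<^sup>* \<cdot> B.rc h
    - A.rc g \<cdot> a\<^sup>* \<cdot> B.rc (\<lambda>t. dyadic_log_lim t * h t)) x"
   by (simp add: minus_blinfun.rep_eq) (intro tendsto_intros A.rc_locally_uniform_limit[OF lu] B.rc_locally_uniform_limit[OF lu] g h)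
  moreover have "?l = (\<lambda>K. A.rc g (diff (dyadic_log K) (B.rc h x)))"
  proof
   fix K
   have "(\<lambda>t. dyadic_log K t * g t) = (\<lambda>t. g t * dyadic_log K t)" by (simp add: mult.commute)
   then have "A.rc (\<lambda>t. dyadic_log K t * g t) = A.rc g \<cdot> A.rc (dyadic_log K)"
    "B.rc (\<lambda>t. dyadic_log K t * h t) = B.rc (dyadic_log K) \<cdot> B.rc h"
    using A.rc_mult[OF Ccr_Cbr[OF g] dyadic_log_Cbr] B.rc_mult[OF dyadic_log_Cbr Ccr_Cbr[OF h]] by simp_all
   then show "?l K = A.rc g (diff (dyadic_log K) (B.rc h x))"
    by (simp add: diff_def minus_blinfun.rep_eq blinfun.diff_right)
  qed
  moreover have "(\<lambda>K. A.rc g (diff (dyadic_log K) (B.rc h x)))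
    \<longlonglongrightarrow> A.rc g (T (B.rc h x))"
   by (intro tendsto_intros lim)
  ultimately show "(A.rc (\<lambda>t. dyadic_log_lim t * g t) \<cdot> a\<^sup>* \<cdot> B.rc h
    - A.rc g \<cdot> a\<^sup>* \<cdot> B.rc (\<lambda>t. dyadic_log_lim t * h t)) x = (A.rc g \<cdot> T \<cdot> B.rc h) x"
   using LIMSEQ_unique by simp
 qed
 have "represents (\<lambda>t. ln (bracket t)) (ln 2 *\<^sub>R T - diff b)"
  unfolding represents_def
 proof (intro ballI)
  fix g h assume g: "g \<in> Ccr" and h: "h \<in> Ccr"
  have C: "(\<lambda>t. dyadic_log_lim t * f t) \<in> Cbr" if "f \<in> Ccr" for f
   by (rule Ccr_Cbr[OF Ccr_mult[OF that continuous_on_dyadic_log_lim]])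
  have eq: "(\<lambda>t. ln (bracket t) * f t) = (\<lambda>t. ln 2 * (dyadic_log_lim t * f t) - b t * f t)" for f
   by (auto simp: b_def left_diff_distrib)
  have "A.rc (\<lambda>t. ln (bracket t) * g t) = ln 2 *\<^sub>R A.rc (\<lambda>t. dyadic_log_lim t * g t) - A.rc g \<cdot> A.rc b"
   "B.rc (\<lambda>t. ln (bracket t) * h t) = ln 2 *\<^sub>R B.rc (\<lambda>t. dyadic_log_lim t * h t) - B.rc b \<cdot> B.rc h"
   unfolding eq A.rc_commute[OF Ccr_Cbr[OF g] b]
   by (simp_all add: A.rc_diff B.rc_diff A.rc_scale B.rc_scale C g h b Ccr_Cbr Cbr_scale Cbr_mult A.rc_mult B.rc_mult)
  then have "A.rc (\<lambda>t. ln (bracket t) * g t) \<cdot> a\<^sup>* \<cdot> B.rc h - A.rc g \<cdot> a\<^sup>* \<cdot> B.rc (\<lambda>t. ln (bracket t) * h t)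
    = ln 2 *\<^sub>R (A.rc (\<lambda>t. dyadic_log_lim t * g t) \<cdot> a\<^sup>* \<cdot> B.rc h
     - A.rc g \<cdot> a\<^sup>* \<cdot> B.rc (\<lambda>t. dyadic_log_lim t * h t)) - A.rc g \<cdot> diff b \<cdot> B.rc h"
   by (simp add: op_simps diff_def scaleR_diff_right op_scaleR)
  also have "\<dots> = A.rc g \<cdot> (ln 2 *\<^sub>R T - diff b) \<cdot> B.rc h"
   unfolding dl[OF g h] by (simp add: op_simps op_scaleR)
  finally show "A.rc (\<lambda>t. ln (bracket t) * g t) \<cdot> a\<^sup>* \<cdot> B.rc h - A.rc g \<cdot> a\<^sup>* \<cdot> B.rc (\<lambda>t. ln (bracket t) * h t)
    = A.rc g \<cdot> (ln 2 *\<^sub>R T - diff b) \<cdot> B.rc h" .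
 qed
 moreover have "ln 2 *\<^sub>R T - diff b \<in> End_star E" using T b by auto
 ultimately show ?thesis by blast
qed

end

section \<open>The sign\<close>

subsection \<open>A smoothed sign function\<close>

text \<open>
 A Riemann sum for \<open>2 / \<pi> \<integral>\<^sub>N\<^sup>M t / (n\<^sup>2 + t\<^sup>2) dn = 2 / \<pi> (arctan (t / N) - arctan (t / M))\<close>, a sign function smoothed at
 scale \<open>N\<close>.  Its commutators are controlled by those of \<open>D (n\<^sup>2 + D\<^sup>2)\<^sup>-\<^sup>1\<close> for \<open>n > N\<close>.
\<close>

definition smooth_sign :: "nat \<Rightarrow> nat \<Rightarrow> real \<Rightarrow> real" where
 "smooth_sign N M t = 2 / pi * (\<Sum>n\<in>{N<..M}. skew (real n) t)"

lemma arctan_diff_bounds: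
 assumes "0 \<le> a" "a < b"
 shows "(b - a) / (1 + b\<^sup>2) \<le> arctan b - arctan a" "arctan b - arctan a \<le> (b - a) / (1 + a\<^sup>2)"
proof -
 obtain z where z: "a < z" "z < b" "arctan b - arctan a = (b - a) * inverse (1 + z\<^sup>2)"
  using MVT2[OF assms(2), of arctan "\<lambda>x. inverse (1 + x\<^sup>2)"] DERIV_arctan by blast
 have "a\<^sup>2 \<le> z\<^sup>2" "z\<^sup>2 \<le> b\<^sup>2" using z assms by (auto intro!: power_mono)
 then have "inverse (1 + b\<^sup>2) \<le> inverse (1 + z\<^sup>2)" "inverse (1 + z\<^sup>2) \<le> inverse (1 + a\<^sup>2)"
  by (auto intro!: le_imp_inverse_le add_pos_nonneg)
 then show "(b - a) / (1 + b\<^sup>2) \<le> arctan b - arctan a" "arctan b - arctan a \<le> (b - a) / (1 + a\<^sup>2)"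
  unfolding z(3) divide_inverse using assms by (auto intro!: mult_left_mono)
qed

lemma skew_arctan_bounds:
 fixes n t :: real
 assumes "0 < t" "1 \<le> n"
 shows "skew n t \<le> arctan (n / t) - arctan ((n - 1) / t)" "arctan (n / t) - arctan ((n - 1) / t) \<le> skew (n - 1) t"
proof -
 have d: "n / t - (n - 1) / t = 1 / t" by (simp add: diff_divide_distrib[symmetric])
 have s: "1 / t / (1 + (m / t)\<^sup>2) = skew m t" for m
 proof -
  have "0 < m\<^sup>2 + t\<^sup>2" using assms by (simp add: add_nonneg_pos)
  then show ?thesis using assms by (simp add: skew_def power_divide divide_simps power2_eq_square)
 qed
 have "(n - 1) / t < n / t" "0 \<le> (n - 1) / t" using assms by (auto simp: divide_strict_right_mono)
 from arctan_diff_bounds[OF this(2,1)]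
 show "skew n t \<le> arctan (n / t) - arctan ((n - 1) / t)" "arctan (n / t) - arctan ((n - 1) / t) \<le> skew (n - 1) t"
  unfolding d s by auto
qed

lemma sum_skew_bounds:
 assumes t: "0 < t" and le: "N \<le> M"
 shows "(\<Sum>n\<in>{N<..M}. skew (real n) t) \<le> arctan (real M / t) - arctan (real N / t)"
  and "arctan (real (M + 1) / t) - arctan (real (N + 1) / t) \<le> (\<Sum>n\<in>{N<..M}. skew (real n) t)"
proof -
 have step: "{N<..Suc M} = insert (Suc M) {N<..M}" if "N \<le> M" for M using that by auto
 show "(\<Sum>n\<in>{N<..M}. skew (real n) t) \<le> arctan (real M / t) - arctan (real N / t)"
  using le
 proof (induction M rule: dec_induct)
  case (step M)
  then show ?case using \<open>N \<le> M \<Longrightarrow> _\<close>[OF step(1)] skew_arctan_bounds(1)[OF t, of "real (Suc M)"]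
   by (simp add: atLeastAtMostSuc_conv)
 qed simp
 show "arctan (real (M + 1) / t) - arctan (real (N + 1) / t) \<le> (\<Sum>n\<in>{N<..M}. skew (real n) t)"
  using le
 proof (induction M rule: dec_induct)
  case (step M)
  then show ?case using \<open>N \<le> M \<Longrightarrow> _\<close>[OF step(1)] skew_arctan_bounds(2)[OF t, of "real (Suc (Suc M))"]
   by (simp add: add_ac)
 qed simp
qed

lemma skew_minus [simp]: "skew n (- t) = - skew n t"
 by (simp add: skew_def)

lemma smooth_sign_minus [simp]: "smooth_sign N M (- t) = - smooth_sign N M t"
 by (simp add: smooth_sign_def sum_negf)

lemma smooth_sign_pos:
 assumes t: "0 < t" and N: "0 < N" "N \<le> M"
 shows "0 \<le> smooth_sign N M t" "smooth_sign N M t \<le> 1"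
  and "1 - smooth_sign N M t \<le> real (N + 1) / t + t / real M"
proof -
 let ?S = "\<Sum>n\<in>{N<..M}. skew (real n) t"
 have "0 \<le> ?S" using t by (intro sum_nonneg) (simp add: skew_def)
 then show "0 \<le> smooth_sign N M t" by (simp add: smooth_sign_def)
 have "0 \<le> arctan (real N / t)" using t by simp
 then have "?S \<le> pi / 2" using sum_skew_bounds(1)[OF t N(2)] arctan_ubound[of "real M / t"] by linarith
 then have "2 / pi * ?S \<le> 2 / pi * (pi / 2)" by (intro mult_left_mono) auto
 then show "smooth_sign N M t \<le> 1" by (simp add: smooth_sign_def)
 have M: "0 < real M" using N by simp
 have "arctan (real (M + 1) / t) = pi / 2 - arctan (t / real (M + 1))"
  using arctan_inverse[of "t / real (M + 1)"] t M by simp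
 moreover have "arctan (t / real (M + 1)) \<le> t / real (M + 1)" "arctan (real (N + 1) / t) \<le> real (N + 1) / t"
  using t by (auto intro!: arctan_le_self)
 moreover have "t / real (M + 1) \<le> t / real M" using t M by (intro divide_left_mono) auto
 ultimately have "pi / 2 - ?S \<le> real (N + 1) / t + t / real M"
  using sum_skew_bounds(2)[OF t N(2)] by linarith
 moreover have "1 - smooth_sign N M t \<le> pi / 2 - ?S"
 proof -
  have "1 - smooth_sign N M t = 2 / pi * (pi / 2 - ?S)"
   by (simp add: smooth_sign_def right_diff_distrib)
  also have "\<dots> \<le> 1 * (pi / 2 - ?S)"
   using \<open>?S \<le> pi / 2\<close> pi_ge_two by (intro mult_right_mono) auto
  finally show ?thesis by (simp only: mult_1)
 qed
 ultimately show "1 - smooth_sign N M t \<le> real (N + 1) / t + t / real M" by (rule order_trans[rotated])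
qed

lemma smooth_sign_bound:
 assumes N: "0 < N" "N \<le> M" shows "\<bar>smooth_sign N M t\<bar> \<le> 1"
proof (cases t "0 :: real" rule: linorder_cases)
 case less
 then show ?thesis using smooth_sign_pos[OF _ N, of "- t"] by simp
next
 case greater
 then show ?thesis using smooth_sign_pos[OF _ N, of t] by simp
qed (simp add: smooth_sign_def skew_def)

lemma smooth_sign_neg:
 assumes t: "t < 0" and N: "0 < N" "N \<le> M"
 shows "0 \<le> 1 + smooth_sign N M t" "1 + smooth_sign N M t \<le> 1"
  and "1 + smooth_sign N M t \<le> real (N + 1) / \<bar>t\<bar> + \<bar>t\<bar> / real M"
 using smooth_sign_pos[OF _ N, of "- t"] t by simp_all

lemma smooth_sign_Cbr [simp]: "0 < N \<Longrightarrow> N \<le> M \<Longrightarrow> smooth_sign N M \<in> Cbr"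
 by (rule CbrI[OF _ smooth_sign_bound])
  (auto simp: smooth_sign_def[abs_def] intro!: continuous_intros continuous_on_skew)

text \<open>
 This is what makes the quadratic form below almost positive.  For \<open>t < 0\<close> the factor \<open>1 + smooth_sign\<close> is at most
 \<open>(N + 1) / |t| + |t| / R\<^sup>2\<close>, and \<open>low R\<close> absorbs the second summand.
\<close>

lemma smooth_sign_form_bound:
 assumes N: "0 < N" "N \<le> R"
 shows "- (real N + 2) \<le> t * ((1 + smooth_sign N (R\<^sup>2) t) * ((1 + smooth_sign N (R\<^sup>2) t) * low R t))"
proof (cases "t < 0")
 case True
 define f where "f = 1 + smooth_sign N (R\<^sup>2) t"
 have R: "0 < real R" "N \<le> R\<^sup>2" using N by (auto simp: power2_eq_square intro: order_trans)
 note f = smooth_sign_neg[OF True N(1) R(2), folded f_def]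
 note l = low_bounds[OF R(1), of t]
 have "- (t * (f * (f * low R t))) = \<bar>t\<bar> * (f * (f * low R t))" using True by simp
 also have "\<dots> \<le> \<bar>t\<bar> * (1 * (f * low R t))"
  using f l by (intro mult_left_mono mult_right_mono) auto
 also have "\<dots> = \<bar>t\<bar> * low R t * f" by simp
 also have "\<dots> \<le> \<bar>t\<bar> * low R t * (real (N + 1) / \<bar>t\<bar> + \<bar>t\<bar> / real (R\<^sup>2))"
  using f l by (intro mult_left_mono) auto
 also have "\<dots> = low R t * real (N + 1) + t\<^sup>2 * low R t / (real R)\<^sup>2"
 proof -
  have "T * L * (x / T + T / m) = L * x + T\<^sup>2 * L / m" if "0 < T" for T L x m :: real
   using that by (simp add: distrib_left power2_eq_square)
  from this[of "\<bar>t\<bar>"] show ?thesis using True by simp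
 qed
 also have "\<dots> \<le> real (N + 1) + 1"
 proof (intro add_mono)
  show "low R t * real (N + 1) \<le> real (N + 1)" using l mult_right_mono[of "low R t" 1 "real (N + 1)"] by simp
  have "t\<^sup>2 * low R t / (real R)\<^sup>2 = 1 - low R t"
   using one_minus_low[OF R(1), of t] R quad_pos[OF R(1), of t]
   by (simp add: low_def skew_def power2_eq_square)
  then show "t\<^sup>2 * low R t / (real R)\<^sup>2 \<le> 1" using l by simp
 qed
 finally show ?thesis unfolding f_def by simp
next
 case False
 have R: "0 < real R" "N \<le> R\<^sup>2" using N by (auto simp: power2_eq_square intro: order_trans)
 have "\<bar>smooth_sign N (R\<^sup>2) t\<bar> \<le> 1" by (rule smooth_sign_bound[OF N(1) R(2)])
 then have "0 \<le> t * ((1 + smooth_sign N (R\<^sup>2) t) * ((1 + smooth_sign N (R\<^sup>2) t) * low R t))"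
  using False low_bounds[OF R(1), of t] by (intro mult_nonneg_nonneg) auto
 then show ?thesis by linarith
qed

definition phase :: "real \<Rightarrow> real" where "phase t = t / bracket t"

lemma phase_Cbr [simp]: "phase \<in> Cbr"
proof (rule CbrI[of _ 1])
 show "continuous_on UNIV phase" unfolding phase_def[abs_def] by (intro continuous_intros) auto
 show "\<bar>phase t\<bar> \<le> 1" for t using abs_le_bracket[of t] by (simp add: phase_def abs_divide)
qed

lemma phase_minus [simp]: "phase (- t) = - phase t"
 by (simp add: phase_def bracket_def)

lemma phase_pos: "0 < t \<Longrightarrow> 0 \<le> 1 - phase t" "0 < t \<Longrightarrow> 1 - phase t \<le> 1" "0 < t \<Longrightarrow> 1 - phase t \<le> 1 / t"
proof -
 assume t: "0 < t"
 show "0 \<le> 1 - phase t" using abs_le_bracket[of t] t by (simp add: phase_def)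
 show "1 - phase t \<le> 1" using t bracket_pos[of t] by (simp add: phase_def divide_nonneg_pos)
 have "bracket t \<le> t + 1" unfolding bracket_def using t by (intro real_le_lsqrt) (auto simp: power2_sum)
 then have "(bracket t - t) * t \<le> 1 * bracket t"
  using abs_le_bracket[of t] t by (intro mult_mono) auto
 then show "1 - phase t \<le> 1 / t" using t by (simp add: phase_def field_simps)
qed

text \<open>
 The left-hand side is at most \<open>1\<close> for \<open>|t| \<le> N\<close> and \<open>O(N / |t|) + |t| / M\<close> beyond, while \<open>(low N t)\<^sup>1\<^sup>/\<^sup>2\<close> has the size of
 \<open>min 1 (N / |t|)\<close>.  In this form the error is absorbed by the estimate for low frequencies below.
\<close>

lemma phase_smooth_sign:
 assumes N: "0 < N" "N \<le> M"
 shows "\<bar>phase t - smooth_sign N M t\<bar> \<le> 6 * sqrt (low N t) + \<bar>t\<bar> / real M"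
proof -
 have pos: "\<bar>phase t - smooth_sign N M t\<bar> \<le> 6 * sqrt (low N t) + \<bar>t\<bar> / real M" if t: "0 < t" for t
 proof -
  have N1: "1 \<le> real N" using N by simp
  have M: "0 \<le> \<bar>t\<bar> / real M" by simp
  note s = smooth_sign_pos[OF t N]
  note f = phase_pos[OF t]
  show ?thesis
  proof (cases "t \<le> real N")
   case True
   then have "t\<^sup>2 \<le> (real N)\<^sup>2" using t by (intro power_mono) auto
   then have "1/4 \<le> low N t" using N1 quad_pos[of "real N" t] by (simp add: low_def field_simps)
   then have "sqrt (1/4) \<le> sqrt (low N t)" by (rule real_sqrt_le_mono)
   then have "1/2 \<le> sqrt (low N t)" by (simp add: real_sqrt_divide)
   moreover have "\<bar>phase t - smooth_sign N M t\<bar> \<le> 1" using s f by linarith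
   ultimately show ?thesis using M by linarith
  next
   case False
   then have "(real N)\<^sup>2 \<le> t\<^sup>2" by (intro power_mono) auto
   then have "(real N)\<^sup>2 / (2 * t\<^sup>2) \<le> low N t" unfolding low_def
    using t N1 by (intro divide_left_mono mult_pos_pos add_nonneg_pos) auto
   moreover have "(real N / (2 * t))\<^sup>2 \<le> (real N)\<^sup>2 / (2 * t\<^sup>2)"
    using t by (simp add: power_divide power_mult_distrib divide_left_mono)
   ultimately have "(real N / (2 * t))\<^sup>2 \<le> low N t" by linarith
   then have "real N / (2 * t) \<le> sqrt (low N t)" by (rule real_le_rsqrt)
   moreover have "1 / t \<le> real N / t" "real (N + 1) / t \<le> 2 * (real N / t)"
    using t N1 by (auto simp: divide_simps)
   ultimately show ?thesis using s f M t by simp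
  qed
 qed
 show ?thesis
 proof (cases t "0 :: real" rule: linorder_cases)
  case less
  then show ?thesis using pos[of "- t"] by (simp add: low_def abs_minus_commute)
 next
  case equal
  then show ?thesis by (simp add: phase_def smooth_sign_def skew_def low_def)
 qed (use pos in simp)
qed

lemma powr_difference_bound:
 fixes n :: real assumes "2 \<le> n" "0 < \<delta>"
 shows "n powr (- 1 - \<delta>) \<le> ((n - 1) powr (- \<delta>) - n powr (- \<delta>)) / \<delta>"
proof -
 have "1 / n \<le> - ln (1 - 1 / n)" using ln_add_one_self_le_self2[of "- (1 / n)"] assms by simp
 then have "1 + \<delta> * (1 / n) \<le> 1 + \<delta> * (- ln (1 - 1 / n))" using assms by (intro add_left_mono mult_left_mono) auto
 also have "\<dots> \<le> exp (\<delta> * (- ln (1 - 1 / n)))" by (rule exp_ge_add_one_self)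
 also have "\<dots> = (1 - 1 / n) powr (- \<delta>)" using assms by (simp add: powr_def)
 finally have "n powr (- \<delta>) * (1 + \<delta> * (1 / n)) \<le> n powr (- \<delta>) * (1 - 1 / n) powr (- \<delta>)"
  by (intro mult_left_mono) auto
 also have "\<dots> = (n * (1 - 1 / n)) powr (- \<delta>)" using assms by (intro powr_mult[symmetric])
 also have "n * (1 - 1 / n) = n - 1" using assms by (simp add: field_simps)
 finally have "\<delta> * (n powr (- \<delta>) / n) \<le> (n - 1) powr (- \<delta>) - n powr (- \<delta>)" by (simp add: algebra_simps)
 moreover have "n powr (- 1 - \<delta>) = n powr (- \<delta>) / n"
 proof -
  have "- 1 - \<delta> = - \<delta> - 1" by simp
  then show ?thesis using assms powr_diff[of n "- \<delta>" 1] by (simp only: powr_one)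
 qed
 ultimately show ?thesis using assms by (simp add: pos_le_divide_eq mult.commute)
qed

lemma sum_powr_le:
 assumes N: "0 < N" "N \<le> M" and \<alpha>: "\<alpha> < 1"
 shows "(\<Sum>n\<in>{N<..M}. real n powr (\<alpha> - 2)) \<le> real N powr (\<alpha> - 1) / (1 - \<alpha>)"
proof -
 have "(\<Sum>n\<in>{N<..M}. real n powr (\<alpha> - 2)) \<le> (real N powr (\<alpha> - 1) - real M powr (\<alpha> - 1)) / (1 - \<alpha>)"
  using N(2)
 proof (induction M rule: dec_induct)
  case (step M)
  have "{N<..Suc M} = insert (Suc M) {N<..M}" using step(1) by auto
  moreover have "real (Suc M) powr (\<alpha> - 2) \<le> (real M powr (\<alpha> - 1) - real (Suc M) powr (\<alpha> - 1)) / (1 - \<alpha>)"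
   using powr_difference_bound[of "real (Suc M)" "1 - \<alpha>"] N(1) step(1) \<alpha> by (simp add: algebra_simps)
  ultimately show ?case using step(3) by (simp add: diff_divide_distrib)
 qed simp
 also have "\<dots> \<le> real N powr (\<alpha> - 1) / (1 - \<alpha>)" using \<alpha> by (intro divide_right_mono) auto
 finally show ?thesis .
qed

subsection \<open>Spectral bands\<close>

lemma Cbr_sqrt:
 assumes f: "f \<in> Cbr" shows "(\<lambda>t. sqrt (f t)) \<in> Cbr"
proof -
 obtain B where B: "0 \<le> B" "\<And>t. \<bar>f t\<bar> \<le> B" using Cbr_bounded[OF f] by blast
 show ?thesis
 proof (rule CbrI[of _ "sqrt B"])
  show "continuous_on UNIV (\<lambda>t. sqrt (f t))" using Cbr_cont[OF f] by (intro continuous_intros)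
  show "\<bar>sqrt (f t)\<bar> \<le> sqrt B" for t using B(2)[of t] by (simp add: abs_le_iff real_sqrt_minus[symmetric])
 qed
qed

context bounded_calculus
begin

text \<open>As \<open>g\<^sup>2 - f\<^sup>2\<close> has a continuous square root \<open>k\<close>, \<open>\<langle>g(D) y, g(D) y\<rangle> = \<langle>f(D) y, f(D) y\<rangle> + \<langle>k(D) y, k(D) y\<rangle>\<close>.\<close>

lemma norm_rc_mono:
 assumes f: "f \<in> Cbr" and g: "g \<in> Cbr" and le: "\<And>t. \<bar>f t\<bar> \<le> \<bar>g t\<bar>"
 shows "norm (rc f \<cdot> Y) \<le> norm (rc g \<cdot> Y)"
proof (rule norm_blinfun_bound)
 fix x
 let ?y = "Y x"
 have sq: "ip E (rc h ?y) (rc h ?y) = ip E ?y (rc (\<lambda>t. h t * h t) ?y)"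
  if "h \<in> Cbr" for h
  using that by (simp add: rc_mult ip_dag)
 have k: "(\<lambda>t. sqrt (g t * g t - f t * f t)) \<in> Cbr"
 proof -
  have "(\<lambda>t. g t * g t - f t * f t) \<in> Cbr" by (intro Cbr_diff Cbr_mult f g)
  then show ?thesis by (rule Cbr_sqrt)
 qed
 have "f t * f t \<le> g t * g t" for t using abs_le_square_iff[of "f t" "g t"] le[of t] by (simp add: power2_eq_square)
 then have "(\<lambda>t. g t * g t) = (\<lambda>t. f t * f t + sqrt (g t * g t - f t * f t) * sqrt (g t * g t - f t * f t))" by simp
 then have "rc (\<lambda>t. g t * g t) = rc (\<lambda>t. f t * f t) + rc (\<lambda>t. sqrt (g t * g t - f t * f t) * sqrt (g t * g t - f t * f t))"
  using rc_add[OF Cbr_mult[OF f f] Cbr_mult[OF k k]] by simp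
 then have "ip E (rc g ?y) (rc g ?y)
   = ip E (rc f ?y) (rc f ?y)
    + ip E (rc (\<lambda>t. sqrt (g t * g t - f t * f t)) ?y) (rc (\<lambda>t. sqrt (g t * g t - f t * f t)) ?y)"
  by (simp add: sq[OF g] sq[OF f] sq[OF k] plus_blinfun.rep_eq ip_add_right)
 then have "(norm (rc f ?y))\<^sup>2 \<le> (norm (rc g ?y))\<^sup>2"
  unfolding norm_ip_self[symmetric] by (simp only: norm_ip_self_le_add)
 then have "norm (rc f ?y) \<le> norm (rc g ?y)" by (rule power2_le_imp_le) simp
 also have "\<dots> \<le> norm (rc g \<cdot> Y) * norm x" using norm_blinfun[of "rc g \<cdot> Y" x] by simp
 finally show "norm ((rc f \<cdot> Y) x) \<le> norm (rc g \<cdot> Y) * norm x" by simp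
qed simp

lemma rc_low_tendsto:
 assumes N: "0 < N" shows "(\<lambda>n. rc (low (real (n + N))) x) \<longlonglongrightarrow> x"
proof -
 have R: "0 < real (n + N)" "1 \<le> real (n + N)" for n using N by auto
 have "(\<lambda>n. rc (low (real (n + N))) x) \<longlonglongrightarrow> rc (\<lambda>_. 1) x"
 proof (rule rc_strong_limit)
  show "\<bar>low (real (n + N)) t\<bar> \<le> 1" for n t using low_bounds[OF R(1), of n t] by simp
  fix S e :: real assume e: "0 < e"
  obtain n0 :: nat where n0: "S\<^sup>2 / e < real n0" using reals_Archimedean2 by blast
  have "\<bar>low (real (n + N)) t - 1\<bar> \<le> e" if n: "n0 \<le> n" and t: "\<bar>t\<bar> \<le> S" for n t
  proof -
   have "1 - low (real (n + N)) t \<le> t\<^sup>2 / (real (n + N))\<^sup>2" by (rule one_minus_low_bounds(2)[OF R(1)])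
   also have "\<dots> \<le> S\<^sup>2 / real (n + N)"
    using t R[of n] self_le_power[OF R(2), of 2 n] abs_le_square_iff[of t S] by (intro frac_le) auto
   also have "\<dots> \<le> e"
   proof -
    have "S\<^sup>2 \<le> e * real (n + N)" using n0 n e by (simp add: pos_divide_less_eq mult.commute)
     (meson add_increasing2 less_imp_le mult_left_mono of_nat_0_le_iff of_nat_le_iff order_trans)
    then show ?thesis by (subst pos_divide_le_eq[OF R(1)])
   qed
   finally show ?thesis using low_bounds[OF R(1), of n t] by simp
  qed
  then show "\<exists>n0. \<forall>n\<ge>n0. \<forall>t. \<bar>t\<bar> \<le> S \<longrightarrow> \<bar>low (real (n + N)) t - 1\<bar> \<le> e" by blast
 qed (use R in simp_all)
 then show ?thesis by simp
qed

lemma norm_comm_smooth_sign: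
 assumes x: "intertwines \<alpha> rc rc x x X" and \<alpha>: "0 \<le> \<alpha>" "\<alpha> < 1" and N: "0 < N" "N \<le> M"
 shows "norm (comm (smooth_sign N M) x) \<le> 2 * norm X / (1 - \<alpha>) * real N powr (\<alpha> - 1)"
proof -
 let ?S = "\<lambda>t. \<Sum>n\<in>{N<..M}. skew (real n) t"
 have C: "?S \<in> Cbr" and S: "rc ?S = (\<Sum>n\<in>{N<..M}. rc (skew (real n)))"
  using N by (auto intro!: rc_sum)
 have "comm (smooth_sign N M) x = (2 / pi) *\<^sub>R (\<Sum>n\<in>{N<..M}. comm (skew (real n)) x)"
  unfolding comm_def smooth_sign_def[abs_def]
  unfolding rc_scale[OF C] S
  by (simp add: op_scaleR
    op_sum scaleR_diff_right sum_subtractf)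
 then have "norm (comm (smooth_sign N M) x) = 2 / pi * norm (\<Sum>n\<in>{N<..M}. comm (skew (real n)) x)" by simp
 also have "\<dots> \<le> 1 * (\<Sum>n\<in>{N<..M}. 2 * norm X * real n powr (\<alpha> - 2))"
  using pi_ge_two N by (intro mult_mono sum_norm_le norm_comm_skew[OF x _ \<alpha>]) auto
 also have "\<dots> = 2 * norm X * (\<Sum>n\<in>{N<..M}. real n powr (\<alpha> - 2))" by (simp add: sum_distrib_left)
 also have "\<dots> \<le> 2 * norm X * (real N powr (\<alpha> - 1) / (1 - \<alpha>))" by (intro mult_left_mono sum_powr_le N \<alpha>) simp
 finally show ?thesis by simp
qed

text \<open>The function is the weight of the quadratic form below; the product rule reduces it to \<open>smooth_sign\<close> and \<open>low\<close>.\<close>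

lemma norm_comm_form:
 assumes x: "intertwines \<alpha> rc rc x x X" and \<alpha>: "0 \<le> \<alpha>" "\<alpha> < 1" and N: "0 < N" "N \<le> M" "N \<le> R"
 shows "norm (comm (\<lambda>t. (1 + smooth_sign N M t) * ((1 + smooth_sign N M t) * low R t)) x)
  \<le> 16 * norm X / (1 - \<alpha>) * real N powr (\<alpha> - 1)"
proof -
 let ?r = "real N powr (\<alpha> - 1)"
 let ?f = "\<lambda>t. 1 + smooth_sign N M t"
 have R: "0 < real R" "1 \<le> real R" using N by auto
 have f: "?f \<in> Cbr" using N by (intro Cbr_add) simp_all
 have fl: "(\<lambda>t. ?f t * low R t) \<in> Cbr" using R by (intro Cbr_mult f) simp
 have f2: "\<bar>?f t\<bar> \<le> 2" for t using smooth_sign_bound[OF N(1,2), of t] by linarith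
 have nf: "norm (rc ?f) \<le> 2" by (rule rc_norm_le[OF f f2])
 have nl: "norm (rc (low R)) \<le> 1" using R low_bounds[OF R(1)] by (intro rc_norm_le) auto
 have nfl: "norm (rc (\<lambda>t. ?f t * low R t)) \<le> 2"
 proof (rule rc_norm_le[OF fl])
  fix t
  have "\<bar>?f t\<bar> * \<bar>low R t\<bar> \<le> 2 * 1" using low_bounds[OF R(1), of t] by (intro mult_mono f2) auto
  then show "\<bar>?f t * low R t\<bar> \<le> 2" by (simp add: abs_mult)
 qed
 have cf: "norm (comm ?f x) \<le> 2 * norm X / (1 - \<alpha>) * ?r"
 proof -
  have "comm ?f x = comm (smooth_sign N M) x"
   using N rc_add[OF Cbr_const[of 1], of "smooth_sign N M"] by (simp add: comm_def op_simps)
  then show ?thesis using norm_comm_smooth_sign[OF x \<alpha> N(1,2)] by simp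
 qed
 have cl: "norm (comm (low R) x) \<le> 2 * norm X / (1 - \<alpha>) * ?r"
 proof -
  have "real R powr (\<alpha> - 1) \<le> ?r" using N \<alpha> by (intro powr_mono2') auto
  then have "2 * norm X * real R powr (\<alpha> - 1) \<le> 2 * norm X * ?r" by (intro mult_left_mono) auto
  also have "\<dots> \<le> 2 * norm X / (1 - \<alpha>) * ?r"
  proof (intro mult_right_mono)
   show "2 * norm X \<le> 2 * norm X / (1 - \<alpha>)"
    using \<alpha> mult_left_mono[of "1 - \<alpha>" 1 "2 * norm X"] by (simp add: pos_le_divide_eq)
  qed simp
  finally show ?thesis using norm_comm_low[OF x R(2) \<alpha>] by linarith
 qed
 let ?c = "2 * norm X / (1 - \<alpha>) * ?r"
 have "norm (comm (\<lambda>t. ?f t * low R t) x) \<le> 2 * ?c + ?c * 1"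
  unfolding comm_mult[OF f rational_Cbr(1)[OF R(1)]]
  by (intro order_trans[OF norm_triangle_ineq] add_mono norm_compose_le nf nl cf cl)
 then have "norm (comm (\<lambda>t. ?f t * (?f t * low R t)) x) \<le> 2 * (2 * ?c + ?c * 1) + ?c * 2"
  unfolding comm_mult[OF f fl]
  by (intro order_trans[OF norm_triangle_ineq] add_mono norm_compose_le nf nfl cf)
 also have "\<dots> = 16 * norm X / (1 - \<alpha>) * ?r" by simp
 finally show ?thesis .
qed

end

subsection \<open>The sign on a spectral band\<close>

lemma bracket_le: "bracket t \<le> 1 + \<bar>t\<bar>"
proof -
 have "1 + t\<^sup>2 \<le> (1 + \<bar>t\<bar>)\<^sup>2" by (simp add: power2_sum)
 then show ?thesis unfolding bracket_def by (intro real_le_lsqrt) auto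
qed

text \<open>On vectors this is monotonicity of the norm on sums of inner squares.\<close>

lemma (in hilbert_module) norm_square_le_add:
 assumes Z: "Z \<in> End_star E" and K: "K \<in> End_star E" and l: "0 < l"
 shows "l * (norm Z)\<^sup>2 \<le> norm (l *\<^sub>R (Z\<^sup>* \<cdot> Z) + K\<^sup>* \<cdot> K)"
proof -
 let ?T = "l *\<^sub>R (Z\<^sup>* \<cdot> Z) + K\<^sup>* \<cdot> K"
 have "norm Z \<le> sqrt (norm ?T / l)"
 proof (rule norm_blinfun_bound)
  fix y
  have "ip E (sqrt l *\<^sub>R Z y) (sqrt l *\<^sub>R Z y)
     + ip E (K y) (K y) = ip E y (?T y)"
   using l by (simp add: ip_scaleR_left ip_scaleR_right ip_dag Z K plus_blinfun.rep_eq scaleR_blinfun.rep_eq ip_add_right)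
  then have "norm (ip E (sqrt l *\<^sub>R Z y) (sqrt l *\<^sub>R Z y)) \<le> norm (ip E y (?T y))"
   using norm_ip_self_le_add[of "sqrt l *\<^sub>R Z y" "K y"] by simp
  also have "\<dots> \<le> norm y * norm (?T y)" by (rule cauchy_schwarz)
  also have "\<dots> \<le> norm y * (norm ?T * norm y)" by (intro mult_left_mono norm_blinfun) simp
  also have "norm (ip E (sqrt l *\<^sub>R Z y) (sqrt l *\<^sub>R Z y)) = l * (norm (Z y))\<^sup>2"
   using l by (simp add: norm_ip_self power_mult_distrib)
  also have "norm y * (norm ?T * norm y) = norm ?T * (norm y)\<^sup>2" by (simp add: power2_eq_square mult_ac)
  finally have "l * (norm (Z y))\<^sup>2 \<le> norm ?T * (norm y)\<^sup>2" .
  then have "(norm (Z y))\<^sup>2 \<le> norm ?T / l * (norm y)\<^sup>2"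
   using l by (simp add: pos_le_divide_eq mult.commute)
  also have "\<dots> = (sqrt (norm ?T / l) * norm y)\<^sup>2" using l by (simp add: power_mult_distrib)
  finally show "norm (Z y) \<le> sqrt (norm ?T / l) * norm y"
   by (rule power2_le_imp_le) (use l in simp)
 qed (use l in simp)
 then have "(norm Z)\<^sup>2 \<le> (sqrt (norm ?T / l))\<^sup>2" by (intro power_mono) auto
 also have "\<dots> = norm ?T / l" using l by simp
 finally show ?thesis using l by (simp add: pos_le_divide_eq mult.commute)
qed

context conformal_pair
begin

lemma rc_conformal:
 "f \<in> Cbr \<Longrightarrow> A.rc f \<cdot> a\<^sup>* = p \<cdot> (A.rc f \<cdot> c\<^sup>*) + (A.comm f (a\<^sup>*) - p \<cdot> A.comm f (c\<^sup>*))"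
 unfolding A.comm_def a_c by (simp add: op_simps)

text \<open>
 \<open>\<beta>\<close> selects a band in the negative spectrum of \<open>D\<^sub>2\<close>.  The band is at distance \<open>N\<^sup>2\<close> from \<open>0\<close>, so that the error \<open>N + 2\<close> in
 the positivity of the form is small in comparison, while the weight \<open>\<langle>D\<^sub>2\<rangle>\<^sup>\<alpha>\<close> is still at most \<open>9 N\<^sup>2 N\<^bsup>\<alpha> - 1\<^esup>\<close> there.
\<close>

context
 fixes N :: nat and \<beta> :: "real \<Rightarrow> real"
 assumes N: "0 < N" and \<beta>: "\<beta> \<in> Cbr" "\<And>t. \<bar>\<beta> t\<bar> \<le> 1"
  and band: "\<And>t. \<beta> t \<noteq> 0 \<Longrightarrow> (real N)\<^sup>2 \<le> - t \<and> - t \<le> 8 * (real N)\<^sup>2"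
begin

private abbreviation "N2 \<equiv> (real N)\<^sup>2"
private abbreviation "r \<equiv> real N powr (\<alpha> - 1)"
private abbreviation "\<kappa> \<equiv> 16 * norm X\<^sub>a / (1 - \<alpha>) + norm p * (16 * norm X\<^sub>c / (1 - \<alpha>))"

lemma N_powers: "1 \<le> real N" "1 / real N \<le> r" "r \<le> 1" "real N \<le> N2 * r"
proof -
 show N1: "1 \<le> real N" using N by simp
 have "real N powr (- 1) \<le> r" using N1 \<alpha> by (intro powr_mono) auto
 then show le: "1 / real N \<le> r" using N1 by (simp add: powr_minus_divide)
 have "r \<le> real N powr 0" using N1 \<alpha> by (intro powr_mono) auto
 then show "r \<le> 1" using N1 by simp
 have "N2 * (1 / real N) \<le> N2 * r" by (intro mult_left_mono le) simp
 then show "real N \<le> N2 * r" using N1 by (simp add: power2_eq_square)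
qed

lemma band_abs_le: "\<bar>t * \<beta> t\<bar> \<le> 8 * N2"
proof (cases "\<beta> t = 0")
 case False
 have "0 \<le> N2" by simp
 then have "\<bar>t\<bar> \<le> 8 * N2" using band[OF False] by linarith
 then have "\<bar>t\<bar> * \<bar>\<beta> t\<bar> \<le> 8 * N2 * 1" by (intro mult_mono \<beta>(2)) auto
 then show ?thesis by (simp add: abs_mult)
qed simp

lemma band_Cb1: "\<beta> \<in> Cb1"
 using \<beta>(1) Cbr_cont[OF \<beta>(1)] unfolding Cb1_def by (auto intro!: CbrI[OF _ band_abs_le] continuous_intros)

lemma bracket_band: assumes "\<beta> t \<noteq> 0" shows "bracket t powr \<alpha> \<le> 9 * (N2 * r)"
proof -
 have N1: "1 \<le> N2" using N_powers(1) by simp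
 have "bracket t \<le> 9 * N2" using bracket_le[of t] band[OF assms] N1 by linarith
 then have "bracket t powr \<alpha> \<le> (9 * N2) powr \<alpha>"
  using bracket_pos[of t] \<alpha> by (intro powr_mono2) (auto intro: less_imp_le)
 moreover have "(9 * N2) powr \<alpha> = 9 powr \<alpha> * N2 powr \<alpha>"
  using powr_mult[of 9 "N2" \<alpha>] by simp
 moreover have "N2 powr \<alpha> \<le> N2 * r"
 proof -
  have sq: "real N powr 2 = N2" using N by simp
  have "N2 powr \<alpha> = real N powr (2 * \<alpha>)" by (simp only: powr_powr sq[symmetric])
  also have "\<dots> \<le> real N powr (2 + (\<alpha> - 1))" using N_powers(1) \<alpha> by (intro powr_mono) auto
  also have "\<dots> = N2 * r" by (simp only: powr_add sq)
  finally show ?thesis .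
 qed
 moreover have "9 powr \<alpha> \<le> (9 :: real)" using powr_mono[of \<alpha> 1 "9 :: real"] \<alpha> by simp
 ultimately show ?thesis
  using mult_mono[of "9 powr \<alpha>" 9 "N2 powr \<alpha>" "N2 * r"] by simp
qed

lemma norm_weighted_band: "norm (B.rc (\<lambda>t. bracket t powr \<alpha> * \<beta> t)) \<le> 9 * (N2 * r)"
proof (rule B.rc_norm_le[OF weighted_Cbr[OF band_Cb1 \<alpha>]])
 show "\<bar>bracket t powr \<alpha> * \<beta> t\<bar> \<le> 9 * (N2 * r)" for t
 proof (cases "\<beta> t = 0")
  case False
  have "bracket t powr \<alpha> * \<bar>\<beta> t\<bar> \<le> 9 * (N2 * r) * 1"
   by (intro mult_mono bracket_band[OF False] \<beta>(2)) auto
  then show ?thesis by (simp add: abs_mult)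
 qed simp
qed

lemma norm_band: "norm (B.rc \<beta>) \<le> 1"
 by (rule B.rc_norm_le[OF \<beta>])

text \<open>
 In \<open>a g(D\<^sub>1) a\<^sup>* D\<^sub>2\<close> replace \<open>a\<^sup>* D\<^sub>2\<close> by \<open>p c\<^sup>* D\<^sub>2 \<approx> p D\<^sub>1 d\<^sup>*\<close>, with \<open>p\<close> moved to the left of \<open>g(D\<^sub>1)\<close>; as \<open>a p = d\<close>, the result
 \<open>d g(D\<^sub>1) D\<^sub>1 d\<^sup>*\<close> is symmetric.
\<close>

lemma form_identity:
 assumes g: "g \<in> Cb1"
 shows "B.rc \<beta> \<cdot> (a \<cdot> (A.rc g \<cdot> a\<^sup>*)) \<cdot> B.rc (\<lambda>t. t * \<beta> t)
  = B.rc \<beta> \<cdot> d \<cdot> A.rc (\<lambda>t. t * g t) \<cdot> d\<^sup>* \<cdot> B.rc \<beta>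
   + B.rc \<beta> \<cdot> (d \<cdot> (A.rc g \<cdot> X\<^sup>* \<cdot> B.rc (\<lambda>t. bracket t powr \<alpha> * \<beta> t))
     + a \<cdot> (A.comm g (a\<^sup>*) - p \<cdot> A.comm g (c\<^sup>*)) \<cdot> B.rc (\<lambda>t. t * \<beta> t))"
proof -
 have "a \<cdot> (A.rc g \<cdot> a\<^sup>*) \<cdot> B.rc (\<lambda>t. t * \<beta> t)
   = (a \<cdot> p) \<cdot> (A.rc g \<cdot> c\<^sup>* \<cdot> B.rc (\<lambda>t. t * \<beta> t)) + a \<cdot> (A.comm g (a\<^sup>*) - p \<cdot> A.comm g (c\<^sup>*)) \<cdot> B.rc (\<lambda>t. t * \<beta> t)"
  unfolding rc_conformal[OF Cb1_Cbr(1)[OF g]] by (simp only: blinfun_compose.add_left blinfun_compose.add_right op_assoc)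
 then show ?thesis
  unfolding intertwines_dag[OF band_Cb1 g] a_p
  by (simp only: blinfun_compose.add_left blinfun_compose.add_right op_assoc add.assoc)
qed

text \<open>
 Let \<open>Z\<close> be the operator on the left and \<open>g = (1 + smooth_sign)\<^sup>2 low R\<close>.  By the preceding identity \<open>Z\<^sup>*Z D\<^sub>2\<close> is, on the
 band and up to small errors, \<open>d (g D\<^sub>1) d\<^sup>*\<close>, where \<open>t g(t) \<ge> - (N + 2)\<close>.  But \<open>D\<^sub>2 \<le> - N\<^sup>2\<close> on the band, so that \<open>Z\<^sup>*Z\<close> has
 to be of the order of the errors divided by \<open>N\<^sup>2\<close>.
\<close>

lemma norm_wrong_sign:
 assumes R: "N \<le> R"
 shows "(norm (A.rc (\<lambda>t. (1 + smooth_sign N (R\<^sup>2) t) * sqrt (low R t)) \<cdot> a\<^sup>* \<cdot> B.rc \<beta>))\<^sup>2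
  \<le> (36 * norm d * norm X + 8 * norm a * \<kappa> + 3 * (norm d)\<^sup>2) * r" (is "(norm ?Z)\<^sup>2 \<le> _")
proof -
 define f where "f t = 1 + smooth_sign N (R\<^sup>2) t" for t
 define s where "s t = f t * sqrt (low R t)" for t
 define g where "g t = f t * (f t * low R t)" for t
 define k where "k t = sqrt (t * g t + (real N + 2))" for t
 (* The band is centred at - 9/2 N^2 and has radius 7/2 N^2; the difference N^2 is the gap that bounds Z from below. *)
 define m where "m t = max (- (7/2 * N2)) (min (7/2 * N2) (t + 9/2 * N2))" for t
 have R0: "0 < real R" "N \<le> R\<^sup>2" using N R by (auto simp: power2_eq_square intro: order_trans)
 have fb: "\<bar>f t\<bar> \<le> 2" for t using smooth_sign_bound[OF N R0(2), of t] unfolding f_def by linarith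
 have fC: "f \<in> Cbr" unfolding f_def[abs_def] using N R0 by (intro Cbr_add) simp_all
 have sC: "s \<in> Cbr" unfolding s_def[abs_def] using R0 by (intro Cbr_mult fC Cbr_sqrt) simp
 have gC: "g \<in> Cb1" unfolding g_def[abs_def] using R0 by (intro Cb1_mult fC) simp
 have ss: "(\<lambda>t. s t * s t) = g"
  unfolding s_def g_def using low_bounds[OF R0(1)] by (auto simp: mult_ac)
 have tgC: "(\<lambda>t. t * g t + (real N + 2)) \<in> Cbr" by (intro Cbr_add Cb1_Cbr gC Cbr_const)
 have kC: "k \<in> Cbr" unfolding k_def[abs_def] by (rule Cbr_sqrt[OF tgC])
 have kk: "(\<lambda>t. k t * k t) = (\<lambda>t. t * g t + (real N + 2))"
 proof
  fix t
  have "- (real N + 2) \<le> t * g t" using smooth_sign_form_bound[OF N R] by (simp add: g_def f_def)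
  then have "0 \<le> t * g t + (real N + 2)" by linarith
  then show "k t * k t = t * g t + (real N + 2)" unfolding k_def by simp
 qed
 have mb: "\<bar>m t\<bar> \<le> 7/2 * N2" for t
 proof -
  have clamp: "\<bar>max (- c) (min c x)\<bar> \<le> c" if "0 \<le> c" for c x :: real using that by (auto simp: max_def min_def)
  show ?thesis unfolding m_def by (rule clamp) simp
 qed
 have mC: "m \<in> Cbr" by (rule CbrI[OF _ mb]) (auto simp: m_def[abs_def] intro!: continuous_intros)
 have nm: "norm (B.rc m) \<le> 7/2 * N2" by (rule B.rc_norm_le[OF mC mb])
 have Z: "?Z = A.rc s \<cdot> a\<^sup>* \<cdot> B.rc \<beta>" unfolding s_def f_def ..
 define Z where "Z = A.rc s \<cdot> a\<^sup>* \<cdot> B.rc \<beta>"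
 define K where "K = A.rc k \<cdot> d\<^sup>* \<cdot> B.rc \<beta>"
 define err where "err = B.rc \<beta> \<cdot> (d \<cdot> (A.rc g \<cdot> X\<^sup>* \<cdot> B.rc (\<lambda>t. bracket t powr \<alpha> * \<beta> t))
     + a \<cdot> (A.comm g (a\<^sup>*) - p \<cdot> A.comm g (c\<^sup>*)) \<cdot> B.rc (\<lambda>t. t * \<beta> t))"
 have ZE: "Z \<in> End_star E" and KE: "K \<in> End_star E" unfolding Z_def K_def using sC kC \<beta>(1) by auto
 have ZZ: "Z\<^sup>* \<cdot> Z = B.rc \<beta> \<cdot> (a \<cdot> (A.rc g \<cdot> a\<^sup>*)) \<cdot> B.rc \<beta>"
  unfolding Z_def ss[symmetric] A.rc_mult[OF sC sC] by (simp add: sC \<beta>(1) op_assoc)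
 have KK: "K\<^sup>* \<cdot> K = B.rc \<beta> \<cdot> d \<cdot> A.rc (\<lambda>t. t * g t) \<cdot> d\<^sup>* \<cdot> B.rc \<beta>
   + (real N + 2) *\<^sub>R (B.rc \<beta> \<cdot> d \<cdot> d\<^sup>* \<cdot> B.rc \<beta>)"
 proof -
  have "A.rc k \<cdot> A.rc k = A.rc (\<lambda>t. t * g t) + (real N + 2) *\<^sub>R \<one>"
   unfolding A.rc_mult[OF kC kC, symmetric] kk
   using A.rc_add[OF Cb1_Cbr(2)[OF gC] Cbr_const[of "real N + 2"]] A.rc_scale[OF Cbr_const[of 1], of "real N + 2"] by simp
  moreover have "K\<^sup>* \<cdot> K = B.rc \<beta> \<cdot> d \<cdot> (A.rc k \<cdot> A.rc k) \<cdot> d\<^sup>* \<cdot> B.rc \<beta>"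
   unfolding K_def by (simp add: kC \<beta>(1) op_assoc)
  ultimately show ?thesis
   by (simp add: op_simps op_scaleR)
 qed
 have t\<beta>: "B.rc (\<lambda>t. t * \<beta> t) = B.rc \<beta> \<cdot> B.rc m - (9/2 * N2) *\<^sub>R B.rc \<beta>"
 proof -
  have "t * \<beta> t = \<beta> t * m t - 9/2 * N2 * \<beta> t" for t
  proof (cases "\<beta> t = 0")
   case False
   have "m t = t + 9/2 * N2" unfolding m_def using band[OF False] by auto
   then show ?thesis by (simp add: algebra_simps)
  qed simp
  then have "(\<lambda>t. t * \<beta> t) = (\<lambda>t. \<beta> t * m t - 9/2 * N2 * \<beta> t)" by blast
  then show ?thesis by (simp only: B.rc_diff[OF Cbr_mult[OF \<beta>(1) mC] Cbr_scale[OF \<beta>(1)]] B.rc_mult[OF \<beta>(1) mC] B.rc_scale[OF \<beta>(1)])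
 qed
 have form: "(9/2 * N2) *\<^sub>R (Z\<^sup>* \<cdot> Z) + K\<^sup>* \<cdot> K
   = Z\<^sup>* \<cdot> Z \<cdot> B.rc m - err + (real N + 2) *\<^sub>R (B.rc \<beta> \<cdot> d \<cdot> d\<^sup>* \<cdot> B.rc \<beta>)"
 proof -
  have "Z\<^sup>* \<cdot> Z \<cdot> B.rc m - (9/2 * N2) *\<^sub>R (Z\<^sup>* \<cdot> Z)
    = B.rc \<beta> \<cdot> (a \<cdot> (A.rc g \<cdot> a\<^sup>*)) \<cdot> B.rc (\<lambda>t. t * \<beta> t)"
   unfolding ZZ t\<beta> by (simp only: blinfun_compose.diff_right blinfun_compose.scaleR_right op_assoc)
  then show ?thesis unfolding KK form_identity[OF gC] err_def[symmetric] by (simp add: algebra_simps)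
 qed
 have nZ: "(norm Z)\<^sup>2 = norm (Z\<^sup>* \<cdot> Z)" by (rule norm_dag_compose[OF ZE, symmetric])
 have "9/2 * N2 * (norm Z)\<^sup>2 \<le> norm ((9/2 * N2) *\<^sub>R (Z\<^sup>* \<cdot> Z) + K\<^sup>* \<cdot> K)"
  using N by (intro norm_square_le_add ZE KE) simp
 also have "\<dots> \<le> (norm Z)\<^sup>2 * (7/2 * N2) + norm err + (real N + 2) * (1 * norm d * norm d * 1)"
  unfolding form
 proof (intro norm_triangle_mono order_trans[OF norm_triangle_ineq4] add_mono order_refl)
  show "norm (Z\<^sup>* \<cdot> Z \<cdot> B.rc m) \<le> (norm Z)\<^sup>2 * (7/2 * N2)"
   by (intro norm_compose_le[OF _ nm]) (simp add: nZ)
  have "norm (B.rc \<beta> \<cdot> d \<cdot> d\<^sup>* \<cdot> B.rc \<beta>) \<le> 1 * norm d * norm d * 1" by (intro norm_compose_le norm_band) simp_all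
  then show "norm ((real N + 2) *\<^sub>R (B.rc \<beta> \<cdot> d \<cdot> d\<^sup>* \<cdot> B.rc \<beta>)) \<le> (real N + 2) * (1 * norm d * norm d * 1)"
   unfolding norm_scaleR by (intro mult_mono) auto
 qed
 finally have "N2 * (norm Z)\<^sup>2 \<le> norm err + (real N + 2) * (norm d)\<^sup>2"
  by (simp add: algebra_simps power2_eq_square)
 also have "\<dots> \<le> 1 * (norm d * (4 * norm X * (9 * (N2 * r))) + norm a * (\<kappa> * r) * (8 * N2))
   + 3 * (N2 * r) * (norm d)\<^sup>2"
 proof (intro add_mono mult_right_mono)
  have "real N + 2 \<le> 3 * real N" using N_powers(1) by linarith
  then show "real N + 2 \<le> 3 * (N2 * r)" using N_powers(4) by linarith
  have ng: "norm (A.rc g) \<le> 4"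
  proof (rule A.rc_norm_le[OF Cb1_Cbr(1)[OF gC]])
   fix t
   have "\<bar>f t\<bar> * (\<bar>f t\<bar> * \<bar>low R t\<bar>) \<le> 2 * (2 * 1)"
    using low_bounds[OF R0(1), of t] by (intro mult_mono fb) auto
   then show "\<bar>g t\<bar> \<le> 4" by (simp add: g_def abs_mult)
  qed
  have nk: "norm (A.comm g (a\<^sup>*) - p \<cdot> A.comm g (c\<^sup>*)) \<le> \<kappa> * r"
  proof -
   have "norm (A.comm g (a\<^sup>*)) \<le> 16 * norm X\<^sub>a / (1 - \<alpha>) * r" "norm (A.comm g (c\<^sup>*)) \<le> 16 * norm X\<^sub>c / (1 - \<alpha>) * r"
    using A.norm_comm_form[OF comm_a \<alpha> N R0(2) R] A.norm_comm_form[OF comm_c \<alpha> N R0(2) R]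
    by (simp_all only: A.norm_comm_dag Cb1_Cbr gC End) (simp_all only: g_def[abs_def] f_def)
   then have "norm (A.comm g (a\<^sup>*) - p \<cdot> A.comm g (c\<^sup>*))
     \<le> 16 * norm X\<^sub>a / (1 - \<alpha>) * r + norm p * (16 * norm X\<^sub>c / (1 - \<alpha>) * r)"
    by (intro order_trans[OF norm_triangle_ineq4] add_mono norm_compose_le order_refl)
   then show ?thesis by (simp only: distrib_right mult.assoc)
  qed
  have nt: "norm (B.rc (\<lambda>t. t * \<beta> t)) \<le> 8 * N2"
   by (rule B.rc_norm_le[OF Cb1_Cbr(2)[OF band_Cb1] band_abs_le])
  show "norm err \<le> 1 * (norm d * (4 * norm X * (9 * (N2 * r))) + norm a * (\<kappa> * r) * (8 * N2))"
   unfolding err_def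
  proof (rule norm_compose_le[OF norm_band])
   have "norm (X\<^sup>*) \<le> norm X" by simp
   then have "norm (d \<cdot> (A.rc g \<cdot> X\<^sup>* \<cdot> B.rc (\<lambda>t. bracket t powr \<alpha> * \<beta> t))) \<le> norm d * (4 * norm X * (9 * (N2 * r)))"
    by (intro norm_compose_le ng norm_weighted_band order_refl)
   moreover have "norm (a \<cdot> (A.comm g (a\<^sup>*) - p \<cdot> A.comm g (c\<^sup>*)) \<cdot> B.rc (\<lambda>t. t * \<beta> t)) \<le> norm a * (\<kappa> * r) * (8 * N2)"
    by (intro norm_compose_le nk nt order_refl)
   ultimately show "norm (d \<cdot> (A.rc g \<cdot> X\<^sup>* \<cdot> B.rc (\<lambda>t. bracket t powr \<alpha> * \<beta> t))
     + a \<cdot> (A.comm g (a\<^sup>*) - p \<cdot> A.comm g (c\<^sup>*)) \<cdot> B.rc (\<lambda>t. t * \<beta> t))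
     \<le> norm d * (4 * norm X * (9 * (N2 * r))) + norm a * (\<kappa> * r) * (8 * N2)"
    by (rule norm_triangle_mono)
  qed
 qed simp
 also have "\<dots> = N2 * ((36 * norm d * norm X + 8 * norm a * \<kappa> + 3 * (norm d)\<^sup>2) * r)"
  by (simp only: distrib_right distrib_left mult_1) (simp add: mult_ac)
 finally show ?thesis unfolding Z Z_def[symmetric] by (rule mult_left_le_imp_le) (use N in simp)
qed

text \<open>Where \<open>|D\<^sub>1| \<lesssim> N\<close> and \<open>|D\<^sub>2| \<ge> N\<^sup>2\<close>, the relation \<open>c\<^sup>* D\<^sub>2 \<approx> D\<^sub>1 d\<^sup>*\<close> makes \<open>c\<^sup>*\<close> small: on the band it is divided by \<open>D\<^sub>2\<close>.\<close>

lemma norm_low_frequency: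
 "(norm (A.rc (\<lambda>t. sqrt (low N t)) \<cdot> a\<^sup>* \<cdot> B.rc \<beta>))\<^sup>2
  \<le> norm a * (norm p * (norm d + 9 * norm X) + (2 * norm X\<^sub>a + norm p * (2 * norm X\<^sub>c))) * r"
proof -
 have N0: "0 < real N" using N by simp
 have s: "(\<lambda>t. sqrt (low N t)) \<in> Cbr" using N0 by (intro Cbr_sqrt) simp
 define Y where "Y = A.rc (\<lambda>t. sqrt (low N t)) \<cdot> a\<^sup>* \<cdot> B.rc \<beta>"
 have YE: "Y \<in> End_star E" unfolding Y_def using s \<beta>(1) by auto
 have "A.rc (low N) = A.rc (\<lambda>t. sqrt (low N t)) \<cdot> A.rc (\<lambda>t. sqrt (low N t))"
  unfolding A.rc_mult[OF s s, symmetric] using low_bounds[OF N0] by simp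
 then have YY: "Y\<^sup>* \<cdot> Y = B.rc \<beta> \<cdot> a \<cdot> (A.rc (low N) \<cdot> a\<^sup>* \<cdot> B.rc \<beta>)"
  unfolding Y_def by (simp add: s \<beta>(1) op_assoc)
 (* h t = \<beta> t / t, written so as to be continuous. *)
 define h where "h t = \<beta> t * - (1 / max N2 (- t))" for t
 have pos: "0 < max N2 (- t)" for t using N0 by (simp add: less_max_iff_disj)
 have th: "(\<lambda>t. t * h t) = \<beta>"
 proof
  fix t
  show "t * h t = \<beta> t"
  proof (cases "\<beta> t = 0")
   case False
   have "max N2 (- t) = - t" "t \<noteq> 0" using band[OF False] N0 by auto
   then show ?thesis by (simp add: h_def)
  qed (simp add: h_def)
 qed
 have hb: "\<bar>h t\<bar> \<le> 1 / N2" for t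
 proof -
  have "1 / max N2 (- t) \<le> 1 / N2" using N0 pos[of t] by (intro divide_left_mono) auto
  then have "\<bar>\<beta> t\<bar> * (1 / max N2 (- t)) \<le> 1 * (1 / N2)"
   using pos[of t] by (intro mult_mono \<beta>(2)) auto
  then show ?thesis using pos[of t] by (simp add: h_def abs_mult)
 qed
 have hC: "h \<in> Cbr"
  unfolding h_def[abs_def] using pos by (intro CbrI[OF _ hb[unfolded h_def]] continuous_intros Cbr_cont[OF \<beta>(1)]) (auto simp: less_imp_neq[symmetric])
 then have hC1: "h \<in> Cb1" using th \<beta>(1) by (simp add: Cb1_def)
 have wh: "norm (B.rc (\<lambda>t. bracket t powr \<alpha> * h t)) \<le> 9 * r"
 proof (rule B.rc_norm_le[OF weighted_Cbr[OF hC1 \<alpha>]])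
  show "\<bar>bracket t powr \<alpha> * h t\<bar> \<le> 9 * r" for t
  proof (cases "\<beta> t = 0")
   case False
   have "bracket t powr \<alpha> * \<bar>h t\<bar> \<le> 9 * (N2 * r) * (1 / N2)"
    by (intro mult_mono bracket_band[OF False] hb) auto
   then show ?thesis using N0 by (simp add: abs_mult)
  qed (simp add: h_def)
 qed
 have tl: "norm (A.rc (\<lambda>t. t * low N t)) \<le> real N"
 proof (rule A.rc_norm_le)
  show "\<bar>t * low (real N) t\<bar> \<le> real N" for t
  proof -
   have "t * low (real N) t = real N * mid (real N) t" by (simp add: low_def mid_def skew_def power2_eq_square)
   then show ?thesis using abs_mid_le_1[OF N0, of t] N0 by (simp add: abs_mult)
  qed
 qed (use N0 in simp)
 have "A.rc (low N) \<cdot> c\<^sup>* \<cdot> B.rc \<beta>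
   = A.rc (\<lambda>t. t * low N t) \<cdot> d\<^sup>* \<cdot> B.rc h + A.rc (low N) \<cdot> X\<^sup>* \<cdot> B.rc (\<lambda>t. bracket t powr \<alpha> * h t)"
  using intertwines_dag[OF hC1, of "low N"] N0 unfolding th by simp
 also have "norm \<dots> \<le> real N * norm d * (1 / N2) + 1 * norm X * (9 * r)"
 proof (rule norm_triangle_mono)
  have "norm (B.rc h) \<le> 1 / N2" by (rule B.rc_norm_le[OF hC hb])
  then show "norm (A.rc (\<lambda>t. t * low N t) \<cdot> d\<^sup>* \<cdot> B.rc h) \<le> real N * norm d * (1 / N2)"
   by (intro norm_compose_le tl) simp_all
  have "norm (A.rc (low N)) \<le> 1" using N0 low_bounds[OF N0] by (intro A.rc_norm_le) auto
  then show "norm (A.rc (low N) \<cdot> X\<^sup>* \<cdot> B.rc (\<lambda>t. bracket t powr \<alpha> * h t)) \<le> 1 * norm X * (9 * r)"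
   by (intro norm_compose_le wh) simp_all
 qed
 also have "real N * norm d * (1 / N2) = 1 / real N * norm d" using N0 by (simp add: power2_eq_square)
 also have "1 / real N * norm d + 1 * norm X * (9 * r) \<le> r * norm d + 1 * norm X * (9 * r)"
  by (intro add_right_mono mult_right_mono N_powers) simp
 finally have c: "norm (A.rc (low N) \<cdot> c\<^sup>* \<cdot> B.rc \<beta>) \<le> r * norm d + 1 * norm X * (9 * r)" .
 have k: "norm (A.comm (low N) (a\<^sup>*)) \<le> 2 * norm X\<^sub>a * r" "norm (A.comm (low N) (c\<^sup>*)) \<le> 2 * norm X\<^sub>c * r"
  using A.norm_comm_low[OF comm_a N_powers(1) \<alpha>] A.norm_comm_low[OF comm_c N_powers(1) \<alpha>] N0
  by (simp_all only: A.norm_comm_dag rational_Cbr End)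
 have "A.rc (low N) \<cdot> a\<^sup>* \<cdot> B.rc \<beta> = p \<cdot> (A.rc (low N) \<cdot> c\<^sup>* \<cdot> B.rc \<beta>)
   + (A.comm (low N) (a\<^sup>*) - p \<cdot> A.comm (low N) (c\<^sup>*)) \<cdot> B.rc \<beta>"
  unfolding rc_conformal[OF rational_Cbr(1)[OF N0]] by (simp only: blinfun_compose.add_left op_assoc)
 also have "norm \<dots> \<le> norm p * (r * norm d + 1 * norm X * (9 * r)) + (2 * norm X\<^sub>a * r + norm p * (2 * norm X\<^sub>c * r)) * 1"
 proof (rule norm_triangle_mono)
  show "norm (p \<cdot> (A.rc (low N) \<cdot> c\<^sup>* \<cdot> B.rc \<beta>)) \<le> norm p * (r * norm d + 1 * norm X * (9 * r))"
   by (rule norm_compose_le[OF order_refl c])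
  show "norm ((A.comm (low N) (a\<^sup>*) - p \<cdot> A.comm (low N) (c\<^sup>*)) \<cdot> B.rc \<beta>) \<le> (2 * norm X\<^sub>a * r + norm p * (2 * norm X\<^sub>c * r)) * 1"
  proof (rule norm_compose_le[OF _ norm_band])
   show "norm (A.comm (low N) (a\<^sup>*) - p \<cdot> A.comm (low N) (c\<^sup>*)) \<le> 2 * norm X\<^sub>a * r + norm p * (2 * norm X\<^sub>c * r)"
    by (intro order_trans[OF norm_triangle_ineq4] add_mono norm_compose_le k order_refl)
  qed
 qed
 finally have "norm (Y\<^sup>* \<cdot> Y) \<le> 1 * norm a * (norm p * (r * norm d + 1 * norm X * (9 * r)) + (2 * norm X\<^sub>a * r + norm p * (2 * norm X\<^sub>c * r)) * 1)"
  unfolding YY by (intro norm_compose_le norm_band order_refl)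
 also have "\<dots> = norm a * (norm p * (norm d + 9 * norm X) + (2 * norm X\<^sub>a + norm p * (2 * norm X\<^sub>c))) * r"
  by (simp only: distrib_right distrib_left mult_1 mult_1_right) (simp only: mult_ac)
 finally show ?thesis unfolding norm_dag_compose[OF YE] unfolding Y_def .
qed

text \<open>
 As \<open>F(D\<^sub>2)\<close> is close to \<open>- 1\<close> on the band, the estimate concerns \<open>(1 + F(D\<^sub>1)) a\<^sup>*\<close>.  Here \<open>F\<close> is replaced by the smoothed
 sign, at the price of an error concentrated at low frequencies of \<open>D\<^sub>1\<close>.  All this takes place behind \<open>low R (D\<^sub>1)\<close>, and
 finally \<open>R \<rightarrow> \<infinity>\<close>.
\<close>

lemma norm_diff_phase_band:
 "norm (diff phase \<cdot> B.rc \<beta>)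
  \<le> (sqrt (36 * norm d * norm X + 8 * norm a * \<kappa> + 3 * (norm d)\<^sup>2)
    + 6 * sqrt (norm a * (norm p * (norm d + 9 * norm X) + (2 * norm X\<^sub>a + norm p * (2 * norm X\<^sub>c)))) + norm a) * sqrt r"
 (is "_ \<le> (sqrt ?CZ + 6 * sqrt ?CY + norm a) * sqrt r")
proof -
 have N0: "0 < real N" using N by simp
 let ?b = "sqrt ?CZ * sqrt r + 6 * (sqrt ?CY * sqrt r)"
 define Y where "Y = a\<^sup>* \<cdot> B.rc \<beta>"
 have nY: "norm Y \<le> norm a * 1" unfolding Y_def by (intro norm_compose_le norm_band) simp
 have f: "(\<lambda>t. 1 + phase t) \<in> Cbr" by (intro Cbr_add) simp_all
 have le: "norm (A.rc (low R) \<cdot> A.rc (\<lambda>t. 1 + phase t) \<cdot> Y) \<le> ?b + norm a * (1 / real R)"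
  if R: "N \<le> R" for R :: nat
 proof -
  have R0: "0 < real R" "N \<le> R\<^sup>2" using N R by (auto simp: power2_eq_square intro: order_trans)
  let ?f = "\<lambda>t. 1 + smooth_sign N (R\<^sup>2) t"
  let ?e = "\<lambda>t. low R t * (phase t - smooth_sign N (R\<^sup>2) t)"
  let ?k = "\<lambda>t. 6 * sqrt (low N t) + 1 / real R"
  have fC: "?f \<in> Cbr" using N R0 by (intro Cbr_add) simp_all
  have lC: "(\<lambda>t. sqrt (low N t)) \<in> Cbr" using N0 by (intro Cbr_sqrt) simp
  have lfC: "(\<lambda>t. low R t * ?f t) \<in> Cbr" and eC: "?e \<in> Cbr" using R0 N fC by (auto intro!: Cbr_mult Cbr_diff)
  have sC: "(\<lambda>t. ?f t * sqrt (low R t)) \<in> Cbr" using R0 by (intro Cbr_mult fC Cbr_sqrt) simp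
  have kC: "?k \<in> Cbr" by (intro Cbr_add Cbr_scale lC Cbr_const)
  have "A.rc (low R) \<cdot> A.rc (\<lambda>t. 1 + phase t) = A.rc (\<lambda>t. low R t * ?f t) + A.rc ?e"
   unfolding A.rc_add[OF lfC eC, symmetric] A.rc_mult[OF rational_Cbr(1)[OF R0(1)] f, symmetric]
   by (rule arg_cong[of _ _ A.rc]) (auto simp: algebra_simps)
  then have "A.rc (low R) \<cdot> A.rc (\<lambda>t. 1 + phase t) \<cdot> Y = A.rc (\<lambda>t. low R t * ?f t) \<cdot> Y + A.rc ?e \<cdot> Y"
   by (simp only: blinfun_compose.add_left)
  also have "norm \<dots> \<le> sqrt ?CZ * sqrt r + (6 * (sqrt ?CY * sqrt r) + norm a * (1 / real R))"
  proof (rule norm_triangle_mono)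
   have "norm (A.rc (\<lambda>t. low R t * ?f t) \<cdot> Y) \<le> norm (A.rc (\<lambda>t. ?f t * sqrt (low R t)) \<cdot> Y)"
   proof (rule A.norm_rc_mono[OF lfC sC])
    fix t
    have l: "0 \<le> low R t" "low R t \<le> 1" by (rule low_bounds[OF R0(1)])+
    then have "low R t * low R t \<le> 1 * low R t" by (intro mult_right_mono)
    then have "low R t \<le> sqrt (low R t)" by (intro real_le_rsqrt) (simp add: power2_eq_square)
    then have "\<bar>?f t\<bar> * low R t \<le> \<bar>?f t\<bar> * sqrt (low R t)" by (intro mult_left_mono) auto
    then show "\<bar>low R t * ?f t\<bar> \<le> \<bar>?f t * sqrt (low R t)\<bar>" using l by (simp add: abs_mult mult.commute)
   qed
   also have "\<dots> \<le> sqrt ?CZ * sqrt r"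
    using real_le_rsqrt[OF norm_wrong_sign[OF R]] by (simp only: real_sqrt_mult Y_def op_assoc)
   finally show "norm (A.rc (\<lambda>t. low R t * ?f t) \<cdot> Y) \<le> sqrt ?CZ * sqrt r" .
   have "norm (A.rc ?e \<cdot> Y) \<le> norm (A.rc ?k \<cdot> Y)"
   proof (rule A.norm_rc_mono[OF eC kC])
    fix t
    have lR: "0 \<le> low R t" "low R t \<le> 1" and lN: "0 \<le> low N t" by (intro low_bounds R0 N0)+
    have "low R t * (\<bar>t\<bar> / real (R\<^sup>2)) = \<bar>mid R t\<bar> * (1 / real R)"
     using quad_pos[OF R0(1), of t] R0 by (simp add: low_def mid_def skew_def abs_mult power2_eq_square)
    also have "\<dots> \<le> 1 * (1 / real R)" using R0 by (intro mult_right_mono abs_mid_le_1) auto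
    finally have t: "low R t * (\<bar>t\<bar> / real (R\<^sup>2)) \<le> 1 / real R" by simp
    have "\<bar>?e t\<bar> \<le> low R t * (6 * sqrt (low N t) + \<bar>t\<bar> / real (R\<^sup>2))"
     unfolding abs_mult using lR phase_smooth_sign[OF N R0(2), of t] by (simp add: mult_left_mono)
    also have "\<dots> \<le> 1 * (6 * sqrt (low N t)) + 1 / real R"
     unfolding distrib_left using lR lN t by (intro add_mono mult_right_mono) auto
    finally show "\<bar>?e t\<bar> \<le> \<bar>?k t\<bar>" by simp
   qed
   also have "A.rc ?k = 6 *\<^sub>R A.rc (\<lambda>t. sqrt (low N t)) + (1 / real R) *\<^sub>R \<one>"
    using A.rc_add[OF Cbr_scale[OF lC] Cbr_const] A.rc_scale[OF Cbr_const[of 1], of "1 / real R"]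
    by (simp add: A.rc_scale[OF lC])
   also have "\<dots> \<cdot> Y = 6 *\<^sub>R (A.rc (\<lambda>t. sqrt (low N t)) \<cdot> Y) + (1 / real R) *\<^sub>R Y"
    by (simp only: blinfun_compose.add_left blinfun_compose.scaleR_left blinfun_compose_id)
   also have "norm \<dots> \<le> 6 * (sqrt ?CY * sqrt r) + norm a * (1 / real R)"
   proof (rule norm_triangle_mono)
    show "norm (6 *\<^sub>R (A.rc (\<lambda>t. sqrt (low N t)) \<cdot> Y)) \<le> 6 * (sqrt ?CY * sqrt r)"
     using real_le_rsqrt[OF norm_low_frequency] by (simp add: real_sqrt_mult Y_def op_assoc)
    show "norm ((1 / real R) *\<^sub>R Y) \<le> norm a * (1 / real R)" using R0 nY by (simp add: divide_right_mono)
   qed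
   finally show "norm (A.rc ?e \<cdot> Y) \<le> 6 * (sqrt ?CY * sqrt r) + norm a * (1 / real R)" .
  qed
  finally show ?thesis by simp
 qed
 have "norm (A.rc (\<lambda>t. 1 + phase t) \<cdot> Y) \<le> ?b"
 proof (rule norm_blinfun_bound)
  fix y
  let ?y = "A.rc (\<lambda>t. 1 + phase t) (Y y)"
  have "(\<lambda>n. (?b + norm a * (1 / real (n + N))) * norm y) \<longlonglongrightarrow> (?b + norm a * 0) * norm y"
   by (intro tendsto_intros LIMSEQ_ignore_initial_segment lim_1_over_n)
  moreover have "norm (A.rc (low (real (n + N))) ?y) \<le> (?b + norm a * (1 / real (n + N))) * norm y" for n
   using order_trans[OF norm_blinfun mult_right_mono[OF le[of "n + N"] norm_ge_zero[of y]]] by simp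
  ultimately have "norm ?y \<le> (?b + norm a * 0) * norm y"
   by (intro LIMSEQ_le[OF tendsto_norm[OF A.rc_low_tendsto[OF N]]]) blast+
  then show "norm ((A.rc (\<lambda>t. 1 + phase t) \<cdot> Y) y) \<le> ?b * norm y" by simp
  show "0 \<le> ?b" by (intro add_nonneg_nonneg mult_nonneg_nonneg real_sqrt_ge_zero divide_nonneg_nonneg) (use \<alpha> in auto)
 qed
 moreover have "norm (a\<^sup>* \<cdot> B.rc (\<lambda>t. (1 + phase t) * \<beta> t)) \<le> norm a * sqrt r"
 proof (rule norm_compose_le)
  have "1 / real N \<le> sqrt r"
  proof -
   have "(1 / real N)\<^sup>2 \<le> 1 / real N" using N_powers(1) by (simp add: power2_eq_square divide_simps)
   then show ?thesis using N_powers(2) by (intro real_le_rsqrt) linarith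
  qed
  then have small: "1 / N2 \<le> sqrt r"
   using N_powers(1) divide_left_mono[of "real N" "N2" 1] self_le_power[of "real N" 2] by simp
  show "norm (B.rc (\<lambda>t. (1 + phase t) * \<beta> t)) \<le> sqrt r"
  proof (rule B.rc_norm_le[OF Cbr_mult[OF f \<beta>(1)]])
   fix t
   show "\<bar>(1 + phase t) * \<beta> t\<bar> \<le> sqrt r"
   proof (cases "\<beta> t = 0")
    case False
    then have t: "N2 \<le> - t" using band by blast
    then have "0 < - t" using N0 by (intro less_le_trans[OF _ t]) simp
    then have "0 \<le> 1 + phase t" "1 + phase t \<le> 1 / - t" using phase_pos[of "- t"] by simp_all
    moreover have "1 / - t \<le> 1 / N2" using t N0 \<open>0 < - t\<close> by (intro divide_left_mono mult_pos_pos) auto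
    ultimately have "\<bar>1 + phase t\<bar> \<le> sqrt r" using small by linarith
    then have "\<bar>1 + phase t\<bar> * \<bar>\<beta> t\<bar> \<le> sqrt r * 1" by (intro mult_mono \<beta>(2)) auto
    then show ?thesis by (simp add: abs_mult)
   qed simp
  qed
 qed simp
 moreover have "diff phase \<cdot> B.rc \<beta> = A.rc (\<lambda>t. 1 + phase t) \<cdot> Y - a\<^sup>* \<cdot> B.rc (\<lambda>t. (1 + phase t) * \<beta> t)"
 proof -
  have "A.rc (\<lambda>t. 1 + phase t) = \<one> + A.rc phase" using A.rc_add[OF Cbr_const[of 1] phase_Cbr] by simp
  moreover have "B.rc (\<lambda>t. (1 + phase t) * \<beta> t) = (\<one> + B.rc phase) \<cdot> B.rc \<beta>"
   unfolding B.rc_mult[OF f \<beta>(1)] using B.rc_add[OF Cbr_const[of 1] phase_Cbr] by simp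
  ultimately show ?thesis unfolding diff_def Y_def by (simp add: op_simps)
 qed
 ultimately have "norm (diff phase \<cdot> B.rc \<beta>) \<le> ?b + norm a * sqrt r"
  by (simp only:) (rule order_trans[OF norm_triangle_ineq4], intro add_mono)
 then show ?thesis by (simp only: distrib_right mult.assoc)
qed

end

text \<open>The preceding estimate for \<open>N = 2\<^sup>k\<close>, with \<open>\<beta>\<close> rescaled.\<close>

lemma diff_phase_band_decay:
 "\<exists>C\<ge>0. \<forall>k. \<forall>\<beta>\<in>Cbr. \<forall>b\<ge>0. (\<forall>t. \<bar>\<beta> t\<bar> \<le> b) \<longrightarrow> (\<forall>t. \<beta> t \<noteq> 0 \<longrightarrow> 4 ^ k \<le> - t \<and> - t \<le> 8 * 4 ^ k) \<longrightarrow>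
   norm (diff phase \<cdot> B.rc \<beta>) \<le> C * b * sqrt (2 powr (\<alpha> - 1)) ^ k"
proof -
 let ?\<kappa> = "16 * norm X\<^sub>a / (1 - \<alpha>) + norm p * (16 * norm X\<^sub>c / (1 - \<alpha>))"
 define C where "C = sqrt (36 * norm d * norm X + 8 * norm a * ?\<kappa> + 3 * (norm d)\<^sup>2)
    + 6 * sqrt (norm a * (norm p * (norm d + 9 * norm X) + (2 * norm X\<^sub>a + norm p * (2 * norm X\<^sub>c)))) + norm a"
 have "0 \<le> C" unfolding C_def
  by (intro add_nonneg_nonneg mult_nonneg_nonneg real_sqrt_ge_zero divide_nonneg_nonneg) (use \<alpha> in auto)
 moreover have "norm (diff phase \<cdot> B.rc \<beta>) \<le> C * b * sqrt (2 powr (\<alpha> - 1)) ^ k"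
  if \<beta>: "\<beta> \<in> Cbr" "0 \<le> b" "\<And>t. \<bar>\<beta> t\<bar> \<le> b" "\<And>t. \<beta> t \<noteq> 0 \<Longrightarrow> 4 ^ k \<le> - t \<and> - t \<le> 8 * 4 ^ k" for k b \<beta>
 proof (cases "b = 0")
  case True
  then have "\<beta> = (\<lambda>t. 0 * \<beta> t)" using \<beta>(3) by auto
  then have "B.rc \<beta> = 0" using B.rc_scale[OF \<beta>(1), of 0] by simp
  then show ?thesis using \<open>0 \<le> C\<close> \<beta>(2) True by simp
 next
  case False
  then have b: "0 < b" using \<beta>(2) by simp
  define \<gamma> where "\<gamma> t = 1 / b * \<beta> t" for t
  have "norm (diff phase \<cdot> B.rc \<gamma>) \<le> C * sqrt (real (2 ^ k) powr (\<alpha> - 1))"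
   unfolding C_def
  proof (rule norm_diff_phase_band)
   show "\<gamma> \<in> Cbr" unfolding \<gamma>_def[abs_def] by (intro Cbr_scale \<beta>)
   show "\<bar>\<gamma> t\<bar> \<le> 1" for t using \<beta>(3)[of t] b by (simp add: \<gamma>_def abs_mult)
   have "(real (2 ^ k))\<^sup>2 = 4 ^ k" by (simp add: power2_eq_square flip: power_mult_distrib)
   then show "(real (2 ^ k))\<^sup>2 \<le> - t \<and> - t \<le> 8 * (real (2 ^ k))\<^sup>2" if "\<gamma> t \<noteq> 0" for t
    using \<beta>(4)[of t] that by (simp add: \<gamma>_def)
  qed simp
  also have "real (2 ^ k) powr (\<alpha> - 1) = (2 powr (\<alpha> - 1)) ^ k"
   by (simp add: powr_powr powr_power mult.commute flip: powr_realpow)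
  also have "sqrt \<dots> = sqrt (2 powr (\<alpha> - 1)) ^ k" by (rule real_sqrt_power)
  finally have "b * norm (diff phase \<cdot> B.rc \<gamma>) \<le> b * (C * sqrt (2 powr (\<alpha> - 1)) ^ k)"
   using b by (intro mult_left_mono) auto
  moreover have "B.rc \<gamma> = (1 / b) *\<^sub>R B.rc \<beta>" unfolding \<gamma>_def[abs_def] by (rule B.rc_scale[OF \<beta>(1)])
  then have "norm (diff phase \<cdot> B.rc \<beta>) = b * norm (diff phase \<cdot> B.rc \<gamma>)"
   using b by (simp add: blinfun_compose.scaleR_right)
  ultimately show ?thesis by (simp add: mult_ac)
 qed
 ultimately show ?thesis by blast
qed

end

subsection \<open>Summation over the bands\<close>

text \<open>Differences of consecutive ramps are supported in the bands \<open>[- 8 \<sqdot> 4\<^sup>k, - 4\<^sup>k]\<close>, and telescope.\<close>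

definition ramp :: "nat \<Rightarrow> real \<Rightarrow> real" where
 "ramp k t = max 0 (min 1 (- t / 4 ^ k - 1))"

lemma ramp_bounds: "0 \<le> ramp k t" "ramp k t \<le> 1"
 and ramp_eq_0: "- t \<le> 4 ^ k \<Longrightarrow> ramp k t = 0"
 and ramp_eq_1: "2 * 4 ^ k \<le> - t \<Longrightarrow> ramp k t = 1"
proof -
 show "0 \<le> ramp k t" "ramp k t \<le> 1" by (auto simp: ramp_def)
 show "ramp k t = 0" if "- t \<le> 4 ^ k"
  using divide_right_mono[OF that, of "4 ^ k"] by (simp add: ramp_def)
 show "ramp k t = 1" if "2 * 4 ^ k \<le> - t"
  using divide_right_mono[OF that, of "4 ^ k"] by (simp add: ramp_def)
qed

lemma ramp_Cbr [simp]: "ramp k \<in> Cbr"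
 by (rule CbrI[of _ 1]) (auto simp: ramp_def[abs_def] intro!: continuous_intros)

lemma continuous_on_ln_bracket: "continuous_on UNIV (\<lambda>t. ln (bracket t))"
 by (intro continuous_intros) auto

lemma ramp_difference_band:
 assumes "ramp k t - ramp (Suc k) t \<noteq> 0" shows "4 ^ k \<le> - t \<and> - t \<le> 8 * 4 ^ k"
proof (rule ccontr)
 assume "\<not> (4 ^ k \<le> - t \<and> - t \<le> 8 * 4 ^ k)"
 moreover have "(0 :: real) < 4 ^ k" by simp
 ultimately have "- t \<le> 4 ^ k \<and> - t \<le> 4 ^ Suc k \<or> 2 * 4 ^ k \<le> - t \<and> 2 * 4 ^ Suc k \<le> - t"
  unfolding power_Suc by linarith
 then show False using assms ramp_eq_0[of t] ramp_eq_1[of _ t] by auto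
qed

lemma abs_ramp_log_le: "\<bar>(ramp k t - ramp (Suc k) t) * ln (bracket t)\<bar> \<le> 4 * real (Suc k)"
proof (cases "ramp k t - ramp (Suc k) t = 0")
 case False
 have "(1 :: real) \<le> 4 ^ k" by simp
 then have "bracket t \<le> 9 * 4 ^ k" using bracket_le[of t] ramp_difference_band[OF False] by linarith
 also have "\<dots> \<le> exp 4 * exp 2 ^ k"
 proof (intro mult_mono power_mono)
  have "(5 :: real) \<le> exp 4" using exp_ge_add_one_self[of 4] by simp
  have "(3 :: real) \<le> exp 2" using exp_ge_add_one_self[of 2] by simp
  then have "(3 :: real) * 3 \<le> exp 2 * exp 2" by (intro mult_mono) auto
  then show "9 \<le> exp (4 :: real)" by (simp flip: exp_add)
  have "(2 :: real) * 2 \<le> exp 1 * exp 1" using exp_ge_add_one_self[of 1] by (intro mult_mono) auto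
  then show "4 \<le> exp (2 :: real)" by (simp flip: exp_add)
 qed auto
 also have "\<dots> = exp (4 + 2 * real k)" by (simp add: exp_add exp_of_nat_mult mult.commute)
 finally have "ln (bracket t) \<le> ln (exp (4 + 2 * real k))" by (intro ln_mono) auto
 then have "ln (bracket t) \<le> 4 * real (Suc k)" by simp
 moreover have "\<bar>ramp k t - ramp (Suc k) t\<bar> \<le> 1" using ramp_bounds[of k t] ramp_bounds[of "Suc k" t] by linarith
 moreover have "0 \<le> ln (bracket t)" using bracket_ge_1[of t] by simp
 ultimately have "\<bar>ramp k t - ramp (Suc k) t\<bar> * \<bar>ln (bracket t)\<bar> \<le> 1 * (4 * real (Suc k))"
  by (intro mult_mono) auto
 then show ?thesis by (simp add: abs_mult)
qed simp

context conformal_pair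
begin

text \<open>On the \<open>k\<close>-th band \<open>log \<langle>t\<rangle>\<close> is of the order of \<open>k\<close>, which is harmless against the geometric decay of the norms.\<close>

lemma half_line:
 "\<exists>V \<in> End_star E. \<forall>h\<in>Ccr. V \<cdot> B.rc h = diff phase \<cdot> B.rc (\<lambda>t. ramp 0 t * ln (bracket t) * h t)"
proof -
 define \<beta> where "\<beta> k t = (ramp k t - ramp (Suc k) t) * ln (bracket t)" for k t
 have b: "\<bar>\<beta> k t\<bar> \<le> 4 * real (Suc k)" for k t unfolding \<beta>_def by (rule abs_ramp_log_le)
 have \<beta>: "\<beta> k \<in> Cbr" for k
 proof (rule CbrI[OF _ b])
  show "continuous_on UNIV (\<beta> k)" unfolding \<beta>_def[abs_def]
   by (intro continuous_on_mult continuous_on_diff continuous_on_ln_bracket Cbr_cont ramp_Cbr)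
 qed
 define q where "q = sqrt (2 powr (\<alpha> - 1))"
 have "(2 :: real) powr (\<alpha> - 1) < 2 powr 0" using \<alpha> by (intro powr_less_mono) auto
 then have q: "0 \<le> q" "q < 1" by (auto simp: q_def)
 obtain C where C: "0 \<le> C" "\<And>k. norm (diff phase \<cdot> B.rc (\<beta> k)) \<le> C * (4 * real (Suc k)) * q ^ k"
 proof -
  obtain C where C: "0 \<le> C" "\<And>k \<beta> b. \<beta> \<in> Cbr \<Longrightarrow> 0 \<le> b \<Longrightarrow> (\<And>t. \<bar>\<beta> t\<bar> \<le> b) \<Longrightarrow>
    (\<And>t. \<beta> t \<noteq> 0 \<Longrightarrow> 4 ^ k \<le> - t \<and> - t \<le> 8 * 4 ^ k) \<Longrightarrow> norm (diff phase \<cdot> B.rc \<beta>) \<le> C * b * q ^ k"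
   using diff_phase_band_decay unfolding q_def by blast
  have "norm (diff phase \<cdot> B.rc (\<beta> k)) \<le> C * (4 * real (Suc k)) * q ^ k" for k
  proof (rule C(2)[OF \<beta> _ b])
   fix t assume "\<beta> k t \<noteq> 0"
   then have "ramp k t - ramp (Suc k) t \<noteq> 0" by (auto simp: \<beta>_def)
   then show "4 ^ k \<le> - t \<and> - t \<le> 8 * 4 ^ k" by (rule ramp_difference_band)
  qed simp
  with C(1) show thesis by (rule that)
 qed
 have "summable (\<lambda>k. diff phase \<cdot> B.rc (\<beta> k))"
 proof (rule summable_comparison_test)
  show "\<exists>N. \<forall>k\<ge>N. norm (diff phase \<cdot> B.rc (\<beta> k)) \<le> C * 4 * (real (Suc k) * q ^ k)"
   using C(2) by (simp add: mult_ac)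
  show "summable (\<lambda>k. C * 4 * (real (Suc k) * q ^ k))"
   using geometric_deriv_sums[of q] q by (intro summable_mult sums_summable) auto
 qed
 then have lim: "(\<lambda>K. \<Sum>k<K. diff phase \<cdot> B.rc (\<beta> k)) \<longlonglongrightarrow> (\<Sum>k. diff phase \<cdot> B.rc (\<beta> k))" (is "_ \<longlonglongrightarrow> ?V")
  by (rule summable_LIMSEQ)
 have V: "?V \<in> End_star E"
  by (rule norm_limit_adjointable(1)[OF _ lim]) (intro End_star_sum End_star_compose diff_End B.rc_End \<beta> phase_Cbr)
 have "?V \<cdot> B.rc h = diff phase \<cdot> B.rc (\<lambda>t. ramp 0 t * ln (bracket t) * h t)" if h: "h \<in> Ccr" for h
 proof -
  have hC: "h \<in> Cbr" by (rule Ccr_Cbr[OF h])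
  obtain R where R: "\<And>t. R < \<bar>t\<bar> \<Longrightarrow> h t = 0" using h by (auto simp: Ccr_def)
  obtain K where K: "R < 4 ^ K" using real_arch_pow[of 4 R] by auto
  have "(\<Sum>k<n. diff phase \<cdot> B.rc (\<beta> k)) \<cdot> B.rc h = diff phase \<cdot> B.rc (\<lambda>t. ramp 0 t * ln (bracket t) * h t)"
   if n: "K \<le> n" for n
  proof -
   have "(4 :: real) ^ K \<le> 4 ^ n" using n by (intro power_increasing) auto
   have eq: "(\<Sum>k<n. \<beta> k t) * h t = ramp 0 t * ln (bracket t) * h t" for t
   proof (cases "h t = 0")
    case False
    then have "\<bar>t\<bar> \<le> R" using R[of t] by linarith
    then have "- t \<le> 4 ^ n" using K \<open>4 ^ K \<le> 4 ^ n\<close> by linarith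
    then have "ramp n t = 0" by (rule ramp_eq_0)
    moreover have "(\<Sum>k<n. \<beta> k t) = (ramp 0 t - ramp n t) * ln (bracket t)"
     unfolding \<beta>_def using sum_lessThan_telescope'[of "\<lambda>k. ramp k t" n] by (simp add: sum_distrib_right[symmetric])
    ultimately show ?thesis by simp
   qed simp
   have "(\<Sum>k<n. diff phase \<cdot> B.rc (\<beta> k)) \<cdot> B.rc h = diff phase \<cdot> (B.rc (\<lambda>t. \<Sum>k<n. \<beta> k t) \<cdot> B.rc h)"
    by (simp add: B.rc_sum(2) \<beta> op_sum op_assoc)
   also have "B.rc (\<lambda>t. \<Sum>k<n. \<beta> k t) \<cdot> B.rc h = B.rc (\<lambda>t. (\<Sum>k<n. \<beta> k t) * h t)"
    by (rule B.rc_mult[symmetric, OF B.rc_sum(1) hC]) (rule \<beta>)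
   finally show ?thesis unfolding eq .
  qed
  then have "\<forall>\<^sub>F n in sequentially. (\<Sum>k<n. diff phase \<cdot> B.rc (\<beta> k)) \<cdot> B.rc h
    = diff phase \<cdot> B.rc (\<lambda>t. ramp 0 t * ln (bracket t) * h t)"
   unfolding eventually_sequentially by blast
  then have "(\<lambda>n. (\<Sum>k<n. diff phase \<cdot> B.rc (\<beta> k)) \<cdot> B.rc h) \<longlonglongrightarrow> diff phase \<cdot> B.rc (\<lambda>t. ramp 0 t * ln (bracket t) * h t)"
   by (rule tendsto_eventually)
  moreover have "(\<lambda>n. (\<Sum>k<n. diff phase \<cdot> B.rc (\<beta> k)) \<cdot> B.rc h) \<longlonglongrightarrow> ?V \<cdot> B.rc h"
   by (rule bounded_bilinear.tendsto[OF bounded_bilinear_blinfun_compose lim tendsto_const])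
  ultimately show ?thesis by (rule LIMSEQ_unique[rotated])
 qed
 with V show ?thesis by blast
qed

end

text \<open>The positive half line is treated by reflection, which replaces \<open>D\<^sub>1\<close> and \<open>D\<^sub>2\<close> by \<open>- D\<^sub>1\<close> and \<open>- D\<^sub>2\<close>.\<close>

definition reflect :: "((real \<Rightarrow> complex) \<Rightarrow> 'c) \<Rightarrow> (real \<Rightarrow> complex) \<Rightarrow> 'c" where
 "reflect \<Phi> f = \<Phi> (\<lambda>t. f (- t))"

lemma Cb_reflect: "f \<in> Cb \<Longrightarrow> (\<lambda>t. f (- t)) \<in> Cb"
 unfolding Cb_def by (auto intro!: continuous_on_compose2[of UNIV f UNIV uminus] continuous_intros)

lemma Cbr_reflect: "f \<in> Cbr \<Longrightarrow> (\<lambda>t. f (- t)) \<in> Cbr"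
 using Cb_reflect[of "cr f"] by (simp add: Cbr_iff)

lemma Ccr_reflect: "f \<in> Ccr \<Longrightarrow> (\<lambda>t. f (- t)) \<in> Ccr"
 unfolding Ccr_def by (auto intro!: continuous_on_compose2[of UNIV f UNIV uminus] continuous_intros) (metis abs_minus_cancel)

lemma bracket_minus [simp]: "bracket (- t) = bracket t"
 by (simp add: bracket_def)

lemma (in bounded_calculus) bounded_calculus_reflect: "bounded_calculus E (reflect \<Phi>)"
proof
 fix f g assume f: "f \<in> Cb" and g: "g \<in> Cb"
 note fg = Cb_reflect[OF f] Cb_reflect[OF g]
 show "reflect \<Phi> (\<lambda>t. f t + g t) = reflect \<Phi> f + reflect \<Phi> g"
  "reflect \<Phi> (\<lambda>t. f t * g t) = reflect \<Phi> f \<cdot> reflect \<Phi> g"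
  unfolding reflect_def by (rule calc_add[OF fg] calc_mult[OF fg])+
next
 fix f :: "real \<Rightarrow> complex" assume f: "f \<in> Cb"
 note f' = Cb_reflect[OF f]
 show "reflect \<Phi> (\<lambda>t. c * f t) = c *\<^sub>C reflect \<Phi> f" for c
  unfolding reflect_def by (rule calc_scale[OF f'])
 show "is_adjoint E E (reflect \<Phi> f) (reflect \<Phi> (\<lambda>t. cnj (f t)))"
  unfolding reflect_def by (rule calc_adjoint[OF f'])
 show "norm (reflect \<Phi> f) \<le> M" if "\<And>t. cmod (f t) \<le> M" for M
  unfolding reflect_def by (rule calc_norm_le[OF f' that])
next
 show "reflect \<Phi> (\<lambda>_. 1) = \<one>" unfolding reflect_def by (rule calc_one)
 show "nondegenerate (reflect \<Phi>)" using calc_nondegenerate by (simp add: nondegenerate_def reflect_def cut_def)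
qed

lemma intertwines_reflect:
 fixes \<Psi>\<^sub>1 \<Psi>\<^sub>2 :: "(real \<Rightarrow> real) \<Rightarrow> 'e \<Rightarrow>\<^sub>L 'e :: real_normed_vector"
 assumes "intertwines \<alpha> \<Psi>\<^sub>2 \<Psi>\<^sub>1 c d X"
  and neg: "\<And>f. f \<in> Cbr \<Longrightarrow> \<Psi>\<^sub>1 (\<lambda>t. - f t) = - \<Psi>\<^sub>1 f" "\<And>f. f \<in> Cbr \<Longrightarrow> \<Psi>\<^sub>2 (\<lambda>t. - f t) = - \<Psi>\<^sub>2 f"
 shows "intertwines \<alpha> (\<lambda>f. \<Psi>\<^sub>2 (\<lambda>t. f (- t))) (\<lambda>f. \<Psi>\<^sub>1 (\<lambda>t. f (- t))) c d (- X)"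
 unfolding intertwines_def
proof (intro ballI)
 fix g h assume g: "g \<in> Cb1" and h: "h \<in> Cb1"
 have refl: "(\<lambda>t. f (- t)) \<in> Cb1" if "f \<in> Cb1" for f
  using Cbr_reflect[OF Cb1_Cbr(1)[OF that]] Cbr_scale[OF Cbr_reflect[OF Cb1_Cbr(2)[OF that]], of "- 1"]
  by (simp add: Cb1_def)
 note g' = refl[OF g] and h' = refl[OF h]
 have "\<Psi>\<^sub>2 (\<lambda>t. - t * g (- t)) = - \<Psi>\<^sub>2 (\<lambda>t. t * g (- t))" "\<Psi>\<^sub>1 (\<lambda>t. - t * h (- t)) = - \<Psi>\<^sub>1 (\<lambda>t. t * h (- t))"
  using neg(2)[OF Cb1_Cbr(2)[OF g']] neg(1)[OF Cb1_Cbr(2)[OF h']] by simp_all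
 moreover have "\<Psi>\<^sub>2 (\<lambda>t. t * g (- t)) \<cdot> c \<cdot> \<Psi>\<^sub>1 (\<lambda>t. h (- t)) - \<Psi>\<^sub>2 (\<lambda>t. g (- t)) \<cdot> d \<cdot> \<Psi>\<^sub>1 (\<lambda>t. t * h (- t))
   = \<Psi>\<^sub>2 (\<lambda>t. bracket t powr \<alpha> * g (- t)) \<cdot> X \<cdot> \<Psi>\<^sub>1 (\<lambda>t. h (- t))"
  by (rule bspec[OF bspec[OF assms(1)[unfolded intertwines_def] g'] h'])
 ultimately show "\<Psi>\<^sub>2 (\<lambda>t. - t * g (- t)) \<cdot> c \<cdot> \<Psi>\<^sub>1 (\<lambda>t. h (- t)) - \<Psi>\<^sub>2 (\<lambda>t. g (- t)) \<cdot> d \<cdot> \<Psi>\<^sub>1 (\<lambda>t. - t * h (- t))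
   = \<Psi>\<^sub>2 (\<lambda>t. bracket (- t) powr \<alpha> * g (- t)) \<cdot> - X \<cdot> \<Psi>\<^sub>1 (\<lambda>t. h (- t))"
  by (simp add: op_simps) (simp add: algebra_simps)
qed

lemma (in conformal_pair) conformal_pair_reflect:
 "conformal_pair E (reflect \<Phi>\<^sub>1) (reflect \<Phi>\<^sub>2) \<alpha> a c d p q (- X) (- X\<^sub>a) (- X\<^sub>c) (- X\<^sub>d)"
proof -
 interpret RA: bounded_calculus E "reflect \<Phi>\<^sub>1" by (rule A.bounded_calculus_reflect)
 interpret RB: bounded_calculus E "reflect \<Phi>\<^sub>2" by (rule B.bounded_calculus_reflect)
 have rc: "RA.rc = (\<lambda>f. A.rc (\<lambda>t. f (- t)))" "RB.rc = (\<lambda>f. B.rc (\<lambda>t. f (- t)))"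
  by (auto simp: RA.rc_def RB.rc_def A.rc_def B.rc_def reflect_def)
 have neg: "f \<in> Cbr \<Longrightarrow> A.rc (\<lambda>t. - f t) = - A.rc f" "f \<in> Cbr \<Longrightarrow> B.rc (\<lambda>t. - f t) = - B.rc f" for f
  using A.rc_scale[of f "- 1"] B.rc_scale[of f "- 1"] by simp_all
 show ?thesis
 proof unfold_locales
  show "intertwines \<alpha> RB.rc RA.rc c d (- X)" "intertwines \<alpha> RA.rc RA.rc a a (- X\<^sub>a)"
   "intertwines \<alpha> RA.rc RA.rc c c (- X\<^sub>c)" "intertwines \<alpha> RA.rc RA.rc d d (- X\<^sub>d)"
   unfolding rc by (intro intertwines_reflect neg intertwines comm_a comm_c comm_d; assumption)+
 qed (simp_all add: \<alpha> a_p a_c[symmetric] a_d[symmetric])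
qed

context conformal_pair
begin

text \<open>The remainder \<open>m\<close>, which is neither covered by the ramp nor by its mirror image, has compact support.\<close>

lemma phase_log_represented:
 "\<exists>V \<in> End_star E. \<forall>h\<in>Ccr. V \<cdot> B.rc h = diff phase \<cdot> B.rc (\<lambda>t. ln (bracket t) * h t)"
proof -
 interpret R: conformal_pair E "reflect \<Phi>\<^sub>1" "reflect \<Phi>\<^sub>2" \<alpha> a c d p q "- X" "- X\<^sub>a" "- X\<^sub>c" "- X\<^sub>d"
  by (rule conformal_pair_reflect)
 have rc: "R.A.rc f = A.rc (\<lambda>t. f (- t))" "R.B.rc f = B.rc (\<lambda>t. f (- t))" for f
  by (auto simp: R.A.rc_def R.B.rc_def A.rc_def B.rc_def reflect_def)
 have rd: "R.diff phase = - diff phase"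
 proof -
  have "A.rc (\<lambda>t. - phase t) = - A.rc phase" "B.rc (\<lambda>t. - phase t) = - B.rc phase"
   using A.rc_scale[of phase "- 1"] B.rc_scale[of phase "- 1"] by simp_all
  then show ?thesis unfolding R.diff_def diff_def rc by (simp add: op_simps)
 qed
 obtain V where V: "V \<in> End_star E" "\<And>h. h \<in> Ccr \<Longrightarrow> V \<cdot> B.rc h = diff phase \<cdot> B.rc (\<lambda>t. ramp 0 t * ln (bracket t) * h t)"
  using half_line by blast
 obtain W where W: "W \<in> End_star E"
  "\<And>h. h \<in> Ccr \<Longrightarrow> W \<cdot> R.B.rc h = R.diff phase \<cdot> R.B.rc (\<lambda>t. ramp 0 t * ln (bracket t) * h t)"
  using R.half_line by blast
 define m where "m t = (1 - ramp 0 t - ramp 0 (- t)) * ln (bracket t)" for t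
 have m: "m \<in> Cbr"
 proof -
  have "m t = m t * cut 2 t" for t
   using ramp_eq_1[of 0 t] ramp_eq_1[of 0 "- t"] ramp_eq_0[of t 0] ramp_eq_0[of "- t" 0] cut_eq_1[of t 2]
   by (cases "\<bar>t\<bar> \<le> 2"; cases "t \<le> 0") (auto simp: m_def)
  then have "m = (\<lambda>t. m t * cut 2 t)" by blast
  moreover have "continuous_on UNIV m" unfolding m_def[abs_def]
   by (intro continuous_on_mult continuous_on_diff continuous_on_const continuous_on_ln_bracket Cbr_cont Cbr_reflect ramp_Cbr)
  ultimately show ?thesis using cut_mult_Cbr[of m 2] by simp
 qed
 have "(V - W + diff phase \<cdot> B.rc m) \<cdot> B.rc h = diff phase \<cdot> B.rc (\<lambda>t. ln (bracket t) * h t)" if h: "h \<in> Ccr" for h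
 proof -
  note hC = Ccr_Cbr[OF h]
  have C: "(\<lambda>t. f t * ln (bracket t) * h t) \<in> Cbr" if "f \<in> Cbr" for f
   using Ccr_Cbr[OF Ccr_mult[OF h, of "\<lambda>t. f t * ln (bracket t)"]] Cbr_cont[OF that]
   by (simp add: continuous_on_mult continuous_on_ln_bracket)
  have "W \<cdot> B.rc h = - diff phase \<cdot> B.rc (\<lambda>t. ramp 0 (- t) * ln (bracket t) * h t)"
   using W(2)[OF Ccr_reflect[OF h]] by (simp add: rc rd)
  then have "(V - W + diff phase \<cdot> B.rc m) \<cdot> B.rc h = diff phase \<cdot> (B.rc (\<lambda>t. ramp 0 t * ln (bracket t) * h t)
    + B.rc (\<lambda>t. ramp 0 (- t) * ln (bracket t) * h t) + B.rc (\<lambda>t. m t * h t))"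
   unfolding B.rc_mult[OF m hC] by (simp add: op_simps V(2)[OF h])
  also have "B.rc (\<lambda>t. ramp 0 t * ln (bracket t) * h t) + B.rc (\<lambda>t. ramp 0 (- t) * ln (bracket t) * h t) + B.rc (\<lambda>t. m t * h t)
    = B.rc (\<lambda>t. ramp 0 t * ln (bracket t) * h t + ramp 0 (- t) * ln (bracket t) * h t + m t * h t)"
   by (simp add: B.rc_add C Cbr_reflect Cbr_add Cbr_mult m hC)
  also have "(\<lambda>t. ramp 0 t * ln (bracket t) * h t + ramp 0 (- t) * ln (bracket t) * h t + m t * h t) = (\<lambda>t. ln (bracket t) * h t)"
   by (auto simp: m_def algebra_simps)
  finally show ?thesis .
 qed
 moreover have "V - W + diff phase \<cdot> B.rc m \<in> End_star E"
  by (intro End_star_add End_star_diff End_star_compose diff_End B.rc_End V(1) W(1) m phase_Cbr)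
 ultimately show ?thesis by blast
qed

text \<open>\<open>L(D\<^sub>1) a\<^sup>* - a\<^sup>* L(D\<^sub>2)\<close> is the sum of \<open>F(D\<^sub>1) (log \<langle>D\<^sub>1\<rangle> a\<^sup>* - a\<^sup>* log \<langle>D\<^sub>2\<rangle>)\<close> and \<open>(F(D\<^sub>1) a\<^sup>* - a\<^sup>* F(D\<^sub>2)) log \<langle>D\<^sub>2\<rangle>\<close>.\<close>

theorem log_fun_represented: "\<exists>T \<in> End_star E. represents log_fun T"
proof -
 obtain T where T: "T \<in> End_star E" "represents (\<lambda>t. ln (bracket t)) T" using log_represented by blast
 obtain V where V: "V \<in> End_star E" "\<And>h. h \<in> Ccr \<Longrightarrow> V \<cdot> B.rc h = diff phase \<cdot> B.rc (\<lambda>t. ln (bracket t) * h t)"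
  using phase_log_represented by blast
 have "represents log_fun (A.rc phase \<cdot> T + V)"
  unfolding represents_def
 proof (intro ballI)
  fix g h assume g: "g \<in> Ccr" and h: "h \<in> Ccr"
  have L: "(\<lambda>t. log_fun t * f t) = (\<lambda>t. ln (bracket t) * (phase t * f t))" "(\<lambda>t. log_fun t * f t) = (\<lambda>t. phase t * (ln (bracket t) * f t))" for f
   by (auto simp: log_fun_def phase_def)
  have pg: "(\<lambda>t. phase t * g t) \<in> Ccr" by (rule Ccr_mult[OF g Cbr_cont[OF phase_Cbr]])
  have lh: "(\<lambda>t. ln (bracket t) * h t) \<in> Ccr" by (rule Ccr_mult[OF h continuous_on_ln_bracket])
  have Apg: "A.rc (\<lambda>t. phase t * g t) = A.rc g \<cdot> A.rc phase"
   unfolding A.rc_mult[OF phase_Cbr Ccr_Cbr[OF g]] by (rule A.rc_commute[OF phase_Cbr Ccr_Cbr[OF g]])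
  have Blh: "B.rc (\<lambda>t. log_fun t * h t) = B.rc phase \<cdot> B.rc (\<lambda>t. ln (bracket t) * h t)"
   unfolding L(2) by (rule B.rc_mult[OF phase_Cbr Ccr_Cbr[OF lh]])
  have "A.rc (\<lambda>t. log_fun t * g t) \<cdot> a\<^sup>* \<cdot> B.rc h - A.rc (\<lambda>t. phase t * g t) \<cdot> a\<^sup>* \<cdot> B.rc (\<lambda>t. ln (bracket t) * h t)
    = A.rc (\<lambda>t. phase t * g t) \<cdot> T \<cdot> B.rc h"
   unfolding L(1)[of g] by (rule bspec[OF bspec[OF T(2)[unfolded represents_def] pg] h])
  moreover have "A.rc g \<cdot> V \<cdot> B.rc h = A.rc g \<cdot> diff phase \<cdot> B.rc (\<lambda>t. ln (bracket t) * h t)"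
   by (simp only: op_assoc V(2)[OF h])
  ultimately show "A.rc (\<lambda>t. log_fun t * g t) \<cdot> a\<^sup>* \<cdot> B.rc h - A.rc g \<cdot> a\<^sup>* \<cdot> B.rc (\<lambda>t. log_fun t * h t)
    = A.rc g \<cdot> (A.rc phase \<cdot> T + V) \<cdot> B.rc h"
   unfolding Blh Apg diff_def by (simp add: op_simps) (simp add: algebra_simps)
 qed
 moreover have "A.rc phase \<cdot> T + V \<in> End_star E" using T(1) V(1) by auto
 ultimately show ?thesis by blast
qed

end

section \<open>From calculi to operators\<close>

context bounded_calculus
begin

lemma calc_cut_tendsto: "(\<lambda>n. \<Phi> (cr (cut (real n))) x) \<longlonglongrightarrow> x"
 using calc_nondegenerate by (simp add: nondegenerate_def)

lemma op_rel_product: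
 assumes f: "continuous_on UNIV f" and h: "h \<in> Cb" "(\<lambda>t. f t * h t) \<in> Cb"
 shows "op_rel \<Phi> f (\<Phi> h x) (\<Phi> (\<lambda>t. f t * h t) x)"
 unfolding op_rel_def
proof
 fix g assume g: "g \<in> Cc"
 have "\<Phi> (\<lambda>t. f t * g t) \<cdot> \<Phi> h = \<Phi> (\<lambda>t. f t * g t * h t)"
  by (rule calc_mult[OF Cc_Cb[OF Cc_mult_left[OF g f]] h(1), symmetric])
 also have "(\<lambda>t. f t * g t * h t) = (\<lambda>t. g t * (f t * h t))" by (simp add: mult_ac)
 also have "\<Phi> \<dots> = \<Phi> g \<cdot> \<Phi> (\<lambda>t. f t * h t)" by (rule calc_mult[OF Cc_Cb[OF g] h(2)])
 finally have "\<Phi> (\<lambda>t. f t * g t) \<cdot> \<Phi> h = \<Phi> g \<cdot> \<Phi> (\<lambda>t. f t * h t)" .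
 then show "\<Phi> (\<lambda>t. f t * g t) (\<Phi> h x) = \<Phi> g (\<Phi> (\<lambda>t. f t * h t) x)"
  by (simp flip: blinfun_apply_blinfun_compose)
qed

text \<open>Test functions \<open>h\<close> without compact support are reached by means of the cutoffs.\<close>

lemma op_rel_apply:
 assumes r: "op_rel \<Phi> f y z" and f: "continuous_on UNIV f" and h: "h \<in> Cb" "(\<lambda>t. f t * h t) \<in> Cb"
 shows "\<Phi> (\<lambda>t. f t * h t) y = \<Phi> h z"
proof -
 have "\<Phi> (\<lambda>t. f t * h t) (\<Phi> (cr (cut (real n))) y) = \<Phi> h (\<Phi> (cr (cut (real n))) z)" for n
 proof -
  let ?c = "cr (cut (real n))"
  have "\<Phi> (\<lambda>t. f t * h t) \<cdot> \<Phi> ?c = \<Phi> (\<lambda>t. f t * h t * ?c t)"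
   by (rule calc_mult[OF h(2) Cc_Cb[OF Cc_cut], symmetric])
  also have "(\<lambda>t. f t * h t * ?c t) = (\<lambda>t. h t * (f t * ?c t))" by (simp add: mult_ac)
  also have "\<Phi> \<dots> = \<Phi> h \<cdot> \<Phi> (\<lambda>t. f t * ?c t)"
   by (rule calc_mult[OF h(1) Cc_Cb[OF Cc_mult_left[OF Cc_cut f]]])
  finally have "(\<Phi> (\<lambda>t. f t * h t) \<cdot> \<Phi> ?c) y = \<Phi> h (\<Phi> (\<lambda>t. f t * ?c t) y)" by simp
  then show ?thesis by (simp add: op_relD[OF r Cc_cut])
 qed
 moreover have "(\<lambda>n. \<Phi> (\<lambda>t. f t * h t) (\<Phi> (cr (cut (real n))) y)) \<longlonglongrightarrow> \<Phi> (\<lambda>t. f t * h t) y"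
  "(\<lambda>n. \<Phi> h (\<Phi> (cr (cut (real n))) z)) \<longlonglongrightarrow> \<Phi> h z"
  by (intro tendsto_intros calc_cut_tendsto)+
 ultimately show ?thesis using LIMSEQ_unique by simp
qed

lemma op_rel_cutI:
 assumes f: "continuous_on UNIV f"
  and eq: "\<And>n. \<Phi> (\<lambda>t. f t * cr (cut (real n)) t) y = \<Phi> (cr (cut (real n))) z"
 shows "op_rel \<Phi> f y z"
proof (rule op_rel_closed)
 show "op_rel \<Phi> f (\<Phi> (cr (cut (real n))) y) (\<Phi> (cr (cut (real n))) z)" for n
  using op_rel_cut_Cc[OF f Cc_cut, of "real n" y] by (simp only: eq)
qed (rule calc_cut_tendsto)+

lemma op_rel_scaleC:
 assumes "op_rel \<Phi> f y z" "continuous_on UNIV f" shows "op_rel \<Phi> f (k *\<^sub>C y) (k *\<^sub>C z)"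
 using assms unfolding op_rel_def
 by (auto simp: apply_scaleC calc_End Cc_Cb Cc_mult_left)

lemma weight_Cbr: "0 \<le> \<alpha> \<Longrightarrow> (\<lambda>t. bracket t powr (- \<alpha>)) \<in> Cbr"
 unfolding Cbr_iff by (rule bracket_pow_Cb) simp

lemma rc_weight:
 assumes g: "g \<in> Cb1" and \<alpha>: "0 \<le> \<alpha>" "\<alpha> < 1"
 shows "rc g = rc (\<lambda>t. bracket t powr \<alpha> * g t) \<cdot> rc (\<lambda>t. bracket t powr (- \<alpha>))"
proof -
 have "g = (\<lambda>t. bracket t powr \<alpha> * g t * bracket t powr (- \<alpha>))"
  by (rule ext) (simp add: powr_minus field_simps)
 then show ?thesis using rc_mult[OF weighted_Cbr[OF g \<alpha>] weight_Cbr[OF \<alpha>(1)]] by simp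
qed

end

lemma op_rel_add: "op_rel \<Phi> f y z \<Longrightarrow> op_rel \<Phi> f y' z' \<Longrightarrow> op_rel \<Phi> f (y + y') (z + z')"
 by (simp add: op_rel_def blinfun.add_right)

lemma map_comp_as_op: "(as_op S \<circ>\<^sub>m T) x = map_option (blinfun_apply S) (T x)" "(T \<circ>\<^sub>m as_op S) x = T (S x)"
 by (auto simp: map_comp_def as_op_def split: option.splits)

lemma map_le_as_opD: "T \<subseteq>\<^sub>m as_op S \<Longrightarrow> T x = Some y \<Longrightarrow> y = S x"
 by (metis as_op_def domI map_le_def option.inject)

text \<open>The relation between an operator and its bounded calculus, in the form in which it is used below.\<close>

locale self_adjoint_calculus = bounded_calculus E \<Phi>
 for E :: "('e :: {complex_normed_vector, banach}, 'b :: cstar_algebra) hilbmod" and \<Phi> +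
 fixes D :: "'e \<rightharpoonup> 'e"
 assumes D_iff: "D y = Some z \<longleftrightarrow> op_rel \<Phi> of_real y z"
  and D_bracket: "s \<le> 0 \<Longrightarrow> bracket_pow E D s = as_op (rc (\<lambda>t. bracket t powr s))"
  and D_log: "log_transform E D y = Some z \<longleftrightarrow> op_rel \<Phi> (cr log_fun) y z"
begin

lemma D_rc: assumes h: "h \<in> Cb1" shows "D (rc h x) = Some (rc (\<lambda>t. t * h t) x)"
 using op_rel_product[of of_real "cr h" x] Cbr_Cb[OF Cb1_Cbr(1)[OF h]] Cbr_Cb[OF Cb1_Cbr(2)[OF h]]
 by (simp add: D_iff rc_def continuous_on_of_real[OF continuous_on_id])

lemma rc_D: assumes "D y = Some z" and h: "h \<in> Cb1"
 shows "rc (\<lambda>t. t * h t) y = rc h z"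
 using op_rel_apply[of of_real y z "cr h"] Cbr_Cb[OF Cb1_Cbr(1)[OF h]] Cbr_Cb[OF Cb1_Cbr(2)[OF h]] assms(1)
 by (simp add: D_iff rc_def continuous_on_of_real[OF continuous_on_id])

text \<open>
 \<open>X\<close> is the bounded extension of \<open>\<langle>D\<rangle>\<^sup>-\<^sup>\<alpha> [D, a]\<close>; vectors in the range of \<open>h(D)\<close> belong to \<open>dom D\<close>, and
 \<open>\<langle>D\<rangle>\<^sup>\<alpha> g(D)\<close> is bounded.
\<close>

lemma Lip_intertwines:
 assumes a: "a \<in> Lip_star \<alpha> E D" and \<alpha>: "0 \<le> \<alpha>" "\<alpha> < 1"
 shows "\<exists>X \<in> End_star E. intertwines \<alpha> rc rc a a X"
proof -
 obtain X where X: "X \<in> End_star E" and le: "bracket_pow E D (- \<alpha>) \<circ>\<^sub>m commutator D a \<subseteq>\<^sub>m as_op X"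
  using a by (auto simp: Lip_star_def bounded_op_def)
 have dom: "blinfun_apply a ` dom D \<subseteq> dom D" using a by (simp add: Lip_star_def preserves_dom_def)
 have "intertwines \<alpha> rc rc a a X"
  unfolding intertwines_def
 proof (intro ballI blinfun_eqI)
  fix g h x assume g: "g \<in> Cb1" and h: "h \<in> Cb1"
  let ?y = "rc h x" and ?z = "rc (\<lambda>t. t * h t) x"
  have D: "D ?y = Some ?z" by (rule D_rc[OF h])
  then obtain v where v: "D (a ?y) = Some v" using dom by blast
  have "commutator D a ?y = Some (v - a ?z)"
   using D v by (simp add: commutator_def op_minus_def map_comp_as_op dom_def)
  then have "(bracket_pow E D (- \<alpha>) \<circ>\<^sub>m commutator D a) ?y = Some (rc (\<lambda>t. bracket t powr (- \<alpha>)) (v - a ?z))"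
   using \<alpha> by (simp add: D_bracket map_comp_as_op)
  then have X: "rc (\<lambda>t. bracket t powr (- \<alpha>)) (v - a ?z) = X ?y"
   by (rule map_le_as_opD[OF le])
  have "rc (\<lambda>t. t * g t) (a ?y) - rc g (a ?z)
    = rc g (v - a ?z)"
   by (simp add: rc_D[OF v g] blinfun.diff_right)
  also have "\<dots> = rc (\<lambda>t. bracket t powr \<alpha> * g t) (X ?y)"
   unfolding rc_weight[OF g \<alpha>] using X by simp
  finally show "(rc (\<lambda>t. t * g t) \<cdot> a \<cdot> rc h - rc g \<cdot> a \<cdot> rc (\<lambda>t. t * h t)) x
    = (rc (\<lambda>t. bracket t powr \<alpha> * g t) \<cdot> X \<cdot> rc h) x"
   by (simp add: minus_blinfun.rep_eq)
 qed
 with X show ?thesis by blast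
qed

end

lemma (in hilbert_module) self_adjoint_calculus_bcalc:
 assumes reg: "regular E D" and sa: "self_adjoint E D"
 shows "self_adjoint_calculus E (bcalc E D) D"
proof -
 interpret bounded_calculus E "bcalc E D" by (rule bcalc_bounded_calculus[OF reg sa])
 show ?thesis
 proof
  show "D y = Some z \<longleftrightarrow> op_rel (bcalc E D) of_real y z" for y z by (rule operator_iff_op_rel[OF reg sa])
  show "bracket_pow E D s = as_op (rc (\<lambda>t. bracket t powr s))" if "s \<le> 0" for s
   by (simp add: bracket_pow_eq[OF reg sa that] as_op_def rc_def)
  show "log_transform E D y = Some z \<longleftrightarrow> op_rel (bcalc E D) (cr log_fun) y z" for y z
   by (rule log_transform_iff[OF reg sa])
 qed
qed

subsection \<open>Operators with bounded logarithmic commutators\<close>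

text \<open>For the calculi of \<open>D\<close> and \<open>D'\<close>, the operators \<open>x\<close> that map \<open>dom L\<^bsub>D'\<^esub>\<close> to \<open>dom L\<^sub>D\<close> and for which \<open>L\<^sub>D x - x L\<^bsub>D'\<^esub>\<close> is bounded.\<close>

definition log_intertwiner ::
 "('e :: {complex_normed_vector, banach}, 'b :: cstar_algebra) hilbmod \<Rightarrow>
  'e calculus \<Rightarrow> 'e calculus \<Rightarrow> 'e endo \<Rightarrow> 'e endo \<Rightarrow> bool" where
 "log_intertwiner E \<Phi> \<Psi> x S \<longleftrightarrow> x \<in> End_star E \<and> S \<in> End_star E \<and>
   (\<forall>y z. op_rel \<Psi> (cr log_fun) y z \<longrightarrow> op_rel \<Phi> (cr log_fun) (blinfun_apply x y) (blinfun_apply x z + blinfun_apply S y))"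

definition log_intertwiners where
 "log_intertwiners E \<Phi> \<Psi> = {x. \<exists>S. log_intertwiner E \<Phi> \<Psi> x S}"

lemma continuous_on_cr_log_fun: "continuous_on UNIV (cr log_fun)"
 by (intro continuous_intros)

definition log_resolvent :: "real \<Rightarrow> real \<Rightarrow> complex" where
 "log_resolvent n t = 1 / (1 + \<i> * of_real (log_fun t) / of_real n)"

lemma log_resolvent_denominator: "1 + \<i> * of_real (log_fun t) / of_real n \<noteq> 0"
 by (auto simp: complex_eq_iff)

lemma log_resolvent_bound: "cmod (log_resolvent n t) \<le> 1"
proof -
 have "1 \<le> cmod (1 + \<i> * of_real (log_fun t) / of_real n)"
  using complex_Re_le_cmod[of "1 + \<i> * of_real (log_fun t) / of_real n"] by simp
 then show ?thesis by (simp add: log_resolvent_def norm_divide divide_le_eq_1)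
qed

lemma log_resolvent_Cb: assumes "0 < n" shows "log_resolvent n \<in> Cb"
proof (rule CbI[OF _ log_resolvent_bound])
 have "complex_of_real n \<noteq> 0" using assms by simp
 then show "continuous_on UNIV (log_resolvent n)"
  unfolding log_resolvent_def[abs_def] by (intro continuous_intros ballI log_resolvent_denominator)
qed

lemma (in hilbert_module) log_intertwiners_compose:
 assumes "x \<in> log_intertwiners E \<Phi> \<Psi>" "y \<in> log_intertwiners E \<Psi> \<Theta>"
 shows "x \<cdot> y \<in> log_intertwiners E \<Phi> \<Theta>"
proof -
 obtain S T where S: "log_intertwiner E \<Phi> \<Psi> x S" and T: "log_intertwiner E \<Psi> \<Theta> y T"
  using assms by (auto simp: log_intertwiners_def)
 have "log_intertwiner E \<Phi> \<Theta> (x \<cdot> y) (x \<cdot> T + S \<cdot> y)"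
  unfolding log_intertwiner_def
 proof (intro conjI allI impI)
  show "x \<cdot> y \<in> End_star E" "x \<cdot> T + S \<cdot> y \<in> End_star E" using S T by (auto simp: log_intertwiner_def)
  fix u v assume "op_rel \<Theta> (cr log_fun) u v"
  then have "op_rel \<Psi> (cr log_fun) (y u) (y v + T u)"
   using T by (simp add: log_intertwiner_def)
  then have "op_rel \<Phi> (cr log_fun) (x (y u))
    (x (y v + T u) + S (y u))"
   using S by (simp add: log_intertwiner_def)
  then show "op_rel \<Phi> (cr log_fun) ((x \<cdot> y) u) ((x \<cdot> y) v + (x \<cdot> T + S \<cdot> y) u)"
   by (simp add: blinfun.add_right plus_blinfun.rep_eq add_ac)
 qed
 then show ?thesis by (auto simp: log_intertwiners_def)
qed

context two_calculi
begin

lemma log_intertwiners_subspace: "module.subspace scaleC (log_intertwiners E \<Phi>\<^sub>1 \<Phi>\<^sub>2)"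
 unfolding module.subspace_def[OF module_scaleC]
proof (intro conjI ballI allI)
 note c = continuous_on_cr_log_fun
 have "log_intertwiner E \<Phi>\<^sub>1 \<Phi>\<^sub>2 0 0" by (simp add: log_intertwiner_def op_rel_def)
 then show "0 \<in> log_intertwiners E \<Phi>\<^sub>1 \<Phi>\<^sub>2" by (auto simp: log_intertwiners_def)
 fix x assume "x \<in> log_intertwiners E \<Phi>\<^sub>1 \<Phi>\<^sub>2"
 then obtain S where S: "log_intertwiner E \<Phi>\<^sub>1 \<Phi>\<^sub>2 x S" by (auto simp: log_intertwiners_def)
 show "k *\<^sub>C x \<in> log_intertwiners E \<Phi>\<^sub>1 \<Phi>\<^sub>2" for k
 proof -
  have "log_intertwiner E \<Phi>\<^sub>1 \<Phi>\<^sub>2 (k *\<^sub>C x) (k *\<^sub>C S)"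
   using S A.op_rel_scaleC[OF _ c] by (auto simp: log_intertwiner_def simp flip: scaleC_add_right)
  then show ?thesis by (auto simp: log_intertwiners_def)
 qed
 fix y assume "y \<in> log_intertwiners E \<Phi>\<^sub>1 \<Phi>\<^sub>2"
 then obtain T where T: "log_intertwiner E \<Phi>\<^sub>1 \<Phi>\<^sub>2 y T" by (auto simp: log_intertwiners_def)
 have "log_intertwiner E \<Phi>\<^sub>1 \<Phi>\<^sub>2 (x + y) (S + T)"
  unfolding log_intertwiner_def
 proof (intro conjI allI impI)
  show "x + y \<in> End_star E" "S + T \<in> End_star E" using S T by (auto simp: log_intertwiner_def)
  fix u v assume "op_rel \<Phi>\<^sub>2 (cr log_fun) u v"
  then have "op_rel \<Phi>\<^sub>1 (cr log_fun) (x u + y u)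
    ((x v + S u) + (y v + T u))"
   using S T by (intro op_rel_add) (auto simp: log_intertwiner_def)
  then show "op_rel \<Phi>\<^sub>1 (cr log_fun) ((x + y) u) ((x + y) v + (S + T) u)"
   by (simp add: plus_blinfun.rep_eq add_ac)
 qed
 then show "x + y \<in> log_intertwiners E \<Phi>\<^sub>1 \<Phi>\<^sub>2" by (auto simp: log_intertwiners_def)
qed

text \<open>
 If \<open>x y\<close> happens to lie in \<open>dom L\<^sub>1\<close> although \<open>y \<notin> dom L\<^sub>2\<close>, then \<open>L\<^sub>1 x y\<close> is the limit of the left-hand sides, where
 \<open>q\<^sub>n = (1 + \<i> L / n)\<^sup>-\<^sup>1\<close>.
\<close>

lemma log_intertwiner_resolvent:
 assumes x: "log_intertwiner E \<Phi>\<^sub>1 \<Phi>\<^sub>2 x S" and u: "op_rel \<Phi>\<^sub>1 (cr log_fun) (x y) u"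
  and n: "0 < n" and q: "q = log_resolvent n"
 shows "\<Phi>\<^sub>1 q u = x (\<Phi>\<^sub>2 (\<lambda>t. of_real (log_fun t) * q t) y)
  + \<Phi>\<^sub>1 q (S (\<Phi>\<^sub>2 q y))"
proof -
 note c = continuous_on_cr_log_fun
 let ?L = "\<lambda>t. complex_of_real (log_fun t) * q t"
 have qC: "q \<in> Cb" unfolding q by (rule log_resolvent_Cb[OF n])
 have Lq: "?L t = of_real n / \<i> * (1 - q t)" for t
  using log_resolvent_denominator[of t n] n unfolding q log_resolvent_def by (simp add: field_simps)
 have LC: "?L \<in> Cb" unfolding Lq by (intro Cb_mult Cb_diff Cb_const qC)
 have q_id: "q t + \<i> / of_real n * ?L t = 1" for t unfolding Lq using n by (simp add: field_simps)
 have resolvent: "\<Phi> q + (\<i> / of_real n) *\<^sub>C \<Phi> ?L = \<one>" if "bounded_calculus E \<Phi>" for \<Phi>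
 proof -
  interpret bounded_calculus E \<Phi> by fact
  have "(\<lambda>t. \<i> / of_real n * ?L t) \<in> Cb" by (intro Cb_mult Cb_const LC)
  from calc_add[OF qC this] have "\<Phi> (\<lambda>t. q t + \<i> / of_real n * ?L t) = \<Phi> q + (\<i> / of_real n) *\<^sub>C \<Phi> ?L"
   by (simp only: calc_scale[OF LC])
  then show ?thesis unfolding q_id using calc_one by simp
 qed
 note res1 = resolvent[OF A.bounded_calculus_axioms] and res2 = resolvent[OF B.bounded_calculus_axioms]
 let ?w = "\<Phi>\<^sub>2 ?L y" and ?v = "\<Phi>\<^sub>2 q y"
 have y: "y = ?v + (\<i> / of_real n) *\<^sub>C ?w"
  using arg_cong[OF res2, of "\<lambda>T. T y"] by (simp add: plus_blinfun.rep_eq)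
 have xE: "x \<in> End_star E" using x by (simp add: log_intertwiner_def)
 have "op_rel \<Phi>\<^sub>2 (cr log_fun) ?v ?w" by (rule B.op_rel_product[OF c qC LC])
 then have "op_rel \<Phi>\<^sub>1 (cr log_fun) (x ?v) (x ?w + S ?v)"
  using x by (simp add: log_intertwiner_def)
 from A.op_rel_apply[OF this c qC LC]
 have v: "\<Phi>\<^sub>1 ?L (x ?v) = \<Phi>\<^sub>1 q (x ?w + S ?v)" .
 have "\<Phi>\<^sub>1 q u = \<Phi>\<^sub>1 ?L (x y)"
  by (rule A.op_rel_apply[OF u c qC LC, symmetric])
 also have "\<dots> = \<Phi>\<^sub>1 ?L (x ?v) + (\<i> / of_real n) *\<^sub>C \<Phi>\<^sub>1 ?L (x ?w)"
  by (subst y) (simp add: blinfun.add_right apply_scaleC[OF xE] apply_scaleC[OF A.calc_End[OF LC]])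
 also have "(\<i> / of_real n) *\<^sub>C \<Phi>\<^sub>1 ?L (x ?w) = x ?w - \<Phi>\<^sub>1 q (x ?w)"
  using arg_cong[OF res1, of "\<lambda>T. T (x ?w)"] by (simp add: plus_blinfun.rep_eq eq_diff_eq add.commute)
 finally show ?thesis unfolding v by (simp add: blinfun.add_right)
qed

end

lemma (in bounded_calculus) log_resolvent_tendsto:
 assumes "x \<longlonglongrightarrow> x0" shows "(\<lambda>n. \<Phi> (log_resolvent (real (Suc n))) (x n)) \<longlonglongrightarrow> x0"
proof -
 let ?q = "\<lambda>n. log_resolvent (real (Suc n))"
 have qC: "?q n \<in> Cb" for n by (rule log_resolvent_Cb) simp
 have "(\<lambda>n. \<Phi> (?q n) x0) \<longlonglongrightarrow> \<Phi> (\<lambda>_. 1) x0"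
 proof (rule calc_strong_limit[OF qC _ log_resolvent_bound])
  show "(\<lambda>_. 1) \<in> Cb" by simp
  fix R e :: real assume e: "0 < e"
  have "compact (log_fun ` {-R..R})" by (intro compact_continuous_image continuous_intros) auto
  then obtain M where M: "\<And>t. \<bar>t\<bar> \<le> R \<Longrightarrow> \<bar>log_fun t\<bar> \<le> M"
   using compact_imp_bounded by (force simp: bounded_iff abs_le_iff)
  obtain n0 :: nat where n0: "M / e < real n0" using reals_Archimedean2 by blast
  have "cmod (?q n t - 1) \<le> e" if n: "n0 \<le> n" and t: "\<bar>t\<bar> \<le> R" for n t
  proof -
   let ?z = "\<i> * complex_of_real (log_fun t) / of_real (real (Suc n))"
   have "?q n t - 1 = - (?z * ?q n t)"
    using log_resolvent_denominator[of t "real (Suc n)"] unfolding log_resolvent_def by (simp add: field_simps)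
   then have "cmod (?q n t - 1) = cmod ?z * cmod (?q n t)" by (simp only: norm_minus_cancel norm_mult)
   also have "\<dots> \<le> cmod ?z * 1" by (intro mult_left_mono log_resolvent_bound) simp
   also have "cmod ?z * 1 = \<bar>log_fun t\<bar> / real (Suc n)" by (simp only: norm_divide norm_mult norm_ii norm_of_real mult_1 mult_1_right abs_of_nat)
   also have "\<dots> \<le> M / real (Suc n)" using M[OF t] by (intro divide_right_mono) auto
   also have "\<dots> \<le> e"
   proof -
    have "M / e \<le> real (Suc n)" using n0 n by simp
    then have "M \<le> e * real (Suc n)" using e by (simp add: pos_divide_le_eq mult.commute)
    then show ?thesis by (subst pos_divide_le_eq) auto
   qed
   finally show ?thesis .
  qed
  then show "\<exists>n0. \<forall>n\<ge>n0. \<forall>t. \<bar>t\<bar> \<le> R \<longrightarrow> cmod (?q n t - 1) \<le> e" by blast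
 qed
 then have "(\<lambda>n. \<Phi> (?q n) x0) \<longlonglongrightarrow> x0" by (simp add: calc_one)
 moreover have "(\<lambda>n. \<Phi> (?q n) (x n - x0)) \<longlonglongrightarrow> 0"
 proof (rule Lim_null_comparison)
  have "norm (\<Phi> (?q n) (x n - x0)) \<le> 1 * norm (x n - x0)" for n
   by (intro order_trans[OF norm_blinfun] mult_right_mono calc_norm_le[OF qC log_resolvent_bound]) simp
  then show "\<forall>\<^sub>F n in sequentially. norm (\<Phi> (?q n) (x n - x0)) \<le> norm (x n - x0)" by simp
  show "(\<lambda>n. norm (x n - x0)) \<longlonglongrightarrow> 0" using assms by (simp add: tendsto_norm_zero LIM_zero)
 qed
 ultimately have "(\<lambda>n. \<Phi> (?q n) (x n - x0) + \<Phi> (?q n) x0) \<longlonglongrightarrow> 0 + x0"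
  by (intro tendsto_add)
 then show ?thesis by (simp add: blinfun.diff_right)
qed

text \<open>The cutoffs on the right converge strongly to \<open>1\<close>, which shows that \<open>x\<close> maps \<open>dom L\<^sub>2\<close> to \<open>dom L\<^sub>1\<close>.\<close>

lemma (in two_calculi) log_intertwinerI:
 assumes x: "x \<in> End_star E" and T: "T \<in> End_star E"
  and eq: "\<And>n m. A.rc (\<lambda>t. log_fun t * cut (real n) t) \<cdot> x \<cdot> B.rc (cut (real m))
    - A.rc (cut (real n)) \<cdot> x \<cdot> B.rc (\<lambda>t. log_fun t * cut (real m) t) = A.rc (cut (real n)) \<cdot> T \<cdot> B.rc (cut (real m))"
 shows "log_intertwiner E \<Phi>\<^sub>1 \<Phi>\<^sub>2 x T"
 unfolding log_intertwiner_def
proof (intro conjI allI impI)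
 let ?c = "\<lambda>n. cut (real n)" and ?l = "\<lambda>n t. log_fun t * cut (real n) t"
 fix y z assume r: "op_rel \<Phi>\<^sub>2 (cr log_fun) y z"
 show "op_rel \<Phi>\<^sub>1 (cr log_fun) (x y) (x z + T y)"
 proof (rule A.op_rel_cutI[OF continuous_on_cr_log_fun])
  fix n
  have r: "B.rc (?l m) y = B.rc (?c m) z" for m
   using op_relD[OF r Cc_cut, of "real m"] by (simp add: B.rc_def)
  have "A.rc (?l n) (x (B.rc (?c m) y)) = A.rc (?c n) (x (B.rc (?c m) z) + T (B.rc (?c m) y))" for m
   using arg_cong[OF eq[of n m], of "\<lambda>T. blinfun_apply T y"]
   by (simp add: minus_blinfun.rep_eq r blinfun.add_right diff_eq_eq add.commute)
  moreover have "(\<lambda>m. A.rc (?l n) (x (B.rc (?c m) y))) \<longlonglongrightarrow> A.rc (?l n) (x y)"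
   by (intro tendsto_intros B.rc_cut_tendsto)
  moreover have "(\<lambda>m. A.rc (?c n) (x (B.rc (?c m) z) + T (B.rc (?c m) y))) \<longlonglongrightarrow> A.rc (?c n) (x z + T y)"
   by (intro tendsto_intros B.rc_cut_tendsto)
  ultimately have "A.rc (?l n) (x y) = A.rc (?c n) (x z + T y)" using LIMSEQ_unique by simp
  then show "\<Phi>\<^sub>1 (\<lambda>t. cr log_fun t * cr (?c n) t) (x y) = \<Phi>\<^sub>1 (cr (?c n)) (x z + T y)"
   by (simp add: A.rc_def)
 qed
qed (use x T in auto)

context conformal_pair
begin

lemma represents_log_intertwiners:
 assumes T: "T \<in> End_star E" "represents log_fun T"
 shows "log_intertwiner E \<Phi>\<^sub>1 \<Phi>\<^sub>2 (a\<^sup>*) T" "log_intertwiner E \<Phi>\<^sub>2 \<Phi>\<^sub>1 a (- T\<^sup>*)"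
proof -
 interpret swap: two_calculi E \<Phi>\<^sub>2 \<Phi>\<^sub>1 by unfold_locales
 let ?c = "\<lambda>n. cut (real n)" and ?l = "\<lambda>n t. log_fun t * cut (real n) t"
 have cut: "?c n \<in> Ccr" for n unfolding Ccr_def by (auto intro!: exI[of _ "real n + 1"] continuous_intros simp: cut_eq_0)
 have lC: "?l n \<in> Cbr" for n by (intro Ccr_Cbr Ccr_mult cut continuous_intros)
 have eq: "A.rc (?l n) \<cdot> a\<^sup>* \<cdot> B.rc (?c m) - A.rc (?c n) \<cdot> a\<^sup>* \<cdot> B.rc (?l m) = A.rc (?c n) \<cdot> T \<cdot> B.rc (?c m)" for n m
  by (rule bspec[OF bspec[OF T(2)[unfolded represents_def] cut] cut])
 show "log_intertwiner E \<Phi>\<^sub>1 \<Phi>\<^sub>2 (a\<^sup>*) T" by (intro log_intertwinerI eq T End_star_dag End)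
 have "B.rc (?l n) \<cdot> a \<cdot> A.rc (?c m) - B.rc (?c n) \<cdot> a \<cdot> A.rc (?l m) = B.rc (?c n) \<cdot> (- T\<^sup>*) \<cdot> A.rc (?c m)" for n m
  using arg_cong[OF eq[of m n], of "\<lambda>T. - T\<^sup>*"] T(1) by (simp add: lC op_simps)
 then show "log_intertwiner E \<Phi>\<^sub>2 \<Phi>\<^sub>1 a (- T\<^sup>*)" by (intro swap.log_intertwinerI) (use T in auto)
qed

lemma log_intertwiners:
 shows "a\<^sup>* \<in> log_intertwiners E \<Phi>\<^sub>1 \<Phi>\<^sub>2" "a \<in> log_intertwiners E \<Phi>\<^sub>2 \<Phi>\<^sub>1"
 using log_fun_represented represents_log_intertwiners unfolding log_intertwiners_def by blast+

end

lemma (in self_adjoint_calculus) Lip_log_intertwiners: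
 assumes b: "b \<in> Lip_star \<alpha> E D" and \<alpha>: "0 \<le> \<alpha>" "\<alpha> < 1"
 shows "b \<in> log_intertwiners E \<Phi> \<Phi>" "b\<^sup>* \<in> log_intertwiners E \<Phi> \<Phi>"
proof -
 obtain X where X: "X \<in> End_star E" "intertwines \<alpha> rc rc b b X" using Lip_intertwines[OF assms] by blast
 have bE: "b \<in> End_star E" using b by (simp add: Lip_star_def)
 interpret conformal_pair E \<Phi> \<Phi> \<alpha> b b b \<one> \<one> X X X X
  by unfold_locales (simp_all add: \<alpha> X bE)
 show "b \<in> log_intertwiners E \<Phi> \<Phi>" "b\<^sup>* \<in> log_intertwiners E \<Phi> \<Phi>" by (rule log_intertwiners)+
qed

lemma densely_defined_mono: "densely_defined S \<Longrightarrow> dom S \<subseteq> dom T \<Longrightarrow> densely_defined T"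
 unfolding densely_defined_def using closure_mono by blast

lemma bounded_commutatorI:
 fixes b :: "('e :: {complex_normed_vector, banach}) endo"
 assumes L: "densely_defined L" and S: "S \<in> End_star E" and b: "\<And>y z. L y = Some z \<Longrightarrow> L (b y) = Some (b z + S y)"
 shows "preserves_dom b L" "bounded_op E E (commutator L b)"
proof -
 have C: "commutator L b y = map_option (\<lambda>_. S y) (L y)" for y
  using b by (cases "L y") (auto simp: commutator_def op_minus_def map_comp_as_op dom_def)
 then have "dom (commutator L b) = dom L" "commutator L b \<subseteq>\<^sub>m as_op S" by (auto simp: dom_def map_le_def as_op_def)
 then show "bounded_op E E (commutator L b)" using L S by (auto simp: bounded_op_def densely_defined_def)
 show "preserves_dom b L" using b by (auto simp: preserves_dom_def)
qed

section \<open>Conformal transformations\<close>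

locale conformal_operators = module_unitary E F U + A: self_adjoint_calculus E \<Phi>\<^sub>1 D\<^sub>1 + C: self_adjoint_calculus F \<Psi> D\<^sub>2
 for E :: "('e :: {complex_normed_vector, banach}, 'b :: cstar_algebra) hilbmod"
  and F :: "('f :: {complex_normed_vector, banach}, 'b) hilbmod" and U \<Phi>\<^sub>1 D\<^sub>1 \<Psi> D\<^sub>2 +
 fixes \<mu> \<nu> :: "'e endo" and \<alpha> :: real
 assumes \<mu>: "\<mu> \<in> End_star E" and \<nu>: "\<nu> \<in> End_star E"
  and inverse: "\<mu> \<cdot> \<nu> = \<one>" "\<nu> \<cdot> \<mu> = \<one>"
  and \<alpha>: "0 \<le> \<alpha>" "\<alpha> < 1"
begin

abbreviation "\<Phi>\<^sub>2 \<equiv> transport E F U \<Psi>"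
abbreviation "M \<equiv> conf_multipliers \<alpha> E F D\<^sub>1 D\<^sub>2 U \<mu>"

lemma calculus_2: "bounded_calculus E \<Phi>\<^sub>2"
 by (rule bounded_calculus_transport[OF C.bounded_calculus_axioms])

lemma inv_of_\<mu>: "inv_of \<mu> = \<nu>"
 unfolding inv_of_def
proof (rule the_equality)
 show "\<mu> \<cdot> \<nu> = \<one> \<and> \<nu> \<cdot> \<mu> = \<one>" using inverse by blast
 fix \<nu>' assume "\<mu> \<cdot> \<nu>' = \<one> \<and> \<nu>' \<cdot> \<mu> = \<one>"
 then have "\<nu>' = \<nu>' \<cdot> (\<mu> \<cdot> \<nu>)" "\<nu>' \<cdot> \<mu> = \<one>" by (simp_all add: inverse)
 then show "\<nu>' = \<nu>" by (simp flip: op_assoc)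
qed

text \<open>
 For \<open>h\<close> in \<open>dom D\<^sub>1\<close> the bound on \<open>D\<^sub>2 a - a \<mu> D\<^sub>1 \<mu>\<^sup>*\<close> is applied to the vector \<open>\<mu>\<^sup>-\<^sup>1\<^sup>* h\<close>, which turns it into the
 intertwining relation for \<open>c = a \<mu>\<^sup>-\<^sup>1\<^sup>*\<close> and \<open>d = a \<mu>\<close>.
\<close>

lemma multiplier_log_intertwiners:
 assumes a: "a \<in> M"
 shows "a \<in> log_intertwiners E \<Phi>\<^sub>2 \<Phi>\<^sub>1" "adj E E a \<in> log_intertwiners E \<Phi>\<^sub>1 \<Phi>\<^sub>2"
  "a \<in> log_intertwiners E \<Phi>\<^sub>1 \<Phi>\<^sub>1" "adj E E a \<in> log_intertwiners E \<Phi>\<^sub>1 \<Phi>\<^sub>1"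
proof -
 interpret B: bounded_calculus E \<Phi>\<^sub>2 by (rule calculus_2)
 let ?c = "a \<cdot> adj E E \<nu>" and ?d = "a \<cdot> \<mu>"
 have L: "a \<in> Lip_star \<alpha> E D\<^sub>1" "?d \<in> Lip_star \<alpha> E D\<^sub>1" "?c \<in> Lip_star \<alpha> E D\<^sub>1"
  and dom: "blinfun_apply a ` dom (D\<^sub>1 \<circ>\<^sub>m as_op (adj E E \<mu>)) \<subseteq> dom (pullback E F U D\<^sub>2)"
  using a by (simp_all add: conf_multipliers_def inv_of_\<mu>)
 have aE: "a \<in> End_star E" using a by (simp add: conf_multipliers_def)
 obtain S where S: "S \<in> Hom_star E F"
  and le: "bracket_pow F D\<^sub>2 (- \<alpha>) \<circ>\<^sub>m as_op U \<circ>\<^sub>m conf_diff E F D\<^sub>1 D\<^sub>2 U \<mu> a \<subseteq>\<^sub>m as_op S"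
  using a by (auto simp: conf_multipliers_def bounded_op_def)
 have pull: "pullback E F U D\<^sub>2 y = Some z \<longleftrightarrow> op_rel \<Phi>\<^sub>2 of_real y z" for y z
  by (rule pullback_iff) (rule C.D_iff)
 have \<mu>\<nu>: "adj E E \<mu> \<cdot> adj E E \<nu> = \<one>" "adj E E \<nu> \<cdot> adj E E \<mu> = \<one>"
  using \<mu> \<nu> inverse by (simp_all flip: E.dag_compose)
 let ?X = "adj E F U \<cdot> S \<cdot> adj E E \<nu>"
 have X: "?X \<in> End_star E"
  using Hom_star_compose[OF Hom_star_compose[OF E.End_star_dag[OF \<nu>] S] Hom_starI[OF adj_U_adjoint]] by (simp add: op_assoc)
 have int: "intertwines \<alpha> B.rc A.rc ?c ?d ?X"
  unfolding intertwines_def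
 proof (intro ballI blinfun_eqI)
  fix g h x assume g: "g \<in> Cb1" and h: "h \<in> Cb1"
  let ?h = "A.rc h x" and ?v = "A.rc (\<lambda>t. t * h t) x"
  let ?y = "adj E E \<nu> ?h"
  have \<mu>y: "adj E E \<mu> ?y = ?h"
   using arg_cong[OF \<mu>\<nu>(1), of "\<lambda>T. T ?h"] by simp
  have D: "D\<^sub>1 (adj E E \<mu> ?y) = Some ?v" unfolding \<mu>y by (rule A.D_rc[OF h])
  then have "?y \<in> dom (D\<^sub>1 \<circ>\<^sub>m as_op (adj E E \<mu>))" by (simp add: dom_def map_comp_as_op)
  then obtain u where u: "pullback E F U D\<^sub>2 (a ?y) = Some u" using dom by blast
  have "conf_diff E F D\<^sub>1 D\<^sub>2 U \<mu> a ?y = Some (u - ?d ?v)"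
   using D u by (simp add: conf_diff_def op_minus_def map_comp_as_op dom_def)
  then have "(bracket_pow F D\<^sub>2 (- \<alpha>) \<circ>\<^sub>m as_op U \<circ>\<^sub>m conf_diff E F D\<^sub>1 D\<^sub>2 U \<mu> a) ?y
    = Some (C.rc (\<lambda>t. bracket t powr (- \<alpha>)) (U (u - ?d ?v)))"
   using \<alpha> by (simp add: C.D_bracket map_comp_def as_op_def)
  then have "C.rc (\<lambda>t. bracket t powr (- \<alpha>)) (U (u - ?d ?v)) = S ?y"
   by (rule map_le_as_opD[OF le])
  then have "(adj E F U \<cdot> C.rc (\<lambda>t. bracket t powr (- \<alpha>)) \<cdot> U) (u - ?d ?v) = adj E F U (S ?y)"
   by simp
  then have S: "B.rc (\<lambda>t. bracket t powr (- \<alpha>)) (u - ?d ?v) = ?X ?h"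
   by (simp add: B.rc_def C.rc_def transport_def)
  have "B.rc (\<lambda>t. t * g t) (a ?y) = B.rc g u"
   using B.op_rel_apply[of of_real "a ?y" u "cr g"] u[unfolded pull] Cbr_Cb[OF Cb1_Cbr(1)[OF g]] Cbr_Cb[OF Cb1_Cbr(2)[OF g]]
   by (simp add: B.rc_def continuous_on_of_real[OF continuous_on_id])
  then have "B.rc (\<lambda>t. t * g t) (a ?y) - B.rc g (?d ?v)
    = B.rc g (u - ?d ?v)"
   by (simp only: blinfun.diff_right)
  also have "\<dots> = B.rc (\<lambda>t. bracket t powr \<alpha> * g t) (?X ?h)"
   unfolding B.rc_weight[OF g \<alpha>] using S by (simp only: blinfun_apply_blinfun_compose)
  finally show "(B.rc (\<lambda>t. t * g t) \<cdot> ?c \<cdot> A.rc h - B.rc g \<cdot> ?d \<cdot> A.rc (\<lambda>t. t * h t)) x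
    = (B.rc (\<lambda>t. bracket t powr \<alpha> * g t) \<cdot> ?X \<cdot> A.rc h) x"
   by (simp add: minus_blinfun.rep_eq)
 qed
 obtain X\<^sub>a where X\<^sub>a: "intertwines \<alpha> A.rc A.rc a a X\<^sub>a" using A.Lip_intertwines[OF L(1) \<alpha>] by (rule bexE)
 obtain X\<^sub>c where X\<^sub>c: "intertwines \<alpha> A.rc A.rc ?c ?c X\<^sub>c" using A.Lip_intertwines[OF L(3) \<alpha>] by (rule bexE)
 obtain X\<^sub>d where X\<^sub>d: "intertwines \<alpha> A.rc A.rc ?d ?d X\<^sub>d" using A.Lip_intertwines[OF L(2) \<alpha>] by (rule bexE)
 interpret P: conformal_pair E \<Phi>\<^sub>1 \<Phi>\<^sub>2 \<alpha> a ?c ?d \<mu> "adj E E \<nu>" ?X X\<^sub>a X\<^sub>c X\<^sub>d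
 proof unfold_locales
  show "adj E E a = \<mu> \<cdot> adj E E ?c" using aE \<nu> by (simp add: inverse flip: op_assoc)
  show "adj E E a = adj E E \<nu> \<cdot> adj E E ?d" using aE \<mu> by (simp add: \<mu>\<nu> flip: op_assoc)
 qed (use X aE \<mu> \<nu> in \<open>simp_all add: int X\<^sub>a X\<^sub>c X\<^sub>d \<alpha>\<close>)
 show "a \<in> log_intertwiners E \<Phi>\<^sub>2 \<Phi>\<^sub>1" "adj E E a \<in> log_intertwiners E \<Phi>\<^sub>1 \<Phi>\<^sub>2"
  using P.log_intertwiners by blast+
 show "a \<in> log_intertwiners E \<Phi>\<^sub>1 \<Phi>\<^sub>1" "adj E E a \<in> log_intertwiners E \<Phi>\<^sub>1 \<Phi>\<^sub>1"
  using A.Lip_log_intertwiners[OF L(1) \<alpha>] by blast+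
qed

definition log_multipliers :: "'e endo set" where
 "log_multipliers = log_intertwiners E \<Phi>\<^sub>1 \<Phi>\<^sub>1 \<inter> log_intertwiners E \<Phi>\<^sub>2 \<Phi>\<^sub>1 \<inter> log_intertwiners E \<Phi>\<^sub>2 \<Phi>\<^sub>2"

lemma log_multipliers_subspace: "module.subspace scaleC log_multipliers"
proof -
 interpret B: bounded_calculus E \<Phi>\<^sub>2 by (rule calculus_2)
 interpret AA: two_calculi E \<Phi>\<^sub>1 \<Phi>\<^sub>1 by unfold_locales
 interpret BA: two_calculi E \<Phi>\<^sub>2 \<Phi>\<^sub>1 by unfold_locales
 interpret BB: two_calculi E \<Phi>\<^sub>2 \<Phi>\<^sub>2 by unfold_locales
 show ?thesis unfolding log_multipliers_def
  by (intro module.subspace_inter[OF module_scaleC] AA.log_intertwiners_subspace BA.log_intertwiners_subspace BB.log_intertwiners_subspace)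
qed

text \<open>
 A multiplier leads from \<open>L\<^sub>1\<close> to \<open>L\<^sub>2\<close> and its adjoint from \<open>L\<^sub>2\<close> to \<open>L\<^sub>1\<close>; a word of this form thus leads from each of
 \<open>L\<^sub>1\<close>, \<open>L\<^sub>2\<close> to \<open>L\<^sub>2\<close>, and from \<open>L\<^sub>1\<close> to itself.
\<close>

lemma words_log_multipliers:
 assumes m: "m \<in> M" "m' \<in> M" and b: "b \<in> Lip_star \<alpha> E D\<^sub>1"
 shows "m \<cdot> b \<cdot> adj E E m' \<in> log_multipliers"
 unfolding log_multipliers_def
 by (intro IntI E.log_intertwiners_compose[OF E.log_intertwiners_compose[OF _ A.Lip_log_intertwiners(1)[OF b \<alpha>]]]
   multiplier_log_intertwiners m)

text \<open>
 The natural domain of \<open>(L\<^sub>2 - L\<^sub>1) a\<close> consists of all \<open>y\<close> with \<open>a y \<in> dom L\<^sub>1 \<inter> dom L\<^sub>2\<close>, and may be larger than \<open>dom L\<^sub>1\<close>;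
 the value at such \<open>y\<close> is computed by resolvents.
\<close>

lemma log_multipliers_bounded:
 "log_multipliers \<subseteq> locally_bounded_multipliers E (log_transform E D\<^sub>1) F (log_transform F D\<^sub>2) U"
proof
 fix a assume a: "a \<in> log_multipliers"
 interpret B: bounded_calculus E \<Phi>\<^sub>2 by (rule calculus_2)
 interpret AA: two_calculi E \<Phi>\<^sub>1 \<Phi>\<^sub>1 by unfold_locales
 interpret BA: two_calculi E \<Phi>\<^sub>2 \<Phi>\<^sub>1 by unfold_locales
 let ?L1 = "log_transform E D\<^sub>1" and ?L2 = "log_transform F D\<^sub>2" and ?L = "cr log_fun"
 let ?P2 = "pullback E F U ?L2" and ?b = "U \<cdot> a \<cdot> adj E F U"
 note c = continuous_on_cr_log_fun
 obtain S11 S21 S22 where S11: "log_intertwiner E \<Phi>\<^sub>1 \<Phi>\<^sub>1 a S11" and S21: "log_intertwiner E \<Phi>\<^sub>2 \<Phi>\<^sub>1 a S21"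
  and S22: "log_intertwiner E \<Phi>\<^sub>2 \<Phi>\<^sub>2 a S22"
  using a by (auto simp: log_multipliers_def log_intertwiners_def)
 have aE: "a \<in> End_star E" and S: "S11 \<in> End_star E" "S21 \<in> End_star E" "S22 \<in> End_star E"
  using S11 S21 S22 by (auto simp: log_intertwiner_def)
 have P2: "?P2 y = Some z \<longleftrightarrow> op_rel \<Phi>\<^sub>2 ?L y z" for y z
  by (rule pullback_iff) (rule C.D_log)
 have m11: "?L1 (a y) = Some (a z + S11 y)" if "?L1 y = Some z" for y z
  using S11 that by (simp add: A.D_log log_intertwiner_def)
 have m21: "?P2 (a y) = Some (a z + S21 y)" if "?L1 y = Some z" for y z
  using S21 that by (simp add: A.D_log P2 log_intertwiner_def)
 have m22: "?L2 (?b y) = Some (?b z + (U \<cdot> S22 \<cdot> adj E F U) y)" if "?L2 y = Some z" for y z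
 proof -
  have "op_rel \<Phi>\<^sub>2 ?L (adj E F U y) (adj E F U z)"
   using that by (simp add: C.D_log op_rel_transport)
  then have "op_rel \<Phi>\<^sub>2 ?L (a (adj E F U y))
    (a (adj E F U z) + S22 (adj E F U y))"
   using S22 by (simp add: log_intertwiner_def)
  then show ?thesis by (simp add: C.D_log op_rel_transport blinfun.add_right)
 qed
 have dense1: "densely_defined ?L1" and dense2: "densely_defined ?L2"
  using A.op_rel_densely_defined[OF c] C.op_rel_densely_defined[OF c]
  by (simp_all add: densely_defined_def dom_def A.D_log C.D_log)
 have d1: "blinfun_apply a ` dom ?L1 \<subseteq> dom ?P2" using m21 by blast
 have US: "U \<cdot> S22 \<cdot> adj E F U \<in> End_star F"
  using Hom_star_compose[OF Hom_starI[OF adj_U_adjoint] Hom_star_compose[OF S(3) U_Hom]] .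
 note c1 = bounded_commutatorI[OF dense1 S(1) m11] and c2 = bounded_commutatorI[OF dense2 US m22]
 have c3: "bounded_op E E ((?P2 \<ominus>\<^sub>m ?L1) \<circ>\<^sub>m as_op a)"
  unfolding bounded_op_def
 proof (intro conjI bexI)
  let ?T = "(?P2 \<ominus>\<^sub>m ?L1) \<circ>\<^sub>m as_op a"
  have T: "?T y = Some w \<longleftrightarrow> (\<exists>u v. ?P2 (a y) = Some u \<and> ?L1 (a y) = Some v \<and> w = u - v)" for y w
   by (auto simp: map_comp_as_op op_minus_def split: if_splits)
  have "dom ?L1 \<subseteq> dom ?T"
  proof
   fix y assume "y \<in> dom ?L1"
   then obtain z where "?L1 y = Some z" by blast
   from m11[OF this] m21[OF this] T show "y \<in> dom ?T" by blast
  qed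
  then show "densely_defined ?T" by (rule densely_defined_mono[OF dense1])
  have "w = (S21 - S11) y" if w: "?T y = Some w" for y w
  proof -
   obtain u v where u: "?P2 (a y) = Some u" and v: "?L1 (a y) = Some v" and w: "w = u - v"
    using w T by blast
   let ?q = "\<lambda>n. log_resolvent (real (Suc n))"
   have "\<Phi>\<^sub>2 (?q n) u - \<Phi>\<^sub>1 (?q n) v
     = \<Phi>\<^sub>2 (?q n) (S21 (\<Phi>\<^sub>1 (?q n) y))
      - \<Phi>\<^sub>1 (?q n) (S11 (\<Phi>\<^sub>1 (?q n) y))" for n
    using BA.log_intertwiner_resolvent[OF S21 u[unfolded P2], of "real (Suc n)" "?q n"]
     AA.log_intertwiner_resolvent[OF S11 v[unfolded A.D_log], of "real (Suc n)" "?q n"]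
    by simp
   moreover have "(\<lambda>n. \<Phi>\<^sub>2 (?q n) u - \<Phi>\<^sub>1 (?q n) v) \<longlonglongrightarrow> u - v"
    by (intro tendsto_diff A.log_resolvent_tendsto B.log_resolvent_tendsto tendsto_const)
   moreover have "(\<lambda>n. \<Phi>\<^sub>2 (?q n) (S21 (\<Phi>\<^sub>1 (?q n) y))
      - \<Phi>\<^sub>1 (?q n) (S11 (\<Phi>\<^sub>1 (?q n) y))) \<longlonglongrightarrow> S21 y - S11 y"
    by (intro tendsto_diff A.log_resolvent_tendsto B.log_resolvent_tendsto blinfun.tendsto tendsto_const)
   ultimately have "u - v = S21 y - S11 y" using LIMSEQ_unique by simp
   then show ?thesis by (simp add: w minus_blinfun.rep_eq)
  qed
  then show "?T \<subseteq>\<^sub>m as_op (S21 - S11)" unfolding map_le_def as_op_def by auto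
  show "S21 - S11 \<in> End_star E" using S by auto
 qed
 show "a \<in> locally_bounded_multipliers E ?L1 F ?L2 U"
  unfolding locally_bounded_multipliers_def using aE d1 c1 c2 c3 by blast
qed

end

subsection \<open>Density\<close>

lemma closure_csubspace:
 fixes S :: "'a :: complex_normed_vector set"
 assumes "module.subspace scaleC S" shows "module.subspace scaleC (closure S)"
 unfolding module.subspace_def[OF module_scaleC]
proof (intro conjI ballI allI)
 note S = assms[unfolded module.subspace_def[OF module_scaleC]]
 show "0 \<in> closure S" using S closure_subset by blast
 fix x assume x: "x \<in> closure S"
 then obtain f where f: "\<And>n. f n \<in> S" "f \<longlonglongrightarrow> x" unfolding closure_sequential by blast
 have "(\<lambda>n. c *\<^sub>C f n) \<longlonglongrightarrow> c *\<^sub>C x" for c by (intro tendsto_intros f)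
 then show "c *\<^sub>C x \<in> closure S" for c
  unfolding closure_sequential using S f(1) by (intro exI[of _ "\<lambda>n. c *\<^sub>C f n"]) blast
 fix y assume y: "y \<in> closure S"
 then obtain g where g: "\<And>n. g n \<in> S" "g \<longlonglongrightarrow> y" unfolding closure_sequential by blast
 have "(\<lambda>n. f n + g n) \<longlonglongrightarrow> x + y" by (intro tendsto_intros f g)
 then show "x + y \<in> closure S"
  unfolding closure_sequential using S f(1) g(1) by (intro exI[of _ "\<lambda>n. f n + g n"]) blast
qed

lemma closure_cspan_subset:
 assumes "Z \<subseteq> closure S" "module.subspace scaleC S"
 shows "closure (cspan Z) \<subseteq> closure S"
 by (intro closure_minimal module.span_minimal[OF module_scaleC] assms closure_csubspace) simp

text \<open>
 Up to closures, \<open>A \<subseteq> span M A\<close> gives \<open>A \<subseteq> span A M\<^sup>*\<close> by taking adjoints, hence \<open>A \<subseteq> span M A M\<^sup>*\<close>; in the latter the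
 middle factor may be taken from \<open>L\<close>.
\<close>

lemma (in hilbert_module) range_subset_closure:
 assumes \<pi>: "star_representation E \<pi>" and S: "module.subspace scaleC S"
  and M: "M \<subseteq> End_star E" "range \<pi> \<subseteq> closure (cspan {m \<cdot> \<pi> b | b m. m \<in> M})"
  and L: "range \<pi> \<subseteq> closure L" and words: "\<And>m m' b. m \<in> M \<Longrightarrow> m' \<in> M \<Longrightarrow> b \<in> L \<Longrightarrow> m \<cdot> b \<cdot> m'\<^sup>* \<in> S"
 shows "range \<pi> \<subseteq> closure S"
proof -
 have \<pi>_adj: "is_adjoint E E (\<pi> b) (\<pi> (star b))" for b using \<pi> by (simp add: star_representation_def)
 have \<pi>E: "\<pi> b \<in> End_star E" for b by (rule Hom_starI[OF \<pi>_adj])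
 have \<pi>_dag: "(\<pi> b)\<^sup>* = \<pi> (star b)" for b by (rule dag_eqI[OF \<pi>_adj])
 have word: "m \<cdot> \<pi> b \<cdot> m'\<^sup>* \<in> closure S" if m: "m \<in> M" "m' \<in> M" for m m' b
 proof -
  have "(\<lambda>T. m \<cdot> T \<cdot> m'\<^sup>*) ` closure L \<subseteq> closure S"
  proof (rule image_closure_subset)
   show "continuous_on (closure L) (\<lambda>T. m \<cdot> T \<cdot> m'\<^sup>*)"
    by (intro bounded_bilinear.continuous_on[OF bounded_bilinear_blinfun_compose] continuous_intros)
   show "(\<lambda>T. m \<cdot> T \<cdot> m'\<^sup>*) ` L \<subseteq> closure S" using words[OF m] closure_subset by blast
  qed simp
  then show ?thesis using L by blast
 qed
 have half: "m \<cdot> \<pi> b \<in> closure S" if m: "m \<in> M" for m b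
 proof -
  have mE: "m \<in> End_star E" using m M(1) by blast
  let ?Z = "{m \<cdot> \<pi> b | b m. m \<in> M}"
  have Z: "?Z \<subseteq> End_star E" using M(1) \<pi>E by auto
  have span: "cspan ?Z \<subseteq> {T \<in> End_star E. m \<cdot> T\<^sup>* \<in> closure S}"
  proof (rule module.span_minimal[OF module_scaleC])
   have "m \<cdot> (m' \<cdot> \<pi> b')\<^sup>* \<in> closure S" if "m' \<in> M" for m' b'
    using word[OF m that, of "star b'"] that M(1) \<pi>E[of b'] by (auto simp: \<pi>_dag op_assoc)
   then show "?Z \<subseteq> {T \<in> End_star E. m \<cdot> T\<^sup>* \<in> closure S}" using Z by blast
   show "module.subspace scaleC {T \<in> End_star E. m \<cdot> T\<^sup>* \<in> closure S}"
    using closure_csubspace[OF S] mE unfolding module.subspace_def[OF module_scaleC]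
    by (auto simp: op_simps compose_scaleC_right)
  qed
  have "\<pi> (star b) \<in> closure (cspan ?Z)" using M(2) by blast
  then obtain T where T: "\<And>n. T n \<in> cspan ?Z" "T \<longlonglongrightarrow> \<pi> (star b)" unfolding closure_sequential by blast
  have TE: "T n \<in> End_star E" "m \<cdot> (T n)\<^sup>* \<in> closure S" for n using T(1)[of n] span by auto
  have "(\<lambda>n. (T n)\<^sup>*) \<longlonglongrightarrow> (\<pi> (star b))\<^sup>*" by (rule norm_limit_adjointable(2)[OF TE(1) T(2)])
  then have lim: "(\<lambda>n. m \<cdot> (T n)\<^sup>*) \<longlonglongrightarrow> m \<cdot> (\<pi> (star b))\<^sup>*"
   by (intro bounded_bilinear.tendsto[OF bounded_bilinear_blinfun_compose] tendsto_const)
  have "m \<cdot> (\<pi> (star b))\<^sup>* \<in> closure S" by (rule closed_sequentially[OF closed_closure TE(2) lim])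
  then show ?thesis by (simp add: \<pi>_dag star_star)
 qed
 have "closure (cspan {m \<cdot> \<pi> b | b m. m \<in> M}) \<subseteq> closure S"
  using half by (intro closure_cspan_subset S) blast
 then show ?thesis using M(2) by blast
qed

theorem theorem2p48:
  fixes \<alpha> :: real
    and E :: "('e :: {complex_normed_vector, banach}, 'b :: cstar_algebra) hilbmod"
    and E' :: "('f :: {complex_normed_vector, banach}, 'b) hilbmod"
    and \<Gamma> :: "('e \<Rightarrow>\<^sub>L 'e) option" and \<Gamma>' :: "('f \<Rightarrow>\<^sub>L 'f) option"
    and \<pi> :: "'a :: cstar_algebra \<Rightarrow> 'e \<Rightarrow>\<^sub>L 'e" and \<pi>' :: "'a \<Rightarrow> 'f \<Rightarrow>\<^sub>L 'f"
    and D1 :: "'e \<rightharpoonup> 'e" and D2 :: "'f \<rightharpoonup> 'f"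
    and U :: "'e \<Rightarrow>\<^sub>L 'f" and \<mu> :: "'e \<Rightarrow>\<^sub>L 'e"
  assumes "0 \<le> \<alpha>" and "\<alpha> < 1"
    and "order_cycle \<alpha> E \<Gamma> \<pi> D1"
    and "order_cycle \<alpha> E' \<Gamma>' \<pi>' D2"
    and "conformal_transformation \<alpha> E \<Gamma> \<pi> D1 E' \<pi>' D2 U \<mu>"
  shows "related_up_to_locally_bounded E \<pi> (log_transform E D1) E' \<pi>' (log_transform E' D2) U"
proof -
 have E: "hilbert_module E" "star_representation E \<pi>" "regular E D1" "self_adjoint E D1" "range \<pi> \<subseteq> closure (Lip_star \<alpha> E D1)"
  and F: "hilbert_module E'" "regular E' D2" "self_adjoint E' D2"
  using assms(3,4) by (simp_all add: order_cycle_def)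
 have U: "unitary_intertwiner E \<pi> E' \<pi>' U"
  and M: "range \<pi> \<subseteq> closure (cspan {m \<cdot> \<pi> b | b m. m \<in> conf_multipliers \<alpha> E E' D1 D2 U \<mu>})"
  and inv: "invertible_in E \<mu>"
  using assms(5) by (simp_all add: conformal_transformation_def Let_def)
 obtain \<nu> where \<nu>: "\<mu> \<in> End_star E" "\<nu> \<in> End_star E" "\<mu> \<cdot> \<nu> = id_blinfun" "\<nu> \<cdot> \<mu> = id_blinfun"
  using inv by (auto simp: invertible_in_def)
 interpret E: hilbert_module E by fact
 interpret F: hilbert_module E' by fact
 interpret A: self_adjoint_calculus E "bcalc E D1" D1 by (rule E.self_adjoint_calculus_bcalc[OF E(3,4)])
 interpret C: self_adjoint_calculus E' "bcalc E' D2" D2 by (rule F.self_adjoint_calculus_bcalc[OF F(2,3)])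
 interpret conformal_operators E E' U "bcalc E D1" D1 "bcalc E' D2" D2 \<mu> \<nu> \<alpha>
  by unfold_locales (use assms(1,2) U \<nu> in \<open>simp_all add: unitary_intertwiner_def\<close>)
 have "range \<pi> \<subseteq> closure log_multipliers"
 proof (rule E.range_subset_closure[OF E(2) log_multipliers_subspace _ M E(5) words_log_multipliers])
  show "M \<subseteq> End_star E" by (auto simp: conf_multipliers_def)
 qed
 then have "range \<pi> \<subseteq> closure (locally_bounded_multipliers E (log_transform E D1) E' (log_transform E' D2) U)"
  using closure_mono[OF log_multipliers_bounded] by blast
 with U show ?thesis by (simp add: related_up_to_locally_bounded_def)
qed

end
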